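(* Let $n\ge2$ and let $F:\mathcal S_n\to\mathbb R$ be uniformly elliptic and positively homogeneous of degree one (as in the context), with scaling exponent $\alpha^*(F)$ and upward-pointing fundamental solution $\Phi$; let $\alpha^*(\tilde F)$ and $\tilde\Phi$ be the scaling exponent and upward-pointing fundamental solution of the dual operator $\tilde F(M):=-F(-M)$. Suppose $u\in C(B_1\setminus\{0\})$ is a viscosity solution of $$F(D^2u)=0\quad\text{in }B_1\setminus\{0\}.$$ If $u$ is bounded above or below in a (punctured) neighborhood of the origin, then precisely one of the following five alternatives holds. (i) The singularity is removable, that is, $u$ can be defined at the origin so that $u\in C(B_1)$ and $F(D^2u)=0$ in $B_1$. (ii) $\alpha^*(F)\ge0$, and there are constants $a,C>0$ such that $a\Phi-C\le u\le a\Phi+C$ in $B_{1/2}\setminus\{0\}$. (iii) $\alpha^*(\tilde F)\ge0$, and there are constants $a,C>0$ such that $-a\tilde\Phi-C\le u\le -a\tilde\Phi+C$ in $B_{1/2}\setminus\{0\}$. (iv) $\alpha^*(F)<0$, and $u$ can be defined at the origin so that $\dfrac{u(x)-u(0)}{\Phi(x)}\to a$ as $x\to0$, for some constant $a>0$. (v) $\alpha^*(\tilde F)<0$, and $u$ can be defined at the origin so that $\dfrac{u(x)-u(0)}{-\tilde\Phi(x)}\to a$ as $x\to0$, for some constant $a>0$.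
   Context: $\mathcal S_n$ is the set of real symmetric $n\times n$ matrices and $B_r=\{x\in\mathbb R^n:|x|<r\}$. The map $F:\mathcal S_n\to\mathbb R$ satisfies, for some constants $0<\lambda\le\Lambda$: (uniform ellipticity) $\lambda\,\mathrm{trace}(N)\le F(M-N)-F(M)\le\Lambda\,\mathrm{trace}(N)$ for all $M,N\in\mathcal S_n$ with $N$ nonnegative definite; (positive homogeneity) $F(tM)=tF(M)$ for all $t\ge0$ and $M\in\mathcal S_n$. All equations and inequalities are understood in the viscosity sense (sign convention of $-\Delta$: subsolution means $F(D^2u)\le0$, supersolution means $F(D^2u)\ge 0$). The dual operator $\tilde F(M):=-F(-M)$ satisfies the same hypotheses. Spaces of homogeneous functions: for $\alpha\in[-1,\infty)\setminus\{0\}$, $H_\alpha^+$ is the set of $v\in C(\mathbb R^n\setminus\{0\})$ with $\alpha v>0$ and $\sigma^\alpha v(\sigma x)=v(x)$ for all $\sigma>0$, $x\ne0$; $H_0^+$ is the set of $v\in C(\mathbb R^n\setminus\{0\})$ with $v(\sigma x)+\log\sigma=v(x)$ for all $\sigma>0$, $x\neq0$. Scaling exponent: $\alpha^*(F):=\sup\{\alpha\in(-1,\infty)\setminus\{0\}:\text{there exists }v\in H_\alpha^+\text{ with }F(D^2v)\ge0\text{ in }\mathbb R^n\setminus\{0\}\}$, which is a finite number $>-1$. Fundamental solution: it is known that there is a unique $\Phi\in H^+_{\alpha^*(F)}$ solving $F(D^2\Phi)=0$ in $\mathbb R^n\setminus\{0\}$ with the normalization $\min_{\partial B_1}(\mathrm{sign}(\alpha^*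 )\Phi)=1$ if $\alpha^*=\alpha^*(F)\ne0$, and $\int_{\partial B_1}\Phi=0$ if $\alpha^*(F)=0$. This $\Phi$ is called the upward-pointing fundamental solution of $F$. (Thus $\Phi(x)\to\infty$ as $x\to0$ if $\alpha^*(F)\ge0$, and $\Phi<0$, $\Phi(x)\to0$ as $x\to 0$ if $\alpha^*(F)<0$.) *)

theory Defs
  imports "HOL-Analysis.Analysis"
begin

definition sym_matrix :: "real ^ 'n ^ 'n \<Rightarrow> bool" where
  "sym_matrix M \<longleftrightarrow> transpose M = M"

definition nonneg_definite :: "real ^ 'n ^ 'n \<Rightarrow> bool" where
  "nonneg_definite N \<longleftrightarrow> (\<forall>x. 0 \<le> x \<bullet> (N *v x))"

text \<open>
  An operator is a function on all square matrices, but only its values at symmetric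
  matrices are constrained, and only those are used below.
\<close>

definition uniformly_elliptic :: "real \<Rightarrow> real \<Rightarrow> (real ^ 'n ^ 'n \<Rightarrow> real) \<Rightarrow> bool" where
  "uniformly_elliptic lam Lam F \<longleftrightarrow>
     (\<forall>M N. sym_matrix M \<longrightarrow> sym_matrix N \<longrightarrow> nonneg_definite N \<longrightarrow>
        lam * trace N \<le> F (M - N) - F M \<and> F (M - N) - F M \<le> Lam * trace N)"

definition positively_homogeneous :: "(real ^ 'n ^ 'n \<Rightarrow> real) \<Rightarrow> bool" where
  "positively_homogeneous F \<longleftrightarrow>
     (\<forall>t M. 0 \<le> t \<longrightarrow> sym_matrix M \<longrightarrow> F (t *\<^sub>R M) = t * F M)"

definition dual_operator :: "(real ^ 'n ^ 'n \<Rightarrow> real) \<Rightarrow> real ^ 'n ^ 'n \<Rightarrow> real" where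
  "dual_operator F M = - F (- M)"

text \<open>
  \<open>C2_with_hessian A \<phi> H\<close>: on the open set \<open>A\<close>, \<open>\<phi>\<close> is twice continuously differentiable with
  Hessian \<open>H\<close>. By continuity of \<open>H\<close> the matrices \<open>H x\<close> are symmetric.
\<close>

definition C2_with_hessian ::
    "(real ^ 'n) set \<Rightarrow> (real ^ 'n \<Rightarrow> real) \<Rightarrow> (real ^ 'n \<Rightarrow> real ^ 'n ^ 'n) \<Rightarrow> bool" where
  "C2_with_hessian A \<phi> H \<longleftrightarrow>
     (\<exists>g. (\<forall>x\<in>A. (\<phi> has_derivative (\<lambda>h. g x \<bullet> h)) (at x)) \<and>
          (\<forall>x\<in>A. (g has_derivative (\<lambda>h. H x *v h)) (at x))) \<and>
     continuous_on A H"

text \<open>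
  Viscosity inequalities \<open>F(D\<^sup>2u) \<le> 0\<close> and \<open>F(D\<^sup>2u) \<ge> 0\<close> in an open set \<open>\<Omega>\<close>. Test functions are
  \<open>C\<^sup>2\<close> in an open neighbourhood \<open>A\<close> of the touching point; \<open>A\<close> may be shrunk, so touching on
  all of \<open>A\<close> expresses a local extremum of \<open>u - \<phi>\<close>. The predicates contain no (semi)continuity
  requirement: they are only applied to functions separately required to be continuous on \<open>\<Omega>\<close>.
\<close>

definition visc_subsolution ::
    "(real ^ 'n ^ 'n \<Rightarrow> real) \<Rightarrow> (real ^ 'n) set \<Rightarrow> (real ^ 'n \<Rightarrow> real) \<Rightarrow> bool" where
  "visc_subsolution F \<Omega> u \<longleftrightarrow>
     (\<forall>A z \<phi> H. open A \<longrightarrow> A \<subseteq> \<Omega> \<longrightarrow> z \<in> A \<longrightarrow> C2_with_hessian A \<phi> H \<longrightarrow>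
        (\<forall>y\<in>A. u y - \<phi> y \<le> u z - \<phi> z) \<longrightarrow> F (H z) \<le> 0)"

definition visc_supersolution ::
    "(real ^ 'n ^ 'n \<Rightarrow> real) \<Rightarrow> (real ^ 'n) set \<Rightarrow> (real ^ 'n \<Rightarrow> real) \<Rightarrow> bool" where
  "visc_supersolution F \<Omega> u \<longleftrightarrow>
     (\<forall>A z \<phi> H. open A \<longrightarrow> A \<subseteq> \<Omega> \<longrightarrow> z \<in> A \<longrightarrow> C2_with_hessian A \<phi> H \<longrightarrow>
        (\<forall>y\<in>A. u z - \<phi> z \<le> u y - \<phi> y) \<longrightarrow> 0 \<le> F (H z))"

definition visc_solution ::
    "(real ^ 'n ^ 'n \<Rightarrow> real) \<Rightarrow> (real ^ 'n) set \<Rightarrow> (real ^ 'n \<Rightarrow> real) \<Rightarrow> bool" where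
  "visc_solution F \<Omega> u \<longleftrightarrow> visc_subsolution F \<Omega> u \<and> visc_supersolution F \<Omega> u"

text \<open>
  Functions on the punctured space are represented by total functions whose value at the origin
  is irrelevant. Only exponents \<open>\<alpha> \<ge> -1\<close> matter.
\<close>

definition H_plus :: "real \<Rightarrow> (real ^ 'n \<Rightarrow> real) set" where
  "H_plus \<alpha> = {v. continuous_on (- {0}) v \<and>
     (if \<alpha> = 0 then \<forall>\<sigma>>0. \<forall>x. x \<noteq> 0 \<longrightarrow> v (\<sigma> *\<^sub>R x) + ln \<sigma> = v x
      else (\<forall>x. x \<noteq> 0 \<longrightarrow> 0 < \<alpha> * v x) \<and>
           (\<forall>\<sigma>>0. \<forall>x. x \<noteq> 0 \<longrightarrow> \<sigma> powr \<alpha> * v (\<sigma> *\<^sub>R x) = v x))}"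

definition scaling_exponent :: "(real ^ 'n ^ 'n \<Rightarrow> real) \<Rightarrow> real" where
  "scaling_exponent F =
     Sup {\<alpha>. -1 < \<alpha> \<and> \<alpha> \<noteq> 0 \<and> (\<exists>v\<in>H_plus \<alpha>. visc_supersolution F (- {0}) v)}"

text \<open>
  Surface measure on the unit sphere, obtained from Lebesgue measure via polar coordinates:
  a Borel set \<open>E\<close> of the sphere has measure \<open>n\<close> times the volume of
  \<open>{r x | 0 < r < 1, x \<in> E}\<close>. Here \<open>sgn x = x / |x|\<close>.
\<close>

definition sphere_measure :: "'a::euclidean_space measure" where
  "sphere_measure =
     scale_measure (ennreal (real DIM('a)))
       (distr (restrict_space lborel (ball 0 1 - {0})) (restrict_space borel (sphere 0 1)) sgn)"

lemma emeasure_sphere_measure: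
  fixes E :: "'a::euclidean_space set"
  assumes "E \<in> sets borel" "E \<subseteq> sphere 0 1"
  shows "emeasure sphere_measure E =
    ennreal (real DIM('a)) * emeasure lborel {x \<in> ball 0 1 - {0}. sgn x \<in> E}"
proof -
  have c: "continuous_on (ball 0 1 - {0}) (sgn :: 'a \<Rightarrow> 'a)"
    by (intro continuous_on_sgn continuous_on_id) auto
  have "(sgn :: 'a \<Rightarrow> 'a) \<in>
      restrict_space borel (ball 0 1 - {0}) \<rightarrow>\<^sub>M restrict_space borel (sphere 0 1)"
    by (intro measurable_restrict_space2 borel_measurable_continuous_on_restrict c)
       (auto simp: space_restrict_space norm_sgn)
  also have "restrict_space borel (ball 0 1 - {0}) \<rightarrow>\<^sub>M restrict_space borel (sphere 0 1) =
      restrict_space lborel (ball 0 1 - {0 :: 'a}) \<rightarrow>\<^sub>M restrict_space borel (sphere 0 1 :: 'a set)"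
    by (intro measurable_cong_sets sets_restrict_space_cong) auto
  finally have m: "(sgn :: 'a \<Rightarrow> 'a) \<in>
      restrict_space lborel (ball 0 1 - {0}) \<rightarrow>\<^sub>M restrict_space borel (sphere 0 1)" .
  have E: "E \<in> sets (restrict_space borel (sphere 0 1))"
    using assms by (auto simp: sets_restrict_space)
  show ?thesis
    unfolding sphere_measure_def emeasure_scale_measure emeasure_distr[OF m E]
    by (subst emeasure_restrict_space)
       (auto simp: space_restrict_space vimage_def Int_def conj_commute
             intro!: arg_cong2[where f = "(*)"] arg_cong2[where f = emeasure])
qed

definition upward_fundamental_solution ::
    "(real ^ 'n ^ 'n \<Rightarrow> real) \<Rightarrow> (real ^ 'n \<Rightarrow> real) \<Rightarrow> bool" where
  "upward_fundamental_solution F \<Phi> \<longleftrightarrow>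
     \<Phi> \<in> H_plus (scaling_exponent F) \<and>
     visc_solution F (- {0}) \<Phi> \<and>
     (if scaling_exponent F = 0
      then (LINT x|sphere_measure. \<Phi> x) = 0
      else (\<exists>x\<in>sphere 0 1. sgn (scaling_exponent F) * \<Phi> x = 1) \<and>
           (\<forall>x\<in>sphere 0 1. 1 \<le> sgn (scaling_exponent F) * \<Phi> x))"

definition exactly_one :: "bool list \<Rightarrow> bool" where
  "exactly_one Ps \<longleftrightarrow> (\<exists>!i. i < length Ps \<and> Ps ! i)"

end

theory Submission
  imports Defs "HOL-Complex_Analysis.Great_Picard"
begin

text \<open>
  Viscosity inequalities are expressed by superjets. The theorem on sums, obtained from Rademacher's
  theorem applied to the proximal map of a convex function, gives the comparison principle; applied to
  a concave function of the distance (Ishii and Lions) it gives an interior Lipschitz estimate, and with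
  it a Harnack inequality for nonnegative solutions in an annulus, without Krylov--Safonov theory.

  Let \<open>u\<close> be bounded below. If \<open>u\<close> is unbounded, then \<open>u\<close> tends to infinity by Harnack, and the largest \<open>a\<close> with
  \<open>a (\<Phi> - C) \<le> u\<close> near the origin is characterised by \<open>u\<close> nearly touching \<open>a \<Phi>\<close> on every small sphere. A
  compactness argument with the strong maximum principle, applied to the rescaled solutions, turns
  touching into closeness on the whole sphere, and comparison yields \<open>u \<le> a \<Phi> + C\<close>. If \<open>u\<close> is bounded, the same
  argument with constants shows that \<open>u\<close> has a limit \<open>c\<close>. If the extended function fails to be a solution at
  the origin, then \<open>u - c\<close> minus a linear function has a sign there; its absolute value is a positive
  solution vanishing at the origin, which is compared with a fundamental solution in the same way, and the
  linear part is negligible because the scaling exponents exceed \<open>-1\<close>.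
\<close>

subsection \<open>Porous sets and Rademacher's theorem\<close>

text \<open>The difference of two solutions of a nonlinear equation satisfies no equation that is at
  hand, so a comparison of \<open>u\<close> with \<open>v\<close> runs on the pair \<open>u\<close>,
  \<open>- v\<close>, the latter a subsolution for \<open>dual_operator F\<close>; doubling the
  variables supplies a matrix for each of the two at nearby points. This requires a touching point
  at which a function that is merely convex has a second-order expansion. The proximal map provides
  it: it is 1-Lipschitz, it maps \<open>y + s y\<close> to \<open>y\<close> for a subgradient
  \<open>s y\<close>, and where a quadratic touches from above its derivative inverts to the
  identity plus a Hessian. Rademacher's theorem thus stands in for Alexandrov's.

  The method of Ishii and Lions treats \<open>u\<close> as a sub- and a supersolution at once and
  yields a bound for solutions only. Since \<open>F\<close> does not depend on position and is
  homogeneous, rescaled solutions are again solutions, and that bound serves both the Harnack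
  inequality and the compactness of rescalings.

  \<open>F\<close> need not be odd: a negative multiple of a solution solves the dual equation. This
  is why two fundamental solutions occur.\<close>

lemma Vitali_balls_in_open:
  fixes a :: "'i \<Rightarrow> 'b::euclidean_space"
  assumes cov: "\<And>x d. x \<in> S \<Longrightarrow> 0 < d \<Longrightarrow> \<exists>i\<in>K. x \<in> ball (a i) (r i) \<and> r i < d"
    and U: "open U" "S \<subseteq> U"
  obtains C where "countable C" "C \<subseteq> K" "disjoint_family_on (\<lambda>i. ball (a i) (r i)) C"
    "(\<Union>i\<in>C. ball (a i) (r i)) \<subseteq> U" "negligible (S - (\<Union>i\<in>C. ball (a i) (r i)))"
proof -
  \<comment> \<open>Balls that leave \<open>U\<close> are discarded. The cover stays fine because
    \<open>U\<close> is open, and the selected disjoint balls then have total measure at most that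
    of \<open>U\<close>, which will be close to that of \<open>S\<close>.\<close>
  define K' where "K' = {i\<in>K. ball (a i) (r i) \<subseteq> U}"
  have "\<exists>i. i \<in> K' \<and> x \<in> ball (a i) (r i) \<and> r i < d" if xS: "x \<in> S" and d: "0 < d" for x d
  proof -
    obtain e where e: "e > 0" "ball x e \<subseteq> U"
      using openE[OF U(1), of x] U(2) xS by blast
    obtain i where i: "i \<in> K" "x \<in> ball (a i) (r i)" "r i < min d (e/2)"
      using cov[of x "min d (e/2)"] xS d e by auto
    have "ball (a i) (r i) \<subseteq> ball x e"
    proof
      fix y assume "y \<in> ball (a i) (r i)"
      then have "dist (a i) y < r i" by simp
      moreover have "dist x y \<le> dist (a i) x + dist (a i) y"
        by (metis dist_commute dist_triangle)
      ultimately show "y \<in> ball x e" using i by auto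
    qed
    then show ?thesis using i e K'_def by auto
  qed
  then obtain C where C: "countable C" "C \<subseteq> K'"
     "pairwise (\<lambda>i j. disjnt (ball (a i) (r i)) (ball (a j) (r j))) C"
     "negligible(S - (\<Union>i \<in> C. ball (a i) (r i)))"
    by (rule Vitali_covering_theorem_balls)
  show thesis
  proof (rule that[of C])
    show "disjoint_family_on (\<lambda>i. ball (a i) (r i)) C"
      using C(3) by (auto simp: pairwise_def disjoint_family_on_def disjnt_def)
  qed (use C K'_def in auto)
qed

lemma emeasure_disjoint_balls_le:
  assumes "countable C" "disjoint_family_on B C" "\<And>i. i \<in> C \<Longrightarrow> B i \<in> sets M"
    and "\<And>i. i \<in> C \<Longrightarrow> emeasure N (D i) \<le> c * emeasure M (B i)"
    and "disjoint_family_on D C" "\<And>i. i \<in> C \<Longrightarrow> D i \<in> sets N"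
  shows "emeasure N (\<Union>i\<in>C. D i) \<le> c * emeasure M (\<Union>i\<in>C. B i)"
proof -
  have "emeasure N (\<Union>i\<in>C. D i) = (\<integral>\<^sup>+i. emeasure N (D i) \<partial>count_space C)"
    using assms by (intro emeasure_UN_countable) auto
  also have "\<dots> \<le> (\<integral>\<^sup>+i. c * emeasure M (B i) \<partial>count_space C)"
    using assms by (intro nn_integral_mono) auto
  also have "\<dots> = c * (\<integral>\<^sup>+i. emeasure M (B i) \<partial>count_space C)"
    by (intro nn_integral_cmult) auto
  also have "(\<integral>\<^sup>+i. emeasure M (B i) \<partial>count_space C) = emeasure M (\<Union>i\<in>C. B i)"
    using assms by (intro emeasure_UN_countable[symmetric]) auto
  finally show ?thesis .
qed

lemma emeasure_open_superset:
  assumes "S \<in> sets lebesgue" "0 < e"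
  obtains U where "open U" "S \<subseteq> U" "emeasure lebesgue U \<le> emeasure lebesgue S + ennreal e"
proof -
  obtain T where T: "open T" "S \<subseteq> T" "(T - S) \<in> lmeasurable" "emeasure lebesgue (T - S) < ennreal e"
    using sets_lebesgue_outer_open[OF assms] by blast
  have "emeasure lebesgue T = emeasure lebesgue (S \<union> (T - S))"
    using T by (simp add: Un_absorb1)
  also have "\<dots> \<le> emeasure lebesgue S + emeasure lebesgue (T - S)"
    using T assms by (intro emeasure_subadditive) auto
  also have "\<dots> \<le> emeasure lebesgue S + ennreal e"
    using T by (intro add_left_mono) auto
  finally show thesis using that T by blast
qed

lemma ennreal_le_contraction:
  fixes x :: ennreal
  assumes "x \<le> ennreal c * x" "c < 1" "x < \<infinity>" "0 \<le> c"
  shows "x = 0"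
proof -
  obtain y where y: "x = ennreal y" "0 \<le> y" using assms(3) by (cases x) auto
  have "y \<le> c * y" using assms y by (simp add: ennreal_mult'[symmetric] ennreal_le_iff)
  then have "(1 - c) * y \<le> 0" by (simp add: algebra_simps)
  then have "y \<le> 0" using assms(2) by (simp add: mult_le_0_iff)
  then show ?thesis using y by simp
qed

lemma ennreal_le_approx:
  fixes x :: ennreal
  assumes "\<And>e. e > 0 \<Longrightarrow> x \<le> ennreal c * (y + ennreal e)" "0 \<le> c" "y < \<infinity>"
  shows "x \<le> ennreal c * y"
proof -
  obtain z where z: "y = ennreal z" "0 \<le> z" using assms(3) by (cases y) auto
  show ?thesis
  proof (rule ennreal_le_epsilon)
    fix e :: real assume e: "0 < e"
    have "x \<le> ennreal c * (y + ennreal (e / (c + 1)))" using e assms by simp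
    also have "\<dots> = ennreal (c * (z + e / (c + 1)))"
      using z e assms by (simp add: ennreal_mult'[symmetric] ennreal_plus[symmetric] del: ennreal_plus)
    also have "\<dots> \<le> ennreal (c * z + e)"
    proof (rule ennreal_leI)
      have "c * (e / (c + 1)) \<le> e" using e assms by (simp add: field_simps)
      then show "c * (z + e / (c + 1)) \<le> c * z + e" by (simp add: algebra_simps)
    qed
    also have "\<dots> = ennreal c * y + ennreal e"
      using z e assms by (simp add: ennreal_mult'[symmetric])
    finally show "x \<le> ennreal c * y + ennreal e" .
  qed
qed

text \<open>Porosity of \<open>E\<close> at \<open>x\<close>: arbitrarily close to \<open>x\<close>
  there are balls that miss \<open>E\<close> and whose radius is a fixed proportion of the distance
  from their centre to \<open>x\<close>.\<close>

definition porous_part :: "'a::euclidean_space set \<Rightarrow> 'a set" where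
  "porous_part E = {x\<in>E. \<not> (\<forall>\<eta>>0. \<exists>\<delta>>0. \<forall>y. norm (y - x) < \<delta> \<longrightarrow> infdist y E \<le> \<eta> * norm (y - x))}"

text \<open>A density argument: a hole of radius \<open>c' * s\<close> in the ball of radius
  \<open>2 * s\<close> around a point of \<open>P\<close> leaves to \<open>P\<close> at most the
  proportion \<open>q < 1\<close> of that ball. Covering a bounded piece of \<open>P\<close> by such
  balls shrinks its measure by the factor \<open>q\<close>.\<close>

lemma negligible_porous_aux:
  fixes E :: "'a::euclidean_space set"
  assumes E: "closed E" and c: "0 < c"
  defines "P \<equiv> {x\<in>E. \<forall>n::nat. \<exists>y. norm (y - x) < 1 / Suc n \<and> infdist y E > c * norm (y - x)}"
  shows "negligible P"
proof -
  define V where "V n = {x. \<exists>y. norm (y - x) < 1 / Suc n \<and> infdist y E > c * norm (y - x)}" for n :: nat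
  have opn: "open (V n)" for n
  proof -
    have "V n = (\<Union>y. {x. norm (y - x) < 1 / Suc n} \<inter> {x. infdist y E > c * norm (y - x)})"
      by (auto simp: V_def)
    also have "open \<dots>"
      by (intro open_UN open_Int ballI open_Collect_less continuous_intros)
    finally show ?thesis .
  qed
  have P: "P = E \<inter> (\<Inter>n. V n)" by (auto simp: P_def V_def)
  have Pb: "P \<in> sets borel" unfolding P using E opn by (intro sets.Int sets.countable_INT) auto
  have "negligible (P \<inter> ball 0 (real k))" for k
  proof -
    define S where "S = P \<inter> ball 0 (real k)"
    have S: "S \<in> sets borel" unfolding S_def using Pb by auto
    then have Sl: "S \<in> sets lebesgue" by simp
    have Sfin: "emeasure lebesgue S < \<infinity>"
    proof -
      have "emeasure lebesgue S \<le> emeasure lebesgue (ball (0::'a) (real k))"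
        by (intro emeasure_mono) (auto simp: S_def)
      also have "\<dots> < \<infinity>" using emeasure_lborel_ball_finite[of "0::'a" "real k"] by simp
      finally show ?thesis .
    qed
    \<comment> \<open>With \<open>c' \<le> 1\<close> the hole around \<open>y\<close>, which has
      distance \<open>s\<close> from \<open>x\<close>, stays inside
      \<open>ball x (2 * s)\<close>.\<close>
    define c' where "c' = min c 1"
    have c': "0 < c'" "c' \<le> 1" "c' \<le> c" using c by (auto simp: c'_def)
    define q where "q = 1 - (c'/2) ^ DIM('a)"
    have q: "0 \<le> q" "q < 1"
      using c' power_le_one[of "c'/2" "DIM('a)"] by (auto simp: q_def)
    define K where "K = {(x,r). x \<in> S \<and> 0 < r \<and> emeasure lebesgue (S \<inter> ball x r) \<le> ennreal q * emeasure lebesgue (ball x r)}"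
    have cov: "\<exists>i\<in>K. x \<in> ball (fst i) (snd i) \<and> snd i < d" if x: "x \<in> S" and d: "0 < d" for x d
    proof -
      obtain n :: nat where n: "1 / Suc n < d / 2"
        using d by (metis half_gt_zero nat_approx_posE)
      have "x \<in> P" using x by (simp add: S_def)
      then obtain y where y: "norm (y - x) < 1 / Suc n" "infdist y E > c * norm (y - x)" and xE: "x \<in> E"
        unfolding P_def by blast
      define s where "s = norm (y - x)"
      have s: "s > 0"
      proof (rule ccontr)
        assume "\<not> ?thesis" then have "y = x" by (simp add: s_def)
        then show False using y xE by simp
      qed
      have sub: "ball y (c' * s) \<subseteq> ball x (2 * s)"
      proof
        fix z assume "z \<in> ball y (c' * s)"
        then have "norm (z - y) < c' * s" by (simp add: dist_norm norm_minus_commute)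
        moreover have "c' * s \<le> s" using c' s by (simp add: mult_le_cancel_right1)
        moreover have "norm (z - x) \<le> norm (z - y) + norm (y - x)"
          by (metis norm_triangle_ineq diff_add_cancel add_diff_eq)
        ultimately show "z \<in> ball x (2 * s)" by (simp add: dist_norm norm_minus_commute s_def)
      qed
      have dis: "ball y (c' * s) \<inter> E = {}"
      proof (rule ccontr)
        assume "\<not> ?thesis"
        then obtain z where z: "z \<in> E" "dist y z < c' * s" by auto
        have "infdist y E \<le> dist y z" using z by (simp add: infdist_le)
        also have "\<dots> < c' * s" by fact
        also have "\<dots> \<le> c * s" using c' s by simp
        finally show False using y by (simp add: s_def)
      qed
      have "emeasure lebesgue (S \<inter> ball x (2 * s)) \<le> emeasure lebesgue (ball x (2 * s) - ball y (c' * s))"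
        using dis by (intro emeasure_mono) (auto simp: S_def P_def)
      also have "\<dots> = emeasure lebesgue (ball x (2 * s)) - emeasure lebesgue (ball y (c' * s))"
        using sub emeasure_lborel_ball_finite[of y "c' * s"] by (intro emeasure_Diff) auto
      also have "\<dots> = ennreal (measure lebesgue (ball x (2 * s)) - measure lebesgue (ball y (c' * s)))"
        using emeasure_lborel_ball_finite[of y "c' * s"] emeasure_lborel_ball_finite[of x "2 * s"]
        by (simp add: emeasure_eq_ennreal_measure ennreal_minus)
      also have "measure lebesgue (ball x (2 * s)) - measure lebesgue (ball y (c' * s)) = q * measure lebesgue (ball x (2 * s))"
        using s c' content_ball_conv_unit_ball[of "2 * s" x] content_ball_conv_unit_ball[of "c' * s" y]
        by (simp add: q_def power_mult_distrib power_divide field_simps)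
      also have "ennreal \<dots> = ennreal q * emeasure lebesgue (ball x (2 * s))"
        using q emeasure_lborel_ball_finite[of x "2 * s"]
        by (simp add: emeasure_eq_ennreal_measure ennreal_mult')
      finally have "(x, 2 * s) \<in> K" using x s by (simp add: K_def)
      moreover have "2 * s < d" using y n s_def by simp
      ultimately show ?thesis using s by (intro bexI[of _ "(x, 2 * s)"]) auto
    qed
    \<comment> \<open>The error \<open>e\<close> is the excess of the open set that encloses
      \<open>S\<close>. Once it has tended to \<open>0\<close>, the finite measure of
      \<open>S\<close> is at most \<open>q\<close> times itself.\<close>
    have "emeasure lebesgue S \<le> ennreal q * (emeasure lebesgue S + ennreal e)" if e: "0 < e" for e
    proof -
      obtain U where U: "open U" "S \<subseteq> U" "emeasure lebesgue U \<le> emeasure lebesgue S + ennreal e"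
        using emeasure_open_superset[OF Sl e] .
      obtain C where C: "countable C" "C \<subseteq> K" "disjoint_family_on (\<lambda>i. ball (fst i) (snd i)) C"
        "(\<Union>i\<in>C. ball (fst i) (snd i)) \<subseteq> U" "negligible (S - (\<Union>i\<in>C. ball (fst i) (snd i)))"
        using Vitali_balls_in_open[OF cov U(1,2)] by blast
      let ?D = "\<lambda>i. S \<inter> ball (fst i) (snd i)"
      have "emeasure lebesgue S = emeasure lebesgue ((\<Union>i\<in>C. ?D i) \<union> (S - (\<Union>i\<in>C. ball (fst i) (snd i))))"
        by (intro arg_cong[where f = "emeasure lebesgue"]) auto
      also have "\<dots> = emeasure lebesgue (\<Union>i\<in>C. ?D i)"
        using C Sl by (intro emeasure_Un_null_set) (auto simp: negligible_iff_null_sets[symmetric] intro!: sets.countable_UN')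
      also have "\<dots> \<le> ennreal q * emeasure lebesgue (\<Union>i\<in>C. ball (fst i) (snd i))"
      proof (rule emeasure_disjoint_balls_le)
        show "disjoint_family_on (\<lambda>i. S \<inter> ball (fst i) (snd i)) C"
          by (rule disjoint_family_on_bisimulation[OF C(3)]) blast
        show "emeasure lebesgue (S \<inter> ball (fst i) (snd i)) \<le> ennreal q * emeasure lebesgue (ball (fst i) (snd i))" if "i \<in> C" for i
        proof -
          have "i \<in> K" using C(2) that by blast
          then show ?thesis by (simp add: K_def split_beta)
        qed
      qed (use C Sl in auto)
      also have "\<dots> \<le> ennreal q * emeasure lebesgue U"
        using C U by (intro mult_left_mono emeasure_mono) auto
      also have "\<dots> \<le> ennreal q * (emeasure lebesgue S + ennreal e)"
        using U by (intro mult_left_mono) auto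
      finally show ?thesis .
    qed
    then have "emeasure lebesgue S \<le> ennreal q * emeasure lebesgue S"
      by (rule ennreal_le_approx[OF _ q(1) Sfin])
    then have "emeasure lebesgue S = 0" using q(2) Sfin q(1) by (rule ennreal_le_contraction)
    then show ?thesis using Sl by (simp add: negligible_iff_null_sets null_sets_def S_def)
  qed
  then have "negligible (\<Union>k. P \<inter> ball 0 (real k))"
    by (intro negligible_Union_nat) auto
  moreover have "(\<Union>k. P \<inter> ball 0 (real k)) = P"
  proof -
    have "\<exists>k::nat. norm x < real k" for x :: 'a using reals_Archimedean2 by blast
    then show ?thesis by auto
  qed
  ultimately show ?thesis by simp
qed

lemma negligible_porous_part:
  assumes "closed E"
  shows "negligible (porous_part E)"
proof -
  have "porous_part E \<subseteq> (\<Union>k::nat. {x\<in>E. \<forall>n::nat. \<exists>y. norm (y - x) < 1 / Suc n \<and> infdist y E > (1 / Suc k) * norm (y - x)})"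
  proof
    fix x assume x: "x \<in> porous_part E"
    then obtain \<eta> where \<eta>: "\<eta> > 0" and *: "\<And>\<delta>. \<delta> > 0 \<Longrightarrow> \<exists>y. norm (y - x) < \<delta> \<and> infdist y E > \<eta> * norm (y - x)"
      unfolding porous_part_def by force
    obtain k :: nat where k: "1 / Suc k < \<eta>" using \<eta> by (metis nat_approx_posE)
    have "\<exists>y. norm (y - x) < 1 / Suc n \<and> infdist y E > (1 / Suc k) * norm (y - x)" for n :: nat
    proof -
      obtain y where y: "norm (y - x) < 1 / Suc n" "infdist y E > \<eta> * norm (y - x)"
        using *[of "1 / Suc n"] by auto
      moreover have "(1 / Suc k) * norm (y - x) \<le> \<eta> * norm (y - x)"
        using k by (intro mult_right_mono) auto
      ultimately show ?thesis by (meson order_le_less_trans)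
    qed
    then show "x \<in> (\<Union>k::nat. {x\<in>E. \<forall>n::nat. \<exists>y. norm (y - x) < 1 / Suc n \<and> infdist y E > (1 / Suc k) * norm (y - x)})"
      using x by (auto simp: porous_part_def)
  qed
  moreover have "negligible \<dots>"
    by (intro negligible_Union_nat negligible_porous_aux assms) auto
  ultimately show ?thesis by (rule negligible_subset[rotated])
qed

lemma negligible_lipschitz_image:
  fixes f :: "'a::euclidean_space \<Rightarrow> 'b::euclidean_space"
  assumes "L-lipschitz_on S f" "negligible S" "DIM('a) \<le> DIM('b)"
  shows "negligible (f ` S)"
  using assms(3,2)
proof (rule negligible_locally_Lipschitz_image)
  fix x assume "x \<in> S"
  then show "\<exists>T B. open T \<and> x \<in> T \<and> (\<forall>y\<in>S \<inter> T. norm (f y - f x) \<le> B * norm (y - x))"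
    using lipschitz_onD[OF assms(1)] by (intro exI[of _ UNIV] exI[of _ L]) (auto simp: dist_norm)
qed

section \<open>Lipschitz functions of one variable\<close>

lemma strict_mono_image_interval:
  fixes G :: "real \<Rightarrow> real"
  assumes "strict_mono G" "continuous_on UNIV G" "a < b"
  shows "G ` {a<..<b} = {G a<..<G b}"
proof (intro equalityI subsetI)
  fix y assume y: "y \<in> {G a<..<G b}"
  have "continuous_on {a..b} G" using assms(2) continuous_on_subset by blast
  then obtain x where x: "a \<le> x" "x \<le> b" "G x = y" using IVT'[of G a y b] y assms(3) by auto
  moreover have "x \<noteq> a" "x \<noteq> b" using x y by auto
  ultimately show "y \<in> G ` {a<..<b}" by force
qed (use assms in \<open>auto simp: strict_mono_def\<close>)

text \<open>A Vitali selection of the intervals offered by \<open>slope\<close> is disjoint and has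
  disjoint images, whose lengths add up to at most \<open>c\<close> times the measure of a
  neighbourhood of \<open>S\<close>. The hypothesis \<open>null\<close> handles the part of
  \<open>S\<close> that the selection misses.\<close>

lemma emeasure_image_le_of_slopes:
  fixes G :: "real \<Rightarrow> real"
  assumes G: "strict_mono G" "continuous_on UNIV G"
    and null: "\<And>N. negligible N \<Longrightarrow> negligible (G ` N)"
    and S: "S \<in> sets lebesgue" "emeasure lebesgue S < \<infinity>" and c: "0 \<le> c"
    and slope: "\<And>x d. x \<in> S \<Longrightarrow> 0 < d \<Longrightarrow> \<exists>a b. a < x \<and> x < b \<and> b - a < d \<and> G b - G a \<le> c * (b - a)"
  shows "emeasure lebesgue (G ` S) \<le> ennreal c * emeasure lebesgue S"
proof (rule ennreal_le_approx)
  fix e :: real assume e: "0 < e"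
  obtain U where U: "open U" "S \<subseteq> U" "emeasure lebesgue U \<le> emeasure lebesgue S + ennreal e"
    using emeasure_open_superset[OF S(1) e] .
  \<comment> \<open>An interval is stored as midpoint and half-length because the covering lemma
    speaks of balls; \<open>x\<close> only has to lie in the interval, not at its midpoint.\<close>
  define K where "K = {(m, r). 0 < r \<and> G (m + r) - G (m - r) \<le> c * (2 * r)}"
  have cov: "\<exists>i\<in>K. x \<in> ball (fst i) (snd i) \<and> snd i < d" if x: "x \<in> S" and d: "0 < d" for x d
  proof -
    obtain a b where ab: "a < x" "x < b" "b - a < d" "G b - G a \<le> c * (b - a)" using slope[OF x d] by blast
    have e1: "(a + b) / 2 + (b - a) / 2 = b" "(a + b) / 2 - (b - a) / 2 = a" by (auto simp: field_simps)
    have e2: "2 * ((b - a) / 2) = b - a" by simp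
    have "((a + b) / 2, (b - a) / 2) \<in> K"
      unfolding K_def mem_Collect_eq prod.case e1 e2 using ab by simp
    moreover have "x \<in> ball ((a + b) / 2) ((b - a) / 2)"
      using ab by (auto simp: dist_real_def abs_if field_simps)
    ultimately show ?thesis using ab by (intro bexI[of _ "((a + b) / 2, (b - a) / 2)"]) auto
  qed
  obtain C where C: "countable C" "C \<subseteq> K" "disjoint_family_on (\<lambda>i. ball (fst i) (snd i)) C"
    "(\<Union>i\<in>C. ball (fst i) (snd i)) \<subseteq> U" "negligible (S - (\<Union>i\<in>C. ball (fst i) (snd i)))"
    using Vitali_balls_in_open[OF cov U(1,2)] by blast
  let ?B = "\<lambda>i. ball (fst i) (snd i)"
  have im: "G ` ?B i = {G (fst i - snd i)<..<G (fst i + snd i)}" if "i \<in> C" for i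
  proof -
    have "0 < snd i" using that C(2) by (auto simp: K_def)
    then show ?thesis
      using strict_mono_image_interval[OF G, of "fst i - snd i" "fst i + snd i"]
      by (simp add: ball_eq_greaterThanLessThan)
  qed
  have inj: "inj G" using G(1) by (simp add: strict_mono_imp_inj_on)
  have meas: "(\<Union>i\<in>C. G ` ?B i) \<in> sets lebesgue" using C(1) im by (intro sets.countable_UN') auto
  have nn: "G ` (S - (\<Union>i\<in>C. ?B i)) \<in> null_sets lebesgue"
    using null[OF C(5)] by (simp add: negligible_iff_null_sets)
  have "emeasure lebesgue (G ` S) \<le> emeasure lebesgue ((\<Union>i\<in>C. G ` ?B i) \<union> G ` (S - (\<Union>i\<in>C. ?B i)))"
  proof (rule emeasure_mono)
    show "G ` S \<subseteq> (\<Union>i\<in>C. G ` ?B i) \<union> G ` (S - (\<Union>i\<in>C. ?B i))" by blast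
  qed (use meas nn in auto)
  also have "\<dots> = emeasure lebesgue (\<Union>i\<in>C. G ` ?B i)"
    using meas nn by (rule emeasure_Un_null_set)
  also have "\<dots> \<le> ennreal c * emeasure lebesgue (\<Union>i\<in>C. ?B i)"
  proof (rule emeasure_disjoint_balls_le)
    fix i assume i: "i \<in> C"
    then have r: "0 < snd i" and l: "G (fst i + snd i) - G (fst i - snd i) \<le> c * (2 * snd i)"
      using C(2) by (auto simp: K_def)
    have m: "G (fst i - snd i) \<le> G (fst i + snd i)" using r G(1) by (simp add: strict_mono_less_eq)
    show "G ` ?B i \<in> sets lebesgue" using im[OF i] by simp
    have "emeasure lebesgue (G ` ?B i) = ennreal (G (fst i + snd i) - G (fst i - snd i))"
      using im[OF i] m by simp
    also have "\<dots> \<le> ennreal (c * (2 * snd i))" using l by (rule ennreal_leI)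
    also have "\<dots> = ennreal c * emeasure lebesgue (?B i)"
      using c r by (simp add: ball_eq_greaterThanLessThan ennreal_mult')
    finally show "emeasure lebesgue (G ` ?B i) \<le> ennreal c * emeasure lebesgue (?B i)" .
  next
    show "disjoint_family_on (\<lambda>i. G ` ?B i) C"
      by (rule disjoint_family_on_bisimulation[OF C(3)]) (simp add: image_Int[OF inj, symmetric])
  qed (use C in auto)
  also have "\<dots> \<le> ennreal c * emeasure lebesgue U"
    using C U by (intro mult_left_mono emeasure_mono) auto
  also have "\<dots> \<le> ennreal c * (emeasure lebesgue S + ennreal e)"
    using U by (intro mult_left_mono) auto
  finally show "emeasure lebesgue (G ` S) \<le> ennreal c * (emeasure lebesgue S + ennreal e)" .
qed (use S c in auto)

text \<open>For Lipschitz \<open>f\<close>, the derivative in direction \<open>b\<close> exists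
  exactly off the union of these sets over rational pairs \<alpha> < \<beta>. Scales
  \<open>1 / Suc n\<close> instead of all positive reals make the set a countable intersection of
  open sets, hence Borel.\<close>

definition osc_set :: "('a::real_normed_vector \<Rightarrow> real) \<Rightarrow> 'a \<Rightarrow> real \<Rightarrow> real \<Rightarrow> 'a set" where
  "osc_set f b \<alpha> \<beta> = {x. \<forall>n::nat. (\<exists>t. t \<noteq> 0 \<and> \<bar>t\<bar> < 1 / Suc n \<and> (f (x + t *\<^sub>R b) - f x) / t < \<alpha>) \<and>
                                  (\<exists>t. t \<noteq> 0 \<and> \<bar>t\<bar> < 1 / Suc n \<and> \<beta> < (f (x + t *\<^sub>R b) - f x) / t)}"

lemma osc_setD:
  assumes "x \<in> osc_set f b \<alpha> \<beta>"
  shows "\<exists>t. t \<noteq> 0 \<and> \<bar>t\<bar> < 1 / Suc n \<and> (f (x + t *\<^sub>R b) - f x) / t < \<alpha>"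
    and "\<exists>t. t \<noteq> 0 \<and> \<bar>t\<bar> < 1 / Suc n \<and> \<beta> < (f (x + t *\<^sub>R b) - f x) / t"
  using assms unfolding osc_set_def mem_Collect_eq by (drule_tac spec[of _ n], simp)+

lemma borel_osc_set:
  fixes f :: "'a::euclidean_space \<Rightarrow> real"
  assumes "continuous_on UNIV f"
  shows "osc_set f b \<alpha> \<beta> \<in> sets borel"
proof -
  have c: "continuous_on UNIV (\<lambda>x. (f (x + t *\<^sub>R b) - f x) / t)" if "t \<noteq> 0" for t
    using that by (intro continuous_intros continuous_on_compose2[OF assms]) auto
  have "osc_set f b \<alpha> \<beta> = (\<Inter>n::nat. (\<Union>t\<in>{t. t \<noteq> 0 \<and> \<bar>t\<bar> < 1 / Suc n}. {x. (f (x + t *\<^sub>R b) - f x) / t < \<alpha>})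
     \<inter> (\<Union>t\<in>{t. t \<noteq> 0 \<and> \<bar>t\<bar> < 1 / Suc n}. {x. \<beta> < (f (x + t *\<^sub>R b) - f x) / t}))"
    by (auto simp: osc_set_def)
  also have "\<dots> \<in> sets borel"
  proof (rule sets.countable_INT)
    have "open ((\<Union>t\<in>{t. t \<noteq> 0 \<and> \<bar>t\<bar> < 1 / Suc n}. {x. (f (x + t *\<^sub>R b) - f x) / t < \<alpha>})
     \<inter> (\<Union>t\<in>{t. t \<noteq> 0 \<and> \<bar>t\<bar> < 1 / Suc n}. {x. \<beta> < (f (x + t *\<^sub>R b) - f x) / t}))" for n :: nat
      by (intro open_Int open_UN ballI open_Collect_less c continuous_intros) auto
    then show "range (\<lambda>n::nat. (\<Union>t\<in>{t. t \<noteq> 0 \<and> \<bar>t\<bar> < 1 / Suc n}. {x. (f (x + t *\<^sub>R b) - f x) / t < \<alpha>})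
     \<inter> (\<Union>t\<in>{t. t \<noteq> 0 \<and> \<bar>t\<bar> < 1 / Suc n}. {x. \<beta> < (f (x + t *\<^sub>R b) - f x) / t})) \<subseteq> sets borel"
      by (intro image_subsetI borel_open)
  qed simp
  finally show ?thesis .
qed

text \<open>On the oscillation set the increasing function \<open>G\<close> has slopes below
  \<open>a'\<close> at all small scales, so it stretches measure by at most \<open>a'\<close>; it
  also has slopes above \<open>b'\<close>, so its inverse \<open>H\<close> stretches by at most
  \<open>1 / b'\<close>. Going there and back multiplies the measure by at most
  \<open>a' / b' < 1\<close>.\<close>

lemma negligible_slope_oscillation:
  fixes g :: "real \<Rightarrow> real"
  assumes L: "L-lipschitz_on UNIV g" and ab: "\<alpha> < \<beta>"
  shows "negligible (osc_set g 1 \<alpha> \<beta>)"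
proof -
  have L0: "0 \<le> L" using L by (rule lipschitz_on_nonneg)
  \<comment> \<open>The linear term puts all difference quotients of \<open>G\<close> between
    \<open>1\<close> and \<open>2 * L + 1\<close>, so that \<open>G\<close> is invertible with
    Lipschitz inverse; the bounds \<alpha>, \<beta> turn into \<open>a'\<close>,
    \<open>b'\<close>.\<close>
  define G where "G x = g x + (L + 1) * x" for x
  have gd: "\<bar>g y - g x\<bar> \<le> L * \<bar>y - x\<bar>" for x y
    using lipschitz_onD[OF L] by (simp add: dist_real_def)
  have low: "y - x \<le> G y - G x" and up: "G y - G x \<le> (2 * L + 1) * (y - x)" if "x \<le> y" for x y
    using gd[of y x] that by (auto simp: G_def algebra_simps abs_if split: if_splits)
  have sm: "strict_mono G" unfolding strict_mono_def
  proof (intro allI impI)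
    fix x y :: real assume "x < y" then show "G x < G y" using low[of x y] by simp
  qed
  have Glip: "(2 * L + 1)-lipschitz_on UNIV G"
  proof (rule lipschitz_onI)
    fix x y show "dist (G x) (G y) \<le> (2 * L + 1) * dist x y"
    proof (cases "x \<le> y")
      case True
      then have "\<bar>x - y\<bar> = y - x" "\<bar>G x - G y\<bar> = G y - G x" using low[of x y] by auto
      then show ?thesis using up[of x y] True by (simp add: dist_real_def)
    next
      case False
      then have "\<bar>x - y\<bar> = x - y" "\<bar>G x - G y\<bar> = G x - G y" using low[of y x] by auto
      then show ?thesis using up[of y x] False by (simp add: dist_real_def)
    qed
  qed (use L0 in simp)
  have Gc: "continuous_on UNIV G" using Glip by (rule lipschitz_on_continuous_on)
  have inj: "inj G" using sm by (simp add: strict_mono_imp_inj_on)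
  have surj: "surj G"
  proof (rule surjI)
    fix y
    define r where "r = \<bar>y - G 0\<bar>"
    have "G (- r) \<le> y" using low[of "-r" 0] by (simp add: r_def)
    moreover have "y \<le> G r" using low[of 0 r] by (simp add: r_def)
    moreover have "continuous_on {-r..r} G" using Gc continuous_on_subset by blast
    moreover have "-r \<le> r" by (simp add: r_def)
    ultimately obtain x where "G x = y" using IVT'[of G "-r" y r] by blast
    then show "G (inv G y) = y" by (metis f_inv_into_f rangeI)
  qed
  define H where "H = inv G"
  have HG: "H (G x) = x" for x using inj by (simp add: H_def)
  have GH: "G (H y) = y" for y using surj by (simp add: H_def surj_f_inv_f)
  have smH: "strict_mono H" unfolding strict_mono_def
  proof (intro allI impI)
    fix x y :: real assume "x < y"
    then have "G (H x) < G (H y)" by (simp add: GH)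
    then show "H x < H y" using sm by (simp add: strict_mono_less)
  qed
  have Hlip: "1-lipschitz_on UNIV H"
  proof (rule lipschitz_onI)
    fix x y show "dist (H x) (H y) \<le> 1 * dist x y"
      using low[of "H x" "H y"] low[of "H y" "H x"] by (cases "H x \<le> H y") (auto simp: dist_real_def GH)
  qed simp
  define P where "P = osc_set g 1 \<alpha> \<beta>"
  have Pb: "P \<in> sets borel" unfolding P_def by (intro borel_osc_set lipschitz_on_continuous_on[OF L])
  define a' b' where "a' = \<alpha> + (L + 1)" and "b' = \<beta> + (L + 1)"
  have slopeG: "(G (x + t) - G x) / t = (g (x + t) - g x) / t + (L + 1)" if "t \<noteq> 0" for x t
    using that by (simp add: G_def field_simps)
  \<comment> \<open>A quotient from \<open>osc_set\<close> has \<open>x\<close> as an end point. The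
    inequality is strict and \<open>G\<close> is continuous, so the interval can be widened slightly
    at both ends, which brings \<open>x\<close> into its interior.\<close>
  have ivl: "\<exists>a b. a < x \<and> x < b \<and> b - a < d \<and> P1 (G b - G a) (b - a)"
    if x: "t \<noteq> 0" "\<bar>t\<bar> < d" and P1: "P1 = (\<lambda>u v. u < c * v) \<or> P1 = (\<lambda>u v. c * v < u)"
      and q: "P1 (G (max x (x+t)) - G (min x (x+t))) \<bar>t\<bar>" for x t d c P1
  proof -
    have at: "\<bar>t\<bar> = max x (x+t) - min x (x+t)" by auto
    have "continuous_on UNIV (\<lambda>s. G (max x (x+t) + s) - G (min x (x+t) - s) - c * (\<bar>t\<bar> + 2 * s))"
      by (intro continuous_intros continuous_on_compose2[OF Gc]) auto
    then have cont: "isCont (\<lambda>s. G (max x (x+t) + s) - G (min x (x+t) - s) - c * (\<bar>t\<bar> + 2 * s)) 0"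
      by (simp add: continuous_on_eq_continuous_at)
    have "\<forall>\<^sub>F s in at 0. P1 (G (max x (x+t) + s) - G (min x (x+t) - s)) (\<bar>t\<bar> + 2 * s)"
      using P1
    proof
      assume P: "P1 = (\<lambda>u v. u < c * v)"
      have "\<forall>\<^sub>F s in at 0. G (max x (x+t) + s) - G (min x (x+t) - s) - c * (\<bar>t\<bar> + 2 * s) < 0"
        using cont q P unfolding isCont_def by (intro order_tendstoD(2)) auto
      then show ?thesis by (rule eventually_mono) (simp add: P)
    next
      assume P: "P1 = (\<lambda>u v. c * v < u)"
      have "\<forall>\<^sub>F s in at 0. 0 < G (max x (x+t) + s) - G (min x (x+t) - s) - c * (\<bar>t\<bar> + 2 * s)"
        using cont q P unfolding isCont_def by (intro order_tendstoD(1)) auto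
      then show ?thesis by (rule eventually_mono) (simp add: P)
    qed
    then obtain e where e: "e > 0" "\<And>s. s \<noteq> 0 \<Longrightarrow> \<bar>s\<bar> < e \<Longrightarrow> P1 (G (max x (x+t) + s) - G (min x (x+t) - s)) (\<bar>t\<bar> + 2 * s)"
      unfolding eventually_at by (auto simp: dist_real_def)
    define s where "s = min (e/2) ((d - \<bar>t\<bar>) / 4)"
    have s: "0 < s" "s < e" "2 * s < d - \<bar>t\<bar>" using e x by (auto simp: s_def min_def)
    have "P1 (G (max x (x+t) + s) - G (min x (x+t) - s)) (\<bar>t\<bar> + 2 * s)" using s by (intro e) auto
    moreover have "\<bar>t\<bar> + 2 * s = (max x (x+t) + s) - (min x (x+t) - s)" by auto
    ultimately have "min x (x+t) - s < x \<and> x < max x (x+t) + s \<and> (max x (x+t) + s) - (min x (x+t) - s) < d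
        \<and> P1 (G (max x (x+t) + s) - G (min x (x+t) - s)) ((max x (x+t) + s) - (min x (x+t) - s))"
      using s x by auto
    then show ?thesis by blast
  qed
  have quot: "G (max x (x+t)) - G (min x (x+t)) = \<bar>t\<bar> * ((G (x + t) - G x) / t)" if "t \<noteq> 0" for x t
    using that by (cases "t > 0") (auto simp: max_def min_def field_simps)
  have lo: "\<exists>a b. a < x \<and> x < b \<and> b - a < d \<and> G b - G a < a' * (b - a)" if xP: "x \<in> P" and d0: "0 < d" for x d
  proof -
    obtain n :: nat where n: "1 / Suc n < d" using nat_approx_posE[OF d0] .
    then obtain t where t: "t \<noteq> 0" "\<bar>t\<bar> < 1 / Suc n" "(g (x + t) - g x) / t < \<alpha>"
      using osc_setD(1)[OF xP[unfolded P_def], of n] by (auto simp del: of_nat_Suc)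
    then have "(G (x + t) - G x) / t < a'" by (simp add: slopeG a'_def)
    then have "G (max x (x+t)) - G (min x (x+t)) < a' * \<bar>t\<bar>"
      using t(1) unfolding quot[OF t(1)] by (subst mult.commute) (rule mult_strict_right_mono, auto)
    then show ?thesis using ivl[of t d "\<lambda>u v. u < a' * v" a' x] t n by auto
  qed
  have hi: "\<exists>a b. a < x \<and> x < b \<and> b - a < d \<and> b' * (b - a) < G b - G a" if xP: "x \<in> P" and d0: "0 < d" for x d
  proof -
    obtain n :: nat where n: "1 / Suc n < d" using nat_approx_posE[OF d0] .
    then obtain t where t: "t \<noteq> 0" "\<bar>t\<bar> < 1 / Suc n" "\<beta> < (g (x + t) - g x) / t"
      using osc_setD(2)[OF xP[unfolded P_def], of n] by (auto simp del: of_nat_Suc)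
    then have "b' < (G (x + t) - G x) / t" by (simp add: slopeG b'_def)
    then have "b' * \<bar>t\<bar> < G (max x (x+t)) - G (min x (x+t))"
      using t(1) unfolding quot[OF t(1)] by (subst (2) mult.commute) (rule mult_strict_right_mono, auto)
    then show ?thesis using ivl[of t d "\<lambda>u v. b' * v < u" b' x] t n by auto
  qed
  have "negligible (P \<inter> ball 0 (real k))" for k
  proof (cases "P \<inter> ball 0 (real k) = {}")
    case False
    define S where "S = P \<inter> ball 0 (real k)"
    have Sl: "S \<in> sets lebesgue" unfolding S_def using Pb by auto
    have Sfin: "emeasure lebesgue S < \<infinity>"
    proof -
      have "emeasure lebesgue S \<le> emeasure lebesgue (ball (0::real) (real k))"
        by (intro emeasure_mono) (auto simp: S_def)
      also have "\<dots> < \<infinity>" using emeasure_lborel_ball_finite[of "0::real" "real k"] by simp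
      finally show ?thesis .
    qed
    obtain x0 where x0: "x0 \<in> P" using False by auto
    \<comment> \<open>All quotients of \<open>G\<close> are at least \<open>1\<close>, and some lie
      below \<open>a'\<close>. This also makes \<open>b'\<close> positive, so that
      \<open>1 / b'\<close> bounds slopes of the inverse.\<close>
    have a1: "1 \<le> a'"
    proof -
      obtain a b where ab: "a < x0" "x0 < b" "G b - G a < a' * (b - a)" using lo[OF x0, of 1] by auto
      have "b - a \<le> G b - G a" using ab by (intro low) simp
      then have "1 * (b - a) < a' * (b - a)" using ab(3) by (simp only: mult_1 order_le_less_trans)
      then show ?thesis using ab by (intro less_imp_le) (rule mult_right_less_imp_less[of 1 "b - a"], auto)
    qed
    have a'b': "a' < b'" using ab by (simp add: a'_def b'_def)
    have GS: "emeasure lebesgue (G ` S) \<le> ennreal a' * emeasure lebesgue S"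
    proof (rule emeasure_image_le_of_slopes[OF sm Gc _ Sl Sfin])
      show "negligible (G ` N)" if "negligible N" for N
        using that Glip by (intro negligible_lipschitz_image) (auto intro: lipschitz_on_subset)
      show "\<exists>a b. a < x \<and> x < b \<and> b - a < d \<and> G b - G a \<le> a' * (b - a)" if "x \<in> S" "0 < d" for x d
        using lo[of x d] that unfolding S_def by (meson IntD1 less_imp_le)
    qed (use a1 in simp)
    have GSm: "G ` S \<in> sets lebesgue"
    proof -
      have "G ` S = H -` S" by (auto simp: HG) (metis GH image_eqI)
      moreover have "H \<in> borel_measurable borel"
        using Hlip by (intro borel_measurable_continuous_onI lipschitz_on_continuous_on)
      moreover have "S \<in> sets borel" unfolding S_def using Pb by auto
      ultimately have "G ` S \<in> sets borel" by (metis measurable_sets_borel)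
      then show ?thesis by simp
    qed
    have fin2: "emeasure lebesgue (G ` S) < \<infinity>"
      using GS Sfin by (simp add: ennreal_mult_less_top order_le_less_trans)
    have "emeasure lebesgue (H ` (G ` S)) \<le> ennreal (1 / b') * emeasure lebesgue (G ` S)"
    proof (rule emeasure_image_le_of_slopes[OF smH _ _ GSm fin2])
      show "continuous_on UNIV H" using Hlip by (rule lipschitz_on_continuous_on)
      show "negligible (H ` N)" if "negligible N" for N
        using that Hlip by (intro negligible_lipschitz_image) (auto intro: lipschitz_on_subset)
      show "\<exists>a b. a < y \<and> y < b \<and> b - a < d \<and> H b - H a \<le> 1 / b' * (b - a)" if y: "y \<in> G ` S" and d: "0 < d" for y d
      proof -
        obtain x where x: "x \<in> P" "y = G x" using y by (auto simp: S_def)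
        have "0 < d / (2 * L + 1)" using d L0 by simp
        then obtain a b where ab: "a < x" "x < b" "b - a < d / (2 * L + 1)" "b' * (b - a) < G b - G a"
          using hi[OF x(1)] by blast
        have "G b - G a \<le> (2 * L + 1) * (b - a)" using up ab by simp
        also have "\<dots> < d" using ab L0 by (simp add: field_simps)
        finally have "G b - G a < d" .
        moreover have "H (G b) - H (G a) \<le> 1 / b' * (G b - G a)"
          using ab a1 a'b' by (simp add: HG field_simps)
        moreover have "G a < y" "y < G b" using ab sm x by (auto simp: strict_mono_less)
        ultimately show ?thesis by blast
      qed
    qed (use a1 a'b' in simp)
    also have "H ` (G ` S) = S" by (simp add: image_image HG)
    also have "ennreal (1 / b') * emeasure lebesgue (G ` S) \<le> ennreal (1 / b') * (ennreal a' * emeasure lebesgue S)"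
      using GS by (intro mult_left_mono) auto
    also have "\<dots> = ennreal (a' / b') * emeasure lebesgue S"
      using a1 a'b' by (simp add: mult.assoc[symmetric] ennreal_mult'[symmetric])
    finally have "emeasure lebesgue S \<le> ennreal (a' / b') * emeasure lebesgue S" .
    then have "emeasure lebesgue S = 0"
      by (rule ennreal_le_contraction) (use a1 a'b' Sfin in auto)
    then show ?thesis using Sl by (simp add: negligible_iff_null_sets null_sets_def S_def)
  qed simp
  then have "negligible (\<Union>k. P \<inter> ball 0 (real k))"
    by (intro negligible_Union_nat) auto
  moreover have "(\<Union>k. P \<inter> ball 0 (real k)) = P"
  proof -
    have "\<exists>k::nat. norm x < real k" for x :: real using reals_Archimedean2 by blast
    then show ?thesis by auto
  qed
  ultimately show ?thesis by (simp add: P_def)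
qed

text \<open>Fubini without a choice of coordinates: the measure of \<open>B\<close> equals its
  average over the translations by \<open>t *\<^sub>R b\<close> with \<open>t\<close> in
  \<open>{0..1}\<close>, and exchanging the two integrals leaves measures of line sections
  inside.\<close>

lemma negligible_of_null_lines:
  fixes B :: "'a::euclidean_space set"
  assumes B: "B \<in> sets borel" and null: "\<And>x. negligible {t::real. x + t *\<^sub>R b \<in> B}"
  shows "negligible B"
proof -
  have [measurable]: "B \<in> sets borel" by fact
  have *: "emeasure lborel {t::real. x + t *\<^sub>R b \<in> B} = 0" for x
  proof -
    have "{t::real. x + t *\<^sub>R b \<in> B} \<in> sets borel" by measurable
    then show ?thesis using null[of x] by (simp add: negligible_iff_emeasure0)
  qed
  have tr: "emeasure lborel B = (\<integral>\<^sup>+x. indicator B (x + t *\<^sub>R b) \<partial>lborel)" for t :: real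
  proof -
    have "emeasure lborel B = (\<integral>\<^sup>+x. indicator B x \<partial>distr lborel borel ((+) (t *\<^sub>R b)))"
      by (simp add: lborel_distr_plus)
    also have "\<dots> = (\<integral>\<^sup>+x. indicator B (t *\<^sub>R b + x) \<partial>lborel)"
      by (subst nn_integral_distr) auto
    finally show ?thesis by (simp add: add.commute)
  qed
  have "emeasure lborel B = (\<integral>\<^sup>+t. emeasure lborel B * indicator {0..1::real} t \<partial>lborel)"
    by (subst nn_integral_cmult_indicator) auto
  also have "\<dots> = (\<integral>\<^sup>+t. (\<integral>\<^sup>+x. indicator B (x + t *\<^sub>R b) * indicator {0..1::real} t \<partial>lborel) \<partial>lborel)"
    by (intro nn_integral_cong) (subst nn_integral_multc, auto simp: tr[symmetric])
  also have "\<dots> = (\<integral>\<^sup>+x. (\<integral>\<^sup>+t. indicator B (x + t *\<^sub>R b) * indicator {0..1::real} t \<partial>lborel) \<partial>lborel)"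
    by (intro lborel_pair.Fubini') measurable
  also have "\<dots> \<le> (\<integral>\<^sup>+x. (\<integral>\<^sup>+t. indicator {t::real. x + t *\<^sub>R b \<in> B} t \<partial>lborel) \<partial>(lborel::'a measure))"
    by (intro nn_integral_mono) (auto simp: indicator_def)
  also have "\<dots> = 0"
    by (subst nn_integral_indicator) (auto simp: *)
  finally show ?thesis using B by (simp add: negligible_iff_emeasure0)
qed

lemma negligible_partial_oscillation:
  fixes f :: "'a::euclidean_space \<Rightarrow> real"
  assumes L: "L-lipschitz_on UNIV f" and b: "norm b \<le> 1" and ab: "\<alpha> < \<beta>"
  shows "negligible (osc_set f b \<alpha> \<beta>)"
proof (rule negligible_of_null_lines[where b = b])
  show "osc_set f b \<alpha> \<beta> \<in> sets borel"
    by (intro borel_osc_set lipschitz_on_continuous_on[OF L])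
  fix x
  define g where "g t = f (x + t *\<^sub>R b)" for t
  have "L-lipschitz_on UNIV g"
  proof (rule lipschitz_onI)
    fix s t :: real
    have "dist (g s) (g t) \<le> L * dist (x + s *\<^sub>R b) (x + t *\<^sub>R b)"
      unfolding g_def by (rule lipschitz_onD[OF L]) auto
    also have "dist (x + s *\<^sub>R b) (x + t *\<^sub>R b) = \<bar>s - t\<bar> * norm b"
      by (simp add: dist_norm scaleR_diff_left[symmetric])
    also have "L * (\<bar>s - t\<bar> * norm b) \<le> L * \<bar>s - t\<bar>"
      using b lipschitz_on_nonneg[OF L] by (intro mult_left_mono) (auto simp: mult_left_le)
    finally show "dist (g s) (g t) \<le> L * dist s t" by (simp add: dist_real_def)
  qed (use lipschitz_on_nonneg[OF L] in simp)
  then have "negligible (osc_set g 1 \<alpha> \<beta>)" using ab by (rule negligible_slope_oscillation)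
  moreover have "{t. x + t *\<^sub>R b \<in> osc_set f b \<alpha> \<beta>} = osc_set g 1 \<alpha> \<beta>"
    by (auto simp: osc_set_def g_def algebra_simps)
  ultimately show "negligible {t. x + t *\<^sub>R b \<in> osc_set f b \<alpha> \<beta>}" by simp
qed

section \<open>From directional derivatives to the total derivative\<close>

lemma differentiable_at_of_approx:
  fixes f :: "'a::real_inner \<Rightarrow> real"
  assumes "\<And>e. e > 0 \<Longrightarrow> \<exists>d>0. \<forall>h. norm h < d \<longrightarrow> \<bar>f (x + h) - f x - p \<bullet> h\<bar> \<le> e * norm h"
  shows "(f has_derivative (\<lambda>h. p \<bullet> h)) (at x)"
  unfolding has_derivative_at_alt
proof (intro conjI allI impI)
  fix e :: real assume "e > 0"
  then obtain d where d: "d > 0" "\<And>h. norm h < d \<Longrightarrow> \<bar>f (x + h) - f x - p \<bullet> h\<bar> \<le> e * norm h"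
    using assms by blast
  then show "\<exists>d>0. \<forall>y. norm (y - x) < d \<longrightarrow> norm (f y - f x - p \<bullet> (y - x)) \<le> e * norm (y - x)"
    by (intro exI[of _ d]) (metis add_diff_cancel_left' diff_add_cancel add.commute real_norm_def)
qed (rule bounded_linear_inner_right)

text \<open>The limit is the supremum of the eventual lower bounds of the quotient, which is bounded
  by \<open>L\<close>. Between this supremum and a larger \<open>a\<close> there are rationals
  \<open>p < q\<close>; as \<open>p\<close> is not an eventual lower bound, the absence of
  oscillation makes \<open>q\<close> an eventual upper bound.\<close>

lemma convergent_quotient_of_no_oscillation:
  fixes f :: "'a::real_normed_vector \<Rightarrow> real"
  assumes L: "L-lipschitz_on UNIV f" and b: "norm b \<le> 1"
    and no: "\<And>p q. p \<in> \<rat> \<Longrightarrow> q \<in> \<rat> \<Longrightarrow> p < q \<Longrightarrow> x \<notin> osc_set f b p q"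
  shows "\<exists>l. ((\<lambda>t. (f (x + t *\<^sub>R b) - f x) / t) \<longlongrightarrow> l) (at 0)"
proof -
  define Q where "Q t = (f (x + t *\<^sub>R b) - f x) / t" for t :: real
  have bd: "\<bar>Q t\<bar> \<le> L" if "t \<noteq> 0" for t
  proof -
    have "\<bar>f (x + t *\<^sub>R b) - f x\<bar> \<le> L * (\<bar>t\<bar> * norm b)"
      using lipschitz_onD[OF L, of "x + t *\<^sub>R b" x] by (simp add: dist_norm)
    also have "\<dots> \<le> L * \<bar>t\<bar>"
      using b lipschitz_on_nonneg[OF L] by (intro mult_left_mono) (auto simp: mult_left_le)
    finally show ?thesis using that by (simp add: Q_def pos_divide_le_eq)
  qed
  have ev: "(\<forall>\<^sub>F t in at 0. p \<le> Q t) \<or> (\<forall>\<^sub>F t in at 0. Q t \<le> q)" if pq: "p \<in> \<rat>" "q \<in> \<rat>" "p < q" for p q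
  proof -
    have "x \<notin> osc_set f b p q" using no pq by blast
    then obtain n :: nat where n: "(\<forall>t. t \<noteq> 0 \<longrightarrow> \<bar>t\<bar> < 1 / Suc n \<longrightarrow> \<not> Q t < p) \<or> (\<forall>t. t \<noteq> 0 \<longrightarrow> \<bar>t\<bar> < 1 / Suc n \<longrightarrow> \<not> q < Q t)"
      unfolding osc_set_def Q_def mem_Collect_eq de_Morgan_conj not_all not_ex by blast
    from n show ?thesis
    proof
      assume "\<forall>t. t \<noteq> 0 \<longrightarrow> \<bar>t\<bar> < 1 / Suc n \<longrightarrow> \<not> Q t < p"
      then have "\<forall>\<^sub>F t in at 0. p \<le> Q t"
        unfolding eventually_at by (intro exI[of _ "1 / Suc n"]) (auto simp: not_less)
      then show ?thesis ..
    next
      assume "\<forall>t. t \<noteq> 0 \<longrightarrow> \<bar>t\<bar> < 1 / Suc n \<longrightarrow> \<not> q < Q t"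
      then have "\<forall>\<^sub>F t in at 0. Q t \<le> q"
        unfolding eventually_at by (intro exI[of _ "1 / Suc n"]) (auto simp: not_less)
      then show ?thesis ..
    qed
  qed
  define A where "A = {p. \<forall>\<^sub>F t in at 0. p \<le> Q t}"
  define l where "l = Sup A"
  have inA: "-L \<in> A" unfolding A_def mem_Collect_eq eventually_at
    using bd by (intro exI[of _ 1]) (auto simp: abs_le_iff minus_le_iff)
  have nt: "(at (0::real)) \<noteq> bot" by simp
  have ub: "p \<le> L" if p: "p \<in> A" for p
  proof -
    have "\<forall>\<^sub>F t in at 0. p \<le> Q t \<and> t \<noteq> 0"
      using p unfolding A_def by (auto intro: eventually_conj simp: eventually_at_filter)
    then obtain t where "p \<le> Q t" "t \<noteq> 0" using eventually_happens'[OF nt] by blast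
    then show ?thesis using bd[of t] by auto
  qed
  have bdd: "bdd_above A" using ub by (auto simp: bdd_above_def)
  have "(Q \<longlongrightarrow> l) (at 0)"
  proof (rule order_tendstoI)
    fix a assume "a < l"
    then obtain p where "p \<in> A" "a < p" unfolding l_def using inA bdd by (metis less_cSup_iff empty_iff)
    then show "\<forall>\<^sub>F t in at 0. a < Q t" unfolding A_def by (auto elim: eventually_mono)
  next
    fix a assume a: "l < a"
    obtain p where p: "p \<in> \<rat>" "l < p" "p < a" using Rats_dense_in_real[OF a] by blast
    obtain q where q: "q \<in> \<rat>" "p < q" "q < a" using Rats_dense_in_real[OF p(3)] by blast
    have "p \<notin> A" using p(2) bdd cSup_upper[of p A] by (auto simp: l_def)
    then have "\<forall>\<^sub>F t in at 0. Q t \<le> q" using ev[of p q] p q by (auto simp: A_def)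
    then show "\<forall>\<^sub>F t in at 0. Q t < a" by (rule eventually_mono) (use q in auto)
  qed
  then show ?thesis by (auto simp: Q_def[abs_def])
qed

text \<open>Near a non-porous point of \<open>A\<close>, every increment can be decomposed into increments in coordinate
  directions that start, up to a small error, at points of \<open>A\<close>.\<close>

lemma increments_near_nonporous_point:
  fixes f :: "'a::euclidean_space \<Rightarrow> real"
  assumes L: "L-lipschitz_on UNIV f" and cl: "closed A" and x: "x \<in> A" and np: "x \<notin> porous_part A"
    and A: "\<And>y b t. y \<in> A \<Longrightarrow> b \<in> Basis \<Longrightarrow> \<bar>t\<bar> \<le> d0 \<Longrightarrow> \<bar>f (y + t *\<^sub>R b) - f y - t * (a \<bullet> b)\<bar> \<le> e * \<bar>t\<bar>"
    and d0: "0 < d0" and e: "0 < e"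
  obtains d where "0 < d" "\<And>h. norm h < d \<Longrightarrow> \<bar>f (x + h) - f x - a \<bullet> h\<bar> \<le> (2 * real DIM('a) * e) * norm h"
proof -
  define \<eta> where "\<eta> = e / (2 * (L + 1))"
  have L0: "0 \<le> L" using L by (rule lipschitz_on_nonneg)
  have \<eta>: "\<eta> > 0" using e L0 by (simp add: \<eta>_def)
  obtain d1 where d1: "d1 > 0" "\<And>y. norm (y - x) < d1 \<Longrightarrow> infdist y A \<le> \<eta> * norm (y - x)"
    using np x \<eta> unfolding porous_part_def by blast
  define d where "d = min d0 d1"
  \<comment> \<open>The path from \<open>x\<close> to \<open>x + h\<close> changes one coordinate at
    a time, and by Pythagoras its vertices \<open>y\<close> stay within \<open>norm h\<close> of
    \<open>x\<close>. A point \<open>z\<close> of \<open>A\<close> lies within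
    \<open>\<eta> * norm h\<close> of \<open>y\<close>. The loss \<open>2 * e\<close> per coordinate
    is \<open>e\<close> for the increment at \<open>z\<close> and \<open>e / 2\<close> for each of
    the two moves between \<open>y\<close> and \<open>z\<close>.\<close>
  have step: "\<bar>f (x + (\<Sum>b\<in>T. (h \<bullet> b) *\<^sub>R b)) - f x - (\<Sum>b\<in>T. (h \<bullet> b) * (a \<bullet> b))\<bar> \<le> real (card T) * (2 * e * norm h)"
    if h: "norm h < d" and T: "T \<subseteq> Basis" and fin: "finite T" for h T
    using fin T
  proof (induction T rule: finite_induct)
    case (insert b0 T)
    define y where "y = x + (\<Sum>b\<in>T. (h \<bullet> b) *\<^sub>R b)"
    have ny: "norm (y - x) \<le> norm h"
    proof -
      have "norm (\<Sum>b\<in>T. (h \<bullet> b) *\<^sub>R b) ^ 2 = (\<Sum>b\<in>T. (h \<bullet> b)\<^sup>2)"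
        using insert by (subst norm_sum_Pythagorean) (auto simp: pairwise_def orthogonal_def inner_not_same_Basis subset_iff power_mult_distrib)
      also have "\<dots> \<le> (\<Sum>b\<in>Basis. (h \<bullet> b)\<^sup>2)" using insert by (intro sum_mono2) auto
      also have "\<dots> = norm h ^ 2"
        unfolding power2_norm_eq_inner by (subst euclidean_inner) (simp add: power2_eq_square)
      finally show ?thesis by (simp add: y_def power2_le_iff_abs_le abs_le_square_iff[symmetric])
    qed
    then have "norm (y - x) < d1" using h by (simp add: d_def)
    then have "infdist y A \<le> \<eta> * norm (y - x)" by (rule d1)
    also have "\<dots> \<le> \<eta> * norm h" using ny \<eta> by simp
    finally obtain z where z: "z \<in> A" "dist y z \<le> \<eta> * norm h"
      using infdist_attains_inf[OF cl, of y] x by (metis empty_iff)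
    define c where "c = h \<bullet> b0"
    have c: "\<bar>c\<bar> \<le> norm h" using insert by (simp add: c_def Basis_le_norm)
    have 1: "\<bar>f (z + c *\<^sub>R b0) - f z - c * (a \<bullet> b0)\<bar> \<le> e * norm h"
    proof -
      have "\<bar>f (z + c *\<^sub>R b0) - f z - c * (a \<bullet> b0)\<bar> \<le> e * \<bar>c\<bar>"
        using A[OF z(1), of b0 c] c h insert by (simp add: d_def)
      also have "\<dots> \<le> e * norm h" using c e by simp
      finally show ?thesis .
    qed
    have "L * dist y z \<le> L * (\<eta> * norm h)" using z L0 by (intro mult_left_mono) auto
    also have "\<dots> \<le> (e / 2) * norm h"
      using L0 e by (simp add: \<eta>_def field_simps mult_left_mono)
    finally have Ly: "L * dist y z \<le> (e/2) * norm h" .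
    have 2: "\<bar>f (y + c *\<^sub>R b0) - f (z + c *\<^sub>R b0)\<bar> \<le> (e/2) * norm h"
      using lipschitz_onD[OF L, of "y + c *\<^sub>R b0" "z + c *\<^sub>R b0"] Ly by (simp add: dist_real_def)
    have 3: "\<bar>f y - f z\<bar> \<le> (e/2) * norm h"
      using lipschitz_onD[OF L, of y z] Ly by (simp add: dist_real_def)
    have IH: "\<bar>f y - f x - (\<Sum>b\<in>T. (h \<bullet> b) * (a \<bullet> b))\<bar> \<le> real (card T) * (2 * e * norm h)"
      using insert by (simp add: y_def)
    have e1: "x + (\<Sum>b\<in>insert b0 T. (h \<bullet> b) *\<^sub>R b) = y + c *\<^sub>R b0"
      using insert by (simp add: y_def c_def)
    have e2: "(\<Sum>b\<in>insert b0 T. (h \<bullet> b) * (a \<bullet> b)) = (\<Sum>b\<in>T. (h \<bullet> b) * (a \<bullet> b)) + c * (a \<bullet> b0)"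
      using insert by (simp add: c_def)
    have e3: "real (card (insert b0 T)) * (2 * e * norm h) = real (card T) * (2 * e * norm h) + 2 * (e * norm h)"
      using insert by (simp add: algebra_simps)
    show ?case unfolding e1 e2 e3 using 1 2 3 IH unfolding abs_le_iff by (intro conjI; linarith)
  qed auto
  show thesis
  proof (rule that[of d])
    show "0 < d" using d0 d1 by (simp add: d_def)
    fix h :: 'a assume h: "norm h < d"
    have "(\<Sum>b\<in>Basis. (h \<bullet> b) * (a \<bullet> b)) = a \<bullet> h"
      by (subst (3) euclidean_inner) (simp add: mult.commute)
    then show "\<bar>f (x + h) - f x - a \<bullet> h\<bar> \<le> (2 * real DIM('a) * e) * norm h"
      using step[OF h subset_refl finite_Basis] by (simp add: euclidean_representation algebra_simps)
  qed
qed

text \<open>Off \<open>N1\<close> all partial derivatives exist. A countable dense set of candidate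
  gradients \<open>a\<close>, together with tolerances and scales, sorts these points into countably
  many closed sets \<open>A a k m\<close> on which the coordinate quotients are uniformly close to
  \<open>a\<close>. Their porous parts form the null set \<open>N2\<close>, and off it closeness
  along the axes becomes closeness of all increments.\<close>

theorem Rademacher_real:
  fixes f :: "'a::euclidean_space \<Rightarrow> real"
  assumes L: "L-lipschitz_on UNIV f"
  shows "negligible {x. \<not> f differentiable (at x)}"
proof -
  obtain D :: "'a set" where D: "countable D" "\<And>X. open X \<Longrightarrow> X \<noteq> {} \<Longrightarrow> \<exists>d\<in>D. d \<in> X"
    using countable_dense_setE by blast
  define A where "A a k m = {x. \<forall>b\<in>Basis. \<forall>t. \<bar>t\<bar> \<le> 1 / Suc m \<longrightarrow> \<bar>f (x + t *\<^sub>R b) - f x - t * (a \<bullet> b)\<bar> \<le> (1 / Suc k) * \<bar>t\<bar>}"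
    for a :: 'a and k m :: nat
  have fc: "continuous_on UNIV f" using L by (rule lipschitz_on_continuous_on)
  have Acl: "closed (A a k m)" for a k m
  proof -
    have "A a k m = (\<Inter>b\<in>Basis. \<Inter>t\<in>{t. \<bar>t\<bar> \<le> 1 / Suc m}. {x. \<bar>f (x + t *\<^sub>R b) - f x - t * (a \<bullet> b)\<bar> \<le> (1 / Suc k) * \<bar>t\<bar>})"
      by (auto simp: A_def)
    also have "closed \<dots>"
      by (intro closed_INT ballI closed_Collect_le continuous_intros continuous_on_compose2[OF fc]) auto
    finally show ?thesis .
  qed
  define N1 where "N1 = (\<Union>b\<in>Basis. \<Union>p\<in>\<rat>. \<Union>q\<in>{q\<in>\<rat>. p < q}. osc_set f b p q)"
  define N2 where "N2 = (\<Union>a\<in>D. \<Union>k. \<Union>m. porous_part (A a k m))"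
  have cR: "countable {q\<in>\<rat>. p < q}" for p :: real
    by (rule countable_subset[OF _ countable_rat]) auto
  have ngU: "negligible (\<Union>i\<in>I. X i)" if "countable I" "\<And>i. i \<in> I \<Longrightarrow> negligible (X i)" for I and X :: "'i \<Rightarrow> 'a set"
    using that by (intro negligible_countable_Union) auto
  have n1: "negligible N1"
    unfolding N1_def
  proof (intro ngU)
    show "negligible (osc_set f b p q)" if "b \<in> Basis" "q \<in> {q\<in>\<rat>. p < q}" for b p q
      using that by (intro negligible_partial_oscillation[OF L]) auto
  qed (use countable_rat cR in \<open>auto simp: countable_finite\<close>)
  have n2: "negligible N2"
    unfolding N2_def by (intro ngU D(1) negligible_porous_part Acl) auto
  have "{x. \<not> f differentiable (at x)} \<subseteq> N1 \<union> N2"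
  proof (rule subsetI, rule ccontr)
    fix x assume x: "x \<in> {x. \<not> f differentiable (at x)}" "x \<notin> N1 \<union> N2"
    have "\<exists>l. ((\<lambda>t. (f (x + t *\<^sub>R b) - f x) / t) \<longlongrightarrow> l) (at 0)" if "b \<in> Basis" for b
    proof (rule convergent_quotient_of_no_oscillation[OF L])
      show "x \<notin> osc_set f b p q" if "p \<in> \<rat>" "q \<in> \<rat>" "p < q" for p q
        using x(2) \<open>b \<in> Basis\<close> that unfolding N1_def by blast
    qed (use that in simp)
    then obtain l where l: "\<And>b. b \<in> Basis \<Longrightarrow> ((\<lambda>t. (f (x + t *\<^sub>R b) - f x) / t) \<longlongrightarrow> l b) (at 0)"
      by metis
    define p where "p = (\<Sum>b\<in>Basis. l b *\<^sub>R b)"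
    have pb: "p \<bullet> b = l b" if "b \<in> Basis" for b using that by (simp add: p_def)
    have "(f has_derivative (\<lambda>h. p \<bullet> h)) (at x)"
    proof (rule differentiable_at_of_approx)
      fix \<epsilon> :: real assume \<epsilon>: "\<epsilon> > 0"
      \<comment> \<open>The multiple \<open>2 * DIM\<close> of \<open>e\<close> is the loss in
        passing from the axes to all directions; one more \<open>e\<close> pays for replacing
        \<open>a\<close> by the vector \<open>p\<close> of partial derivatives.\<close>
      define e0 where "e0 = \<epsilon> / (2 * real DIM('a) + 1)"
      have "e0 > 0" using \<epsilon> by (simp add: e0_def add_nonneg_pos)
      then obtain k :: nat where k: "1 / Suc k < e0" by (metis nat_approx_posE)
      define e where "e = 1 / Suc k"
      have e: "0 < e" "e < e0" using k by (auto simp: e_def)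
      obtain a where a: "a \<in> D" "dist p a < e / 2" using D(2)[of "ball p (e/2)"] e by auto
      have pa: "norm (p - a) \<le> e / 2" using a by (simp add: dist_norm)
      have "\<exists>r>0. \<forall>t. t \<noteq> 0 \<and> \<bar>t\<bar> < r \<longrightarrow> \<bar>(f (x + t *\<^sub>R b) - f x) / t - l b\<bar> < e / 2" if "b \<in> Basis" for b
        using tendstoD[OF l[OF that], of "e/2"] e unfolding eventually_at by (simp add: dist_real_def)
      then obtain r where r: "\<And>b. b \<in> Basis \<Longrightarrow> r b > 0"
        "\<And>b t. b \<in> Basis \<Longrightarrow> t \<noteq> 0 \<Longrightarrow> \<bar>t\<bar> < r b \<Longrightarrow> \<bar>(f (x + t *\<^sub>R b) - f x) / t - l b\<bar> < e / 2" by metis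
      define r0 where "r0 = Min (r ` Basis)"
      have r0: "r0 > 0" "\<And>b. b \<in> Basis \<Longrightarrow> r0 \<le> r b" using r by (auto simp: r0_def)
      obtain m :: nat where m: "1 / Suc m < r0" using r0(1) by (metis nat_approx_posE)
      have xA: "x \<in> A a k m" unfolding A_def mem_Collect_eq
      proof (intro ballI allI impI)
        fix b t assume b: "(b::'a) \<in> Basis" and t: "\<bar>t\<bar> \<le> 1 / Suc m"
        have ba: "\<bar>l b - a \<bullet> b\<bar> \<le> e / 2"
          using Cauchy_Schwarz_ineq2[of "p - a" b] b pa pb[OF b] by (simp add: inner_diff_left)
        show "\<bar>f (x + t *\<^sub>R b) - f x - t * (a \<bullet> b)\<bar> \<le> (1 / Suc k) * \<bar>t\<bar>"
        proof (cases "t = 0")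
          case False
          have "\<bar>(f (x + t *\<^sub>R b) - f x) / t - l b\<bar> < e / 2"
            using False t m r0(2)[OF b] by (intro r(2) b) auto
          then have "\<bar>(f (x + t *\<^sub>R b) - f x) / t - a \<bullet> b\<bar> \<le> e" using ba by linarith
          then have "\<bar>t\<bar> * \<bar>(f (x + t *\<^sub>R b) - f x) / t - a \<bullet> b\<bar> \<le> \<bar>t\<bar> * e" by (intro mult_left_mono) auto
          moreover have "f (x + t *\<^sub>R b) - f x - t * (a \<bullet> b) = t * ((f (x + t *\<^sub>R b) - f x) / t - a \<bullet> b)"
            using False by (simp add: field_simps)
          ultimately show ?thesis by (simp add: abs_mult e_def)
        qed simp
      qed
      have "x \<notin> porous_part (A a k m)" using x(2) a(1) by (auto simp: N2_def)
      then obtain d where d: "0 < d" "\<And>h. norm h < d \<Longrightarrow> \<bar>f (x + h) - f x - a \<bullet> h\<bar> \<le> (2 * real DIM('a) * e) * norm h"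
        using increments_near_nonporous_point[OF L Acl xA, of "1 / Suc m" a e] e by (auto simp: A_def e_def)
      show "\<exists>d>0. \<forall>h. norm h < d \<longrightarrow> \<bar>f (x + h) - f x - p \<bullet> h\<bar> \<le> \<epsilon> * norm h"
      proof (intro exI[of _ d] conjI allI impI)
        fix h :: 'a assume h: "norm h < d"
        have "\<bar>(p - a) \<bullet> h\<bar> \<le> norm (p - a) * norm h" by (rule Cauchy_Schwarz_ineq2)
        also have "\<dots> \<le> e * norm h" using pa e by (intro mult_right_mono) auto
        finally have "\<bar>f (x + h) - f x - p \<bullet> h\<bar> \<le> (2 * real DIM('a) * e) * norm h + e * norm h"
          using d(2)[OF h] by (simp add: inner_diff_left)
        also have "\<dots> = ((2 * real DIM('a) + 1) * e) * norm h" by (simp add: algebra_simps)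
        also have "\<dots> \<le> \<epsilon> * norm h"
        proof (rule mult_right_mono)
          have "(2 * real DIM('a) + 1) * e \<le> (2 * real DIM('a) + 1) * e0" using e by (intro mult_left_mono) auto
          also have "\<dots> = \<epsilon>"
          proof -
            have "2 * real DIM('a) + 1 \<noteq> 0" by (metis add_nonneg_eq_0_iff mult_nonneg_nonneg of_nat_0_le_iff zero_le_numeral zero_neq_one zero_le_one)
            then show ?thesis by (simp add: e0_def)
          qed
          finally show "(2 * real DIM('a) + 1) * e \<le> \<epsilon>" .
        qed simp
        finally show "\<bar>f (x + h) - f x - p \<bullet> h\<bar> \<le> \<epsilon> * norm h" .
      qed (rule d)
    qed
    then show False using x(1) by (auto simp: differentiable_def)
  qed
  then show ?thesis using n1 n2 negligible_Un negligible_subset by blast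
qed

corollary Rademacher:
  fixes f :: "'a::euclidean_space \<Rightarrow> 'b::euclidean_space"
  assumes L: "L-lipschitz_on UNIV f"
  shows "negligible {x. \<not> f differentiable (at x)}"
proof -
  have "negligible {x. \<not> (\<lambda>x. f x \<bullet> i) differentiable (at x)}" if i: "i \<in> Basis" for i
  proof (rule Rademacher_real)
    show "L-lipschitz_on UNIV (\<lambda>x. f x \<bullet> i)"
    proof (rule lipschitz_onI)
      fix x y
      have "dist (f x \<bullet> i) (f y \<bullet> i) \<le> norm (f x - f y)"
        using Basis_le_norm[OF i, of "f x - f y"] by (simp add: dist_real_def inner_diff_left)
      then show "dist (f x \<bullet> i) (f y \<bullet> i) \<le> L * dist x y"
        using lipschitz_onD[OF L, of x y] by (simp add: dist_norm)
    qed (use lipschitz_on_nonneg[OF L] in simp)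
  qed
  then have "negligible (\<Union>i\<in>Basis. {x. \<not> (\<lambda>x. f x \<bullet> i) differentiable (at x)})"
    by (intro negligible_Union) auto
  moreover have "{x. \<not> f differentiable (at x)} \<subseteq> (\<Union>i\<in>Basis. {x. \<not> (\<lambda>x. f x \<bullet> i) differentiable (at x)})"
    by (auto simp: differentiable_componentwise_within[of f])
  ultimately show ?thesis by (rule negligible_subset)
qed

subsection \<open>Second-order differentiability of convex functions\<close>

lemma norm_add_scaleR_power2:
  fixes a b :: "'a::real_inner"
  shows "(norm (a + t *\<^sub>R b))\<^sup>2 = (norm a)\<^sup>2 + 2 * t * (a \<bullet> b) + t\<^sup>2 * (norm b)\<^sup>2"
  unfolding power2_norm_eq_inner by (simp add: inner_commute algebra_simps power2_eq_square)

text \<open>A convex function is given by one chosen subgradient at every point. Suprema of affine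
  functions, such as the sup-convolutions below, come with such a choice, and convexity follows from
  it.\<close>

locale subgradient_selection =
  fixes f :: "'a::euclidean_space \<Rightarrow> real" and s :: "'a \<Rightarrow> 'a"
  assumes subgradient: "f x + s x \<bullet> (y - x) \<le> f y"
begin

lemma convex_on_UNIV: "convex_on UNIV f"
proof (rule convex_onI)
  fix t :: real and x y :: 'a assume t: "0 < t" "t < 1"
  define z where "z = (1 - t) *\<^sub>R x + t *\<^sub>R y"
  define a b where "a = s z \<bullet> (x - z)" and "b = s z \<bullet> (y - z)"
  have "(1 - t) * (f z + a) + t * (f z + b) \<le> (1 - t) * f x + t * f y"
    unfolding a_def b_def using t by (intro add_mono mult_left_mono subgradient) auto
  moreover have "(1 - t) * a + t * b = s z \<bullet> ((1 - t) *\<^sub>R (x - z) + t *\<^sub>R (y - z))"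
    by (simp add: a_def b_def inner_add_right)
  moreover have "(1 - t) *\<^sub>R (x - z) + t *\<^sub>R (y - z) = 0"
    by (simp add: z_def algebra_simps)
  ultimately have "(1 - t) * (f z + a) + t * (f z + b) \<le> (1 - t) * f x + t * f y" "(1 - t) * a + t * b = 0"
    by simp_all
  moreover have "(1 - t) * (f z + a) + t * (f z + b) = f z + ((1 - t) * a + t * b)"
    by (simp add: algebra_simps)
  ultimately show "f ((1 - t) *\<^sub>R x + t *\<^sub>R y) \<le> (1 - t) * f x + t * f y"
    by (simp add: z_def[symmetric])
qed simp

lemma continuous: "continuous_on UNIV f"
  using convex_on_continuous[OF open_UNIV convex_on_UNIV] .

text \<open>The point \<open>p\<close> minimises \<open>f\<close> plus half the squared distance to
  \<open>w\<close>. Moving from \<open>p\<close> towards \<open>y\<close> by a fraction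
  \<open>t\<close>, dividing by \<open>t\<close> and letting it tend to \<open>0\<close> turns
  minimality into the statement that \<open>w - p\<close> is a subgradient at
  \<open>p\<close>.\<close>

lemma proximal_point_exists:
  "\<exists>p. \<forall>y. f p + (w - p) \<bullet> (y - p) \<le> f y"
proof -
  define h where "h y = f y + (norm (y - w))\<^sup>2 / 2" for y
  \<comment> \<open>Outside this ball the quadratic outweighs the drop of the support plane of
    \<open>f\<close> at \<open>w\<close>, so a minimum over the ball is global.\<close>
  define R where "R = 2 * norm (s w)"
  have "continuous_on (cball w R) h"
    unfolding h_def using continuous_on_subset[OF continuous] by (intro continuous_intros) auto
  then obtain p where p: "p \<in> cball w R" "\<And>y. y \<in> cball w R \<Longrightarrow> h p \<le> h y"
    using continuous_attains_inf[of "cball w R" h] by (auto simp: R_def)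
  have hw: "h p \<le> h w" using p(2)[of w] by (simp add: R_def)
  have glob: "h p \<le> h y" for y
  proof (cases "y \<in> cball w R")
    case False
    then have ny: "2 * norm (s w) < norm (y - w)" by (simp add: R_def dist_norm norm_minus_commute)
    have "s w \<bullet> (y - w) \<ge> - (norm (s w) * norm (y - w))"
      using Cauchy_Schwarz_ineq2[of "s w" "y - w"] by (simp add: abs_le_iff)
    moreover have "2 * norm (s w) * norm (y - w) \<le> norm (y - w) * norm (y - w)"
      using ny by (intro mult_right_mono) auto
    ultimately have "h w \<le> h y"
      using subgradient[of w y] by (simp add: h_def power2_eq_square)
    then show ?thesis using hw by simp
  qed (use p in auto)
  have "f p + (w - p) \<bullet> (y - p) \<le> f y" for y
  proof -
    define c where "c = (norm (y - p))\<^sup>2 / 2"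
    have small: "(w - p) \<bullet> (y - p) \<le> (f y - f p) + t * c" if t: "0 < t" "t < 1" for t
    proof -
      define z where "z = (1 - t) *\<^sub>R p + t *\<^sub>R y"
      define X where "X = (p - w) \<bullet> (y - p)"
      have "f z \<le> (1 - t) * f p + t * f y"
        unfolding z_def using convex_onD[OF convex_on_UNIV, of t p y] t by simp
      then have 1: "f z \<le> f p + t * (f y - f p)" by (simp add: algebra_simps)
      have 2: "f p + (norm (p - w))\<^sup>2 / 2 \<le> f z + (norm (z - w))\<^sup>2 / 2" using glob[of z] by (simp add: h_def)
      have "z - w = (p - w) + t *\<^sub>R (y - p)" by (simp add: z_def algebra_simps)
      then have "(norm (z - w))\<^sup>2 = (norm (p - w))\<^sup>2 + 2 * t * X + t\<^sup>2 * (norm (y - p))\<^sup>2"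
        by (simp only: norm_add_scaleR_power2 X_def)
      then have "(norm (z - w))\<^sup>2 = (norm (p - w))\<^sup>2 + 2 * (t * X) + 2 * (t\<^sup>2 * c)"
        by (simp add: c_def)
      then have "0 \<le> t * (f y - f p) + t * X + t\<^sup>2 * c"
        using 1 2 by linarith
      then have "0 \<le> t * ((f y - f p) + X + t * c)"
        by (simp add: algebra_simps power2_eq_square)
      then have "0 \<le> (f y - f p) + X + t * c"
        using t by (simp add: zero_le_mult_iff)
      moreover have "X = - ((w - p) \<bullet> (y - p))" by (simp add: X_def inner_diff_left)
      ultimately show ?thesis by simp
    qed
    have "(w - p) \<bullet> (y - p) \<le> f y - f p"
    proof (rule field_le_epsilon)
      fix e :: real assume e: "0 < e"
      have c0: "c \<ge> 0" by (simp add: c_def)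
      define t where "t = min (1/2) (e / (c + 1))"
      have t: "0 < t" "t < 1" using e c0 by (auto simp: t_def)
      have "t * c \<le> e / (c + 1) * c" using c0 by (intro mult_right_mono) (auto simp: t_def)
      also have "\<dots> \<le> e" using e c0 by (simp add: field_simps)
      finally show "(w - p) \<bullet> (y - p) \<le> f y - f p + e" using small[OF t] by linarith
    qed
    then show ?thesis by simp
  qed
  then show ?thesis by blast
qed

text \<open>The resolvent of the subdifferential, that is, the inverse of the identity plus the
  subdifferential.\<close>

definition prox :: "'a \<Rightarrow> 'a" where
  "prox w = (SOME p. \<forall>y. f p + (w - p) \<bullet> (y - p) \<le> f y)"

lemma prox: "f (prox w) + (w - prox w) \<bullet> (y - prox w) \<le> f y"
  using someI_ex[OF proximal_point_exists[of w]] unfolding prox_def by blast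

text \<open>Monotonicity: the subgradients \<open>w - prox w\<close> and \<open>v - prox v\<close>
  have nonnegative inner product along the difference of their base points.\<close>

lemma prox_lipschitz: "1-lipschitz_on UNIV prox"
proof (rule lipschitz_onI)
  fix w v
  define d where "d = prox w - prox v"
  have "(w - prox w) \<bullet> (prox v - prox w) + (v - prox v) \<bullet> (prox w - prox v) \<le> 0"
    using prox[of w "prox v"] prox[of v "prox w"] by linarith
  then have "d \<bullet> d \<le> (w - v) \<bullet> d"
    by (simp add: d_def algebra_simps)
  also have "\<dots> \<le> norm (w - v) * norm d" by (rule norm_cauchy_schwarz)
  finally have "norm d * norm d \<le> norm (w - v) * norm d" by (simp add: power2_norm_eq_inner[symmetric] power2_eq_square)
  then have "norm d \<le> norm (w - v)"
    by (cases "d = 0") (simp, meson mult_right_le_imp_le zero_less_norm_iff)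
  then show "dist (prox w) (prox v) \<le> 1 * dist w v" by (simp add: d_def dist_norm)
qed simp

lemma prox_eq: "prox (y + s y) = y"
proof -
  define w where "w = y + s y"
  define d where "d = prox w - y"
  have "(w - prox w) \<bullet> (y - prox w) + s y \<bullet> (prox w - y) \<le> 0"
    using prox[of w y] subgradient[of y "prox w"] by linarith
  then have "d \<bullet> d \<le> 0" by (simp add: d_def w_def algebra_simps)
  then have "d = 0" by (metis inner_eq_zero_iff inner_ge_zero order_antisym)
  then show ?thesis by (simp add: d_def w_def)
qed

text \<open>A quadratic upper bound at the single point \<open>z\<close> controls nearby
  subgradients. The support plane at \<open>y\<close> is tested at \<open>y + h\<close>, with
  \<open>h\<close> parallel to \<open>s y - s z\<close> and as long as \<open>y - z\<close>, so that
  \<open>y + h\<close> is still in the range of the upper bound.\<close>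

lemma subgradient_lipschitz_at:
  assumes above: "\<And>y. norm (y - z) < r \<Longrightarrow> f y \<le> f z + s z \<bullet> (y - z) + C / 2 * (norm (y - z))\<^sup>2"
    and C: "0 \<le> C" and y: "norm (y - z) < r / 2"
  shows "norm (s y - s z) \<le> 2 * C * norm (y - z)"
proof (cases "y = z \<or> s y = s z")
  case False
  define k where "k = norm (y - z)"
  define v where "v = s y - s z"
  have k: "k > 0" and v: "norm v > 0" using False by (auto simp: k_def v_def)
  define h where "h = (k / norm v) *\<^sub>R v"
  have nh: "norm h = k" using v k by (simp add: h_def)
  have n2: "norm (y + h - z) \<le> 2 * k"
    using norm_triangle_ineq[of "y - z" h] nh by (simp add: k_def algebra_simps)
  have "f z + s z \<bullet> (y - z) + s y \<bullet> h \<le> f (y + h)"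
    using subgradient[of z y] subgradient[of y "y + h"] by simp
  also have "\<dots> \<le> f z + s z \<bullet> (y + h - z) + C / 2 * (norm (y + h - z))\<^sup>2"
    using n2 y by (intro above) (simp add: k_def)
  also have "\<dots> \<le> f z + s z \<bullet> (y + h - z) + C / 2 * (2 * k)\<^sup>2"
    using n2 C by (intro add_left_mono mult_left_mono power_mono) auto
  finally have "v \<bullet> h \<le> 2 * C * k\<^sup>2" by (simp add: v_def algebra_simps power2_eq_square)
  moreover have "v \<bullet> h = k * norm v"
    using v by (simp add: h_def power2_norm_eq_inner[symmetric] power2_eq_square)
  ultimately have "k * norm v \<le> k * (2 * C * k)" by (simp add: power2_eq_square algebra_simps)
  then show ?thesis using k by (simp add: v_def k_def)
qed (use C in auto)

text \<open>The first-order expansion of \<open>s\<close> is integrated along the segment, although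
  \<open>f\<close> need not be differentiable there. The segment is cut into equal pieces and both
  subgradient inequalities are used on each; the errors quadratic in the step add up to a multiple
  of the step and vanish in the limit.\<close>

lemma second_order_of_subgradient_derivative:
  assumes M: "linear M"
    and s': "\<And>e. e > 0 \<Longrightarrow> \<exists>d>0. \<forall>h. norm h < d \<longrightarrow> norm (s (z + h) - s z - M h) \<le> e * norm h"
    and e: "0 < e"
  shows "\<exists>d>0. \<forall>h. norm h < d \<longrightarrow> \<bar>f (z + h) - f z - s z \<bullet> h - h \<bullet> M h / 2\<bar> \<le> e * (norm h)\<^sup>2"
proof -
  obtain d where d: "d > 0" "\<And>h. norm h < d \<Longrightarrow> norm (s (z + h) - s z - M h) \<le> e * norm h"
    using s'[OF e] by blast
  have "\<bar>f (z + h) - f z - s z \<bullet> h - h \<bullet> M h / 2\<bar> \<le> e * (norm h)\<^sup>2" if h: "norm h < d" for h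
  proof -
    define q where "q = h \<bullet> M h"
    define E where "E = e * (norm h)\<^sup>2"
    have sd: "\<bar>s (z + t *\<^sub>R h) \<bullet> h - s z \<bullet> h - t * q\<bar> \<le> E" if t: "0 \<le> t" "t \<le> 1" for t
    proof -
      have nt: "norm (t *\<^sub>R h) \<le> norm h" using t by (simp add: mult_left_le_one_le)
      have "s (z + t *\<^sub>R h) \<bullet> h - s z \<bullet> h - t * q = (s (z + t *\<^sub>R h) - s z - M (t *\<^sub>R h)) \<bullet> h"
        using linear_cmul[OF M] by (simp add: q_def inner_diff_left inner_diff_right inner_commute)
      also have "\<bar>\<dots>\<bar> \<le> norm (s (z + t *\<^sub>R h) - s z - M (t *\<^sub>R h)) * norm h" by (rule Cauchy_Schwarz_ineq2)
      also have "\<dots> \<le> (e * norm h) * norm h"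
      proof (rule mult_right_mono)
        have "norm (s (z + t *\<^sub>R h) - s z - M (t *\<^sub>R h)) \<le> e * norm (t *\<^sub>R h)" using nt h by (intro d) auto
        also have "\<dots> \<le> e * norm h" using nt e by (intro mult_left_mono) auto
        finally show "norm (s (z + t *\<^sub>R h) - s z - M (t *\<^sub>R h)) \<le> e * norm h" .
      qed simp
      finally show ?thesis by (simp add: E_def power2_eq_square)
    qed
    define g where "g t = f (z + t *\<^sub>R h) - t * (s z \<bullet> h) - t\<^sup>2 / 2 * q" for t
    have inc: "\<bar>g t' - g t\<bar> \<le> E * (t' - t) + \<bar>q\<bar> * (t' - t)\<^sup>2 / 2" if t: "0 \<le> t" "t \<le> t'" "t' \<le> 1" for t t'
    proof -
      define D where "D = t' - t"
      have D: "D \<ge> 0" using t by (simp add: D_def)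
      have up: "f (z + t' *\<^sub>R h) - f (z + t *\<^sub>R h) \<le> (s (z + t' *\<^sub>R h) \<bullet> h) * D"
        using subgradient[of "z + t' *\<^sub>R h" "z + t *\<^sub>R h"]
        by (simp add: D_def algebra_simps)
      have lo: "(s (z + t *\<^sub>R h) \<bullet> h) * D \<le> f (z + t' *\<^sub>R h) - f (z + t *\<^sub>R h)"
        using subgradient[of "z + t *\<^sub>R h" "z + t' *\<^sub>R h"]
        by (simp add: D_def algebra_simps)
      have chain: "d \<le> r" if "d = fu - S - K" "fu \<le> u" "u \<le> v" "v - S - K = r" for d r fu S K u v :: real
        using that by linarith
      have chain': "r \<le> d" if "d = fu - S - K" "u \<le> fu" "v \<le> u" "v - S - K = r" for d r fu S K u v :: real
        using that by linarith
      have sD: "(s (z + t' *\<^sub>R h) \<bullet> h) * D \<le> (s z \<bullet> h + t' * q + E) * D"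
        "(s z \<bullet> h + t * q - E) * D \<le> (s (z + t *\<^sub>R h) \<bullet> h) * D"
        using sd[of t'] sd[of t] t D by (auto intro!: mult_right_mono)
      have gd: "g t' - g t = (f (z + t' *\<^sub>R h) - f (z + t *\<^sub>R h)) - D * (s z \<bullet> h) - (t + t') / 2 * D * q"
        by (simp add: g_def D_def power2_eq_square algebra_simps) (simp add: field_simps)
      have "g t' - g t \<le> E * D + q * D\<^sup>2 / 2"
        by (rule chain[OF gd up sD(1)]) (simp add: D_def power2_eq_square field_simps)
      moreover have "- (E * D + q * D\<^sup>2 / 2) \<le> g t' - g t"
        by (rule chain'[OF gd lo sD(2)]) (simp add: D_def power2_eq_square field_simps)
      moreover have "q * D\<^sup>2 \<le> \<bar>q\<bar> * D\<^sup>2" by (intro mult_right_mono) auto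
      ultimately show ?thesis unfolding D_def[symmetric] abs_le_iff by linarith
    qed
    have "\<bar>g 1 - g 0\<bar> \<le> E + \<bar>q\<bar> / 2 / Suc n" for n :: nat
    proof -
      define N where "N = Suc n"
      have N: "real N > 0" by (simp add: N_def)
      have "g 1 - g 0 = (\<Sum>i<N. g (real (Suc i) / N) - g (real i / N))"
        using N by (subst sum_lessThan_telescope) simp
      also have "\<bar>\<dots>\<bar> \<le> (\<Sum>i<N. \<bar>g (real (Suc i) / N) - g (real i / N)\<bar>)" by (rule sum_abs)
      also have "\<dots> \<le> (\<Sum>i<N. E * (1 / N) + \<bar>q\<bar> * (1 / N)\<^sup>2 / 2)"
      proof (rule sum_mono)
        fix i assume "i \<in> {..<N}"
        then have "real (Suc i) \<le> real N" by (metis lessThan_iff of_nat_le_iff Suc_leI)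
        moreover have "real (Suc i) / N - real i / N = 1 / N" using N by (simp add: diff_divide_distrib[symmetric])
        ultimately show "\<bar>g (real (Suc i) / N) - g (real i / N)\<bar> \<le> E * (1 / N) + \<bar>q\<bar> * (1 / N)\<^sup>2 / 2"
          using inc[of "real i / N" "real (Suc i) / N"] N by (simp add: divide_right_mono)
      qed
      also have "\<dots> = E + \<bar>q\<bar> / 2 / N" using N by (simp add: power2_eq_square field_simps)
      finally show ?thesis by (simp add: N_def)
    qed
    moreover have "(\<lambda>n. E + \<bar>q\<bar> / 2 / Suc n) \<longlonglongrightarrow> E + 0"
      by (intro tendsto_intros LIMSEQ_Suc[OF lim_const_over_n])
    ultimately have "\<bar>g 1 - g 0\<bar> \<le> E" by (intro LIMSEQ_le_const[of _ E]) auto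
    then show ?thesis by (simp add: g_def q_def E_def algebra_simps)
  qed
  then show ?thesis using d(1) by blast
qed

text \<open>The increment \<open>k h\<close> of the identity plus \<open>s\<close> satisfies
  \<open>prox (w + k h) = z + h\<close> and is bounded by a multiple of \<open>h\<close>. Hence
  \<open>D (k h)\<close> equals \<open>h\<close> up to a smaller error, \<open>D\<close> is
  invertible, and its inverse minus the identity is the derivative of \<open>s\<close> at
  \<open>z\<close>.\<close>

lemma second_order_of_prox_differentiable:
  assumes above: "\<And>y. norm (y - z) < r \<Longrightarrow> f y \<le> f z + s z \<bullet> (y - z) + C / 2 * (norm (y - z))\<^sup>2"
    and C: "0 \<le> C" and r: "0 < r"
    and diff: "prox differentiable (at (z + s z))"
  obtains M where "linear M"
    "\<And>e. e > 0 \<Longrightarrow> \<exists>d>0. \<forall>h. norm h < d \<longrightarrow> \<bar>f (z + h) - f z - s z \<bullet> h - h \<bullet> M h / 2\<bar> \<le> e * (norm h)\<^sup>2"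
proof -
  define w where "w = z + s z"
  obtain D where D: "(prox has_derivative D) (at w)" using diff by (auto simp: differentiable_def w_def)
  have lin: "linear D" using D has_derivative_linear by blast
  define k where "k h = h + (s (z + h) - s z)" for h
  have nk: "norm (k h) \<le> (1 + 2 * C) * norm h" if "norm h < r / 2" for h
  proof -
    have "norm (s (z + h) - s z) \<le> 2 * C * norm h"
      using subgradient_lipschitz_at[where y = "z + h", OF above C] that by simp
    then show ?thesis using norm_triangle_ineq[of h "s (z + h) - s z"] by (simp add: k_def algebra_simps)
  qed
  have pk: "prox (w + k h) = z + h" for h
    using prox_eq[of "z + h"] by (simp add: w_def k_def algebra_simps)
  have near: "\<exists>d>0. \<forall>h. norm h < d \<longrightarrow> norm (h - D (k h)) \<le> e * norm h" if e: "e > 0" for e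
  proof -
    define e' where "e' = e / (1 + 2 * C)"
    have e': "e' > 0" using e C by (simp add: e'_def)
    obtain d where d: "d > 0" "\<And>y. norm (y - w) < d \<Longrightarrow> norm (prox y - prox w - D (y - w)) \<le> e' * norm (y - w)"
      using D e' unfolding has_derivative_at_alt by blast
    define d' where "d' = min (r / 2) (d / (1 + 2 * C))"
    have "d' > 0" using d r C by (simp add: d'_def)
    moreover have "norm (h - D (k h)) \<le> e * norm h" if h: "norm h < d'" for h
    proof -
      have h1: "norm h < r / 2" and h2: "norm h < d / (1 + 2 * C)" using h by (auto simp: d'_def)
      have "norm (k h) \<le> (1 + 2 * C) * norm h" using nk h1 by blast
      also have "\<dots> < d" using h2 C by (simp add: field_simps)
      finally have "norm (prox (w + k h) - prox w - D (k h)) \<le> e' * norm (k h)"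
        using d(2)[of "w + k h"] by simp
      also have "\<dots> \<le> e' * ((1 + 2 * C) * norm h)" using nk[OF h1] e' by (intro mult_left_mono) auto
      also have "\<dots> = e * norm h" using C by (simp add: e'_def)
      finally show ?thesis using prox_eq[of z] by (simp add: pk w_def[symmetric])
    qed
    ultimately show ?thesis by blast
  qed
  \<comment> \<open>If some \<open>n\<close> were orthogonal to the range of \<open>D\<close>, then
    for small \<open>h\<close> along \<open>n\<close> the vector \<open>h - D (k h)\<close> would be
    at least as long as \<open>h\<close>, whereas it is at most half as long.\<close>
  have "surj D"
  proof (rule ccontr)
    assume "\<not> surj D"
    have sub: "subspace (range D)" using lin by (simp add: linear_subspace_image)
    then have "dim (range D) \<noteq> DIM('a)"
      using \<open>\<not> surj D\<close> by (metis dim_eq_full span_eq_iff)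
    then have "dim (range D) < DIM('a)" using dim_subset_UNIV[of "range D"] by simp
    then obtain n where n: "n \<noteq> 0" "\<And>y. y \<in> span (range D) \<Longrightarrow> orthogonal n y"
      using orthogonal_to_subspace_exists by blast
    then have on: "n \<bullet> D x = 0" for x by (metis orthogonal_def rangeI span_base)
    obtain d where d: "d > 0" "\<And>h. norm h < d \<Longrightarrow> norm (h - D (k h)) \<le> 1/2 * norm h"
      using near[of "1/2"] by auto
    define h where "h = (d / 2 / norm n) *\<^sub>R n"
    have h: "norm h < d" "norm h > 0" using d n by (auto simp: h_def)
    have "h \<bullet> D (k h) = 0" using on by (simp add: h_def)
    then have "(norm h)\<^sup>2 \<le> (norm (h - D (k h)))\<^sup>2"
      unfolding power2_norm_eq_inner by (simp add: inner_diff_left inner_diff_right inner_commute)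
    then have "norm h \<le> norm (h - D (k h))" by (simp add: power2_le_iff_abs_le)
    then show False using d(2)[OF h(1)] h(2) by simp
  qed
  then obtain B where B: "linear B" "\<And>x. B (D x) = x"
    using linear_surjective_isomorphism[OF lin] by blast
  obtain b where b: "b > 0" "\<And>x. norm (B x) \<le> b * norm x"
    using linear_bounded_pos[OF B(1)] by blast
  define M where "M h = B h - h" for h
  have linM: "linear M" unfolding M_def using B(1) by (intro linear_compose_sub linear_ident)
  have "\<exists>d>0. \<forall>h. norm h < d \<longrightarrow> norm (s (z + h) - s z - M h) \<le> e * norm h" if e: "e > 0" for e
  proof -
    obtain d where d: "d > 0" "\<And>h. norm h < d \<Longrightarrow> norm (h - D (k h)) \<le> e / b * norm h"
      using near[of "e / b"] e b by auto
    have "norm (s (z + h) - s z - M h) \<le> e * norm h" if h: "norm h < d" for h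
    proof -
      have "s (z + h) - s z - M h = k h - B h" by (simp add: k_def M_def)
      also have "\<dots> = - B (h - D (k h))" using B by (simp add: linear_diff)
      finally have "norm (s (z + h) - s z - M h) \<le> b * norm (h - D (k h))" using b(2) by simp
      also have "\<dots> \<le> b * (e / b * norm h)" using d(2)[OF h] b by (intro mult_left_mono) auto
      finally show ?thesis using b by simp
    qed
    then show ?thesis using d(1) by blast
  qed
  then show thesis using that[of M] linM second_order_of_subgradient_derivative[OF linM] by blast
qed

text \<open>The slopes \<open>P\<close> for which \<open>f - A/2 - P\<close> has an interior maximum fill a ball, and each of them is the value
  of one Lipschitz map at a preimage of the contact point under the proximal map. By Rademacher's theorem the
  proximal map is differentiable at one of these preimages.\<close>

theorem Jensen_Alexandrov:
  assumes A: "linear A" "\<And>x y. x \<bullet> A y = A x \<bullet> y"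
    and strict: "\<And>y. norm y \<le> \<rho> \<Longrightarrow> f y \<le> f 0 + y \<bullet> A y / 2 - \<theta> * (norm y)\<^sup>2"
    and \<rho>: "0 < \<rho>" and \<theta>: "0 < \<theta>"
  obtains z p M where "norm z < \<rho>" "linear M"
    "\<And>y. norm y \<le> \<rho> \<Longrightarrow> f y \<le> f z + p \<bullet> (y - z) + (y - z) \<bullet> A (y - z) / 2"
    "\<And>e. e > 0 \<Longrightarrow> \<exists>d>0. \<forall>h. norm h < d \<longrightarrow> \<bar>f (z + h) - f z - p \<bullet> h - h \<bullet> M h / 2\<bar> \<le> e * (norm h)\<^sup>2"
proof -
  obtain B where B: "B > 0" "\<And>x. norm (A x) \<le> B * norm x" using linear_bounded_pos[OF A(1)] by blast
  have Ac: "continuous_on S A" for S using A(1) by (simp add: linear_continuous_on linear_conv_bounded_linear)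
  \<comment> \<open>If \<open>z\<close> is a contact point for the slope \<open>P\<close>, its
    subgradient is \<open>P + A z\<close>, and \<Psi> maps \<open>z + s z\<close> to
    \<open>P\<close>. The bad slopes therefore lie in the Lipschitz image of the null set
    \<open>E\<close> where \<open>prox\<close> is not differentiable.\<close>
  define \<Psi> where "\<Psi> w = (w - prox w) - A (prox w)" for w
  have Psi: "(2 + B)-lipschitz_on UNIV \<Psi>"
  proof (rule lipschitz_onI)
    fix w v
    have p: "norm (prox w - prox v) \<le> norm (w - v)"
      using lipschitz_onD[OF prox_lipschitz, of w v] by (simp add: dist_norm)
    have "\<Psi> w - \<Psi> v = (w - v) - (prox w - prox v) - A (prox w - prox v)"
      using A(1) by (simp add: \<Psi>_def linear_diff)
    then have "norm (\<Psi> w - \<Psi> v) \<le> norm (w - v) + norm (prox w - prox v) + norm (A (prox w - prox v))"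
      using norm_triangle_ineq4[of "(w - v) - (prox w - prox v)" "A (prox w - prox v)"]
        norm_triangle_ineq4[of "w - v" "prox w - prox v"] by simp
    also have "\<dots> \<le> norm (w - v) + norm (w - v) + B * norm (w - v)"
    proof (intro add_mono order_refl p)
      have "norm (A (prox w - prox v)) \<le> B * norm (prox w - prox v)" by (rule B)
      also have "\<dots> \<le> B * norm (w - v)" using p B by simp
      finally show "norm (A (prox w - prox v)) \<le> B * norm (w - v)" .
    qed
    finally show "dist (\<Psi> w) (\<Psi> v) \<le> (2 + B) * dist w v" by (simp add: dist_norm algebra_simps)
  qed (use B in simp)
  define E where "E = {w. \<not> prox differentiable (at w)}"
  have "negligible E" unfolding E_def by (rule Rademacher[OF prox_lipschitz])
  then have "negligible (\<Psi> ` E)"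
    by (intro negligible_lipschitz_image[OF lipschitz_on_subset[OF Psi subset_UNIV]]) auto
  moreover have "\<not> negligible (ball (0::'a) (\<rho> * \<theta>))"
    using \<rho> \<theta> by (metis open_ball open_not_negligible ball_eq_empty mult_pos_pos not_le)
  ultimately have "\<not> ball (0::'a) (\<rho> * \<theta>) \<subseteq> \<Psi> ` E" using negligible_subset by blast
  then obtain P where "P \<in> ball (0::'a) (\<rho> * \<theta>)" "P \<notin> \<Psi> ` E" by blast
  then have P: "norm P < \<rho> * \<theta>" "P \<notin> \<Psi> ` E" by auto
  define g where "g y = f y - y \<bullet> A y / 2 - P \<bullet> y" for y
  have "continuous_on (cball 0 \<rho>) g"
    unfolding g_def using continuous_on_subset[OF continuous] Ac by (intro continuous_intros) auto
  then obtain z where z: "z \<in> cball 0 \<rho>" "\<And>y. y \<in> cball 0 \<rho> \<Longrightarrow> g y \<le> g z"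
    using continuous_attains_sup[of "cball (0::'a) \<rho>" g] \<rho> by auto
  \<comment> \<open>On the boundary sphere the strict inequality costs
    \<open>\<theta> * \<rho>\<^sup>2\<close>, more than a slope shorter than
    \<open>\<rho> * \<theta>\<close> can regain over the distance \<rho>.\<close>
  have zi: "norm z < \<rho>"
  proof (rule ccontr)
    assume "\<not> ?thesis" then have nz: "norm z = \<rho>" using z(1) by simp
    have "f 0 \<le> g z" using z(2)[of 0] \<rho> linear_0[OF A(1)] by (simp add: g_def)
    also have "\<dots> \<le> f 0 - \<theta> * \<rho>\<^sup>2 - P \<bullet> z" using strict[of z] nz by (simp add: g_def)
    finally have "\<theta> * \<rho>\<^sup>2 \<le> - (P \<bullet> z)" by simp
    moreover have "- (P \<bullet> z) \<le> norm P * \<rho>"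
      using Cauchy_Schwarz_ineq2[of P z] nz by (simp add: abs_le_iff)
    moreover have "norm P * \<rho> < (\<rho> * \<theta>) * \<rho>" using P \<rho> by (intro mult_strict_right_mono) auto
    moreover have "(\<rho> * \<theta>) * \<rho> = \<theta> * \<rho>\<^sup>2" by (simp add: power2_eq_square)
    ultimately show False by linarith
  qed
  define p where "p = P + A z"
  have touch: "f y \<le> f z + p \<bullet> (y - z) + (y - z) \<bullet> A (y - z) / 2" if "norm y \<le> \<rho>" for y
  proof -
    have "g y \<le> g z" using z(2) that by simp
    moreover have "(y - z) \<bullet> A (y - z) = y \<bullet> A y - z \<bullet> A z - 2 * (A z \<bullet> (y - z))"
      using A by (simp add: linear_diff algebra_simps inner_commute)
    ultimately show ?thesis unfolding g_def p_def inner_diff_right inner_add_left by argo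
  qed
  \<comment> \<open>A quadratic touches \<open>f\<close> at \<open>z\<close> from above, so its
    gradient is the only subgradient there. The length \<open>t\<close> is bounded by
    \<open>1 / B\<close> to make the quadratic term at most half of the linear gain.\<close>
  have sp: "s z = p"
  proof (rule ccontr)
    assume ne: "s z \<noteq> p"
    define v where "v = s z - p"
    have v: "norm v > 0" using ne by (simp add: v_def)
    define t where "t = min ((\<rho> - norm z) / norm v) (1 / B)"
    have t: "t > 0" using v zi B by (simp add: t_def)
    have tv: "t * norm v \<le> \<rho> - norm z" using v by (simp add: t_def min_mult_distrib_right)
    have nt: "norm (z + t *\<^sub>R v) \<le> \<rho>"
      using norm_triangle_ineq[of z "t *\<^sub>R v"] tv t by simp
    have "v \<bullet> A v \<le> norm v * (B * norm v)"
      using Cauchy_Schwarz_ineq2[of v "A v"] B(2)[of v] mult_left_mono[OF B(2)[of v], of "norm v"] by simp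
    then have "t\<^sup>2 * (v \<bullet> A v) \<le> t\<^sup>2 * (B * (norm v)\<^sup>2)" by (intro mult_left_mono) (auto simp: power2_eq_square mult_ac)
    also have "\<dots> = (t * B) * (t * (norm v)\<^sup>2)" by (simp add: power2_eq_square mult_ac)
    also have "\<dots> \<le> 1 * (t * (norm v)\<^sup>2)"
    proof (rule mult_right_mono)
      have "t * B \<le> 1 / B * B" using B by (intro mult_right_mono) (auto simp: t_def)
      then show "t * B \<le> 1" using B by simp
    qed (use t in simp)
    finally have 1: "t\<^sup>2 * (v \<bullet> A v) \<le> t * (norm v)\<^sup>2" by simp
    have "f z + s z \<bullet> (t *\<^sub>R v) \<le> f z + p \<bullet> (t *\<^sub>R v) + (t *\<^sub>R v) \<bullet> A (t *\<^sub>R v) / 2"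
      using subgradient[of z "z + t *\<^sub>R v"] touch[OF nt] by simp
    then have "t * (v \<bullet> v) \<le> t\<^sup>2 * (v \<bullet> A v) / 2"
    proof -
      have "(t *\<^sub>R v) \<bullet> A (t *\<^sub>R v) = t\<^sup>2 * (v \<bullet> A v)" using A(1) by (simp add: linear_cmul power2_eq_square)
      moreover have "s z \<bullet> (t *\<^sub>R v) - p \<bullet> (t *\<^sub>R v) = t * (v \<bullet> v)"
        by (simp add: v_def inner_diff_left right_diff_distrib)
      ultimately show ?thesis
        using \<open>f z + s z \<bullet> (t *\<^sub>R v) \<le> f z + p \<bullet> (t *\<^sub>R v) + (t *\<^sub>R v) \<bullet> A (t *\<^sub>R v) / 2\<close> by argo
    qed
    then have "t * (norm v)\<^sup>2 \<le> t * (norm v)\<^sup>2 / 2" using 1 by (simp add: power2_norm_eq_inner)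
    then show False using t v by simp
  qed
  have "P = \<Psi> (z + s z)" using prox_eq[of z] sp by (simp add: \<Psi>_def p_def)
  then have diff: "prox differentiable (at (z + s z))" using P(2) by (auto simp: E_def)
  have "f y \<le> f z + s z \<bullet> (y - z) + B / 2 * (norm (y - z))\<^sup>2" if "norm (y - z) < \<rho> - norm z" for y
  proof -
    have "norm y \<le> \<rho>" using that norm_triangle_sub[of y z] by simp
    moreover have "(y - z) \<bullet> A (y - z) \<le> norm (y - z) * (B * norm (y - z))"
      using Cauchy_Schwarz_ineq2[of "y - z" "A (y - z)"] mult_left_mono[OF B(2)[of "y - z"], of "norm (y - z)"] by simp
    then have "(y - z) \<bullet> A (y - z) \<le> B * (norm (y - z))\<^sup>2" by (simp add: power2_eq_square mult_ac)
    ultimately show ?thesis using touch[of y] unfolding sp by argo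
  qed
  then obtain M where "linear M"
    "\<And>e. e > 0 \<Longrightarrow> \<exists>d>0. \<forall>h. norm h < d \<longrightarrow> \<bar>f (z + h) - f z - s z \<bullet> h - h \<bullet> M h / 2\<bar> \<le> e * (norm h)\<^sup>2"
    using second_order_of_prox_differentiable[of z "\<rho> - norm z" B] B(1) zi diff by auto
  then show thesis using that[of z M p] zi touch sp by simp
qed

end

subsection \<open>The theorem on sums\<close>

text \<open>The second-order superjet of viscosity theory. \<open>X\<close> is a map and not a
  matrix, which keeps the theorem on sums in an arbitrary Euclidean space. Only its quadratic form
  matters, so symmetry can be arranged afterwards.\<close>

definition superjet :: "('a::euclidean_space \<Rightarrow> real) \<Rightarrow> 'a \<Rightarrow> 'a \<Rightarrow> ('a \<Rightarrow> 'a) \<Rightarrow> bool" where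
  "superjet u x p X \<longleftrightarrow> (\<forall>e>0. \<exists>d>0. \<forall>h. norm h < d \<longrightarrow> u (x + h) \<le> u x + p \<bullet> h + h \<bullet> X h / 2 + e * (norm h)\<^sup>2)"

lemma superjetD:
  assumes "superjet u x p X" "0 < e"
  obtains d where "0 < d" "\<And>h. norm h < d \<Longrightarrow> u (x + h) \<le> u x + p \<bullet> h + h \<bullet> X h / 2 + e * (norm h)\<^sup>2"
  using assms unfolding superjet_def by blast

text \<open>\<open>g \<xi>\<close> is the sup-convolution of \<open>a\<close> with parameter
  \<open>l\<close>, plus \<open>l / 2\<close> times the squared norm of \<xi>. Written in this way
  it is a maximum of affine functions of \<xi>, hence convex, with subgradient
  \<open>l *\<^sub>R m \<xi>\<close>.\<close>

lemma sup_convolution_exists: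
  fixes a :: "'a::euclidean_space \<Rightarrow> real"
  assumes "continuous_on (cball 0 r) a" "0 \<le> r"
  shows "\<exists>g m. (\<forall>\<xi>. m \<xi> \<in> cball 0 r) \<and>
    (\<forall>\<xi>. g \<xi> = a (m \<xi>) - l / 2 * (norm (m \<xi>))\<^sup>2 + l * (m \<xi> \<bullet> \<xi>)) \<and>
    (\<forall>\<xi>. \<forall>h\<in>cball 0 r. a h - l / 2 * (norm h)\<^sup>2 + l * (h \<bullet> \<xi>) \<le> g \<xi>)"
proof -
  define b where "b \<xi> h = a h - l / 2 * (norm h)\<^sup>2 + l * (h \<bullet> \<xi>)" for \<xi> h
  have "\<exists>m\<in>cball 0 r. \<forall>h\<in>cball 0 r. b \<xi> h \<le> b \<xi> m" for \<xi>
    using assms unfolding b_def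
    by (intro continuous_attains_sup continuous_intros) auto
  then obtain m where "\<And>\<xi>. m \<xi> \<in> cball 0 r" "\<And>\<xi> h. h \<in> cball 0 r \<Longrightarrow> b \<xi> h \<le> b \<xi> (m \<xi>)"
    by metis
  then show ?thesis unfolding b_def by (intro exI[of _ "\<lambda>\<xi>. b \<xi> (m \<xi>)"] exI[of _ m]) (simp add: b_def)
qed

text \<open>Sup-convolution of a quadratic form changes it little when \<open>l\<close> is large:
  with \<open>z = \<zeta> + w\<close>, the cross term is split by Young's inequality, and the part
  quadratic in \<open>w\<close> is absorbed by the penalty.\<close>

lemma quadratic_sup_convolution_bound:
  fixes A :: "'a::euclidean_space \<Rightarrow> 'a"
  assumes A: "linear A" "\<And>x y. x \<bullet> A y = A x \<bullet> y" and B: "0 \<le> B" "\<And>x. norm (A x) \<le> B * norm x"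
    and e: "0 < e" and l: "2 * B\<^sup>2 / e + B \<le> l"
  shows "z \<bullet> A z / 2 - l / 2 * (norm (z - \<zeta>))\<^sup>2 \<le> \<zeta> \<bullet> A \<zeta> / 2 + e / 4 * (norm \<zeta>)\<^sup>2"
proof -
  define w where "w = z - \<zeta>"
  have "z = \<zeta> + w" by (simp add: w_def)
  then have "z \<bullet> A z = \<zeta> \<bullet> A \<zeta> + 2 * (A \<zeta> \<bullet> w) + w \<bullet> A w"
    using A by (simp add: linear_add algebra_simps inner_commute)
  moreover have "A \<zeta> \<bullet> w \<le> B * norm \<zeta> * norm w"
    using norm_cauchy_schwarz[of "A \<zeta>" w] mult_right_mono[OF B(2)[of \<zeta>], of "norm w"] by simp
  moreover have "w \<bullet> A w \<le> B * (norm w)\<^sup>2"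
    using norm_cauchy_schwarz[of w "A w"] mult_left_mono[OF B(2)[of w], of "norm w"]
    by (simp add: power2_eq_square mult_ac)
  moreover have "B * norm \<zeta> * norm w \<le> e / 4 * (norm \<zeta>)\<^sup>2 + B\<^sup>2 / e * (norm w)\<^sup>2"
  proof -
    have "e / 4 * (norm \<zeta>)\<^sup>2 + B\<^sup>2 / e * (norm w)\<^sup>2 - B * norm \<zeta> * norm w = (e * norm \<zeta> - 2 * B * norm w)\<^sup>2 / (4 * e)"
      using e by (simp add: power2_eq_square field_simps)
    also have "\<dots> \<ge> 0" using e by simp
    finally show ?thesis by simp
  qed
  moreover have "(B\<^sup>2 / e + B / 2) * (norm w)\<^sup>2 \<le> l / 2 * (norm w)\<^sup>2"
  proof (rule mult_right_mono)
    have "2 * B\<^sup>2 / e = 2 * (B\<^sup>2 / e)" by simp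
    then show "B\<^sup>2 / e + B / 2 \<le> l / 2" using l by linarith
  qed simp
  then have "B\<^sup>2 / e * (norm w)\<^sup>2 + B * (norm w)\<^sup>2 / 2 \<le> l / 2 * (norm w)\<^sup>2"
    by (simp add: algebra_simps)
  ultimately show ?thesis unfolding w_def[symmetric] by linarith
qed

text \<open>The first hypothesis is what comparison of the maximiser \<open>x\<close> with the
  competitor \<open>0\<close> gives. The conclusion keeps maximisers inside the ball when \<xi> is
  small.\<close>

lemma sup_convolution_maximizer_bound:
  fixes x \<xi> :: "'a::euclidean_space"
  assumes "- (l / 2 * (norm \<xi>)\<^sup>2) \<le> B / 2 * (norm x)\<^sup>2 - l / 2 * (norm (x - \<xi>))\<^sup>2" "B + 1 \<le> l" "0 \<le> B"
  shows "norm x \<le> 2 * l * norm \<xi>"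
proof -
  have "(norm (x - \<xi>))\<^sup>2 = (norm x)\<^sup>2 - 2 * (x \<bullet> \<xi>) + (norm \<xi>)\<^sup>2"
    unfolding power2_norm_eq_inner by (simp add: inner_commute algebra_simps)
  then have "l * (norm (x - \<xi>))\<^sup>2 = l * ((norm x)\<^sup>2 - 2 * (x \<bullet> \<xi>) + (norm \<xi>)\<^sup>2)"
    by (simp only:)
  also have "\<dots> = l * (norm x)\<^sup>2 - 2 * (l * (x \<bullet> \<xi>)) + l * (norm \<xi>)\<^sup>2"
    by (simp add: algebra_simps)
  finally have "l * (norm (x - \<xi>))\<^sup>2 = l * (norm x)\<^sup>2 - 2 * (l * (x \<bullet> \<xi>)) + l * (norm \<xi>)\<^sup>2" .
  then have "(l - B) / 2 * (norm x)\<^sup>2 \<le> l * (x \<bullet> \<xi>)"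
    using assms(1) by (simp add: left_diff_distrib diff_divide_distrib) argo
  also have "\<dots> \<le> l * (norm x * norm \<xi>)" using assms by (intro mult_left_mono norm_cauchy_schwarz) auto
  finally have "(l - B) / 2 * (norm x)\<^sup>2 \<le> l * (norm x * norm \<xi>)" .
  moreover have "1 / 2 * (norm x)\<^sup>2 \<le> (l - B) / 2 * (norm x)\<^sup>2" using assms by (intro mult_right_mono) auto
  ultimately have "1 / 2 * (norm x)\<^sup>2 \<le> l * (norm x * norm \<xi>)" by (rule order_trans[rotated])
  then have "norm x * norm x \<le> norm x * (2 * l * norm \<xi>)" by (simp add: power2_eq_square mult_ac)
  then show ?thesis using assms by (cases "x = 0") auto
qed

text \<open>The sum of the two sup-convolutions, made convex by a quadratic, lies below the
  quadratic form of \<open>A\<close> up to small terms, and \<open>Jensen_Alexandrov\<close> yields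
  a second-order expansion at a touching point. The jets are found near \<open>x0\<close> and
  \<open>y0\<close> and the matrix inequality holds up to \<open>e\<close>; no passage to the limit
  points is made, which suffices for an operator that does not depend on position.\<close>

theorem theorem_on_sums:
  fixes u w :: "'a::euclidean_space \<Rightarrow> real" and A :: "'a \<times> 'a \<Rightarrow> 'a \<times> 'a"
  assumes A: "linear A" "\<And>x y. x \<bullet> A y = A x \<bullet> y"
    and uc: "continuous_on (cball x0 r) u" and wc: "continuous_on (cball y0 r) w" and r: "0 < r"
    and above: "\<And>h k. norm h \<le> r \<Longrightarrow> norm k \<le> r \<Longrightarrow>
      u (x0 + h) + w (y0 + k) \<le> u x0 + w y0 + p \<bullet> h + q \<bullet> k + (h, k) \<bullet> A (h, k) / 2"
    and e: "0 < e"
  obtains x y px py X Y where "x \<in> ball x0 r" "y \<in> ball y0 r" "linear X" "linear Y"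
    "superjet u x px X" "superjet w y py Y"
    "\<And>h k. h \<bullet> X h + k \<bullet> Y k \<le> (h, k) \<bullet> A (h, k) + e * ((norm h)\<^sup>2 + (norm k)\<^sup>2)"
proof -
  obtain B where B: "B > 0" "\<And>x. norm (A x) \<le> B * norm x" using linear_bounded_pos[OF A(1)] by blast
  define l where "l = 2 * B\<^sup>2 / e + B + 1"
  have l: "2 * B\<^sup>2 / e + B \<le> l" "B + 1 \<le> l" "0 < l" using e B by (auto simp: l_def add_pos_pos)
  define a where "a h = u (x0 + h) - u x0 - p \<bullet> h" for h
  define b where "b k = w (y0 + k) - w y0 - q \<bullet> k" for k
  have ab0: "a 0 = 0" "b 0 = 0" by (auto simp: a_def b_def)
  have ab: "a h + b k \<le> (h, k) \<bullet> A (h, k) / 2" if "norm h \<le> r" "norm k \<le> r" for h k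
    using above[OF that] by (simp add: a_def b_def)
  have ac: "continuous_on (cball 0 r) a" unfolding a_def
    by (intro continuous_intros continuous_on_compose2[OF uc]) (auto simp: dist_norm)
  have bc: "continuous_on (cball 0 r) b" unfolding b_def
    by (intro continuous_intros continuous_on_compose2[OF wc]) (auto simp: dist_norm)
  obtain f1 m1 where f1: "\<And>\<xi>. m1 \<xi> \<in> cball 0 r"
    "\<And>\<xi>. f1 \<xi> = a (m1 \<xi>) - l / 2 * (norm (m1 \<xi>))\<^sup>2 + l * (m1 \<xi> \<bullet> \<xi>)"
    "\<And>\<xi> h. h \<in> cball 0 r \<Longrightarrow> a h - l / 2 * (norm h)\<^sup>2 + l * (h \<bullet> \<xi>) \<le> f1 \<xi>"
    using sup_convolution_exists[OF ac less_imp_le[OF r], of l] by blast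
  obtain f2 m2 where f2: "\<And>\<xi>. m2 \<xi> \<in> cball 0 r"
    "\<And>\<xi>. f2 \<xi> = b (m2 \<xi>) - l / 2 * (norm (m2 \<xi>))\<^sup>2 + l * (m2 \<xi> \<bullet> \<xi>)"
    "\<And>\<xi> h. h \<in> cball 0 r \<Longrightarrow> b h - l / 2 * (norm h)\<^sup>2 + l * (h \<bullet> \<xi>) \<le> f2 \<xi>"
    using sup_convolution_exists[OF bc less_imp_le[OF r], of l] by blast
  define f where "f \<zeta> = f1 (fst \<zeta>) + f2 (snd \<zeta>)" for \<zeta>
  define s where "s \<zeta> = (l *\<^sub>R m1 (fst \<zeta>), l *\<^sub>R m2 (snd \<zeta>))" for \<zeta>
  interpret subgradient_selection f s
  proof
    fix x y :: "'a \<times> 'a"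
    have "f1 (fst x) + l * (m1 (fst x) \<bullet> (fst y - fst x)) \<le> f1 (fst y)"
      using f1(2)[of "fst x"] f1(3)[OF f1(1)[of "fst x"], of "fst y"] by (simp add: algebra_simps)
    moreover have "f2 (snd x) + l * (m2 (snd x) \<bullet> (snd y - snd x)) \<le> f2 (snd y)"
      using f2(2)[of "snd x"] f2(3)[OF f2(1)[of "snd x"], of "snd y"] by (simp add: algebra_simps)
    ultimately show "f x + s x \<bullet> (y - x) \<le> f y"
      by (simp add: f_def s_def inner_prod_def algebra_simps)
  qed
  \<comment> \<open>The shift by \<open>l\<close> accounts for the quadratic that makes the
    sup-convolutions convex. Of the shift by \<open>e\<close>, one half covers the error of
    sup-convolving the form of \<open>A\<close>, and the other half provides the strictness that
    \<open>Jensen_Alexandrov\<close> asks for.\<close>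
  define A' where "A' \<zeta> = A \<zeta> + (e + l) *\<^sub>R \<zeta>" for \<zeta>
  have A': "linear A'" "\<And>x y. x \<bullet> A' y = A' x \<bullet> y"
    unfolding A'_def using A by (auto intro!: linear_compose_add linear_compose_scale_right linear_ident simp: algebra_simps)
  have sq: "- l / 2 * (norm h)\<^sup>2 + l * (h \<bullet> \<xi>) = l / 2 * (norm \<xi>)\<^sup>2 - l / 2 * (norm (h - \<xi>))\<^sup>2" for h \<xi> :: 'a
    unfolding power2_norm_eq_inner by (simp add: inner_commute algebra_simps)
  have f0: "0 \<le> f1 0" "0 \<le> f2 0" using f1(3)[of 0 0] f2(3)[of 0 0] r ab0 by auto
  have strict: "f \<zeta> \<le> f 0 + \<zeta> \<bullet> A' \<zeta> / 2 - e / 4 * (norm \<zeta>)\<^sup>2" for \<zeta>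
  proof -
    define z where "z = (m1 (fst \<zeta>), m2 (snd \<zeta>))"
    have nz: "(norm (z - \<zeta>))\<^sup>2 = (norm (m1 (fst \<zeta>) - fst \<zeta>))\<^sup>2 + (norm (m2 (snd \<zeta>) - snd \<zeta>))\<^sup>2"
      by (simp add: z_def norm_prod_def)
    have n\<zeta>: "(norm \<zeta>)\<^sup>2 = (norm (fst \<zeta>))\<^sup>2 + (norm (snd \<zeta>))\<^sup>2" by (simp add: norm_prod_def)
    have "f \<zeta> = a (m1 (fst \<zeta>)) + b (m2 (snd \<zeta>)) + l / 2 * (norm \<zeta>)\<^sup>2 - l / 2 * (norm (z - \<zeta>))\<^sup>2"
      using sq[of "m1 (fst \<zeta>)" "fst \<zeta>"] sq[of "m2 (snd \<zeta>)" "snd \<zeta>"]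
      unfolding f_def f1(2) f2(2) nz n\<zeta> distrib_left by linarith
    also have "\<dots> \<le> z \<bullet> A z / 2 + l / 2 * (norm \<zeta>)\<^sup>2 - l / 2 * (norm (z - \<zeta>))\<^sup>2"
      using ab[of "m1 (fst \<zeta>)" "m2 (snd \<zeta>)"] f1(1)[of "fst \<zeta>"] f2(1)[of "snd \<zeta>"] by (simp add: z_def)
    also have "\<dots> \<le> \<zeta> \<bullet> A \<zeta> / 2 + e / 4 * (norm \<zeta>)\<^sup>2 + l / 2 * (norm \<zeta>)\<^sup>2"
      using quadratic_sup_convolution_bound[OF A less_imp_le[OF B(1)] B(2) e l(1), of z \<zeta>] by linarith
    also have "\<dots> = \<zeta> \<bullet> A' \<zeta> / 2 - e / 4 * (norm \<zeta>)\<^sup>2"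
      by (simp add: A'_def inner_add_right power2_norm_eq_inner field_simps)
    also have "\<dots> \<le> f 0 + \<zeta> \<bullet> A' \<zeta> / 2 - e / 4 * (norm \<zeta>)\<^sup>2" using f0 by (simp add: f_def)
    finally show ?thesis .
  qed
  \<comment> \<open>Maximisers that belong to points of norm below \<rho> have norm at most
    \<open>2 * l * \<rho> = r\<close>, strictly less in fact, so the functions may be varied around
    them.\<close>
  define \<rho> where "\<rho> = r / (2 * l)"
  have \<rho>: "\<rho> > 0" using r l by (simp add: \<rho>_def)
  obtain z P M where z: "norm z < \<rho>" and M: "linear M"
    and touch: "\<And>y. norm y \<le> \<rho> \<Longrightarrow> f y \<le> f z + P \<bullet> (y - z) + (y - z) \<bullet> A' (y - z) / 2"
    and taylor: "\<And>e. e > 0 \<Longrightarrow> \<exists>d>0. \<forall>h. norm h < d \<longrightarrow> \<bar>f (z + h) - f z - P \<bullet> h - h \<bullet> M h / 2\<bar> \<le> e * (norm h)\<^sup>2"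
    using Jensen_Alexandrov[OF A' strict \<rho>, of] e by (metis divide_pos_pos zero_less_numeral)
  obtain \<xi> \<eta> where z_eq: "z = (\<xi>, \<eta>)" by (cases z)
  obtain P1 P2 where P_eq: "P = (P1, P2)" by (cases P)
  have n\<xi>: "norm \<xi> < \<rho>" "norm \<eta> < \<rho>"
    using z norm_fst_le[of \<xi> \<eta>] norm_snd_le[of \<eta> \<xi>] by (auto simp: z_eq)
  define x1 y1 where "x1 = m1 \<xi>" and "y1 = m2 \<eta>"
  have xb: "norm x1 < r"
  proof -
    have "a x1 + b 0 \<le> B / 2 * (norm x1)\<^sup>2"
    proof -
      have "(x1, 0) \<bullet> A (x1, 0) \<le> norm (x1, 0::'a) * norm (A (x1, 0))" by (rule norm_cauchy_schwarz)
      also have "\<dots> \<le> norm (x1, 0::'a) * (B * norm (x1, 0::'a))" by (intro mult_left_mono B) auto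
      finally have "(x1, 0) \<bullet> A (x1, 0) \<le> B * (norm x1)\<^sup>2" by (simp add: power2_eq_square mult_ac)
      moreover have "a x1 + b 0 \<le> (x1, 0) \<bullet> A (x1, 0) / 2" using f1(1)[of \<xi>] r by (intro ab) (auto simp: x1_def)
      ultimately show ?thesis by argo
    qed
    moreover have "- (l / 2 * (norm \<xi>)\<^sup>2) \<le> a x1 - l / 2 * (norm (x1 - \<xi>))\<^sup>2"
      using f1(2)[of \<xi>] f1(3)[of 0 \<xi>] sq[of x1 \<xi>] r ab0 unfolding x1_def by simp
    ultimately have "norm x1 \<le> 2 * l * norm \<xi>"
      using l B ab0 by (intro sup_convolution_maximizer_bound[of l \<xi> B]) auto
    also have "\<dots> < r" using n\<xi>(1) l r by (simp add: \<rho>_def field_simps)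
    finally show ?thesis .
  qed
  have yb: "norm y1 < r"
  proof -
    have "a 0 + b y1 \<le> B / 2 * (norm y1)\<^sup>2"
    proof -
      have "(0, y1) \<bullet> A (0, y1) \<le> norm (0::'a, y1) * norm (A (0, y1))" by (rule norm_cauchy_schwarz)
      also have "\<dots> \<le> norm (0::'a, y1) * (B * norm (0::'a, y1))" by (intro mult_left_mono B) auto
      finally have "(0, y1) \<bullet> A (0, y1) \<le> B * (norm y1)\<^sup>2" by (simp add: power2_eq_square mult_ac)
      moreover have "a 0 + b y1 \<le> (0, y1) \<bullet> A (0, y1) / 2" using f2(1)[of \<eta>] r by (intro ab) (auto simp: y1_def)
      ultimately show ?thesis by argo
    qed
    moreover have "- (l / 2 * (norm \<eta>)\<^sup>2) \<le> b y1 - l / 2 * (norm (y1 - \<eta>))\<^sup>2"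
      using f2(2)[of \<eta>] f2(3)[of 0 \<eta>] sq[of y1 \<eta>] r ab0 unfolding y1_def by simp
    ultimately have "norm y1 \<le> 2 * l * norm \<eta>"
      using l B ab0 by (intro sup_convolution_maximizer_bound[of l \<eta> B]) auto
    also have "\<dots> < r" using n\<xi>(2) l r by (simp add: \<rho>_def field_simps)
    finally show ?thesis .
  qed
  define X Y where "X h = fst (M (h, 0)) - l *\<^sub>R h" and "Y k = snd (M (0, k)) - l *\<^sub>R k" for h k
  have lin1: "linear (\<lambda>h::'a. (h, 0::'a))" "linear (\<lambda>k::'a. (0::'a, k))" by (auto intro!: linearI)
  have linX: "linear X"
    unfolding X_def
    using linear_compose[OF linear_compose[OF lin1(1) M] linear_fst]
    by (intro linear_compose_sub linear_compose_scale_right linear_ident) (simp add: o_def)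
  have linY: "linear Y"
    unfolding Y_def
    using linear_compose[OF linear_compose[OF lin1(2) M] linear_snd]
    by (intro linear_compose_sub linear_compose_scale_right linear_ident) (simp add: o_def)
  \<comment> \<open>Moving the point \<xi> and the competitor \<open>x1\<close> by the same
    \<open>h\<close> leaves the penalty between them unchanged, so an upper expansion of the
    sup-convolution at \<xi> becomes a superjet of \<open>u\<close> at the maximiser.\<close>
  have jx: "superjet u (x0 + x1) (p + P1 - l *\<^sub>R \<xi>) X"
    unfolding superjet_def
  proof (intro allI impI)
    fix \<epsilon> :: real assume \<epsilon>: "0 < \<epsilon>"
    obtain d where d: "d > 0" "\<And>h. norm h < d \<Longrightarrow> \<bar>f (z + h) - f z - P \<bullet> h - h \<bullet> M h / 2\<bar> \<le> \<epsilon> * (norm h)\<^sup>2"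
      using taylor[OF \<epsilon>] by blast
    have "u (x0 + x1 + h) \<le> u (x0 + x1) + (p + P1 - l *\<^sub>R \<xi>) \<bullet> h + h \<bullet> X h / 2 + \<epsilon> * (norm h)\<^sup>2"
      if h: "norm h < min d (r - norm x1)" for h
    proof -
      have "norm (x1 + h) \<le> r" using norm_triangle_ineq[of x1 h] h by simp
      then have "a (x1 + h) - l / 2 * (norm (x1 + h))\<^sup>2 + l * ((x1 + h) \<bullet> (\<xi> + h)) \<le> f1 (\<xi> + h)"
        by (intro f1(3)) simp
      moreover have "f1 \<xi> = a x1 - l / 2 * (norm x1)\<^sup>2 + l * (x1 \<bullet> \<xi>)" unfolding x1_def by (rule f1(2))
      moreover have "f1 (\<xi> + h) - f1 \<xi> \<le> P1 \<bullet> h + h \<bullet> fst (M (h, 0)) / 2 + \<epsilon> * (norm h)\<^sup>2"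
        using d(2)[of "(h, 0)"] h by (simp add: z_eq P_eq f_def inner_prod_def abs_le_iff)
      moreover have "- (l / 2 * (norm (x1 + h))\<^sup>2) + l * ((x1 + h) \<bullet> (\<xi> + h)) + l / 2 * (norm x1)\<^sup>2 - l * (x1 \<bullet> \<xi>)
          = l * (\<xi> \<bullet> h) + l * (h \<bullet> h) / 2"
        unfolding power2_norm_eq_inner by (simp add: inner_commute algebra_simps; (simp add: field_simps)?)
      moreover have "h \<bullet> X h = h \<bullet> fst (M (h, 0)) - l * (h \<bullet> h)" by (simp add: X_def inner_diff_right)
      ultimately have "a (x1 + h) \<le> a x1 + P1 \<bullet> h - l * (\<xi> \<bullet> h) + h \<bullet> X h / 2 + \<epsilon> * (norm h)\<^sup>2" by linarith
      then show ?thesis by (simp add: a_def algebra_simps)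
    qed
    then show "\<exists>d>0. \<forall>h. norm h < d \<longrightarrow>
        u (x0 + x1 + h) \<le> u (x0 + x1) + (p + P1 - l *\<^sub>R \<xi>) \<bullet> h + h \<bullet> X h / 2 + \<epsilon> * (norm h)\<^sup>2"
      using d(1) xb by (intro exI[of _ "min d (r - norm x1)"]) auto
  qed
  have jy: "superjet w (y0 + y1) (q + P2 - l *\<^sub>R \<eta>) Y"
    unfolding superjet_def
  proof (intro allI impI)
    fix \<epsilon> :: real assume \<epsilon>: "0 < \<epsilon>"
    obtain d where d: "d > 0" "\<And>h. norm h < d \<Longrightarrow> \<bar>f (z + h) - f z - P \<bullet> h - h \<bullet> M h / 2\<bar> \<le> \<epsilon> * (norm h)\<^sup>2"
      using taylor[OF \<epsilon>] by blast
    have "w (y0 + y1 + h) \<le> w (y0 + y1) + (q + P2 - l *\<^sub>R \<eta>) \<bullet> h + h \<bullet> Y h / 2 + \<epsilon> * (norm h)\<^sup>2"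
      if h: "norm h < min d (r - norm y1)" for h
    proof -
      have "norm (y1 + h) \<le> r" using norm_triangle_ineq[of y1 h] h by simp
      then have "b (y1 + h) - l / 2 * (norm (y1 + h))\<^sup>2 + l * ((y1 + h) \<bullet> (\<eta> + h)) \<le> f2 (\<eta> + h)"
        by (intro f2(3)) simp
      moreover have "f2 \<eta> = b y1 - l / 2 * (norm y1)\<^sup>2 + l * (y1 \<bullet> \<eta>)" unfolding y1_def by (rule f2(2))
      moreover have "f2 (\<eta> + h) - f2 \<eta> \<le> P2 \<bullet> h + h \<bullet> snd (M (0, h)) / 2 + \<epsilon> * (norm h)\<^sup>2"
        using d(2)[of "(0, h)"] h by (simp add: z_eq P_eq f_def inner_prod_def abs_le_iff)
      moreover have "- (l / 2 * (norm (y1 + h))\<^sup>2) + l * ((y1 + h) \<bullet> (\<eta> + h)) + l / 2 * (norm y1)\<^sup>2 - l * (y1 \<bullet> \<eta>)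
          = l * (\<eta> \<bullet> h) + l * (h \<bullet> h) / 2"
        unfolding power2_norm_eq_inner by (simp add: inner_commute algebra_simps; (simp add: field_simps)?)
      moreover have "h \<bullet> Y h = h \<bullet> snd (M (0, h)) - l * (h \<bullet> h)" by (simp add: Y_def inner_diff_right)
      ultimately have "b (y1 + h) \<le> b y1 + P2 \<bullet> h - l * (\<eta> \<bullet> h) + h \<bullet> Y h / 2 + \<epsilon> * (norm h)\<^sup>2" by linarith
      then show ?thesis by (simp add: b_def algebra_simps)
    qed
    then show "\<exists>d>0. \<forall>h. norm h < d \<longrightarrow>
        w (y0 + y1 + h) \<le> w (y0 + y1) + (q + P2 - l *\<^sub>R \<eta>) \<bullet> h + h \<bullet> Y h / 2 + \<epsilon> * (norm h)\<^sup>2"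
      using d(1) yb by (intro exI[of _ "min d (r - norm y1)"]) auto
  qed
  have ineq: "h \<bullet> X h + k \<bullet> Y k \<le> (h, k) \<bullet> A (h, k) + e * ((norm h)\<^sup>2 + (norm k)\<^sup>2)" for h k
  proof -
    define \<zeta> where "\<zeta> = (h, k)"
    define N where "N = (norm h)\<^sup>2 + (norm k)\<^sup>2"
    define m where "m = h \<bullet> fst (M (h, 0)) + k \<bullet> snd (M (0, k))"
    \<comment> \<open>\<open>f\<close> is a sum of functions of separate variables, so its value at
      \<open>z + t *\<^sub>R \<zeta>\<close> follows from the expansions along the two factors. Only
      the diagonal blocks of \<open>M\<close> enter, and the touching inequality bounds their sum by
      \<open>A'\<close>.\<close>
    have "m \<le> \<zeta> \<bullet> A' \<zeta> + \<epsilon>" if \<epsilon>: "0 < \<epsilon>" for \<epsilon>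
    proof -
      define \<epsilon>' where "\<epsilon>' = \<epsilon> / (2 * (N + 1))"
      have N0: "N \<ge> 0" by (simp add: N_def)
      then have \<epsilon>': "\<epsilon>' > 0" using \<epsilon> by (simp add: \<epsilon>'_def)
      obtain d where d: "d > 0" "\<And>h. norm h < d \<Longrightarrow> \<bar>f (z + h) - f z - P \<bullet> h - h \<bullet> M h / 2\<bar> \<le> \<epsilon>' * (norm h)\<^sup>2"
        using taylor[OF \<epsilon>'] by blast
      define t where "t = min (d / 2) (\<rho> - norm z) / (norm \<zeta> + 1)"
      have t: "t > 0" using d z by (simp add: t_def add_nonneg_pos)
      have tz: "t * norm \<zeta> \<le> min (d / 2) (\<rho> - norm z)"
      proof -
        have "0 < norm \<zeta> + 1" by (simp add: add_nonneg_pos)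
        then have "norm \<zeta> / (norm \<zeta> + 1) \<le> 1" by (simp add: pos_divide_le_eq)
        then have "min (d / 2) (\<rho> - norm z) * (norm \<zeta> / (norm \<zeta> + 1)) \<le> min (d / 2) (\<rho> - norm z) * 1"
          using d z by (intro mult_left_mono) auto
        then show ?thesis by (simp add: t_def)
      qed
      have nh: "norm (t *\<^sub>R h) \<le> t * norm \<zeta>" "norm (t *\<^sub>R k) \<le> t * norm \<zeta>"
        using t norm_fst_le[of h k] norm_snd_le[of k h] by (auto simp: \<zeta>_def)
      have "t * norm \<zeta> \<le> d / 2" using tz by simp
      then have nd: "norm (t *\<^sub>R h, 0::'a) < d" "norm (0::'a, t *\<^sub>R k) < d"
        using nh d(1) unfolding norm_Pair1 norm_Pair2 by linarith+
      have "norm (z + t *\<^sub>R \<zeta>) \<le> \<rho>" using norm_triangle_ineq[of z "t *\<^sub>R \<zeta>"] tz t by simp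
      from touch[OF this] have "f (z + t *\<^sub>R \<zeta>) \<le> f z + P \<bullet> (t *\<^sub>R \<zeta>) + (t *\<^sub>R \<zeta>) \<bullet> A' (t *\<^sub>R \<zeta>) / 2" by simp
      then have 1: "f (z + t *\<^sub>R \<zeta>) \<le> f z + t * (P \<bullet> \<zeta>) + t\<^sup>2 * (\<zeta> \<bullet> A' \<zeta>) / 2"
        using A'(1) by (simp add: linear_cmul power2_eq_square mult.assoc)
      have 2: "f (z + t *\<^sub>R \<zeta>) = f (z + (t *\<^sub>R h, 0)) + f (z + (0, t *\<^sub>R k)) - f z"
        by (simp add: f_def \<zeta>_def z_eq)
      have Mh: "M (t *\<^sub>R h, 0) = t *\<^sub>R M (h, 0)" "M (0, t *\<^sub>R k) = t *\<^sub>R M (0, k)"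
        using linear_cmul[OF M, of t "(h, 0)"] linear_cmul[OF M, of t "(0, k)"] by simp_all
      have 3: "f z + t * (P1 \<bullet> h) + t\<^sup>2 * (h \<bullet> fst (M (h, 0))) / 2 - \<epsilon>' * t\<^sup>2 * (norm h)\<^sup>2 \<le> f (z + (t *\<^sub>R h, 0))"
        using d(2)[OF nd(1)] Mh t
        by (simp add: P_eq inner_prod_def abs_le_iff power2_eq_square algebra_simps)
      have 4: "f z + t * (P2 \<bullet> k) + t\<^sup>2 * (k \<bullet> snd (M (0, k))) / 2 - \<epsilon>' * t\<^sup>2 * (norm k)\<^sup>2 \<le> f (z + (0, t *\<^sub>R k))"
        using d(2)[OF nd(2)] Mh t
        by (simp add: P_eq inner_prod_def abs_le_iff power2_eq_square algebra_simps)
      have 5: "t * (P \<bullet> \<zeta>) = t * (P1 \<bullet> h) + t * (P2 \<bullet> k)"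
        by (simp add: P_eq \<zeta>_def inner_prod_def distrib_left)
      have 6: "t\<^sup>2 * m = t\<^sup>2 * (h \<bullet> fst (M (h, 0))) + t\<^sup>2 * (k \<bullet> snd (M (0, k)))"
        "\<epsilon>' * t\<^sup>2 * N = \<epsilon>' * t\<^sup>2 * (norm h)\<^sup>2 + \<epsilon>' * t\<^sup>2 * (norm k)\<^sup>2"
        by (simp_all add: m_def N_def distrib_left)
      have "t\<^sup>2 * m / 2 - \<epsilon>' * t\<^sup>2 * N \<le> t\<^sup>2 * (\<zeta> \<bullet> A' \<zeta>) / 2"
        using 1 2 3 4 5 6 by linarith
      then have "t\<^sup>2 * m \<le> t\<^sup>2 * (\<zeta> \<bullet> A' \<zeta> + 2 * \<epsilon>' * N)" by (simp add: algebra_simps)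
      then have "m \<le> \<zeta> \<bullet> A' \<zeta> + 2 * \<epsilon>' * N" using t by simp
      also have "2 * \<epsilon>' * N \<le> \<epsilon>" using N0 \<epsilon> by (simp add: \<epsilon>'_def field_simps)
      finally show ?thesis by simp
    qed
    then have "m \<le> \<zeta> \<bullet> A' \<zeta>" by (rule field_le_epsilon)
    moreover have "h \<bullet> X h + k \<bullet> Y k = m - l * N"
      by (simp add: X_def Y_def m_def N_def inner_diff_right power2_norm_eq_inner algebra_simps)
    moreover have "\<zeta> \<bullet> A' \<zeta> = \<zeta> \<bullet> A \<zeta> + e * N + l * N"
      by (simp add: A'_def inner_add_right N_def \<zeta>_def power2_norm_eq_inner algebra_simps)
    ultimately show ?thesis unfolding \<zeta>_def N_def by linarith
  qed
  show thesis
    using that[OF _ _ linX linY jx jy ineq] xb yb by (simp add: dist_norm)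
qed

subsection \<open>Second-order expansions\<close>

definition jet2 :: "('a::euclidean_space \<Rightarrow> real) \<Rightarrow> 'a \<Rightarrow> 'a \<Rightarrow> ('a \<Rightarrow> 'a) \<Rightarrow> bool" where
  "jet2 g z p H \<longleftrightarrow> (\<forall>e>0. \<exists>d>0. \<forall>h. norm h < d \<longrightarrow> \<bar>g (z + h) - g z - p \<bullet> h - h \<bullet> H h / 2\<bar> \<le> e * (norm h)\<^sup>2)"

lemma jet2_uminus: "jet2 g z p H \<Longrightarrow> jet2 (\<lambda>x. - g x) z (- p) (\<lambda>h. - H h)"
proof -
  have "- g (z + h) - - g z - (- p) \<bullet> h - h \<bullet> (- H h) / 2 = - (g (z + h) - g z - p \<bullet> h - h \<bullet> H h / 2)" for h
    by simp
  then show "jet2 g z p H \<Longrightarrow> jet2 (\<lambda>x. - g x) z (- p) (\<lambda>h. - H h)"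
    unfolding jet2_def by (simp only: abs_minus_cancel)
qed

lemma jet2_cmult: "jet2 (\<lambda>x. c * g x) z (c *\<^sub>R p) (\<lambda>h. c *\<^sub>R H h)" if "jet2 g z p H"
  unfolding jet2_def
proof (intro allI impI)
  fix e :: real assume e: "e > 0"
  define e' where "e' = e / (\<bar>c\<bar> + 1)"
  have e': "e' > 0" using e by (simp add: e'_def add_nonneg_pos)
  obtain d where d: "d > 0" "\<And>h. norm h < d \<Longrightarrow> \<bar>g (z + h) - g z - p \<bullet> h - h \<bullet> H h / 2\<bar> \<le> e' * (norm h)\<^sup>2"
    using \<open>jet2 g z p H\<close> e' unfolding jet2_def by blast
  have "\<bar>c * g (z + h) - c * g z - (c *\<^sub>R p) \<bullet> h - h \<bullet> (c *\<^sub>R H h) / 2\<bar> \<le> e * (norm h)\<^sup>2" if h: "norm h < d" for h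
  proof -
    have "c * g (z + h) - c * g z - (c *\<^sub>R p) \<bullet> h - h \<bullet> (c *\<^sub>R H h) / 2 = c * (g (z + h) - g z - p \<bullet> h - h \<bullet> H h / 2)"
      by (simp add: algebra_simps)
    also have "\<bar>\<dots>\<bar> \<le> \<bar>c\<bar> * (e' * (norm h)\<^sup>2)" unfolding abs_mult using d(2)[OF h] by (intro mult_left_mono) auto
    also have "\<dots> \<le> (\<bar>c\<bar> + 1) * (e' * (norm h)\<^sup>2)" using e' by (intro mult_right_mono) auto
    also have "\<dots> = e * (norm h)\<^sup>2" unfolding e'_def by (simp add: add_nonneg_pos)
    finally show ?thesis .
  qed
  then show "\<exists>d>0. \<forall>h. norm h < d \<longrightarrow> \<bar>c * g (z + h) - c * g z - (c *\<^sub>R p) \<bullet> h - h \<bullet> (c *\<^sub>R H h) / 2\<bar> \<le> e * (norm h)\<^sup>2"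
    using d(1) by blast
qed

lemma jet2_of_derivatives:
  fixes \<phi> :: "'a::euclidean_space \<Rightarrow> real"
  assumes r: "r > 0" and d1: "\<And>x. x \<in> ball z r \<Longrightarrow> (\<phi> has_derivative (\<lambda>h. g x \<bullet> h)) (at x)"
    and d2: "(g has_derivative H) (at z)"
  shows "jet2 \<phi> z (g z) H"
  unfolding jet2_def
proof (intro allI impI)
  fix e :: real assume "e > 0"
  then obtain d where d: "d > 0" "\<And>y. norm (y - z) < d \<Longrightarrow> norm (g y - g z - H (y - z)) \<le> e * norm (y - z)"
    using d2 unfolding has_derivative_at_alt by blast
  have lin: "linear H" using d2 has_derivative_linear by blast
  have "\<bar>\<phi> (z + h) - \<phi> z - g z \<bullet> h - h \<bullet> H h / 2\<bar> \<le> e * (norm h)\<^sup>2" if h: "norm h < min d r" for h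
  proof -
    define f where "f t = \<phi> (z + t *\<^sub>R h) - t * (g z \<bullet> h) - t\<^sup>2 / 2 * (h \<bullet> H h)" for t
    have der: "(f has_real_derivative ((g (z + t *\<^sub>R h) - g z - H (t *\<^sub>R h)) \<bullet> h)) (at t)" if t: "0 \<le> t" "t \<le> 1" for t
    proof -
      have "norm (t *\<^sub>R h) \<le> norm h" using t by (simp add: mult_left_le_one_le)
      then have "z + t *\<^sub>R h \<in> ball z r" using h by (simp add: dist_norm)
      then have "((\<lambda>t. \<phi> (z + t *\<^sub>R h)) has_derivative (\<lambda>s. g (z + t *\<^sub>R h) \<bullet> (s *\<^sub>R h))) (at t)"
        by (intro has_derivative_compose[of "\<lambda>t. z + t *\<^sub>R h" "\<lambda>s. s *\<^sub>R h" t UNIV \<phi>, simplified] d1)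
          (auto intro!: derivative_eq_intros)
      then have "((\<lambda>t. \<phi> (z + t *\<^sub>R h)) has_real_derivative (g (z + t *\<^sub>R h) \<bullet> h)) (at t)"
        by (simp add: has_field_derivative_def mult.commute[of _ "g _ \<bullet> h"])
      then show ?thesis unfolding f_def
        by (auto intro!: derivative_eq_intros simp: inner_diff_left inner_diff_right linear_cmul[OF lin] inner_commute)
    qed
    have "\<exists>t. 0 < t \<and> t < 1 \<and> f 1 - f 0 = (1 - 0) * ((g (z + t *\<^sub>R h) - g z - H (t *\<^sub>R h)) \<bullet> h)"
      by (rule MVT2) (auto intro!: der)
    then obtain t where t: "0 < t" "t < 1" "f 1 - f 0 = (g (z + t *\<^sub>R h) - g z - H (t *\<^sub>R h)) \<bullet> h" by auto
    have nt: "norm (t *\<^sub>R h) \<le> norm h" using t by (simp add: mult_left_le_one_le)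
    have "\<bar>f 1 - f 0\<bar> \<le> norm (g (z + t *\<^sub>R h) - g z - H (t *\<^sub>R h)) * norm h"
      unfolding t by (rule Cauchy_Schwarz_ineq2)
    also have "\<dots> \<le> (e * norm h) * norm h"
    proof (rule mult_right_mono)
      have "norm (g (z + t *\<^sub>R h) - g z - H (t *\<^sub>R h)) \<le> e * norm (t *\<^sub>R h)"
        using d(2)[of "z + t *\<^sub>R h"] nt h by simp
      also have "\<dots> \<le> e * norm h" using nt \<open>e > 0\<close> by (intro mult_left_mono) auto
      finally show "norm (g (z + t *\<^sub>R h) - g z - H (t *\<^sub>R h)) \<le> e * norm h" .
    qed simp
    finally show ?thesis by (simp add: f_def power2_eq_square algebra_simps)
  qed
  then show "\<exists>d>0. \<forall>h. norm h < d \<longrightarrow> \<bar>\<phi> (z + h) - \<phi> z - g z \<bullet> h - h \<bullet> H h / 2\<bar> \<le> e * (norm h)\<^sup>2"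
    using d(1) r by (intro exI[of _ "min d r"]) auto
qed

text \<open>Both sides are the limit of the same second difference quotient of \<open>\<phi>\<close>.\<close>

lemma second_derivative_symmetric:
  fixes \<phi> :: "'a::euclidean_space \<Rightarrow> real"
  assumes r: "r > 0" and d1: "\<And>x. x \<in> ball z r \<Longrightarrow> (\<phi> has_derivative (\<lambda>h. g x \<bullet> h)) (at x)"
    and d2: "(g has_derivative H) (at z)"
  shows "H h \<bullet> k = H k \<bullet> h"
proof -
  have lin: "linear H" using d2 has_derivative_linear by blast
  define N where "N h k = (norm h + norm k) * norm k" for h k :: 'a
  define D where "D s h k = \<phi> (z + s *\<^sub>R h + s *\<^sub>R k) - \<phi> (z + s *\<^sub>R h) - \<phi> (z + s *\<^sub>R k) + \<phi> z" for s h k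
  have key: "\<exists>s0>0. \<forall>s. 0 < s \<and> s < s0 \<longrightarrow> \<bar>D s h k - s\<^sup>2 * (H h \<bullet> k)\<bar> \<le> 2 * e * s\<^sup>2 * N h k" if e: "e > 0" for e h k
  proof -
    obtain d where d: "d > 0" "\<And>y. norm (y - z) < d \<Longrightarrow> norm (g y - g z - H (y - z)) \<le> e * norm (y - z)"
      using d2 e unfolding has_derivative_at_alt by blast
    define s0 where "s0 = min d r / (norm h + norm k + 1)"
    have pos: "norm h + norm k + 1 > 0" by (simp add: add_nonneg_pos)
    have s0: "s0 > 0" using d r pos by (simp add: s0_def)
    have "\<bar>D s h k - s\<^sup>2 * (H h \<bullet> k)\<bar> \<le> 2 * e * s\<^sup>2 * N h k" if s: "0 < s" "s < s0" for s
    proof -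
      have sb: "s * (norm h + norm k) < min d r"
      proof -
        have "s * (norm h + norm k) \<le> s * (norm h + norm k + 1)" using s by (intro mult_left_mono) auto
        also have "\<dots> < s0 * (norm h + norm k + 1)" using s pos by (intro mult_strict_right_mono) auto
        also have "\<dots> = min d r" using pos by (simp add: s0_def)
        finally show ?thesis .
      qed
      have nb: "norm (c *\<^sub>R h + t *\<^sub>R k) \<le> s * (norm h + norm k)" if "0 \<le> c" "c \<le> s" "0 \<le> t" "t \<le> s" for c t
      proof -
        have "norm (c *\<^sub>R h + t *\<^sub>R k) \<le> c * norm h + t * norm k"
          using norm_triangle_ineq[of "c *\<^sub>R h" "t *\<^sub>R k"] that by simp
        also have "\<dots> \<le> s * norm h + s * norm k" using that by (intro add_mono mult_right_mono) auto
        finally show ?thesis by (simp add: distrib_left)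
      qed
      have inb: "z + v \<in> ball z r" if "norm v < r" for v using that by (simp add: dist_norm)
      define f where "f t = \<phi> (z + s *\<^sub>R h + t *\<^sub>R k) - \<phi> (z + t *\<^sub>R k)" for t
      have line: "((\<lambda>t. \<phi> (y + t *\<^sub>R k)) has_real_derivative (g (y + t *\<^sub>R k) \<bullet> k)) (at t)"
        if "y + t *\<^sub>R k \<in> ball z r" for y t
      proof -
        have "((\<lambda>t. \<phi> (y + t *\<^sub>R k)) has_derivative (\<lambda>c. g (y + t *\<^sub>R k) \<bullet> (c *\<^sub>R k))) (at t)"
          by (intro has_derivative_compose[of "\<lambda>t. y + t *\<^sub>R k" "\<lambda>c. c *\<^sub>R k" t UNIV \<phi>, simplified] d1 that)
            (auto intro!: derivative_eq_intros)
        then show ?thesis by (simp add: has_field_derivative_def mult.commute[of _ "g _ \<bullet> k"])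
      qed
      have der: "(f has_real_derivative ((g (z + s *\<^sub>R h + t *\<^sub>R k) - g (z + t *\<^sub>R k)) \<bullet> k)) (at t)" if t: "0 \<le> t" "t \<le> s" for t
      proof -
        have "z + s *\<^sub>R h + t *\<^sub>R k \<in> ball z r" "z + t *\<^sub>R k \<in> ball z r"
          using inb[of "s *\<^sub>R h + t *\<^sub>R k"] inb[of "t *\<^sub>R k"] nb[of s t] nb[of 0 t] sb s t by (auto simp: add.assoc)
        then show ?thesis unfolding f_def inner_diff_left by (intro DERIV_diff line)
      qed
      have "\<exists>t. 0 < t \<and> t < s \<and> f s - f 0 = (s - 0) * ((g (z + s *\<^sub>R h + t *\<^sub>R k) - g (z + t *\<^sub>R k)) \<bullet> k)"
        using s by (intro MVT2) (auto intro!: der)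
      then obtain t where t: "0 < t" "t < s" "f s - f 0 = s * ((g (z + s *\<^sub>R h + t *\<^sub>R k) - g (z + t *\<^sub>R k)) \<bullet> k)" by auto
      define R1 where "R1 = g (z + s *\<^sub>R h + t *\<^sub>R k) - g z - H (s *\<^sub>R h + t *\<^sub>R k)"
      define R2 where "R2 = g (z + t *\<^sub>R k) - g z - H (t *\<^sub>R k)"
      have r1: "norm R1 \<le> e * (s * (norm h + norm k))"
      proof -
        have n1: "norm (s *\<^sub>R h + t *\<^sub>R k) \<le> s * (norm h + norm k)" using nb[of s t] t s by simp
        have "norm R1 \<le> e * norm (s *\<^sub>R h + t *\<^sub>R k)"
          using d(2)[of "z + s *\<^sub>R h + t *\<^sub>R k"] n1 sb by (simp add: R1_def add.assoc)
        also have "\<dots> \<le> e * (s * (norm h + norm k))" using n1 e by (intro mult_left_mono) auto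
        finally show ?thesis .
      qed
      have r2: "norm R2 \<le> e * (s * (norm h + norm k))"
      proof -
        have n1: "norm (t *\<^sub>R k) \<le> s * (norm h + norm k)" using nb[of 0 t] t s by simp
        have "norm R2 \<le> e * norm (t *\<^sub>R k)"
          using d(2)[of "z + t *\<^sub>R k"] n1 sb by (simp add: R2_def)
        also have "\<dots> \<le> e * (s * (norm h + norm k))" using n1 e by (intro mult_left_mono) auto
        finally show ?thesis .
      qed
      have gd: "g (z + s *\<^sub>R h + t *\<^sub>R k) - g (z + t *\<^sub>R k) = s *\<^sub>R H h + (R1 - R2)"
        using lin by (simp add: R1_def R2_def linear_add linear_cmul)
      have "f s - f 0 = s\<^sup>2 * (H h \<bullet> k) + s * ((R1 - R2) \<bullet> k)"
        unfolding t(3) gd by (simp add: inner_add_left power2_eq_square algebra_simps)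
      moreover have "f s - f 0 = D s h k" by (simp add: f_def D_def)
      ultimately have "\<bar>D s h k - s\<^sup>2 * (H h \<bullet> k)\<bar> = s * \<bar>(R1 - R2) \<bullet> k\<bar>"
        using s by (simp add: abs_mult)
      also have "\<dots> \<le> s * ((2 * (e * (s * (norm h + norm k)))) * norm k)"
      proof (rule mult_left_mono)
        have "\<bar>(R1 - R2) \<bullet> k\<bar> \<le> norm (R1 - R2) * norm k" by (rule Cauchy_Schwarz_ineq2)
        also have "\<dots> \<le> (2 * (e * (s * (norm h + norm k)))) * norm k"
          using norm_triangle_ineq4[of R1 R2] r1 r2 by (intro mult_right_mono) auto
        finally show "\<bar>(R1 - R2) \<bullet> k\<bar> \<le> (2 * (e * (s * (norm h + norm k)))) * norm k" .
      qed (use s in simp)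
      also have "\<dots> = 2 * e * s\<^sup>2 * N h k" by (simp add: N_def power2_eq_square)
      finally show ?thesis .
    qed
    then show ?thesis using s0 by blast
  qed
  define c where "c = N h k + N k h"
  have c: "c \<ge> 0" by (simp add: c_def N_def)
  have "\<bar>H h \<bullet> k - H k \<bullet> h\<bar> \<le> 0 + e" if e: "e > 0" for e
  proof -
    define e' where "e' = e / (2 * (c + 1))"
    have e': "e' > 0" using e c by (simp add: e'_def)
    obtain s1 where s1: "s1 > 0" "\<And>s. 0 < s \<Longrightarrow> s < s1 \<Longrightarrow> \<bar>D s h k - s\<^sup>2 * (H h \<bullet> k)\<bar> \<le> 2 * e' * s\<^sup>2 * N h k"
      using key[OF e', of h k] by blast
    obtain s2 where s2: "s2 > 0" "\<And>s. 0 < s \<Longrightarrow> s < s2 \<Longrightarrow> \<bar>D s k h - s\<^sup>2 * (H k \<bullet> h)\<bar> \<le> 2 * e' * s\<^sup>2 * N k h"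
      using key[OF e', of k h] by blast
    define s where "s = min s1 s2 / 2"
    have s: "0 < s" "s < s1" "s < s2" using s1 s2 by (auto simp: s_def)
    have "D s h k = D s k h" by (simp add: D_def add.assoc add.commute[of "s *\<^sub>R h"])
    then have "\<bar>s\<^sup>2 * (H h \<bullet> k) - s\<^sup>2 * (H k \<bullet> h)\<bar> \<le> 2 * e' * s\<^sup>2 * N h k + 2 * e' * s\<^sup>2 * N k h"
      using s1(2)[OF s(1,2)] s2(2)[OF s(1,3)] by linarith
    moreover have "s\<^sup>2 * (H h \<bullet> k) - s\<^sup>2 * (H k \<bullet> h) = s\<^sup>2 * (H h \<bullet> k - H k \<bullet> h)"
      "2 * e' * s\<^sup>2 * N h k + 2 * e' * s\<^sup>2 * N k h = s\<^sup>2 * (2 * e' * c)" by (simp_all add: c_def algebra_simps)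
    ultimately have "s\<^sup>2 * \<bar>H h \<bullet> k - H k \<bullet> h\<bar> \<le> s\<^sup>2 * (2 * e' * c)" by (simp add: abs_mult)
    then have "\<bar>H h \<bullet> k - H k \<bullet> h\<bar> \<le> 2 * e' * c" using s by simp
    also have "\<dots> \<le> e" using c e by (simp add: e'_def field_simps)
    finally show ?thesis by simp
  qed
  then have "\<bar>H h \<bullet> k - H k \<bullet> h\<bar> \<le> 0" by (rule field_le_epsilon)
  then show ?thesis by simp
qed

lemma jet2_imp_superjet: "jet2 g z p H \<Longrightarrow> superjet g z p H"
  unfolding jet2_def superjet_def
proof (intro allI impI)
  fix e :: real assume *: "\<forall>e>0. \<exists>d>0. \<forall>h. norm h < d \<longrightarrow> \<bar>g (z + h) - g z - p \<bullet> h - h \<bullet> H h / 2\<bar> \<le> e * (norm h)\<^sup>2" and "e > 0"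
  then obtain d where d: "d > 0" "\<And>h. norm h < d \<Longrightarrow> \<bar>g (z + h) - g z - p \<bullet> h - h \<bullet> H h / 2\<bar> \<le> e * (norm h)\<^sup>2"
    by blast
  have "g (z + h) \<le> g z + p \<bullet> h + h \<bullet> H h / 2 + e * (norm h)\<^sup>2" if "norm h < d" for h
    using abs_le_D1[OF d(2)[OF that]] by linarith
  then show "\<exists>d>0. \<forall>h. norm h < d \<longrightarrow> g (z + h) \<le> g z + p \<bullet> h + h \<bullet> H h / 2 + e * (norm h)\<^sup>2"
    using d(1) by blast
qed

lemma superjet_cong:
  assumes "superjet u z p X" "r > 0" "\<And>x. x \<in> ball z r \<Longrightarrow> u x = v x"
  shows "superjet v z p X"
  unfolding superjet_def
proof (intro allI impI)
  fix e :: real assume "e > 0"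
  then obtain d where d: "0 < d" "\<And>h. norm h < d \<Longrightarrow> u (z + h) \<le> u z + p \<bullet> h + h \<bullet> X h / 2 + e * (norm h)\<^sup>2"
    using superjetD[OF assms(1)] by metis
  have "v (z + h) \<le> v z + p \<bullet> h + h \<bullet> X h / 2 + e * (norm h)\<^sup>2" if "norm h < min d r" for h
    using d(2)[of h] assms(3)[of "z + h"] assms(3)[of z] assms(2) that by (simp add: dist_norm)
  then show "\<exists>d>0. \<forall>h. norm h < d \<longrightarrow> v (z + h) \<le> v z + p \<bullet> h + h \<bullet> X h / 2 + e * (norm h)\<^sup>2"
    using assms(2) d(1) by (intro exI[of _ "min d r"]) auto
qed

lemma superjet_le:
  assumes "superjet v z p X" "r > 0" "\<And>x. x \<in> ball z r \<Longrightarrow> u x \<le> v x" "u z = v z"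
  shows "superjet u z p X"
  unfolding superjet_def
proof (intro allI impI)
  fix e :: real assume "e > 0"
  then obtain d where d: "0 < d" "\<And>h. norm h < d \<Longrightarrow> v (z + h) \<le> v z + p \<bullet> h + h \<bullet> X h / 2 + e * (norm h)\<^sup>2"
    using superjetD[OF assms(1)] by metis
  have "u (z + h) \<le> u z + p \<bullet> h + h \<bullet> X h / 2 + e * (norm h)\<^sup>2" if "norm h < min d r" for h
    using d(2)[of h] assms(3)[of "z + h"] assms(4) that by (simp add: dist_norm)
  then show "\<exists>d>0. \<forall>h. norm h < d \<longrightarrow> u (z + h) \<le> u z + p \<bullet> h + h \<bullet> X h / 2 + e * (norm h)\<^sup>2"
    using d(1) assms(2) by (intro exI[of _ "min d r"]) auto
qed

lemma superjet_add_jet2: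
  assumes "superjet u z p X" "jet2 g z q H"
  shows "superjet (\<lambda>x. u x + g x) z (p + q) (\<lambda>h. X h + H h)"
  unfolding superjet_def
proof (intro allI impI)
  fix e :: real assume "e > 0"
  then have e2: "e / 2 > 0" by simp
  obtain d where d: "0 < d" "\<And>h. norm h < d \<Longrightarrow> u (z + h) \<le> u z + p \<bullet> h + h \<bullet> X h / 2 + e / 2 * (norm h)\<^sup>2"
    using superjetD[OF assms(1) e2] by metis
  obtain d' where d': "0 < d'" "\<And>h. norm h < d' \<Longrightarrow> \<bar>g (z + h) - g z - q \<bullet> h - h \<bullet> H h / 2\<bar> \<le> e / 2 * (norm h)\<^sup>2"
    using assms(2) e2 unfolding jet2_def by blast
  have "u (z + h) + g (z + h) \<le> u z + g z + (p + q) \<bullet> h + h \<bullet> (X h + H h) / 2 + e * (norm h)\<^sup>2" if "norm h < min d d'" for h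
  proof -
    define K where "K = e / 2 * (norm h)\<^sup>2"
    have "u (z + h) \<le> u z + p \<bullet> h + h \<bullet> X h / 2 + K" "g (z + h) - g z - q \<bullet> h - h \<bullet> H h / 2 \<le> K"
      using d(2)[of h] abs_le_D1[OF d'(2)[of h]] that unfolding K_def by auto
    moreover have "e * (norm h)\<^sup>2 = 2 * K" by (simp add: K_def)
    ultimately show ?thesis unfolding inner_add_left inner_add_right by argo
  qed
  then show "\<exists>d>0. \<forall>h. norm h < d \<longrightarrow> u (z + h) + g (z + h) \<le> u z + g z + (p + q) \<bullet> h + h \<bullet> (X h + H h) / 2 + e * (norm h)\<^sup>2"
    using d(1) d'(1) by (intro exI[of _ "min d d'"]) auto
qed

lemma superjet_diff_jet2:
  assumes "superjet (\<lambda>x. u x + g x) z p X" "jet2 g z q H"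
  shows "superjet u z (p - q) (\<lambda>h. X h - H h)"
  using superjet_add_jet2[OF assms(1) jet2_uminus[OF assms(2)]] by simp

lemma superjet_cmult:
  assumes u: "superjet u z p (X :: 'a::euclidean_space \<Rightarrow> 'a)" and c: "0 < c"
  shows "superjet (\<lambda>x. c * u x) z (c *\<^sub>R p) (\<lambda>h. c *\<^sub>R X h)"
  unfolding superjet_def
proof (intro allI impI)
  fix e :: real assume "e > 0"
  then have e2: "e / c > 0" using c by simp
  obtain d where d: "0 < d" "\<And>h. norm h < d \<Longrightarrow> u (z + h) \<le> u z + p \<bullet> h + h \<bullet> X h / 2 + e / c * (norm h)\<^sup>2"
    using superjetD[OF u e2] by metis
  have "c * u (z + h) \<le> c * u z + (c *\<^sub>R p) \<bullet> h + h \<bullet> (c *\<^sub>R X h) / 2 + e * (norm h)\<^sup>2" if "norm h < d" for h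
  proof -
    have "c * u (z + h) \<le> c * (u z + p \<bullet> h + h \<bullet> X h / 2 + e / c * (norm h)\<^sup>2)"
      using d(2)[OF that] c by (intro mult_left_mono) auto
    then show ?thesis using c by (simp add: distrib_left)
  qed
  then show "\<exists>d>0. \<forall>h. norm h < d \<longrightarrow> c * u (z + h) \<le> c * u z + (c *\<^sub>R p) \<bullet> h + h \<bullet> (c *\<^sub>R X h) / 2 + e * (norm h)\<^sup>2"
    using d(1) by blast
qed

lemma superjet_rescale:
  assumes u: "superjet (\<lambda>x. u (r *\<^sub>R x)) z p (X :: 'a::euclidean_space \<Rightarrow> 'a)" and r: "0 < r" and lin: "linear X"
  shows "superjet u (r *\<^sub>R z) ((1 / r) *\<^sub>R p) (\<lambda>h. (1 / r\<^sup>2) *\<^sub>R X h)"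
  unfolding superjet_def
proof (intro allI impI)
  fix e :: real assume "e > 0"
  then have e2: "e * r\<^sup>2 > 0" using r by simp
  obtain d where d: "0 < d" "\<And>h. norm h < d \<Longrightarrow> u (r *\<^sub>R (z + h)) \<le> u (r *\<^sub>R z) + p \<bullet> h + h \<bullet> X h / 2 + e * r\<^sup>2 * (norm h)\<^sup>2"
    using superjetD[OF u e2] by metis
  have "u (r *\<^sub>R z + h) \<le> u (r *\<^sub>R z) + ((1 / r) *\<^sub>R p) \<bullet> h + h \<bullet> ((1 / r\<^sup>2) *\<^sub>R X h) / 2 + e * (norm h)\<^sup>2" if h: "norm h < r * d" for h
  proof -
    have "norm ((1 / r) *\<^sub>R h) < d" using h r by (simp add: field_simps)
    from d(2)[OF this] show ?thesis
      using r linear_cmul[OF lin, of "1 / r" h] by (simp add: scaleR_right_distrib power2_eq_square divide_simps)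
  qed
  then show "\<exists>d>0. \<forall>h. norm h < d \<longrightarrow> u (r *\<^sub>R z + h) \<le> u (r *\<^sub>R z) + ((1 / r) *\<^sub>R p) \<bullet> h + h \<bullet> ((1 / r\<^sup>2) *\<^sub>R X h) / 2 + e * (norm h)\<^sup>2"
    using d(1) r by (intro exI[of _ "r * d"]) auto
qed

lemma jet2_affine: "jet2 (\<lambda>x. c + p \<bullet> x) z p (\<lambda>h. 0)"
proof -
  have "c + p \<bullet> (z + h) - (c + p \<bullet> z) - p \<bullet> h - h \<bullet> 0 / 2 = 0" for h by (simp add: inner_add_right)
  then show ?thesis unfolding jet2_def by (auto intro!: exI[of _ 1])
qed

lemma jet2_norm_square: "jet2 (\<lambda>x. c * (norm (x - y))\<^sup>2) z ((2 * c) *\<^sub>R (z - y)) (\<lambda>h. (2 * c) *\<^sub>R h)"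
proof -
  have "c * (norm (z + h - y))\<^sup>2 - c * (norm (z - y))\<^sup>2 - ((2 * c) *\<^sub>R (z - y)) \<bullet> h - h \<bullet> ((2 * c) *\<^sub>R h) / 2 = 0" for h
    unfolding power2_norm_eq_inner by (simp add: inner_commute algebra_simps)
  then show ?thesis unfolding jet2_def by (auto intro!: exI[of _ 1])
qed

subsection \<open>Uniformly elliptic operators\<close>

lemma sym_matrix_iff: "sym_matrix (M :: real^'n^'n) \<longleftrightarrow> (\<forall>i j. M $ i $ j = M $ j $ i)"
  unfolding sym_matrix_def transpose_def vec_eq_iff vec_lambda_beta by metis

lemma sym_matrix_ops [simp, intro]:
  fixes M N :: "real^'n^'n"
  shows "sym_matrix M \<Longrightarrow> sym_matrix N \<Longrightarrow> sym_matrix (M + N)"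
    "sym_matrix M \<Longrightarrow> sym_matrix N \<Longrightarrow> sym_matrix (M - N)"
    "sym_matrix M \<Longrightarrow> sym_matrix (c *\<^sub>R M)"
    "sym_matrix M \<Longrightarrow> sym_matrix (- M)"
    "sym_matrix (mat c :: real^'n^'n)" "sym_matrix (0 :: real^'n^'n)"
proof -
  have "transpose (M + N) = transpose M + transpose N" "transpose (M - N) = transpose M - transpose N"
    "transpose (c *\<^sub>R M) = c *\<^sub>R transpose M" "transpose (- M) = - transpose M" "transpose (0 :: real^'n^'n) = 0"
    by (simp_all add: transpose_def vec_eq_iff)
  then show "sym_matrix M \<Longrightarrow> sym_matrix N \<Longrightarrow> sym_matrix (M + N)"
    "sym_matrix M \<Longrightarrow> sym_matrix N \<Longrightarrow> sym_matrix (M - N)"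
    "sym_matrix M \<Longrightarrow> sym_matrix (c *\<^sub>R M)"
    "sym_matrix M \<Longrightarrow> sym_matrix (- M)"
    "sym_matrix (mat c :: real^'n^'n)" "sym_matrix (0 :: real^'n^'n)"
    by (simp_all add: sym_matrix_def transpose_mat)
qed

lemma sym_matrix_inner: "sym_matrix (M :: real^'n^'n) \<Longrightarrow> x \<bullet> (M *v y) = (M *v x) \<bullet> y"
  unfolding sym_matrix_def by (metis dot_lmul_matrix transpose_matrix_vector)

lemma sym_matrixI:
  assumes "\<And>x y. x \<bullet> (M *v y) = (M *v x) \<bullet> (y :: real^'n)"
  shows "sym_matrix M"
proof -
  have "M $ i $ j = M $ j $ i" for i j
    using assms[of "axis i 1" "axis j 1"]
    by (simp add: matrix_vector_mult_basis column_def inner_axis' inner_axis)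
  then show ?thesis by (simp add: sym_matrix_iff)
qed

lemma uminus_matrix_vector: "(- M) *v x = - (M *v (x :: real^'n))" for M :: "real^'n^'n"
  by (simp add: vec_eq_iff matrix_vector_mult_def sum_negf)

lemmas mv_simps = matrix_vector_mult_add_rdistrib matrix_vector_mult_diff_rdistrib uminus_matrix_vector
  scaleR_matrix_vector_assoc[symmetric] matrix_vector_mul_lid

lemma trace_scaleR: "trace (c *\<^sub>R M) = c * trace (M :: real^'n^'n)"
  by (simp add: trace_def sum_distrib_left)

lemma trace_mat1: "trace (c *\<^sub>R mat 1 :: real^'n^'n) = real CARD('n) * c"
  by (simp add: trace_scaleR trace_I)

text \<open>Semidefiniteness on the plane of two axes bounds each off-diagonal product by the
  corresponding diagonal entries. Summing over all pairs gives the factor \<open>CARD('n)\<close>,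
  which is crude but avoids eigenvalues.\<close>

lemma psd_form_le_trace:
  fixes N :: "real^'n^'n"
  assumes s: "sym_matrix N" and psd: "nonneg_definite N" and x: "norm x = 1"
  shows "x \<bullet> (N *v x) \<le> real CARD('n) * trace N"
proof -
  have entry: "axis i 1 \<bullet> (N *v axis j 1) = N $ i $ j" for i j
    by (simp add: matrix_vector_mult_basis column_def inner_axis')
  have diag: "0 \<le> N $ i $ i" for i
    using psd entry[of i i] unfolding nonneg_definite_def by metis
  have xi: "(x $ i)\<^sup>2 \<le> 1" for i
    using component_le_norm_cart[of x i] x by (simp add: abs_square_le_1)
  have off: "2 * (x $ i * x $ j * N $ i $ j) \<le> (x $ i)\<^sup>2 * N $ i $ i + (x $ j)\<^sup>2 * N $ j $ j" for i j
  proof -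
    define v :: "real^'n" where "v = x $ i *\<^sub>R axis i 1 - x $ j *\<^sub>R axis j 1"
    have "0 \<le> v \<bullet> (N *v v)" using psd by (simp add: nonneg_definite_def)
    also have "v \<bullet> (N *v v) = (x $ i)\<^sup>2 * N $ i $ i + (x $ j)\<^sup>2 * N $ j $ j - 2 * (x $ i * x $ j * N $ i $ j)"
      using s unfolding v_def
      by (simp add: matrix_vector_mult_diff_distrib matrix_vector_mult_scaleR inner_diff_left inner_diff_right entry
          sym_matrix_iff power2_eq_square algebra_simps)
    finally show ?thesis by simp
  qed
  have "2 * (x \<bullet> (N *v x)) = (\<Sum>i\<in>UNIV. \<Sum>j\<in>UNIV. 2 * (x $ i * x $ j * N $ i $ j))"
    by (simp add: inner_vec_def matrix_vector_mult_def sum_distrib_left mult_ac)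
  also have "\<dots> \<le> (\<Sum>i\<in>UNIV. \<Sum>j\<in>UNIV. (x $ i)\<^sup>2 * N $ i $ i + (x $ j)\<^sup>2 * N $ j $ j)"
    by (intro sum_mono off)
  also have "\<dots> \<le> (\<Sum>i\<in>(UNIV::'n set). \<Sum>j\<in>(UNIV::'n set). N $ i $ i + N $ j $ j)"
    using xi diag by (intro sum_mono add_mono mult_left_le_one_le) auto
  also have "\<dots> = 2 * (real CARD('n) * trace N)"
  proof -
    have "(\<Sum>i\<in>(UNIV::'n set). \<Sum>j\<in>(UNIV::'n set). N $ i $ i) = real CARD('n) * trace N"
      by (simp add: trace_def sum_distrib_left)
    moreover have "(\<Sum>i\<in>(UNIV::'n set). \<Sum>j\<in>(UNIV::'n set). N $ j $ j) = real CARD('n) * trace N"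
      by (simp add: trace_def)
    ultimately show ?thesis by (simp add: sum.distrib)
  qed
  finally show ?thesis by simp
qed

lemma trace_nonneg: "nonneg_definite N \<Longrightarrow> 0 \<le> trace (N :: real^'n^'n)"
proof -
  assume "nonneg_definite N"
  then have "0 \<le> axis i 1 \<bullet> (N *v axis i 1)" for i by (simp add: nonneg_definite_def)
  then show ?thesis unfolding trace_def
    by (intro sum_nonneg) (simp add: matrix_vector_mult_basis column_def inner_axis')
qed

definition outer :: "real^'n \<Rightarrow> real^'n^'n" where
  "outer d = (\<chi> i j. d $ i * d $ j)"

lemma outer: "sym_matrix (outer d)" "outer d *v h = (d \<bullet> h) *\<^sub>R d" "trace (outer d) = (norm d)\<^sup>2" "nonneg_definite (outer d)"
proof -
  show "sym_matrix (outer d)" by (simp add: outer_def sym_matrix_iff)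
  show *: "outer d *v h = (d \<bullet> h) *\<^sub>R d" for h
    by (simp add: outer_def vec_eq_iff matrix_vector_mult_def inner_vec_def sum_distrib_left sum_distrib_right mult_ac)
  show "trace (outer d) = (norm d)\<^sup>2"
    by (simp add: outer_def trace_def power2_norm_eq_inner inner_vec_def)
  show "nonneg_definite (outer d)" by (simp add: nonneg_definite_def * inner_commute)
qed

lemma symmetric_part:
  fixes X :: "real^'n \<Rightarrow> real^'n"
  assumes "linear X"
  obtains S where "sym_matrix S" "\<And>h. h \<bullet> (S *v h) = h \<bullet> X h"
proof -
  define S where "S = (1/2) *\<^sub>R (matrix X + transpose (matrix X))"
  have "sym_matrix S" by (simp add: S_def sym_matrix_iff transpose_def)
  moreover have "h \<bullet> (S *v h) = h \<bullet> X h" for h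
  proof -
    have "h \<bullet> (transpose (matrix X) *v h) = h \<bullet> (matrix X *v h)"
      by (metis dot_lmul_matrix inner_commute transpose_matrix_vector)
    then show ?thesis using fun_cong[OF matrix_vector_mul(2)[OF assms]]
      by (simp add: S_def mv_simps inner_add_right assms)
  qed
  ultimately show thesis using that by blast
qed

lemma superjet_form_cong:
  assumes "superjet u z p X" "\<And>h. h \<bullet> Y h = h \<bullet> X h"
  shows "superjet u z p Y"
  using assms unfolding superjet_def by simp

section \<open>Viscosity inequalities in superjet form and their invariances\<close>

definition jet_sub :: "(real^'n^'n \<Rightarrow> real) \<Rightarrow> (real^'n) set \<Rightarrow> (real^'n \<Rightarrow> real) \<Rightarrow> bool" where
  "jet_sub F \<Omega> u \<longleftrightarrow> (\<forall>z\<in>\<Omega>. \<forall>p X. sym_matrix X \<longrightarrow> superjet u z p ((*v) X) \<longrightarrow> F X \<le> 0)"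

text \<open>The supersolution half is phrased as the subsolution property of \<open>- u\<close> for
  the dual operator, so that a statement about subsolutions, used once for each operator, covers
  both halves.\<close>

definition jet_sol :: "(real^'n^'n \<Rightarrow> real) \<Rightarrow> (real^'n) set \<Rightarrow> (real^'n \<Rightarrow> real) \<Rightarrow> bool" where
  "jet_sol F \<Omega> u \<longleftrightarrow> jet_sub F \<Omega> u \<and> jet_sub (dual_operator F) \<Omega> (\<lambda>x. - u x)"

lemma jet_subD: "jet_sub F \<Omega> u \<Longrightarrow> z \<in> \<Omega> \<Longrightarrow> sym_matrix X \<Longrightarrow> superjet u z p ((*v) X) \<Longrightarrow> F X \<le> 0"
  unfolding jet_sub_def by blast

lemma jet_sub_subset: "jet_sub F \<Omega> u \<Longrightarrow> \<Omega>' \<subseteq> \<Omega> \<Longrightarrow> jet_sub F \<Omega>' u"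
  unfolding jet_sub_def by blast

lemma jet_sol_subset: "jet_sol F \<Omega> u \<Longrightarrow> \<Omega>' \<subseteq> \<Omega> \<Longrightarrow> jet_sol F \<Omega>' u"
  unfolding jet_sol_def using jet_sub_subset by blast

lemma dual_dual [simp]: "dual_operator (dual_operator F) = F"
  by (simp add: dual_operator_def fun_eq_iff)

lemma jet_sol_dual: "jet_sol F \<Omega> u \<Longrightarrow> jet_sol (dual_operator F) \<Omega> (\<lambda>x. - u x)"
  unfolding jet_sol_def by simp

lemma jet_sub_add_affine:
  assumes "jet_sub F \<Omega> u"
  shows "jet_sub F \<Omega> (\<lambda>x. u x + (c + p \<bullet> x))"
  unfolding jet_sub_def
proof (intro ballI allI impI)
  fix z q X assume z: "z \<in> \<Omega>" "sym_matrix X" "superjet (\<lambda>x. u x + (c + p \<bullet> x)) z q ((*v) X)"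
  have "superjet u z (q - p) ((*v) X)" using superjet_diff_jet2[OF z(3) jet2_affine] by simp
  then show "F X \<le> 0" using jet_subD[OF assms z(1,2)] by blast
qed

lemma jet_sol_add_affine:
  assumes "jet_sol F \<Omega> u"
  shows "jet_sol F \<Omega> (\<lambda>x. u x + (c + p \<bullet> x))"
  using jet_sub_add_affine[of F \<Omega> u c p] jet_sub_add_affine[of "dual_operator F" \<Omega> "\<lambda>x. - u x" "- c" "- p"] assms
  unfolding jet_sol_def by (simp add: algebra_simps)

lemma jet_sol_add_const: "jet_sol F \<Omega> u \<Longrightarrow> jet_sol F \<Omega> (\<lambda>x. u x + c)"
  using jet_sol_add_affine[of F \<Omega> u c 0] by simp

lemma jet2_quadratic:
  assumes "sym_matrix X"
  shows "jet2 (\<lambda>x. p \<bullet> (x - z) + (x - z) \<bullet> (X *v (x - z)) / 2) y (p + X *v (y - z)) ((*v) X)"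
proof -
  have "p \<bullet> (y + h - z) + (y + h - z) \<bullet> (X *v (y + h - z)) / 2 - (p \<bullet> (y - z) + (y - z) \<bullet> (X *v (y - z)) / 2)
      - (p + X *v (y - z)) \<bullet> h - h \<bullet> (X *v h) / 2 = 0" for h
  proof -
    have e: "y + h - z = (y - z) + h" by simp
    have E: "(y - z + h) \<bullet> (X *v (y - z + h)) = (y - z) \<bullet> (X *v (y - z)) + 2 * ((X *v (y - z)) \<bullet> h) + h \<bullet> (X *v h)"
      using sym_matrix_inner[OF assms, of "y - z" h] unfolding matrix_vector_right_distrib
      by (simp add: inner_add_left inner_add_right inner_commute)
    show ?thesis unfolding e E by (simp add: inner_add_left inner_add_right add_divide_distrib)
  qed
  then show ?thesis unfolding jet2_def by (simp only: abs_zero) (auto intro!: exI[of _ 1])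
qed

locale elliptic_operator =
  fixes F :: "real^'n^'n \<Rightarrow> real" and lam Lam :: real
  assumes lam: "0 < lam" "lam \<le> Lam" and ell: "uniformly_elliptic lam Lam F" and hom: "positively_homogeneous F"
begin

lemma Lam_pos: "0 < Lam" using lam by simp

lemma dual: "elliptic_operator (dual_operator F) lam Lam"
proof
  show "uniformly_elliptic lam Lam (dual_operator F)"
    unfolding uniformly_elliptic_def dual_operator_def
  proof (intro allI impI)
    fix M N :: "real^'n^'n" assume *: "sym_matrix M" "sym_matrix N" "nonneg_definite N"
    have "sym_matrix (N - M)" using * by auto
    then have "lam * trace N \<le> F (N - M - N) - F (N - M) \<and> F (N - M - N) - F (N - M) \<le> Lam * trace N"
      using ell *(2,3) unfolding uniformly_elliptic_def by blast
    moreover have "N - M - N = - M" "- (M - N) = N - M" by simp_all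
    ultimately show "lam * trace N \<le> - F (- (M - N)) - - F (- M) \<and> - F (- (M - N)) - - F (- M) \<le> Lam * trace N"
      by simp
  qed
  show "positively_homogeneous (dual_operator F)"
    unfolding positively_homogeneous_def dual_operator_def
  proof (intro allI impI)
    fix t :: real and M :: "real^'n^'n" assume "0 \<le> t" "sym_matrix M"
    then have "F (t *\<^sub>R (- M)) = t * F (- M)" using hom unfolding positively_homogeneous_def by blast
    then show "- F (- (t *\<^sub>R M)) = t * - F (- M)" by simp
  qed
qed (use lam in auto)

lemma add_psd:
  assumes "sym_matrix M" "sym_matrix N" "nonneg_definite N"
  shows "F (M + N) \<le> F M - lam * trace N" "F M \<le> F (M + N) + Lam * trace N"
proof -
  have "lam * trace N \<le> F (M + N - N) - F (M + N) \<and> F (M + N - N) - F (M + N) \<le> Lam * trace N"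
    using ell assms unfolding uniformly_elliptic_def by blast
  then show "F (M + N) \<le> F M - lam * trace N" "F M \<le> F (M + N) + Lam * trace N" by auto
qed

lemma F_scaleR: "0 \<le> t \<Longrightarrow> sym_matrix M \<Longrightarrow> F (t *\<^sub>R M) = t * F M"
  using hom unfolding positively_homogeneous_def by blast

lemma F_zero: "F 0 = 0"
  using F_scaleR[of 0 0] by simp

text \<open>The matrix \<open>N = Y + I - X\<close> is nonnegative definite, and the gap in the
  direction \<open>x\<close> forces its trace to be at least \<open>k / real CARD('n)\<close>;
  ellipticity converts this trace into a decrease of \<open>F\<close>.\<close>

lemma compare_forms_gap:
  assumes s: "sym_matrix X" "sym_matrix Y" and c: "0 \<le> c"
    and le: "\<And>h. h \<bullet> (X *v h) \<le> h \<bullet> (Y *v h) + c * (norm h)\<^sup>2"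
    and gap: "norm x = 1" "x \<bullet> (X *v x) \<le> x \<bullet> (Y *v x) - k"
  shows "F Y \<le> F X + Lam * (real CARD('n) * c) - lam * (k / real CARD('n))"
proof -
  define I where "I = (c *\<^sub>R mat 1 :: real^'n^'n)"
  define N where "N = Y + I - X"
  have sI: "sym_matrix I" "nonneg_definite I" using c by (auto simp: I_def nonneg_definite_def mv_simps)
  have form: "h \<bullet> (N *v h) = h \<bullet> (Y *v h) + c * (norm h)\<^sup>2 - h \<bullet> (X *v h)" for h
    by (simp add: N_def I_def mv_simps inner_add_right inner_diff_right power2_norm_eq_inner)
  have sN: "sym_matrix N" "nonneg_definite N"
    using s sI le by (auto simp: N_def nonneg_definite_def form[unfolded N_def])
  have "k \<le> x \<bullet> (N *v x)" using form[of x] gap c by simp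
  also have "\<dots> \<le> real CARD('n) * trace N" by (rule psd_form_le_trace[OF sN gap(1)])
  finally have "k / real CARD('n) \<le> trace N" by (simp add: pos_divide_le_eq mult.commute)
  then have "lam * (k / real CARD('n)) \<le> lam * trace N" using lam by (intro mult_left_mono) auto
  moreover have "F Y \<le> F (Y + I) + Lam * trace I" using add_psd(2)[OF s(2) sI] .
  moreover have "F (X + N) \<le> F X - lam * trace N" using add_psd(1)[OF s(1) sN] .
  moreover have "X + N = Y + I" by (simp add: N_def)
  ultimately show ?thesis by (simp add: I_def trace_mat1)
qed

lemma compare_forms:
  assumes s: "sym_matrix X" "sym_matrix Y" and c: "0 \<le> c"
    and le: "\<And>h. h \<bullet> (X *v h) \<le> h \<bullet> (Y *v h) + c * (norm h)\<^sup>2"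
  shows "F Y \<le> F X + Lam * (real CARD('n) * c)"
proof -
  define I where "I = (c *\<^sub>R mat 1 :: real^'n^'n)"
  define N where "N = Y + I - X"
  have sI: "sym_matrix I" "nonneg_definite I" using c by (auto simp: I_def nonneg_definite_def mv_simps)
  have form: "h \<bullet> (N *v h) = h \<bullet> (Y *v h) + c * (norm h)\<^sup>2 - h \<bullet> (X *v h)" for h
    by (simp add: N_def I_def mv_simps inner_add_right inner_diff_right power2_norm_eq_inner)
  have sN: "sym_matrix N" "nonneg_definite N"
    using s sI le by (auto simp: N_def nonneg_definite_def form[unfolded N_def])
  have "0 \<le> lam * trace N" using lam trace_nonneg[OF sN(2)] by simp
  moreover have "F Y \<le> F (Y + I) + Lam * trace I" using add_psd(2)[OF s(2) sI] .
  moreover have "F (X + N) \<le> F X - lam * trace N" using add_psd(1)[OF s(1) sN] .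
  moreover have "X + N = Y + I" by (simp add: N_def)
  ultimately show ?thesis by (simp add: I_def trace_mat1)
qed

lemma nonpos_of_perturbation:
  assumes X: "sym_matrix X" and le: "\<And>e. e > 0 \<Longrightarrow> F (X + e *\<^sub>R mat 1) \<le> 0"
  shows "F X \<le> 0"
proof (rule field_le_epsilon)
  fix e :: real assume e: "e > 0"
  define e' where "e' = e / (Lam * real CARD('n))"
  have e': "e' > 0" using e Lam_pos by (simp add: e'_def)
  have "F X \<le> F (X + e' *\<^sub>R mat 1) + Lam * (real CARD('n) * e')"
    using X e' by (intro compare_forms) (auto simp: mv_simps inner_add_right power2_norm_eq_inner)
  moreover have "Lam * (real CARD('n) * e') = e" using Lam_pos by (simp add: e'_def)
  ultimately show "F X \<le> 0 + e" using le[OF e'] by simp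
qed

text \<open>A superjet dominates \<open>u\<close> only up to a small quadratic error. Adding
  \<open>e\<close> times the identity to the matrix absorbs this error and gives a quadratic test
  function; the continuity of \<open>F\<close> removes \<open>e\<close> again.\<close>

lemma jet_sub_of_visc:
  assumes o: "open \<Omega>" and u: "visc_subsolution F \<Omega> u"
  shows "jet_sub F \<Omega> u"
  unfolding jet_sub_def
proof (intro ballI allI impI)
  fix z p and X :: "real^'n^'n" assume z: "z \<in> \<Omega>" and X: "sym_matrix X" and j: "superjet u z p ((*v) X)"
  obtain r where r: "r > 0" "ball z r \<subseteq> \<Omega>" using openE[OF o z] by blast
  show "F X \<le> 0"
  proof (rule nonpos_of_perturbation[OF X])
    fix e :: real assume e: "e > 0"
    define X' where "X' = X + e *\<^sub>R mat 1"
    have X': "sym_matrix X'" using X by (auto simp: X'_def)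
    have "e / 2 > 0" using e by simp
    then obtain d where d: "0 < d" "\<And>h. norm h < d \<Longrightarrow> u (z + h) \<le> u z + p \<bullet> h + h \<bullet> (X *v h) / 2 + e / 2 * (norm h)\<^sup>2"
      using superjetD[OF j] by metis
    define A where "A = ball z (min d r)"
    define \<phi> where "\<phi> x = p \<bullet> (x - z) + (x - z) \<bullet> (X' *v (x - z)) / 2" for x
    have "C2_with_hessian A \<phi> (\<lambda>_. X')"
      unfolding C2_with_hessian_def
    proof (intro conjI exI[of _ "\<lambda>x. p + X' *v (x - z)"] ballI continuous_on_const)
      fix x
      show "(\<phi> has_derivative (\<lambda>h. (p + X' *v (x - z)) \<bullet> h)) (at x)"
        unfolding \<phi>_def using sym_matrix_inner[OF X', of "x - z"]
        by (auto intro!: derivative_eq_intros bounded_linear.has_derivative[OF matrix_vector_mul_bounded_linear]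
            simp: inner_add_left inner_add_right inner_commute)
      show "((\<lambda>x. p + X' *v (x - z)) has_derivative ((*v) X')) (at x)"
        by (auto intro!: derivative_eq_intros bounded_linear.has_derivative[OF matrix_vector_mul_bounded_linear])
    qed
    moreover have "u y - \<phi> y \<le> u z - \<phi> z" if "y \<in> A" for y
    proof -
      have "norm (y - z) < d" using that by (simp add: A_def dist_norm norm_minus_commute)
      then show ?thesis using d(2)[of "y - z"]
        by (simp add: \<phi>_def X'_def mv_simps inner_add_right power2_norm_eq_inner add_divide_distrib)
    qed
    moreover have "open A" "A \<subseteq> \<Omega>" "z \<in> A" using r d by (auto simp: A_def)
    ultimately show "F (X + e *\<^sub>R mat 1) \<le> 0" using u unfolding visc_subsolution_def X'_def by blast
  qed
qed

end

lemma superjet_of_test: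
  assumes C2: "C2_with_hessian A \<phi> H" and A: "open A" "z \<in> A" and le: "\<And>y. y \<in> A \<Longrightarrow> u y - \<phi> y \<le> u z - \<phi> z"
  obtains p where "superjet u z p ((*v) (H z))" "sym_matrix (H z)"
proof -
  obtain g where g: "\<And>x. x \<in> A \<Longrightarrow> (\<phi> has_derivative (\<lambda>h. g x \<bullet> h)) (at x)"
    "\<And>x. x \<in> A \<Longrightarrow> (g has_derivative (\<lambda>h. H x *v h)) (at x)"
    using C2 unfolding C2_with_hessian_def by blast
  obtain r where r: "r > 0" "ball z r \<subseteq> A" using openE[OF A] by blast
  have j: "jet2 \<phi> z (g z) ((*v) (H z))"
    using g r A by (intro jet2_of_derivatives[of r]) auto
  have "(H z *v h) \<bullet> k = (H z *v k) \<bullet> h" for h k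
    using g r A by (intro second_derivative_symmetric[of r z \<phi> g]) auto
  then have "sym_matrix (H z)" by (intro sym_matrixI) (metis inner_commute)
  moreover have "superjet (\<lambda>x. \<phi> x + (u z - \<phi> z)) z (g z) ((*v) (H z))"
    using superjet_add_jet2[OF jet2_imp_superjet[OF j] jet2_affine[of "u z - \<phi> z" 0 z]] by simp
  then have "superjet u z (g z) ((*v) (H z))"
    by (rule superjet_le[OF _ r(1)]) (use le r in \<open>auto simp: algebra_simps subset_iff\<close>)
  ultimately show thesis using that by blast
qed

lemma visc_of_jet_sub: "jet_sub F \<Omega> u \<Longrightarrow> visc_subsolution F \<Omega> u"
  unfolding visc_subsolution_def
proof (intro allI impI)
  fix A z \<phi> H assume u: "jet_sub F \<Omega> u" and A: "open A" "A \<subseteq> \<Omega>" "z \<in> A" "C2_with_hessian A \<phi> H" "\<forall>y\<in>A. u y - \<phi> y \<le> u z - \<phi> z"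
  obtain p where "superjet u z p ((*v) (H z))" "sym_matrix (H z)"
    using superjet_of_test[OF A(4,1,3), of u] A(5) by blast
  then show "F (H z) \<le> 0" using jet_subD[OF u] A by blast
qed

lemma C2_uminus: "C2_with_hessian A \<phi> H \<Longrightarrow> C2_with_hessian A (\<lambda>x. - \<phi> x) (\<lambda>x. - H x)"
  unfolding C2_with_hessian_def
proof (elim conjE exE, intro conjI)
  fix g assume g: "\<forall>x\<in>A. (\<phi> has_derivative (\<lambda>h. g x \<bullet> h)) (at x)" "\<forall>x\<in>A. (g has_derivative (\<lambda>h. H x *v h)) (at x)"
  show "\<exists>g. (\<forall>x\<in>A. ((\<lambda>x. - \<phi> x) has_derivative (\<lambda>h. g x \<bullet> h)) (at x)) \<and> (\<forall>x\<in>A. (g has_derivative (\<lambda>h. (- H x) *v h)) (at x))"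
    using g by (intro exI[of _ "\<lambda>x. - g x"]) (auto simp: uminus_matrix_vector intro!: has_derivative_minus)
qed (intro continuous_on_minus)

lemma visc_super_iff_dual: "visc_supersolution F \<Omega> u \<longleftrightarrow> visc_subsolution (dual_operator F) \<Omega> (\<lambda>x. - u x)"
proof
  assume u: "visc_supersolution F \<Omega> u"
  show "visc_subsolution (dual_operator F) \<Omega> (\<lambda>x. - u x)"
    unfolding visc_subsolution_def
  proof (intro allI impI)
    fix A z \<phi> H assume A: "open A" "A \<subseteq> \<Omega>" "z \<in> A" "C2_with_hessian A \<phi> H" "\<forall>y\<in>A. - u y - \<phi> y \<le> - u z - \<phi> z"
    have "\<forall>y\<in>A. u z - - \<phi> z \<le> u y - - \<phi> y" using A(5) by (simp add: algebra_simps)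
    then have "0 \<le> F (- H z)" using u C2_uminus[OF A(4)] A(1-3) unfolding visc_supersolution_def by blast
    then show "dual_operator F (H z) \<le> 0" by (simp add: dual_operator_def)
  qed
next
  assume u: "visc_subsolution (dual_operator F) \<Omega> (\<lambda>x. - u x)"
  show "visc_supersolution F \<Omega> u"
    unfolding visc_supersolution_def
  proof (intro allI impI)
    fix A z \<phi> H assume A: "open A" "A \<subseteq> \<Omega>" "z \<in> A" "C2_with_hessian A \<phi> H" "\<forall>y\<in>A. u z - \<phi> z \<le> u y - \<phi> y"
    have "\<forall>y\<in>A. - u y - - \<phi> y \<le> - u z - - \<phi> z" using A(5) by (simp add: algebra_simps)
    then have "dual_operator F (- H z) \<le> 0" using u C2_uminus[OF A(4)] A(1-3) unfolding visc_subsolution_def by blast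
    then show "0 \<le> F (H z)" by (simp add: dual_operator_def)
  qed
qed

lemma visc_of_jet_sol: "jet_sol F \<Omega> u \<Longrightarrow> visc_solution F \<Omega> u"
  unfolding jet_sol_def visc_solution_def visc_super_iff_dual by (auto intro: visc_of_jet_sub)

context elliptic_operator
begin

lemma jet_sol_of_visc: "open \<Omega> \<Longrightarrow> visc_solution F \<Omega> u \<Longrightarrow> jet_sol F \<Omega> u"
  unfolding jet_sol_def visc_solution_def visc_super_iff_dual
  by (auto intro: jet_sub_of_visc elliptic_operator.jet_sub_of_visc[OF dual])

lemma jet_sub_const: "jet_sub F \<Omega> (\<lambda>_. c)"
  unfolding jet_sub_def
proof (intro ballI allI impI)
  fix z p and X :: "real^'n^'n" assume X: "sym_matrix X" and j: "superjet (\<lambda>_. c) z p ((*v) X)"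
  show "F X \<le> 0"
  proof (rule nonpos_of_perturbation[OF X])
    fix e :: real assume e: "e > 0"
    then have "e / 2 > 0" by simp
    then obtain d where d: "0 < d" "\<And>h. norm h < d \<Longrightarrow> c \<le> c + p \<bullet> h + h \<bullet> (X *v h) / 2 + e / 2 * (norm h)\<^sup>2"
      using superjetD[OF j] by metis
    have "0 \<le> h \<bullet> ((X + e *\<^sub>R mat 1) *v h)" for h
    proof (cases "h = 0")
      case False
      define t where "t = d / 2 / norm h"
      have t: "t > 0" "norm (t *\<^sub>R h) < d" "norm ((- t) *\<^sub>R h) < d" using False d(1) by (auto simp: t_def)
      have n2: "(norm (t *\<^sub>R h))\<^sup>2 = t\<^sup>2 * (h \<bullet> h)"
        by (simp add: power_mult_distrib power2_norm_eq_inner)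
      \<comment> \<open>The expansions for \<open>t *\<^sub>R h\<close> and for its negative are
        added, which cancels \<open>p\<close>.\<close>
      have "0 \<le> (t *\<^sub>R h) \<bullet> (X *v (t *\<^sub>R h)) + e * (norm (t *\<^sub>R h))\<^sup>2"
        using d(2)[OF t(2)] d(2)[OF t(3)] by (simp add: matrix_vector_mult_scaleR del: scaleR_minus_left)
      also have "\<dots> = t\<^sup>2 * (h \<bullet> ((X + e *\<^sub>R mat 1) *v h))"
        unfolding n2 by (simp add: matrix_vector_mult_scaleR mv_simps inner_add_right power2_eq_square algebra_simps)
      finally show ?thesis using t by (simp add: zero_le_mult_iff)
    qed simp
    then have "nonneg_definite (X + e *\<^sub>R mat 1)" by (simp add: nonneg_definite_def)
    then have "F (0 + (X + e *\<^sub>R mat 1)) \<le> F 0 - lam * trace (X + e *\<^sub>R mat 1)"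
      using X by (intro add_psd) auto
    moreover have "0 \<le> lam * trace (X + e *\<^sub>R mat 1)"
      using lam trace_nonneg[OF \<open>nonneg_definite (X + e *\<^sub>R mat 1)\<close>] by simp
    ultimately show "F (X + e *\<^sub>R mat 1) \<le> 0" using F_zero by simp
  qed
qed

lemma jet_sol_const: "jet_sol F \<Omega> (\<lambda>_. c)"
  unfolding jet_sol_def using jet_sub_const elliptic_operator.jet_sub_const[OF dual] by simp

lemma jet_sub_cmult:
  assumes u: "jet_sub F \<Omega> u" and c: "0 \<le> c"
  shows "jet_sub F \<Omega> (\<lambda>x. c * u x)"
proof (cases "c = 0")
  case False
  then have c: "c > 0" using c by simp
  show ?thesis unfolding jet_sub_def
  proof (intro ballI allI impI)
    fix z p and X :: "real^'n^'n" assume z: "z \<in> \<Omega>" and X: "sym_matrix X" and j: "superjet (\<lambda>x. c * u x) z p ((*v) X)"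
    have "superjet u z ((1 / c) *\<^sub>R p) ((*v) ((1 / c) *\<^sub>R X))"
    proof (rule superjet_form_cong)
      show "superjet u z ((1 / c) *\<^sub>R p) (\<lambda>h. (1 / c) *\<^sub>R (X *v h))"
        using superjet_cmult[OF j, of "1 / c"] c by simp
    qed (simp add: mv_simps)
    then have "F ((1 / c) *\<^sub>R X) \<le> 0" using jet_subD[OF u z] X by blast
    then show "F X \<le> 0" using F_scaleR[of "1 / c" X] c X by (simp add: divide_le_0_iff)
  qed
qed (use jet_sub_const in simp)

lemma jet_sol_cmult: "jet_sol F \<Omega> u \<Longrightarrow> 0 \<le> c \<Longrightarrow> jet_sol F \<Omega> (\<lambda>x. c * u x)"
  unfolding jet_sol_def using jet_sub_cmult elliptic_operator.jet_sub_cmult[OF dual, of \<Omega> "\<lambda>x. - u x" c] by simp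

lemma jet_sub_rescale:
  assumes u: "jet_sub F \<Omega> u" and r: "0 < r" and sub: "\<And>x. x \<in> \<Omega>' \<Longrightarrow> r *\<^sub>R x \<in> \<Omega>"
  shows "jet_sub F \<Omega>' (\<lambda>x. u (r *\<^sub>R x))"
  unfolding jet_sub_def
proof (intro ballI allI impI)
  fix z p and X :: "real^'n^'n" assume z: "z \<in> \<Omega>'" and X: "sym_matrix X" and j: "superjet (\<lambda>x. u (r *\<^sub>R x)) z p ((*v) X)"
  have "superjet u (r *\<^sub>R z) ((1 / r) *\<^sub>R p) ((*v) ((1 / r\<^sup>2) *\<^sub>R X))"
    by (rule superjet_form_cong[OF superjet_rescale[OF j r]]) (simp_all add: mv_simps)
  then have "F ((1 / r\<^sup>2) *\<^sub>R X) \<le> 0" using jet_subD[OF u sub[OF z]] X by blast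
  then show "F X \<le> 0" using F_scaleR[of "1 / r\<^sup>2" X] r X by (simp add: divide_le_0_iff)
qed

lemma jet_sol_rescale:
  assumes "jet_sol F \<Omega> u" "0 < r" "\<And>x. x \<in> \<Omega>' \<Longrightarrow> r *\<^sub>R x \<in> \<Omega>"
  shows "jet_sol F \<Omega>' (\<lambda>x. u (r *\<^sub>R x))"
  using assms jet_sub_rescale[of \<Omega> u r \<Omega>'] elliptic_operator.jet_sub_rescale[OF dual, of \<Omega> "\<lambda>x. - u x" r \<Omega>']
  unfolding jet_sol_def by simp

text \<open>Adding \<open>e\<close> times the identity makes the touching of \<open>v\<close>
  strict, so a uniformly close \<open>u j\<close> has an interior maximum of its difference with the
  same quadratic.\<close>

lemma jet_sub_uniform_limit:
  assumes r: "r > 0" and uc: "\<And>j::nat. continuous_on (cball z r) (u j)" and us: "\<And>j. jet_sub F (ball z r) (u j)"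
    and lim: "\<And>e. e > 0 \<Longrightarrow> \<exists>j. \<forall>x\<in>cball z r. \<bar>u j x - v x\<bar> < e"
    and X: "sym_matrix X" and j: "superjet v z p ((*v) X)"
  shows "F X \<le> 0"
proof (rule nonpos_of_perturbation[OF X])
  fix e :: real assume e: "e > 0"
  then have "e / 4 > 0" by simp
  then obtain d where d: "0 < d" "\<And>h. norm h < d \<Longrightarrow> v (z + h) \<le> v z + p \<bullet> h + h \<bullet> (X *v h) / 2 + e / 4 * (norm h)\<^sup>2"
    using superjetD[OF j] by metis
  define \<rho> where "\<rho> = min r (d / 2)"
  have \<rho>: "0 < \<rho>" "\<rho> \<le> r" "\<rho> < d" using r d by (auto simp: \<rho>_def)
  define X' where "X' = X + e *\<^sub>R mat 1"
  have X': "sym_matrix X'" using X by (auto simp: X'_def)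
  define \<phi> where "\<phi> x = p \<bullet> (x - z) + (x - z) \<bullet> (X' *v (x - z)) / 2" for x
  \<comment> \<open>On the sphere of radius \<rho> the quadratic lies above \<open>v\<close> by
    \<open>e / 4 * \<rho>\<^sup>2\<close>; the two errors of uniform approximation use up only half
    of that.\<close>
  have "e / 16 * \<rho>\<^sup>2 > 0" using e \<rho> by simp
  then obtain j where j: "\<And>x. x \<in> cball z r \<Longrightarrow> \<bar>u j x - v x\<bar> < e / 16 * \<rho>\<^sup>2" using lim by blast
  have phic: "continuous_on S \<phi>" for S
    unfolding \<phi>_def by (intro continuous_intros linear_continuous_on_compose[OF _ matrix_vector_mul_linear]) auto
  have "continuous_on (cball z \<rho>) (\<lambda>x. u j x - \<phi> x)"
    using \<rho> by (intro continuous_intros phic continuous_on_subset[OF uc]) auto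
  then obtain y where y: "y \<in> cball z \<rho>" "\<And>x. x \<in> cball z \<rho> \<Longrightarrow> u j x - \<phi> x \<le> u j y - \<phi> y"
    using continuous_attains_sup[of "cball z \<rho>" "\<lambda>x. u j x - \<phi> x"] \<rho> by auto
  have yi: "norm (y - z) < \<rho>"
  proof (rule ccontr)
    assume "\<not> ?thesis"
    then have ny: "norm (y - z) = \<rho>" using y(1) by (simp add: dist_norm norm_minus_commute)
    have "u j z \<le> u j y - \<phi> y" using y(2)[of z] \<rho> by (simp add: \<phi>_def)
    moreover have "v y \<le> v z + \<phi> y - e / 4 * \<rho>\<^sup>2"
    proof -
      have "(y - z) \<bullet> (X' *v (y - z)) = (y - z) \<bullet> (X *v (y - z)) + e * \<rho>\<^sup>2"
        using ny by (simp add: X'_def mv_simps inner_add_right power2_norm_eq_inner[symmetric])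
      moreover have "v y \<le> v z + p \<bullet> (y - z) + (y - z) \<bullet> (X *v (y - z)) / 2 + e * \<rho>\<^sup>2 / 4"
        using d(2)[of "y - z"] ny \<rho> by simp
      ultimately show ?thesis unfolding \<phi>_def by argo
    qed
    moreover have "\<bar>u j y - v y\<bar> < e / 16 * \<rho>\<^sup>2" "\<bar>u j z - v z\<bar> < e / 16 * \<rho>\<^sup>2"
      using j y(1) \<rho> r by auto
    ultimately have "e / 8 * \<rho>\<^sup>2 < 0" unfolding abs_less_iff by (simp add: field_simps)
    then show False using e by (simp add: mult_less_0_iff)
  qed
  have "superjet (\<lambda>x. \<phi> x + (u j y - \<phi> y)) y (p + X' *v (y - z)) ((*v) X')"
    using superjet_add_jet2[OF jet2_imp_superjet[OF jet2_quadratic[OF X', of p z y]] jet2_affine[of "u j y - \<phi> y" 0 y]]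
    by (simp add: \<phi>_def)
  then have "superjet (u j) y (p + X' *v (y - z)) ((*v) X')"
  proof (rule superjet_le)
    show "\<rho> - norm (y - z) > 0" using yi by simp
    fix x assume "x \<in> ball y (\<rho> - norm (y - z))"
    then have "x \<in> cball z \<rho>" using norm_triangle_ineq[of "x - y" "y - z"] by (simp add: dist_norm norm_minus_commute)
    then show "u j x \<le> \<phi> x + (u j y - \<phi> y)" using y(2)[of x] by simp
  qed simp
  then show "F (X + e *\<^sub>R mat 1) \<le> 0"
    using jet_subD[OF us[of j], of y X'] X' yi \<rho> by (simp add: X'_def dist_norm norm_minus_commute)
qed

subsection \<open>The comparison principle\<close>

text \<open>Doubling of variables; the quadratic penalisation is the test function of the theorem on sums.\<close>

lemma strict_comparison:
  fixes u w :: "real^'n \<Rightarrow> real"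
  assumes U: "open U" "bounded U" and uc: "continuous_on (closure U) u" and wc: "continuous_on (closure U) w"
    and us: "\<And>z p X. z \<in> U \<Longrightarrow> sym_matrix X \<Longrightarrow> superjet u z p ((*v) X) \<Longrightarrow> F X \<le> - c" and c: "c > 0"
    and ws: "jet_sub (dual_operator F) U w"
    and a: "a \<in> U" and bd: "\<And>y. y \<in> frontier U \<Longrightarrow> u y + w y < u a + w a"
  shows False
proof -
  define K where "K = closure U"
  have K: "compact K" using U(2) by (simp add: K_def compact_closure)
  have aK: "a \<in> K" using a closure_subset by (auto simp: K_def)
  \<comment> \<open>The variables of \<open>u\<close> and \<open>w\<close> are doubled, and the
    penalty forces the two points together as \<open>j\<close> grows.\<close>
  define \<Phi> where "\<Phi> j z = u (fst z) + w (snd z) - real j * (norm (fst z - snd z))\<^sup>2" for j :: nat and z :: "(real^'n) \<times> (real^'n)"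
  have uK: "continuous_on K u" and wK: "continuous_on K w" using uc wc by (auto simp: K_def)
  have uf: "continuous_on (K \<times> K) (\<lambda>z. u (fst z))"
    by (rule continuous_on_compose2[OF uK continuous_on_fst[OF continuous_on_id]]) auto
  have wf: "continuous_on (K \<times> K) (\<lambda>z. w (snd z))"
    by (rule continuous_on_compose2[OF wK continuous_on_snd[OF continuous_on_id]]) auto
  have "\<exists>z\<in>K \<times> K. \<forall>z'\<in>K \<times> K. \<Phi> j z' \<le> \<Phi> j z" for j
  proof (rule continuous_attains_sup)
    show "continuous_on (K \<times> K) (\<Phi> j)"
      unfolding \<Phi>_def by (intro continuous_intros uf wf)
  qed (use K aK in \<open>auto intro: compact_Times\<close>)
  then obtain Z where Z: "\<And>j. Z j \<in> K \<times> K" "\<And>j z'. z' \<in> K \<times> K \<Longrightarrow> \<Phi> j z' \<le> \<Phi> j (Z j)" by metis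
  obtain l \<sigma> where l: "l \<in> K \<times> K" "strict_mono (\<sigma> :: nat \<Rightarrow> nat)" "(Z \<circ> \<sigma>) \<longlonglongrightarrow> l"
    using compact_Times[OF K K, unfolded compact_def, rule_format, of Z] Z(1) by blast
  have "\<exists>B. \<forall>x\<in>K. \<bar>u x\<bar> \<le> B" using compact_continuous_image[OF uK K] compact_imp_bounded bounded_real by (metis imageI)
  moreover have "\<exists>B. \<forall>x\<in>K. \<bar>w x\<bar> \<le> B" using compact_continuous_image[OF wK K] compact_imp_bounded bounded_real by (metis imageI)
  ultimately obtain B1 B2 where B: "\<And>x. x \<in> K \<Longrightarrow> \<bar>u x\<bar> \<le> B1" "\<And>x. x \<in> K \<Longrightarrow> \<bar>w x\<bar> \<le> B2" by metis
  define C where "C = B1 + B2 - (u a + w a)"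
  have ge: "u a + w a \<le> \<Phi> j (Z j)" for j using Z(2)[of "(a, a)" j] aK by (simp add: \<Phi>_def)
  \<comment> \<open>The maximal value is at least the value at the pair \<open>(a, a)\<close>, so
    the penalty stays bounded while its weight grows; the two points converge to the same
    limit.\<close>
  have pen: "real j * (norm (fst (Z j) - snd (Z j)))\<^sup>2 \<le> C" for j
  proof -
    have "fst (Z j) \<in> K" "snd (Z j) \<in> K" using Z(1)[of j] by auto
    then have "u (fst (Z j)) \<le> B1" "w (snd (Z j)) \<le> B2" using B abs_le_D1 by blast+
    then show ?thesis using ge[of j] by (simp add: \<Phi>_def C_def)
  qed
  define D where "D n = (norm (fst (Z (\<sigma> n)) - snd (Z (\<sigma> n))))\<^sup>2" for n
  have lf: "(\<lambda>n. fst (Z (\<sigma> n))) \<longlonglongrightarrow> fst l" "(\<lambda>n. snd (Z (\<sigma> n))) \<longlonglongrightarrow> snd l"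
    using tendsto_fst[OF l(3)] tendsto_snd[OF l(3)] by (auto simp: o_def)
  have "D \<longlonglongrightarrow> (norm (fst l - snd l))\<^sup>2" unfolding D_def by (intro tendsto_intros lf)
  moreover have "D \<longlonglongrightarrow> 0"
  proof (rule tendsto_sandwich[where f = "\<lambda>_. 0" and h = "\<lambda>n. C / real n"])
    show "\<forall>\<^sub>F n in sequentially. D n \<le> C / real n"
      using eventually_gt_at_top[of 0]
    proof eventually_elim
      case (elim n)
      have "real n * D n \<le> real (\<sigma> n) * D n"
        using seq_suble[OF l(2), of n] by (intro mult_right_mono) (auto simp: D_def)
      also have "\<dots> \<le> C" unfolding D_def by (rule pen)
      finally show ?case using elim by (simp add: pos_le_divide_eq mult.commute)
    qed
    show "(\<lambda>n. C / real n) \<longlonglongrightarrow> 0" by (rule lim_const_over_n)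
  qed (auto simp: D_def)
  ultimately have "(norm (fst l - snd l))\<^sup>2 = 0" by (rule LIMSEQ_unique)
  then have ll: "snd l = fst l" by simp
  have fl: "fst l \<in> K" using l(1) by auto
  have "u a + w a \<le> u (fst l) + w (fst l)"
  proof (rule LIMSEQ_le_const)
    show "(\<lambda>n. u (fst (Z (\<sigma> n))) + w (snd (Z (\<sigma> n)))) \<longlonglongrightarrow> u (fst l) + w (fst l)"
    proof (intro tendsto_add)
      show "(\<lambda>n. u (fst (Z (\<sigma> n)))) \<longlonglongrightarrow> u (fst l)"
        using Z(1) by (intro continuous_on_tendsto_compose[OF uK lf(1) fl]) (auto simp: mem_Times_iff)
      show "(\<lambda>n. w (snd (Z (\<sigma> n)))) \<longlonglongrightarrow> w (fst l)"
        using Z(1) lf(2) fl unfolding ll by (intro continuous_on_tendsto_compose[OF wK]) (auto simp: mem_Times_iff)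
    qed
    have "u a + w a \<le> u (fst (Z (\<sigma> n))) + w (snd (Z (\<sigma> n)))" for n
    proof -
      have "0 \<le> real (\<sigma> n) * (norm (fst (Z (\<sigma> n)) - snd (Z (\<sigma> n))))\<^sup>2" by simp
      then show ?thesis using ge[of "\<sigma> n"] unfolding \<Phi>_def by linarith
    qed
    then show "\<exists>N. \<forall>n\<ge>N. u a + w a \<le> u (fst (Z (\<sigma> n))) + w (snd (Z (\<sigma> n)))" by blast
  qed
  \<comment> \<open>The limit point carries at least the value at \<open>a\<close>, which the strict
    boundary inequality forbids on the frontier. For large indices both points are therefore
    interior.\<close>
  then have "fst l \<notin> frontier U" using bd[of "fst l"] by auto
  then have lU: "fst l \<in> U" using fl U(1) by (simp add: K_def frontier_def interior_open)
  have "\<forall>\<^sub>F n in sequentially. fst (Z (\<sigma> n)) \<in> U \<and> snd (Z (\<sigma> n)) \<in> U"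
    using topological_tendstoD[OF lf(1) U(1) lU] topological_tendstoD[OF lf(2) U(1)] lU ll by (auto intro: eventually_conj)
  then obtain n where n: "fst (Z (\<sigma> n)) \<in> U" "snd (Z (\<sigma> n)) \<in> U"
    using eventually_happens'[OF sequentially_bot] by blast
  define j where "j = \<sigma> n"
  define x0 y0 where "x0 = fst (Z j)" and "y0 = snd (Z j)"
  have Zj: "Z j = (x0, y0)" by (simp add: x0_def y0_def)
  obtain r1 where r1: "r1 > 0" "cball x0 r1 \<subseteq> U" using n U(1) open_contains_cball unfolding x0_def j_def by metis
  obtain r2 where r2: "r2 > 0" "cball y0 r2 \<subseteq> U" using n U(1) open_contains_cball unfolding y0_def j_def by metis
  define r where "r = min r1 r2"
  have r: "r > 0" "cball x0 r \<subseteq> U" "cball y0 r \<subseteq> U" using r1 r2 by (auto simp: r_def)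
  \<comment> \<open>The Hessian of the penalty. Its form depends on \<open>h - k\<close> alone and
    vanishes for \<open>h = k\<close>, which is how the two matrices are compared below.\<close>
  define A where "A z = (let d = (2 * real j) *\<^sub>R (fst z - snd z) in (d, - d))" for z :: "(real^'n) \<times> (real^'n)"
  have linA: "linear A" by (rule linearI) (auto simp: A_def Let_def algebra_simps)
  have sA: "x \<bullet> A y = A x \<bullet> y" for x y by (simp add: A_def Let_def inner_prod_def algebra_simps inner_commute)
  have Aform: "(h, k) \<bullet> A (h, k) = 2 * real j * (norm (h - k))\<^sup>2" for h k
    unfolding power2_norm_eq_inner by (simp add: A_def Let_def algebra_simps inner_commute)
  define q where "q = (2 * real j) *\<^sub>R (x0 - y0)"
  have above: "u (x0 + h) + w (y0 + k) \<le> u x0 + w y0 + q \<bullet> h + (- q) \<bullet> k + (h, k) \<bullet> A (h, k) / 2"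
    if "norm h \<le> r" "norm k \<le> r" for h k
  proof -
    have "x0 + h \<in> U" "y0 + k \<in> U" using r that by (auto simp: subset_iff dist_norm)
    then have "(x0 + h, y0 + k) \<in> K \<times> K" using closure_subset by (auto simp: K_def)
    then have "\<Phi> j (x0 + h, y0 + k) \<le> \<Phi> j (x0, y0)" using Z(2)[of _ j] Zj by simp
    then have le: "u (x0 + h) + w (y0 + k) - real j * (norm (x0 + h - (y0 + k)))\<^sup>2 \<le> u x0 + w y0 - real j * (norm (x0 - y0))\<^sup>2"
      by (simp add: \<Phi>_def)
    have sq: "(norm (x0 + h - (y0 + k)))\<^sup>2 = (norm (x0 - y0))\<^sup>2 + 2 * ((x0 - y0) \<bullet> (h - k)) + (norm (h - k))\<^sup>2"
      unfolding power2_norm_eq_inner by (simp add: algebra_simps inner_commute)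
    show ?thesis using le unfolding Aform sq by (simp add: q_def algebra_simps)
  qed
  \<comment> \<open>Chosen to make the error \<open>Lam * n * 2 e\<close> of the matrix comparison
    equal to \<open>c / 2\<close>.\<close>
  define e where "e = c / (4 * Lam * real CARD('n))"
  have e: "e > 0" using c Lam_pos by (simp add: e_def)
  have sub: "cball x0 r \<subseteq> closure U" "cball y0 r \<subseteq> closure U" using r closure_subset by blast+
  obtain x y px py X Y where xy: "x \<in> ball x0 r" "y \<in> ball y0 r" "linear X" "linear Y"
    "superjet u x px X" "superjet w y py Y"
    and form: "\<And>h k. h \<bullet> X h + k \<bullet> Y k \<le> (h, k) \<bullet> A (h, k) + e * ((norm h)\<^sup>2 + (norm k)\<^sup>2)"
    using theorem_on_sums[OF linA sA continuous_on_subset[OF uc sub(1)] continuous_on_subset[OF wc sub(2)] r(1) above e] by metis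
  obtain S where S: "sym_matrix S" "\<And>h. h \<bullet> (S *v h) = h \<bullet> X h" using symmetric_part[OF xy(3)] by blast
  obtain T where T: "sym_matrix T" "\<And>h. h \<bullet> (T *v h) = h \<bullet> Y h" using symmetric_part[OF xy(4)] by blast
  have xU: "x \<in> U" "y \<in> U" using xy(1,2) r ball_subset_cball by blast+
  have 1: "F S \<le> - c" using us[OF xU(1) S(1) superjet_form_cong[OF xy(5)]] S(2) by simp
  have 2: "dual_operator F T \<le> 0" using jet_subD[OF ws xU(2) T(1) superjet_form_cong[OF xy(6)]] T(2) by simp
  have "h \<bullet> (S *v h) \<le> h \<bullet> ((- T) *v h) + (2 * e) * (norm h)\<^sup>2" for h
    using form[of h h] S(2)[of h] T(2)[of h] by (simp add: Aform mv_simps)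
  then have "F (- T) \<le> F S + Lam * (real CARD('n) * (2 * e))"
    using S T e by (intro compare_forms) auto
  moreover have "Lam * (real CARD('n) * (2 * e)) = c / 2" using Lam_pos by (simp add: e_def)
  ultimately show False using 1 2 c by (simp add: dual_operator_def)
qed

text \<open>A small multiple of the squared norm turns \<open>u\<close> into a strict subsolution:
  its Hessian is positive and ellipticity decreases \<open>F\<close>.\<close>

theorem comparison:
  fixes u w :: "real^'n \<Rightarrow> real"
  assumes U: "open U" "bounded U" and uc: "continuous_on (closure U) u" and wc: "continuous_on (closure U) w"
    and us: "jet_sub F U u" and ws: "jet_sub (dual_operator F) U w"
    and bd: "\<And>y. y \<in> frontier U \<Longrightarrow> u y + w y \<le> 0" and a: "a \<in> U"
  shows "u a + w a \<le> 0"
proof (rule ccontr)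
  assume "\<not> ?thesis"
  then have m: "u a + w a > 0" by simp
  obtain R where R: "R > 0" "\<And>x. x \<in> closure U \<Longrightarrow> norm x \<le> R"
    using bounded_closure[OF U(2)] unfolding bounded_pos by blast
  \<comment> \<open>On the closure of \<open>U\<close> the added term is at most half of the
    positive value at \<open>a\<close>, so the boundary inequality remains strict.\<close>
  define n where "n = (u a + w a) / (2 * R\<^sup>2)"
  have n: "n > 0" using m R by (simp add: n_def)
  define u' where "u' x = u x + n * (norm (x - 0))\<^sup>2" for x
  show False
  proof (rule strict_comparison[OF U _ wc _ _ ws a])
    show "continuous_on (closure U) u'" unfolding u'_def by (intro continuous_intros uc)
    show "0 < lam * (real CARD('n) * (2 * n))" using lam n by simp
    fix z p and X :: "real^'n^'n" assume z: "z \<in> U" and X: "sym_matrix X" and j: "superjet u' z p ((*v) X)"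
    define I where "I = ((2 * n) *\<^sub>R mat 1 :: real^'n^'n)"
    have I: "sym_matrix I" "nonneg_definite I" using n by (auto simp: I_def nonneg_definite_def mv_simps)
    have "superjet u z (p - (2 * n) *\<^sub>R (z - 0)) ((*v) (X - I))"
      by (rule superjet_form_cong[OF superjet_diff_jet2[OF j[unfolded u'_def[abs_def]] jet2_norm_square]]) (simp add: I_def mv_simps)
    then have "F (X - I) \<le> 0" using jet_subD[OF us z] X I by blast
    moreover have "F (X - I + I) \<le> F (X - I) - lam * trace I" using X I by (intro add_psd) auto
    ultimately show "F X \<le> - (lam * (real CARD('n) * (2 * n)))" by (simp add: I_def trace_mat1)
  next
    fix y assume y: "y \<in> frontier U"
    then have "norm y \<le> R" using R by (auto simp: frontier_def)
    then have "n * (norm y)\<^sup>2 \<le> n * R\<^sup>2" using n by (intro mult_left_mono power_mono) auto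
    also have "\<dots> = (u a + w a) / 2" using R by (simp add: n_def)
    finally have "u' y + w y < u a + w a" using bd[OF y] m by (simp add: u'_def)
    also have "\<dots> \<le> u' a + w a" using n by (simp add: u'_def)
    finally show "u' y + w y < u' a + w a" .
  qed
qed

end

subsection \<open>Radial barriers and the strong maximum principle\<close>

text \<open>The Hessian at \<open>d\<close> of \<open>x \<mapsto> (x \<bullet> x) powr a\<close>. As
  the base is the squared norm, \<open>a\<close> stands for the power \<open>2 * a\<close> of the
  norm.\<close>

definition radial_hessian :: "real \<Rightarrow> real^'n \<Rightarrow> real^'n^'n" where
  "radial_hessian a d = (2 * a * (d \<bullet> d) powr (a - 1)) *\<^sub>R mat 1 + (4 * a * (a - 1) * (d \<bullet> d) powr (a - 2)) *\<^sub>R outer d"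

lemma sym_radial_hessian [simp]: "sym_matrix (radial_hessian a d)"
  unfolding radial_hessian_def by (intro sym_matrix_ops outer)

lemma jet2_radial_power:
  fixes z y :: "real^'n"
  assumes zy: "z \<noteq> y"
  shows "jet2 (\<lambda>x. ((x - y) \<bullet> (x - y)) powr a) z ((2 * a * ((z - y) \<bullet> (z - y)) powr (a - 1)) *\<^sub>R (z - y)) ((*v) (radial_hessian a (z - y)))"
proof -
  have pw: "((\<lambda>x. ((x - y) \<bullet> (x - y)) powr b) has_derivative (\<lambda>h. b * ((x - y) \<bullet> (x - y)) powr (b - 1) * (2 * ((x - y) \<bullet> h)))) (at x)"
    if "x \<noteq> y" for x :: "real^'n" and b
  proof -
    have sq: "((\<lambda>x. (x - y) \<bullet> (x - y)) has_derivative (\<lambda>h. 2 * ((x - y) \<bullet> h))) (at x)"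
      by (auto intro!: derivative_eq_intros simp: inner_commute)
    have "(x - y) \<bullet> (x - y) > 0" using that by simp
    then have "((\<lambda>t. t powr b) has_derivative (\<lambda>s. b * ((x - y) \<bullet> (x - y)) powr (b - 1) * s)) (at ((x - y) \<bullet> (x - y)))"
      using has_real_derivative_powr[of "(x - y) \<bullet> (x - y)" b] by (simp add: has_field_derivative_def)
    from has_derivative_compose[OF sq this] show ?thesis .
  qed
  define g where "g x = (2 * a * ((x - y) \<bullet> (x - y)) powr (a - 1)) *\<^sub>R (x - y)" for x
  have "jet2 (\<lambda>x. ((x - y) \<bullet> (x - y)) powr a) z (g z) ((*v) (radial_hessian a (z - y)))"
  proof (rule jet2_of_derivatives)
    show "dist z y > 0" using zy by simp
    fix x assume "x \<in> ball z (dist z y)"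
    then have "x \<noteq> y" by auto
    then show "((\<lambda>x. ((x - y) \<bullet> (x - y)) powr a) has_derivative (\<lambda>h. g x \<bullet> h)) (at x)"
      using pw[of x a] by (simp add: g_def mult_ac)
  next
    have "(g has_derivative (\<lambda>h. (2 * a * ((z - y) \<bullet> (z - y)) powr (a - 1)) *\<^sub>R h
        + (2 * a * ((a - 1) * ((z - y) \<bullet> (z - y)) powr (a - 1 - 1) * (2 * ((z - y) \<bullet> h)))) *\<^sub>R (z - y))) (at z)"
      unfolding g_def
    proof (rule has_derivative_scaleR)
      show "((\<lambda>x. 2 * a * ((x - y) \<bullet> (x - y)) powr (a - 1)) has_derivative
          (\<lambda>h. 2 * a * ((a - 1) * ((z - y) \<bullet> (z - y)) powr (a - 1 - 1) * (2 * ((z - y) \<bullet> h))))) (at z)"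
        by (rule has_derivative_mult_right[OF pw[OF zy]])
      show "((\<lambda>x. x - y) has_derivative (\<lambda>h. h)) (at z)" by (auto intro!: derivative_eq_intros)
    qed
    moreover have "(2 * a * ((z - y) \<bullet> (z - y)) powr (a - 1)) *\<^sub>R h
        + (2 * a * ((a - 1) * ((z - y) \<bullet> (z - y)) powr (a - 1 - 1) * (2 * ((z - y) \<bullet> h)))) *\<^sub>R (z - y)
      = radial_hessian a (z - y) *v h" for h
      by (simp add: radial_hessian_def mv_simps outer(2) mult_ac)
    ultimately show "(g has_derivative (*v) (radial_hessian a (z - y))) (at z)" by simp
  qed
  then show ?thesis by (simp add: g_def)
qed

lemma superjet_translate:
  "superjet (\<lambda>x. u (y + x)) z p X \<Longrightarrow> superjet u (y + z) p X"
  unfolding superjet_def by (simp add: add.assoc)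

lemma jet_sub_translate:
  assumes "jet_sub F \<Omega> u" "\<And>x. x \<in> \<Omega>' \<Longrightarrow> y + x \<in> \<Omega>"
  shows "jet_sub F \<Omega>' (\<lambda>x. u (y + x))"
  using assms superjet_translate unfolding jet_sub_def by blast

lemma jet_sol_translate:
  "jet_sol F \<Omega> u \<Longrightarrow> (\<And>x. x \<in> \<Omega>' \<Longrightarrow> y + x \<in> \<Omega>) \<Longrightarrow> jet_sol F \<Omega>' (\<lambda>x. u (y + x))"
  unfolding jet_sol_def using jet_sub_translate[of _ \<Omega> _ \<Omega>' y] by blast

lemma nonneg_definite_scaleR: "0 \<le> c \<Longrightarrow> nonneg_definite N \<Longrightarrow> nonneg_definite (c *\<^sub>R N)"
  by (simp add: nonneg_definite_def mv_simps)

lemma nonneg_definite_mat1: "nonneg_definite (mat 1)"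
  by (simp add: nonneg_definite_def)

context elliptic_operator
begin

text \<open>An exponent for which \<open>\<bar>x\<bar> powr (- 2 * decay)\<close> is a strict subsolution away from the origin.\<close>

definition decay :: real where "decay = Lam * real CARD('n) / lam"

lemma decay: "0 < decay" "Lam * real CARD('n) < 2 * lam * (decay + 1)"
proof -
  show "0 < decay" using lam Lam_pos by (simp add: decay_def)
  have "lam * decay = Lam * real CARD('n)" using lam by (simp add: decay_def)
  moreover have "0 < Lam * real CARD('n)" using Lam_pos by simp
  moreover have "2 * lam * (decay + 1) = 2 * (lam * decay) + 2 * lam" by (simp add: algebra_simps)
  ultimately show "Lam * real CARD('n) < 2 * lam * (decay + 1)" using lam by linarith
qed

text \<open>With \<open>t\<close> the squared distance from the pole, a lower bound for how negative
  \<open>F\<close> is on the Hessian of the barrier with exponent \<open>- decay\<close>.\<close>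

definition barrier_gain :: "real \<Rightarrow> real" where
  "barrier_gain t = 2 * decay * t powr (- decay - 1) * (2 * lam * (decay + 1) - Lam * real CARD('n))"

lemma barrier_gain_pos: "0 < t \<Longrightarrow> 0 < barrier_gain t"
  using decay by (simp add: barrier_gain_def)

lemma barrier_gain_antimono: "0 < s \<Longrightarrow> s \<le> t \<Longrightarrow> barrier_gain t \<le> barrier_gain s"
  unfolding barrier_gain_def using decay
  by (intro mult_right_mono mult_left_mono) (auto intro: powr_mono2')

text \<open>The Hessian splits into a positive radial part, which ellipticity weighs at least with
  \<open>lam\<close>, and a negative multiple of the identity, weighed at most with
  \<open>Lam\<close>. The choice of \<open>decay\<close> lets the radial part win.\<close>

lemma radial_barrier:
  fixes d :: "real^'n"
  assumes M: "sym_matrix M" and d: "d \<noteq> 0" and e: "0 \<le> e" and k: "0 \<le> k"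
  shows "F (M + e *\<^sub>R (radial_hessian (- decay) d - k *\<^sub>R mat 1)) \<le> F M - e * (barrier_gain (d \<bullet> d) - Lam * real CARD('n) * k)"
proof -
  define t where "t = d \<bullet> d"
  have t: "t > 0" using d by (simp add: t_def)
  define A where "A = (e * (4 * decay * (decay + 1) * t powr (- decay - 2))) *\<^sub>R outer d"
  define B where "B = ((e * (2 * decay * t powr (- decay - 1) + k)) *\<^sub>R mat 1 :: real^'n^'n)"
  have A: "sym_matrix A" "nonneg_definite A"
    unfolding A_def using outer(1,4)[of d] e decay by (auto intro!: nonneg_definite_scaleR)
  have B: "sym_matrix B" "nonneg_definite B"
    unfolding B_def using e decay k by (auto intro!: nonneg_definite_scaleR nonneg_definite_mat1)
  have "t * t powr (- decay - 2) = t powr (1 + (- decay - 2))"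
    using t by (intro powr_mult_base) simp
  also have "1 + (- decay - 2) = - decay - 1" by simp
  finally have "t powr (- decay - 2) * t = t powr (- decay - 1)" by (simp only: mult.commute)
  then have tA: "trace A = e * (4 * decay * (decay + 1) * t powr (- decay - 1))"
    unfolding A_def trace_scaleR outer(3) by (simp add: t_def power2_norm_eq_inner mult.assoc)
  have tB: "trace B = real CARD('n) * (e * (2 * decay * t powr (- decay - 1) + k))"
    unfolding B_def by (rule trace_mat1)
  have eq: "M + e *\<^sub>R (radial_hessian (- decay) d - k *\<^sub>R mat 1) = M + A - B"
    by (simp add: radial_hessian_def A_def B_def t_def algebra_simps)
  have "F (M + A - B) \<le> F (M + A) + Lam * trace B"
    using add_psd(2)[of "M + A - B" B] M A B by simp
  also have "F (M + A) \<le> F M - lam * trace A" by (rule add_psd(1)[OF M A])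
  finally have "F (M + A - B) \<le> F M - lam * trace A + Lam * trace B" by simp
  also have "F M - lam * trace A + Lam * trace B = F M - e * (barrier_gain (d \<bullet> d) - Lam * real CARD('n) * k)"
    unfolding tA tB barrier_gain_def t_def[symmetric] by (simp add: algebra_simps)
  finally show ?thesis unfolding eq .
qed

lemma F_radial_barrier:
  fixes d :: "real^'n"
  assumes "d \<noteq> 0"
  shows "F (radial_hessian (- decay) d) < 0"
  using radial_barrier[of 0 d 1 0] assms barrier_gain_pos[of "d \<bullet> d"] F_zero by simp

text \<open>Away from the origin, \<open>- \<bar>x\<bar> powr (2 * b)\<close> with \<open>2 * b\<close> slightly below \<open>1\<close> is a strict supersolution:
  there are \<open>n - 1 \<ge> 1\<close> negative tangential eigenvalues and one small positive radial one.\<close>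

lemma F_radial_concave:
  fixes d :: "real^'n"
  assumes d: "d \<noteq> 0" and n: "2 \<le> CARD('n)" and b: "0 < b" "b < 1 / 2" "1 - 2 * b \<le> lam / (2 * Lam)"
  shows "0 < F (- radial_hessian b d)"
proof -
  define t where "t = d \<bullet> d"
  have t: "t > 0" using d by (simp add: t_def)
  \<comment> \<open>\<open>P\<close> is the projection onto the radial direction and
    \<open>Q\<close> the one onto the tangent space, so that the negated Hessian is a positive
    multiple of \<open>c *\<^sub>R P - Q\<close> with small \<open>c\<close>. The trace of
    \<open>Q\<close> is at least \<open>1\<close> because the dimension is at least
    \<open>2\<close>.\<close>
  define P where "P = (1 / t) *\<^sub>R outer d"
  define Q where "Q = mat 1 - P"
  have P: "sym_matrix P" "nonneg_definite P" "trace P = 1"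
    using outer[of d] t by (auto simp: P_def nonneg_definite_def mv_simps trace_scaleR inner_commute t_def power2_norm_eq_inner)
  have Q: "sym_matrix Q" "trace Q = real CARD('n) - 1"
    using P by (auto simp: Q_def trace_sub trace_I)
  have "0 \<le> x \<bullet> (Q *v x)" for x
  proof -
    have "(d \<bullet> x)\<^sup>2 \<le> t * (x \<bullet> x)" unfolding t_def by (rule Cauchy_Schwarz_ineq)
    then have "(d \<bullet> x)\<^sup>2 / t \<le> x \<bullet> x" using t by (simp add: pos_divide_le_eq mult.commute)
    moreover have "x \<bullet> (Q *v x) = x \<bullet> x - (d \<bullet> x)\<^sup>2 / t"
      by (simp add: Q_def P_def mv_simps outer inner_diff_right power2_eq_square inner_commute)
    ultimately show ?thesis by simp
  qed
  then have Qp: "nonneg_definite Q" by (simp add: nonneg_definite_def)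
  define c where "c = 1 - 2 * b"
  have c: "0 < c" "Lam * c \<le> lam / 2"
    using b Lam_pos mult_left_mono[OF b(3), of Lam] by (auto simp: c_def)
  have cP: "sym_matrix (c *\<^sub>R P)" "nonneg_definite (c *\<^sub>R P)"
    using P c by (auto intro!: nonneg_definite_scaleR)
  have "F 0 \<le> F (0 + c *\<^sub>R P) + Lam * trace (c *\<^sub>R P)" using cP by (intro add_psd) auto
  then have 1: "- (Lam * c) \<le> F (c *\<^sub>R P)" by (simp add: F_zero trace_scaleR P)
  have "F (c *\<^sub>R P - Q + Q) \<le> F (c *\<^sub>R P - Q) - lam * trace Q" using cP Q Qp by (intro add_psd) auto
  then have 2: "F (c *\<^sub>R P) + lam * trace Q \<le> F (c *\<^sub>R P - Q)" by simp
  have "lam * 1 \<le> lam * trace Q" unfolding Q(2) using lam n by (intro mult_left_mono) auto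
  then have pos: "0 < F (c *\<^sub>R P - Q)" using 1 2 c lam by linarith
  have eq: "- radial_hessian b d = (2 * b * t powr (b - 1)) *\<^sub>R (c *\<^sub>R P - Q)"
  proof -
    have "t * t powr (b - 2) = t powr (1 + (b - 2))" using t by (intro powr_mult_base) simp
    also have "1 + (b - 2) = b - 1" by simp
    finally have pw: "t powr (b - 1) = t * t powr (b - 2)" by simp
    have co: "4 * b * (b - 1) * t powr (b - 2) = - (2 * b * t powr (b - 1) * ((2 - 2 * b) * (1 / t)))"
      unfolding pw using t by (simp add: algebra_simps)
    have "c *\<^sub>R P - Q = (2 - 2 * b) *\<^sub>R P - mat 1" by (simp add: Q_def c_def scaleR_2 algebra_simps)
    then show ?thesis
      unfolding radial_hessian_def t_def[symmetric] co by (simp add: P_def scaleR_diff_right)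
  qed
  have "F (- radial_hessian b d) = (2 * b * t powr (b - 1)) * F (c *\<^sub>R P - Q)"
    unfolding eq using b t cP Q by (intro F_scaleR) auto
  then show ?thesis using pos b t by simp
qed

text \<open>Hopf's argument at a boundary point of the contact set; the term \<open>\<kappa> \<bar>x - x1\<bar>^2\<close> makes the barrier
  strictly negative on the part of the small sphere outside the tangent ball.\<close>

lemma hopf_contradiction:
  fixes u w :: "real^'n \<Rightarrow> real"
  assumes U: "open U" and uc: "continuous_on U u" and wc: "continuous_on U w"
    and us: "jet_sub F U u" and ws: "jet_sub (dual_operator F) U w"
    and le: "\<And>x. x \<in> U \<Longrightarrow> u x + w x \<le> 0"
    and x1: "x1 \<in> U" "u x1 + w x1 = 0" and yx: "y \<noteq> x1"
    and neg: "\<And>x. x \<in> U \<Longrightarrow> dist y x < dist y x1 \<Longrightarrow> u x + w x < 0"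
  shows False
proof -
  define d0 where "d0 = dist y x1"
  have d0: "d0 > 0" using yx by (simp add: d0_def)
  obtain r where r: "r > 0" "cball x1 r \<subseteq> U" using U x1(1) open_contains_cball by blast
  define \<rho> where "\<rho> = min r (d0 / 2)"
  have \<rho>: "0 < \<rho>" "\<rho> \<le> d0 / 2" "cball x1 \<rho> \<subseteq> U" using r d0 by (auto simp: \<rho>_def)
  define g where "g = barrier_gain ((3 * d0 / 2)\<^sup>2)"
  have g: "g > 0" using d0 by (simp add: g_def barrier_gain_pos)
  \<comment> \<open>The quadratic correction may use up half of \<open>g\<close>, and
    \<open>g\<close> bounds the gain from below on the whole small ball, whose points are within
    \<open>3 * d0 / 2\<close> of \<open>y\<close>.\<close>
  define k where "k = g / (4 * Lam * real CARD('n))"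
  have k: "k > 0" "Lam * real CARD('n) * (2 * k) = g / 2" using g Lam_pos by (auto simp: k_def)
  define b where "b x = ((x - y) \<bullet> (x - y)) powr (- decay)" for x
  define h where "h x = b x - b x1 - k * (norm (x - x1))\<^sup>2" for x
  have dyx: "d0 / 2 \<le> dist y x" "dist y x \<le> 3 * d0 / 2" if "x \<in> cball x1 \<rho>" for x
    using that \<rho>(2) dist_triangle[of y x1 x] dist_triangle[of y x x1] by (auto simp: d0_def dist_commute)
  then have ny: "x \<noteq> y" if "x \<in> cball x1 \<rho>" for x using that d0 by force
  have bc: "continuous_on (cball x1 \<rho>) b"
    unfolding b_def using ny by (intro continuous_intros) auto
  have hc: "continuous_on (cball x1 \<rho>) h" unfolding h_def by (intro continuous_intros bc)
  \<comment> \<open>Where \<open>h\<close> is nonnegative on the small sphere, the barrier exceeds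
    its value at \<open>x1\<close> because of the subtracted quadratic; such points are closer to
    \<open>y\<close> than \<open>x1\<close>, where \<open>u + w\<close> is negative by
    assumption.\<close>
  have hneg: "u x + w x < 0" if x: "x \<in> sphere x1 \<rho>" "0 \<le> h x" for x
  proof (rule neg)
    have xc: "x \<in> cball x1 \<rho>" using x(1) by simp
    show "x \<in> U" using xc \<rho>(3) by blast
    have nx: "norm (x - x1) = \<rho>" using x(1) by (simp add: dist_norm norm_minus_commute)
    have "k * \<rho>\<^sup>2 > 0" using k(1) \<rho>(1) by simp
    then have "b x1 < b x" using x(2) by (simp add: h_def nx)
    show "dist y x < dist y x1"
    proof (rule ccontr)
      assume "\<not> ?thesis"
      then have "(dist y x1)\<^sup>2 \<le> (dist y x)\<^sup>2" by (intro power_mono) auto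
      then have "(x1 - y) \<bullet> (x1 - y) \<le> (x - y) \<bullet> (x - y)"
        by (simp add: dist_norm norm_minus_commute[of y] power2_norm_eq_inner)
      then have "b x \<le> b x1" unfolding b_def using yx decay by (intro powr_mono2') auto
      then show False using \<open>b x1 < b x\<close> by simp
    qed
  qed
  define S where "S = {x\<in>sphere x1 \<rho>. 0 \<le> h x}"
  have hs: "continuous_on (sphere x1 \<rho>) h" using hc sphere_cball continuous_on_subset by blast
  have "closed S" unfolding S_def by (intro continuous_on_closed_Collect_le hs continuous_on_const closed_sphere)
  moreover have "S \<subseteq> sphere x1 \<rho>" by (auto simp: S_def)
  then have "bounded S" using bounded_sphere bounded_subset by blast
  ultimately have Sc: "compact S" by (simp add: compact_eq_bounded_closed)
  have uwS: "continuous_on S (\<lambda>x. u x + w x)"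
    using \<rho>(3) uc wc by (intro continuous_intros continuous_on_subset[OF uc] continuous_on_subset[OF wc]) (auto simp: S_def)
  obtain m where m: "m > 0" "\<And>x. x \<in> S \<Longrightarrow> u x + w x \<le> - m"
  proof (cases "S = {}")
    case False
    then obtain a where "a \<in> S" "\<And>x. x \<in> S \<Longrightarrow> u x + w x \<le> u a + w a"
      using continuous_attains_sup[OF Sc False uwS] by blast
    moreover have "u a + w a < 0" using hneg \<open>a \<in> S\<close> by (auto simp: S_def)
    ultimately show ?thesis by (intro that[of "- (u a + w a)"]) (auto simp: add.commute)
  qed (use that[of 1] in simp)
  have "bounded (h ` cball x1 \<rho>)" using compact_imp_bounded[OF compact_continuous_image[OF hc compact_cball]] .
  then obtain B where B: "B > 0" "\<And>x. x \<in> cball x1 \<rho> \<Longrightarrow> \<bar>h x\<bar> \<le> B" unfolding bounded_pos by (auto simp: image_iff)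
  define e where "e = m / (2 * B)"
  have e: "e > 0" using m B by (simp add: e_def)
  define u' where "u' x = u x + e * h x" for x
  show False
  proof (rule strict_comparison[of "ball x1 \<rho>" u' w "e * (g / 2)" x1])
    have cl: "closure (ball x1 \<rho>) = cball x1 \<rho>" using \<rho> by simp
    show "continuous_on (closure (ball x1 \<rho>)) u'" unfolding cl u'_def
      by (intro continuous_intros hc continuous_on_subset[OF uc \<rho>(3)])
    show "continuous_on (closure (ball x1 \<rho>)) w" unfolding cl by (intro continuous_on_subset[OF wc \<rho>(3)])
    show "jet_sub (dual_operator F) (ball x1 \<rho>) w" using ws \<rho>(3) ball_subset_cball by (intro jet_sub_subset[OF ws]) blast
    fix x assume "x \<in> frontier (ball x1 \<rho>)"
    then have x: "x \<in> sphere x1 \<rho>" using \<rho> by simp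
    have a0: "u' x1 + w x1 = 0" using x1 by (simp add: u'_def h_def)
    show "u' x + w x < u' x1 + w x1"
    proof (cases "0 \<le> h x")
      case True
      have "h x \<le> B" using abs_le_D1[OF B(2)[of x]] x by simp
      then have "e * h x \<le> e * B" using e by (intro mult_left_mono) auto
      also have "e * B = m / 2" using B by (simp add: e_def)
      finally show ?thesis using m(2)[of x] True x m(1) a0 by (simp add: S_def u'_def)
    next
      case False
      then have "e * h x < 0" using e by (simp add: mult_less_0_iff)
      moreover have "u x + w x \<le> 0" using x \<rho>(3) by (intro le) auto
      ultimately show ?thesis using a0 by (simp add: u'_def)
    qed
  next
    fix z p and X :: "real^'n^'n" assume z: "z \<in> ball x1 \<rho>" and X: "sym_matrix X" and j: "superjet u' z p ((*v) X)"
    have zc: "z \<in> cball x1 \<rho>" using z by simp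
    then have zy: "z \<noteq> y" by (rule ny)
    define H where "H = radial_hessian (- decay) (z - y) - (2 * k) *\<^sub>R mat 1"
    have H: "sym_matrix H" by (simp add: H_def)
    define q where "q = e *\<^sub>R ((2 * - decay * ((z - y) \<bullet> (z - y)) powr (- decay - 1)) *\<^sub>R (z - y))"
    have j1: "superjet (\<lambda>x. u x + e * (b x - b x1) - e * k * (norm (x - x1))\<^sup>2) z p ((*v) X)"
      by (rule superjet_cong[OF j zero_less_one]) (simp add: u'_def h_def algebra_simps)
    have "jet2 (\<lambda>x. - (e * k) * (norm (x - x1))\<^sup>2) z ((2 * - (e * k)) *\<^sub>R (z - x1)) (\<lambda>h. (2 * - (e * k)) *\<^sub>R h)"
      by (rule jet2_norm_square)
    then have j2: "superjet (\<lambda>x. u x + e * (b x - b x1)) z (p - (2 * - (e * k)) *\<^sub>R (z - x1)) (\<lambda>h. X *v h - (2 * - (e * k)) *\<^sub>R h)"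
      by (intro superjet_diff_jet2) (use j1 in simp_all)
    have jb: "jet2 (\<lambda>x. e * b x) z (e *\<^sub>R ((2 * - decay * ((z - y) \<bullet> (z - y)) powr (- decay - 1)) *\<^sub>R (z - y))) (\<lambda>h. e *\<^sub>R (radial_hessian (- decay) (z - y) *v h))"
      unfolding b_def by (intro jet2_cmult jet2_radial_power zy)
    have ju: "superjet (\<lambda>x. (u x + (- e * b x1)) + e * b x) z (p - (2 * - (e * k)) *\<^sub>R (z - x1)) (\<lambda>h. X *v h - (2 * - (e * k)) *\<^sub>R h)"
      by (rule superjet_cong[OF j2 zero_less_one]) (simp add: algebra_simps)
    have jc: "superjet (\<lambda>x. u x + (- e * b x1)) z (p - (2 * - (e * k)) *\<^sub>R (z - x1) - q)
        (\<lambda>h. X *v h - (2 * - (e * k)) *\<^sub>R h - e *\<^sub>R (radial_hessian (- decay) (z - y) *v h))"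
      unfolding q_def by (rule superjet_diff_jet2[OF ju jb])
    have jd: "jet2 (\<lambda>x. - e * b x1) z 0 (\<lambda>h. 0)" using jet2_affine[of "- e * b x1" 0 z] by simp
    have "superjet u z (p - (2 * - (e * k)) *\<^sub>R (z - x1) - q - 0)
        (\<lambda>h. X *v h - (2 * - (e * k)) *\<^sub>R h - e *\<^sub>R (radial_hessian (- decay) (z - y) *v h) - 0)"
      by (rule superjet_diff_jet2[OF jc jd])
    then have "superjet u z (p - (2 * - (e * k)) *\<^sub>R (z - x1) - q - 0) ((*v) (X - e *\<^sub>R H))"
      by (rule superjet_form_cong) (simp add: H_def mv_simps algebra_simps)
    then have F0: "F (X - e *\<^sub>R H) \<le> 0" using jet_subD[OF us] zc \<rho>(3) X H by blast
    have "F (X - e *\<^sub>R H + e *\<^sub>R H) \<le> F (X - e *\<^sub>R H) - e * (barrier_gain ((z - y) \<bullet> (z - y)) - Lam * real CARD('n) * (2 * k))"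
      unfolding H_def using zy X H e k by (intro radial_barrier) (auto simp: H_def)
    moreover have "g \<le> barrier_gain ((z - y) \<bullet> (z - y))"
    proof -
      have "(norm (z - y))\<^sup>2 \<le> (3 * d0 / 2)\<^sup>2"
        using dyx[OF zc] by (intro power_mono) (auto simp: dist_norm norm_minus_commute)
      then show ?thesis unfolding g_def using zy by (intro barrier_gain_antimono) (auto simp: power2_norm_eq_inner)
    qed
    then have "e * (g - g / 2) \<le> e * (barrier_gain ((z - y) \<bullet> (z - y)) - Lam * real CARD('n) * (2 * k))"
      unfolding k(2) using e by (intro mult_left_mono) auto
    ultimately show "F X \<le> - (e * (g / 2))" using F0 by simp
  qed (use e g \<rho> in auto)
qed

text \<open>If the contact set were not open, a non-contact point \<open>y\<close> close to a
  contact point would have a nearest contact point, and the ball around \<open>y\<close> through it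
  would be the situation excluded by \<open>hopf_contradiction\<close>.\<close>

theorem strong_maximum_principle:
  fixes u w :: "real^'n \<Rightarrow> real"
  assumes U: "open U" "connected U" and uc: "continuous_on U u" and wc: "continuous_on U w"
    and us: "jet_sub F U u" and ws: "jet_sub (dual_operator F) U w"
    and le: "\<And>x. x \<in> U \<Longrightarrow> u x + w x \<le> 0"
    and x0: "x0 \<in> U" "u x0 + w x0 = 0" and x: "x \<in> U"
  shows "u x + w x = 0"
proof -
  define Z where "Z = {x\<in>U. u x + w x = 0}"
  have cont: "continuous_on U (\<lambda>x. u x + w x)" by (intro continuous_intros uc wc)
  have "closedin (top_of_set U) Z"
    unfolding Z_def using continuous_closedin_preimage_constant[OF cont, of 0] .
  moreover have "openin (top_of_set U) Z"
  proof (rule ccontr)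
    assume "\<not> ?thesis"
    then have "\<not> open Z" using U(1) openin_open_eq[OF U(1), of Z] by (auto simp: Z_def)
    then obtain a where a: "a \<in> Z" "\<And>e. e > 0 \<Longrightarrow> \<not> ball a e \<subseteq> Z" unfolding open_contains_ball by blast
    have aU: "a \<in> U" using a(1) by (simp add: Z_def)
    obtain r where r: "r > 0" "cball a r \<subseteq> U" using U(1) aU open_contains_cball by blast
    \<comment> \<open>With \<open>y\<close> within \<open>r / 2\<close> of \<open>a\<close>, all
      points that are closer to \<open>y\<close> than \<open>a\<close> is lie in
      \<open>cball a r\<close>, so a nearest contact point in that ball is nearest among
      all.\<close>
    have "\<not> ball a (r / 2) \<subseteq> Z" using r(1) by (intro a(2)) simp
    then obtain y where y: "y \<in> ball a (r / 2)" "y \<notin> Z" by blast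
    define C where "C = {x\<in>cball a r. u x + w x = 0}"
    have "continuous_on (cball a r) (\<lambda>x. u x + w x)" using cont r(2) continuous_on_subset by blast
    then have "closed C" unfolding C_def by (intro continuous_closed_preimage_constant) auto
    moreover have "a \<in> C" using a(1) r(1) by (auto simp: C_def Z_def)
    ultimately obtain x1 where x1: "x1 \<in> C" "\<And>x. x \<in> C \<Longrightarrow> dist y x1 \<le> dist y x"
      using distance_attains_inf[of C y] by blast
    show False
    proof (rule hopf_contradiction[OF U(1) uc wc us ws le])
      show "x1 \<in> U" "u x1 + w x1 = 0" using x1(1) r(2) by (auto simp: C_def)
      then show "y \<noteq> x1" using y(2) by (auto simp: Z_def)
      fix x assume x: "x \<in> U" "dist y x < dist y x1"
      have "dist y x1 \<le> dist y a" using x1(2) \<open>a \<in> C\<close> by blast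
      then have "dist a x \<le> r" using x(2) y(1) dist_triangle[of a x y] by (simp add: dist_commute)
      then have "u x + w x \<noteq> 0" using x1(2)[of x] x(2) by (auto simp: C_def)
      then show "u x + w x < 0" using le[OF x(1)] by simp
    qed auto
  qed
  ultimately have "Z = {} \<or> Z = U" using U(2) connected_clopen by blast
  then show ?thesis using x0 x by (auto simp: Z_def)
qed

end

subsection \<open>The interior Lipschitz estimate\<close>

text \<open>The second-order Taylor term of the norm is half of the last summand. The other half
  absorbs the remainder as long as \<open>v\<close> is at most half as long as
  \<open>z\<close>.\<close>

lemma norm_add_le_quadratic:
  fixes z v :: "'a::real_inner"
  assumes "z \<noteq> 0" "norm v \<le> norm z / 2"
  defines "d \<equiv> norm z" and "e \<equiv> z /\<^sub>R norm z"
  shows "norm (z + v) \<le> d + e \<bullet> v + ((norm v)\<^sup>2 - (e \<bullet> v)\<^sup>2) / d"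
proof -
  have d: "d > 0" using assms by (simp add: d_def)
  have ne: "norm e = 1" using assms by (simp add: e_def)
  have ze: "z = d *\<^sub>R e" using assms by (simp add: d_def e_def)
  define a where "a = d + e \<bullet> v"
  define b where "b = (norm v)\<^sup>2 - (e \<bullet> v)\<^sup>2"
  have ev: "\<bar>e \<bullet> v\<bar> \<le> norm v" using Cauchy_Schwarz_ineq2[of e v] ne by simp
  have a: "a \<ge> d / 2" using ev assms(2) by (auto simp: a_def d_def abs_le_iff)
  have b: "b \<ge> 0" unfolding b_def using power_mono[OF ev, of 2] by simp
  have "(norm (z + v))\<^sup>2 = a\<^sup>2 + b"
    unfolding power2_norm_eq_inner a_def b_def ze using ne
    by (simp add: inner_commute power2_eq_square algebra_simps norm_eq_1)
  also have "\<dots> \<le> (a + b / d)\<^sup>2"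
  proof -
    have "b \<le> 2 * a * (b / d)" using a b d mult_right_mono[of d "2 * a" "b / d"] by simp
    moreover have "0 \<le> (b / d)\<^sup>2" by simp
    moreover have "(a + b / d)\<^sup>2 = a\<^sup>2 + 2 * a * (b / d) + (b / d)\<^sup>2" by (simp add: power2_sum)
    ultimately show ?thesis by linarith
  qed
  finally have "norm (z + v) \<le> a + b / d"
    by (rule power2_le_imp_le) (use a b d in simp)
  then show ?thesis by (simp add: a_def b_def)
qed

context elliptic_operator
begin

text \<open>The least value for which the ellipticity gain in \<open>lipschitz_estimate_aux\<close>
  balances the errors is \<open>33\<close> plus the second summand; one more makes the inequality
  strict, and \<open>34\<close> also confines the maximum to the interior.\<close>

definition lip_const :: real where
  "lip_const = 34 + 33 * (Lam * real CARD('n) * real CARD('n) / lam)"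

lemma lip_const: "34 \<le> lip_const"
  unfolding lip_const_def using lam Lam_pos by simp

text \<open>The method of Ishii and Lions: the concavity of \<open>t - t^2 / 4\<close> in the direction of \<open>x - y\<close> contradicts ellipticity.\<close>

lemma lipschitz_estimate_aux:
  fixes u :: "real^'n \<Rightarrow> real"
  assumes us: "jet_sol F (ball 0 1) u" and uc: "continuous_on (ball 0 1) u" and ub: "\<And>x. x \<in> ball 0 1 \<Longrightarrow> \<bar>u x\<bar> \<le> 1"
    and xy: "norm x \<le> 3/4" "norm y \<le> 3/4"
  shows "u x - u y \<le> lip_const * norm (x - y) + 32 * (norm x)\<^sup>2"
proof -
  define L where "L = lip_const"
  have L: "L \<ge> 34" using lip_const by (simp add: L_def)
  \<comment> \<open>The first bracket is a concave function of the distance, increasing up to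
    \<open>2\<close>; the term with \<open>32\<close> pulls the maximum towards the origin. It
    suffices to show that \<Theta> is nowhere positive.\<close>
  define \<Theta> where "\<Theta> z = u (fst z) - u (snd z) - L * (norm (fst z - snd z) - (norm (fst z - snd z))\<^sup>2 / 4) - 32 * (norm (fst z))\<^sup>2"
    for z :: "(real^'n) \<times> (real^'n)"
  define K where "K = cball (0::real^'n) (3/4)"
  have uK: "continuous_on K u" unfolding K_def by (rule continuous_on_subset[OF uc]) auto
  have uf: "continuous_on (K \<times> K) (\<lambda>z. u (fst z))"
    by (rule continuous_on_compose2[OF uK continuous_on_fst[OF continuous_on_id]]) auto
  have ug: "continuous_on (K \<times> K) (\<lambda>z. u (snd z))"
    by (rule continuous_on_compose2[OF uK continuous_on_snd[OF continuous_on_id]]) auto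
  have "\<exists>z\<in>K \<times> K. \<forall>z'\<in>K \<times> K. \<Theta> z' \<le> \<Theta> z"
  proof (rule continuous_attains_sup)
    show "continuous_on (K \<times> K) \<Theta>"
      unfolding \<Theta>_def by (intro continuous_intros uf ug) auto
    show "compact (K \<times> K)" unfolding K_def by (intro compact_Times compact_cball)
    show "K \<times> K \<noteq> {}" by (auto simp: K_def)
  qed
  then obtain Z where Z: "Z \<in> K \<times> K" "\<And>z'. z' \<in> K \<times> K \<Longrightarrow> \<Theta> z' \<le> \<Theta> Z" by blast
  define x0 y0 where "x0 = fst Z" and "y0 = snd Z"
  have Zeq: "Z = (x0, y0)" by (simp add: x0_def y0_def)
  have n0: "norm x0 \<le> 3/4" "norm y0 \<le> 3/4" using Z(1) by (auto simp: Zeq K_def)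
  define d where "d = norm (x0 - y0)"
  have "\<Theta> Z \<le> 0"
  proof (rule ccontr)
    assume "\<not> ?thesis"
    then have pos: "\<Theta> (x0, y0) > 0" by (simp add: Zeq)
    have d2: "d \<le> 3/2" using norm_triangle_ineq4[of x0 y0] n0 by (simp add: d_def)
    have psi: "d / 2 \<le> d - d\<^sup>2 / 4"
    proof -
      have "d * d \<le> (3/2) * d" using d2 by (intro mult_right_mono) (auto simp: d_def)
      moreover have "0 \<le> d" by (simp add: d_def)
      ultimately show ?thesis unfolding power2_eq_square by linarith
    qed
    have "\<bar>u x0\<bar> \<le> 1" "\<bar>u y0\<bar> \<le> 1" using ub n0 by auto
    \<comment> \<open>As \<open>u\<close> varies by at most \<open>2\<close>, positivity bounds both
      penalties. This gives \<open>norm x0 < 1/4\<close>, \<open>d < 1/4\<close> and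
      \<open>norm y0 < 1/2\<close>, away from the boundary of the domain of \<Theta>.\<close>
    then have two: "L * (d - d\<^sup>2 / 4) + 32 * (norm x0)\<^sup>2 < 2"
      using pos by (simp add: \<Theta>_def d_def abs_le_iff)
    have Lpsi: "34 * (d / 2) \<le> L * (d - d\<^sup>2 / 4)" using L psi by (intro mult_mono) (auto simp: d_def)
    have dpos: "0 \<le> d" by (simp add: d_def)
    have "32 * (norm x0)\<^sup>2 < 2" using two Lpsi dpos by linarith
    then have "(norm x0)\<^sup>2 < (1/4)\<^sup>2" by (simp add: power2_eq_square)
    then have nx: "norm x0 < 1/4" by (rule power_less_imp_less_base) simp
    have d14: "d < 1/4" using two Lpsi zero_le_power2[of "norm x0"] by linarith
    have ny: "norm y0 < 1/2" using norm_triangle_ineq4[of x0 "x0 - y0"] nx d14 by (simp add: d_def)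
    have ne: "x0 \<noteq> y0" using pos by (auto simp: \<Theta>_def)
    then have d: "d > 0" by (simp add: d_def)
    define e where "e = (x0 - y0) /\<^sub>R norm (x0 - y0)"
    have e1: "norm e = 1" using ne by (simp add: e_def)
    have ee: "e \<bullet> e = 1" using e1 by (simp add: norm_eq_1)
    have ze: "x0 - y0 = d *\<^sub>R e" using ne by (simp add: d_def e_def)
    \<comment> \<open>A quadratic form that dominates the second-order behaviour of \<open>L\<close>
      times the concave function of the distance. It is positive across \<open>e\<close>, and along
      \<open>e\<close> only the concave part \<open>- L / 2\<close> remains.\<close>
    define G where "G v = (2 * L) *\<^sub>R ((1 / d) *\<^sub>R (v - (e \<bullet> v) *\<^sub>R e) - (1 / 4) *\<^sub>R v)" for v
    have linG: "linear G" by (rule linearI) (auto simp: G_def algebra_simps)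
    have sG: "v \<bullet> G v' = G v \<bullet> v'" for v v' by (simp add: G_def algebra_simps inner_commute)
    have Gform: "v \<bullet> G v = 2 * L * (((norm v)\<^sup>2 - (e \<bullet> v)\<^sup>2) / d - (norm v)\<^sup>2 / 4)" for v
      unfolding power2_norm_eq_inner by (simp add: G_def algebra_simps inner_commute power2_eq_square diff_divide_distrib)
    define A where "A z = (G (fst z - snd z) + 64 *\<^sub>R fst z, - G (fst z - snd z))" for z
    have linA: "linear A"
    proof (rule linearI)
      show "A (a + b) = A a + A b" for a b
      proof -
        have "fst (a + b) - snd (a + b) = (fst a - snd a) + (fst b - snd b)" by simp
        then have "G (fst (a + b) - snd (a + b)) = G (fst a - snd a) + G (fst b - snd b)"
          using linear_add[OF linG] by metis
        then show ?thesis by (simp add: A_def scaleR_add_right)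
      qed
      show "A (c *\<^sub>R a) = c *\<^sub>R A a" for c a
      proof -
        have "fst (c *\<^sub>R a) - snd (c *\<^sub>R a) = c *\<^sub>R (fst a - snd a)" by (simp add: scaleR_diff_right)
        then have "G (fst (c *\<^sub>R a) - snd (c *\<^sub>R a)) = c *\<^sub>R G (fst a - snd a)"
          using linear_cmul[OF linG] by metis
        then show ?thesis by (simp add: A_def scaleR_add_right)
      qed
    qed
    have sA: "a \<bullet> A b = A a \<bullet> b" for a b
      using sG[of "fst a - snd a" "fst b - snd b"] by (simp add: A_def inner_prod_def algebra_simps)
    have Aform: "(h, k) \<bullet> A (h, k) = (h - k) \<bullet> G (h - k) + 64 * (norm h)\<^sup>2" for h k
      unfolding power2_norm_eq_inner by (simp add: A_def algebra_simps)
    define r where "r = d / 4"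
    have r: "r > 0" "r < 1/4" using d d14 by (auto simp: r_def)
    have sub: "cball x0 r \<subseteq> ball 0 1" "cball y0 r \<subseteq> ball 0 1"
    proof -
      have "norm z < 1" if "dist c z \<le> r" "norm c < 1/2" for c z :: "real^'n"
        using that r(2) norm_triangle_ineq4[of c "c - z"] by (simp add: dist_norm)
      then show "cball x0 r \<subseteq> ball 0 1" "cball y0 r \<subseteq> ball 0 1" using nx ny by auto
    qed
    define q where "q = L *\<^sub>R (e - (d / 2) *\<^sub>R e)"
    have above: "u (x0 + h) + - u (y0 + k) \<le> u x0 + - u y0 + (q + 64 *\<^sub>R x0) \<bullet> h + (- q) \<bullet> k + (h, k) \<bullet> A (h, k) / 2"
      if hk: "norm h \<le> r" "norm k \<le> r" for h k
    proof -
      define v where "v = h - k"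
      have nv: "norm v \<le> norm (x0 - y0) / 2" using norm_triangle_ineq4[of h k] hk by (simp add: v_def r_def d_def)
      have "norm (x0 + h) \<le> 3/4" "norm (y0 + k) \<le> 3/4"
        using norm_triangle_ineq[of x0 h] norm_triangle_ineq[of y0 k] hk r nx ny by auto
      then have "(x0 + h, y0 + k) \<in> K \<times> K" by (simp add: K_def)
      from Z(2)[OF this] have 1: "u (x0 + h) - u (y0 + k) \<le> u x0 - u y0
          + L * ((norm (x0 + h - (y0 + k)) - (norm (x0 + h - (y0 + k)))\<^sup>2 / 4) - (d - d\<^sup>2 / 4))
          + 32 * ((norm (x0 + h))\<^sup>2 - (norm x0)\<^sup>2)"
        by (simp add: \<Theta>_def Zeq d_def right_diff_distrib)
      have e2: "x0 + h - (y0 + k) = (x0 - y0) + v" by (simp add: v_def)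
      have 2: "norm ((x0 - y0) + v) \<le> d + e \<bullet> v + ((norm v)\<^sup>2 - (e \<bullet> v)\<^sup>2) / d"
        using norm_add_le_quadratic[of "x0 - y0" v] ne nv by (simp add: d_def e_def)
      have 3: "(norm ((x0 - y0) + v))\<^sup>2 = d\<^sup>2 + 2 * (d * (e \<bullet> v)) + (norm v)\<^sup>2"
        unfolding power2_norm_eq_inner ze using ee by (simp add: algebra_simps inner_commute power2_eq_square)
      have "(norm ((x0 - y0) + v) - (norm ((x0 - y0) + v))\<^sup>2 / 4) - (d - d\<^sup>2 / 4)
          \<le> (e \<bullet> v - d * (e \<bullet> v) / 2) + (((norm v)\<^sup>2 - (e \<bullet> v)\<^sup>2) / d - (norm v)\<^sup>2 / 4)"
        unfolding 3 using 2 by argo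
      then have "L * ((norm ((x0 - y0) + v) - (norm ((x0 - y0) + v))\<^sup>2 / 4) - (d - d\<^sup>2 / 4))
          \<le> L * ((e \<bullet> v - d * (e \<bullet> v) / 2) + (((norm v)\<^sup>2 - (e \<bullet> v)\<^sup>2) / d - (norm v)\<^sup>2 / 4))"
        using L by (intro mult_left_mono) auto
      also have "\<dots> = q \<bullet> v + (v \<bullet> G v) / 2"
      proof -
        have qv: "q \<bullet> v = L * (e \<bullet> v - d * (e \<bullet> v) / 2)" by (simp add: q_def inner_diff_left)
        show ?thesis unfolding Gform qv by (simp add: distrib_left)
      qed
      finally have 4: "L * ((norm ((x0 - y0) + v) - (norm ((x0 - y0) + v))\<^sup>2 / 4) - (d - d\<^sup>2 / 4)) \<le> q \<bullet> v + (v \<bullet> G v) / 2" .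
      have 5: "32 * ((norm (x0 + h))\<^sup>2 - (norm x0)\<^sup>2) = (64 *\<^sub>R x0) \<bullet> h + 32 * (norm h)\<^sup>2"
        unfolding power2_norm_eq_inner by (simp add: algebra_simps inner_commute)
      have 6: "q \<bullet> v = q \<bullet> h - q \<bullet> k" by (simp add: v_def inner_diff_right)
      show ?thesis using 1 4 unfolding e2 5 6 Aform v_def[symmetric] inner_add_left inner_minus_left by argo
    qed
    have c1: "continuous_on (cball x0 r) u" "continuous_on (cball y0 r) (\<lambda>x. - u x)"
      using sub by (auto intro!: continuous_on_minus continuous_on_subset[OF uc])
    obtain x1 y1 px py X Y where J: "x1 \<in> ball x0 r" "y1 \<in> ball y0 r" "linear X" "linear Y"
      "superjet u x1 px X" "superjet (\<lambda>x. - u x) y1 py Y"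
      and form: "\<And>h k. h \<bullet> X h + k \<bullet> Y k \<le> (h, k) \<bullet> A (h, k) + 1 * ((norm h)\<^sup>2 + (norm k)\<^sup>2)"
      using theorem_on_sums[OF linA sA c1 r(1) above zero_less_one] by metis
    obtain S where S: "sym_matrix S" "\<And>h. h \<bullet> (S *v h) = h \<bullet> X h" using symmetric_part[OF J(3)] by blast
    obtain T where T: "sym_matrix T" "\<And>h. h \<bullet> (T *v h) = h \<bullet> Y h" using symmetric_part[OF J(4)] by blast
    have xU: "x1 \<in> ball 0 1" "y1 \<in> ball 0 1" using J(1,2) sub ball_subset_cball by blast+
    have us1: "jet_sub F (ball 0 1) u" "jet_sub (dual_operator F) (ball 0 1) (\<lambda>x. - u x)" using us by (auto simp: jet_sol_def)
    have 1: "F S \<le> 0" using jet_subD[OF us1(1) xU(1) S(1) superjet_form_cong[OF J(5)]] S(2) by simp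
    have 2: "dual_operator F T \<le> 0" using jet_subD[OF us1(2) xU(2) T(1) superjet_form_cong[OF J(6)]] T(2) by simp
    have G0: "G 0 = 0" by (rule linear_0[OF linG])
    \<comment> \<open>For equal displacements the distance does not change. What remains is
      \<open>64\<close> from the localising term and \<open>2\<close> from the error of the theorem
      on sums.\<close>
    have le: "h \<bullet> (S *v h) \<le> h \<bullet> ((- T) *v h) + 66 * (norm h)\<^sup>2" for h
      using form[of h h] S(2)[of h] T(2)[of h] by (simp add: Aform mv_simps G0)
    \<comment> \<open>Opposite displacements along \<open>e\<close> change the distance at double
      speed, and the concavity contributes \<open>- 2 * L\<close>.\<close>
    have gap: "e \<bullet> (S *v e) \<le> e \<bullet> ((- T) *v e) - (2 * L - 66)"
    proof -
      have "(e - - e) \<bullet> G (e - - e) = - (2 * L)"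
        unfolding Gform using d e1 ee by (simp add: scaleR_2[symmetric] power2_eq_square)
      then have "e \<bullet> X e + (- e) \<bullet> Y (- e) \<le> - (2 * L) + 66" using form[of e "- e"] e1 by (simp add: Aform)
      moreover have "(- e) \<bullet> Y (- e) = e \<bullet> Y e" using linear_neg[OF J(4)] by simp
      ultimately show ?thesis using S(2)[of e] T(2)[of e] by (simp add: mv_simps)
    qed
    have "F (- T) \<le> F S + Lam * (real CARD('n) * 66) - lam * ((2 * L - 66) / real CARD('n))"
      using S T le e1 gap by (intro compare_forms_gap) auto
    moreover have "Lam * (real CARD('n) * 66) < lam * ((2 * L - 66) / real CARD('n))"
      using lam by (simp add: L_def lip_const_def field_simps)
    ultimately show False using 1 2 by (simp add: dual_operator_def)
  qed
  moreover have "\<Theta> (x, y) \<le> \<Theta> Z" using xy by (intro Z(2)) (simp add: K_def)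
  ultimately have "u x - u y \<le> L * (norm (x - y) - (norm (x - y))\<^sup>2 / 4) + 32 * (norm x)\<^sup>2" by (simp add: \<Theta>_def)
  also have "L * (norm (x - y) - (norm (x - y))\<^sup>2 / 4) \<le> L * norm (x - y)" using L by (intro mult_left_mono) auto
  finally show ?thesis by (simp add: L_def)
qed

text \<open>After rescaling to the unit ball the auxiliary estimate is used with its first point at
  the centre, where the localising term vanishes; applied to \<open>- v\<close> and the dual
  operator it gives the other sign.\<close>

theorem lipschitz_estimate:
  fixes u :: "real^'n \<Rightarrow> real"
  assumes us: "jet_sol F (ball y s) u" and uc: "continuous_on (ball y s) u" and s: "0 < s" and S: "0 < S"
    and ub: "\<And>x. x \<in> ball y s \<Longrightarrow> \<bar>u x\<bar> \<le> S" and x: "norm (x - y) \<le> s / 2"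
  shows "\<bar>u x - u y\<bar> \<le> lip_const * (S / s) * norm (x - y)"
proof -
  define v where "v z = (1 / S) * u (y + s *\<^sub>R z)" for z
  have inb: "y + s *\<^sub>R z \<in> ball y s" if "z \<in> ball 0 1" for z
    using that s by (simp add: dist_norm)
  have "jet_sol F (ball 0 s) (\<lambda>z. u (y + z))"
    using us by (rule jet_sol_translate) (simp add: dist_norm)
  then have "jet_sol F (ball 0 1) (\<lambda>z. u (y + s *\<^sub>R z))"
    using s by (intro jet_sol_rescale[where u = "\<lambda>z. u (y + z)"]) auto
  then have vs: "jet_sol F (ball 0 1) v"
    unfolding v_def using S by (intro jet_sol_cmult) auto
  have vc: "continuous_on (ball 0 1) v"
    unfolding v_def using inb by (intro continuous_intros continuous_on_compose2[OF uc]) auto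
  have vb: "\<bar>v z\<bar> \<le> 1" if "z \<in> ball 0 1" for z
    using ub[OF inb[OF that]] S by (simp add: v_def abs_mult)
  have vs': "jet_sol (dual_operator F) (ball 0 1) (\<lambda>z. - v z)" using vs by (rule jet_sol_dual)
  define z where "z = (1 / s) *\<^sub>R (x - y)"
  have "norm z = norm (x - y) / s" using s by (simp add: z_def)
  then have z: "norm z \<le> 1 / 2" "x = y + s *\<^sub>R z" using x s by (auto simp: z_def pos_divide_le_eq)
  have "v 0 - v z \<le> lip_const * norm (0 - z) + 32 * (norm (0::real^'n))\<^sup>2"
    using z by (intro lipschitz_estimate_aux[OF vs vc vb]) auto
  moreover have "(- v 0) - (- v z) \<le> elliptic_operator.lip_const TYPE('n) lam Lam * norm (0 - z) + 32 * (norm (0::real^'n))\<^sup>2"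
    using z vc vb by (intro elliptic_operator.lipschitz_estimate_aux[OF dual vs']) (auto intro: continuous_on_minus)
  ultimately have "\<bar>v z - v 0\<bar> \<le> lip_const * norm z" by (simp add: abs_le_iff)
  moreover have "v z - v 0 = (u x - u y) / S" unfolding z(2) by (simp add: v_def diff_divide_distrib)
  ultimately have "\<bar>u x - u y\<bar> \<le> S * (lip_const * norm z)" using S by (simp add: pos_divide_le_eq mult.commute)
  also have "\<dots> = lip_const * (S / s) * norm (x - y)" using s by (simp add: z_def)
  finally show ?thesis .
qed

end

subsection \<open>The Harnack inequality\<close>

lemma jet2_add_const: "jet2 g z p H \<Longrightarrow> jet2 (\<lambda>x. g x + c) z p H"
  unfolding jet2_def by simp

context elliptic_operator
begin

text \<open>In the annulus \<open>u\<close> is compared with the decaying power that equals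
  \<open>m\<close> on the inner sphere and \<open>0\<close> on the outer one. This barrier is a
  strict subsolution, so \<open>u - g\<close> cannot have a negative interior minimum.\<close>

lemma supersolution_growth:
  fixes u :: "real^'n \<Rightarrow> real"
  assumes us: "jet_sub (dual_operator F) (ball y R) (\<lambda>x. - u x)" and uc: "continuous_on (cball y R) u"
    and nn: "\<And>x. x \<in> cball y R \<Longrightarrow> 0 \<le> u x" and \<rho>: "0 < \<rho>" "\<rho> < R" and m: "0 < m"
    and inner: "\<And>x. x \<in> cball y \<rho> \<Longrightarrow> m \<le> u x" and z: "dist y z \<le> R / 2"
  shows "m * (min 1 (4 powr decay - 1) * (\<rho> / R) powr (2 * decay)) \<le> u z"
proof -
  define s where "s = decay"
  have s: "s > 0" using decay by (simp add: s_def)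
  \<comment> \<open>At distance \<open>R / 2\<close> from the centre the barrier exceeds its
    boundary level by the factor \<open>4 powr s - 1\<close> times \<open>R powr (- 2 * s)\<close>;
    the minimum with \<open>1\<close> covers a point \<open>z\<close> in the inner ball.\<close>
  define c where "c = min 1 (4 powr s - 1)"
  have c: "0 < c" "c \<le> 1" "c \<le> 4 powr s - 1" using s gr_one_powr[of 4 s] by (auto simp: c_def)
  have sqp: "(r\<^sup>2) powr (- s) = r powr (- 2 * s)" if "0 < r" for r :: real
    using that by (simp add: powr_powr flip: powr_numeral)
  have q1: "(\<rho> / R) powr (2 * s) \<le> 1" using \<rho> s powr_mono2[of "2 * s" "\<rho> / R" 1] by simp
  show ?thesis
  proof (cases "dist y z \<le> \<rho>")
    case True
    have "c * (\<rho> / R) powr (2 * s) \<le> 1 * 1" using c q1 by (intro mult_mono) auto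
    then have "m * (c * (\<rho> / R) powr (2 * s)) \<le> m * 1" using m by (intro mult_left_mono) auto
    then show ?thesis using inner[of z] True by (simp add: c_def s_def)
  next
    case False
    define b where "b x = ((x - y) \<bullet> (x - y)) powr (- s)" for x
    have bd: "b x = (dist y x) powr (- 2 * s)" if "x \<noteq> y" for x
      using sqp[of "dist y x"] that by (simp add: b_def dist_norm norm_minus_commute[of y] power2_norm_eq_inner)
    define k where "k = m / (\<rho> powr (- 2 * s) - R powr (- 2 * s))"
    have "R powr (- 2 * s) < \<rho> powr (- 2 * s)" using \<rho> s by (intro powr_less_mono2_neg) auto
    then have k: "k > 0" "k * (\<rho> powr (- 2 * s) - R powr (- 2 * s)) = m" using m by (auto simp: k_def)
    define g where "g x = k * b x + - (k * R powr (- 2 * s))" for x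
    define A where "A = {x\<in>cball y R. \<rho> \<le> dist y x}"
    have "closed A" unfolding A_def by (intro continuous_on_closed_Collect_le continuous_intros closed_cball)
    moreover have "A \<subseteq> cball y R" by (auto simp: A_def)
    then have "bounded A" using bounded_cball bounded_subset by blast
    ultimately have Ac: "compact A" by (simp add: compact_eq_bounded_closed)
    have zA: "z \<in> A" using False z \<rho> by (auto simp: A_def)
    have ny: "x \<noteq> y" if "x \<in> A" for x using that \<rho> by (auto simp: A_def)
    have "continuous_on A (\<lambda>x. u x - g x)"
      unfolding g_def b_def using ny
      by (intro continuous_intros continuous_on_subset[OF uc \<open>A \<subseteq> cball y R\<close>]) auto
    then obtain a where a: "a \<in> A" "\<And>x. x \<in> A \<Longrightarrow> u a - g a \<le> u x - g x"
      using continuous_attains_inf[OF Ac] zA by blast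
    have "0 \<le> u a - g a"
    proof (rule ccontr)
      assume neg: "\<not> ?thesis"
      have na: "dist y a \<noteq> \<rho>"
      proof
        assume "dist y a = \<rho>"
        then have "g a = m" using bd[OF ny[OF a(1)]] k(2) by (simp add: g_def right_diff_distrib)
        then show False using inner[of a] neg \<open>dist y a = \<rho>\<close> by simp
      qed
      have nb: "dist y a \<noteq> R"
      proof
        assume "dist y a = R"
        then have "g a = 0" using bd[OF ny[OF a(1)]] by (simp add: g_def)
        then show False using nn[of a] neg \<open>dist y a = R\<close> by simp
      qed
      define r where "r = min (dist y a - \<rho>) (R - dist y a)"
      have r: "r > 0" using na nb a(1) by (auto simp: r_def A_def)
      have sub: "x \<in> A" if "x \<in> ball a r" for x
        using that dist_triangle[of y x a] dist_triangle[of y a x] by (auto simp: A_def r_def dist_commute)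
      define H where "H = radial_hessian (- decay) (a - y)"
      have "jet2 (\<lambda>x. - g x) a (- (k *\<^sub>R ((2 * - decay * ((a - y) \<bullet> (a - y)) powr (- decay - 1)) *\<^sub>R (a - y))))
          (\<lambda>h. - (k *\<^sub>R (H *v h)))"
        unfolding g_def b_def s_def H_def
        by (intro jet2_uminus jet2_add_const jet2_cmult jet2_radial_power ny a)
      then have "superjet (\<lambda>x. - g x + (g a - u a)) a (- (k *\<^sub>R ((2 * - decay * ((a - y) \<bullet> (a - y)) powr (- decay - 1)) *\<^sub>R (a - y))))
          (\<lambda>h. - (k *\<^sub>R (H *v h)))"
        by (intro jet2_imp_superjet jet2_add_const)
      then have "superjet (\<lambda>x. - u x) a (- (k *\<^sub>R ((2 * - decay * ((a - y) \<bullet> (a - y)) powr (- decay - 1)) *\<^sub>R (a - y))))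
          (\<lambda>h. - (k *\<^sub>R (H *v h)))"
        by (rule superjet_le[OF _ r]) (use a(2) sub in \<open>fastforce+\<close>)
      then have "superjet (\<lambda>x. - u x) a (- (k *\<^sub>R ((2 * - decay * ((a - y) \<bullet> (a - y)) powr (- decay - 1)) *\<^sub>R (a - y))))
          ((*v) (- (k *\<^sub>R H)))"
        by (rule superjet_form_cong) (simp add: mv_simps)
      moreover have "a \<in> ball y R" using a(1) nb by (auto simp: A_def)
      ultimately have "dual_operator F (- (k *\<^sub>R H)) \<le> 0"
        using jet_subD[OF us] by (simp add: H_def)
      then have "0 \<le> F (k *\<^sub>R H)" by (simp add: dual_operator_def)
      also have "F (k *\<^sub>R H) = k * F H" using k by (intro F_scaleR) (auto simp: H_def)
      also have "\<dots> < 0" using k F_radial_barrier[of "a - y"] ny[OF a(1)] by (simp add: H_def mult_less_0_iff)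
      finally show False by simp
    qed
    then have gz: "g z \<le> u z" using a(2)[OF zA] by linarith
    have zy: "z \<noteq> y" using ny zA by blast
    have R0: "R > 0" using \<rho> by simp
    have "(R / 2) powr (- 2 * s) \<le> dist y z powr (- 2 * s)" using z zy s by (intro powr_mono2') auto
    moreover have "(R / 2) powr (- 2 * s) = 4 powr s * R powr (- 2 * s)"
    proof -
      have "(2::real) powr (- 2 * s) = 4 powr (- s)"
        using powr_powr[of 2 2 "- s"] by simp
      then show ?thesis using R0 by (simp add: powr_divide powr_minus_divide)
    qed
    ultimately have "(4 powr s - 1) * R powr (- 2 * s) \<le> b z - R powr (- 2 * s)"
      using bd[OF zy] by (simp add: left_diff_distrib)
    then have 1: "k * ((4 powr s - 1) * R powr (- 2 * s)) \<le> g z"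
      using k mult_left_mono[of _ "b z - R powr (- 2 * s)" k] by (simp add: g_def right_diff_distrib)
    have "m / \<rho> powr (- 2 * s) \<le> k"
      unfolding k_def using m \<rho> \<open>R powr (- 2 * s) < \<rho> powr (- 2 * s)\<close> by (intro divide_left_mono) auto
    moreover have "m / \<rho> powr (- 2 * s) = m * \<rho> powr (2 * s)" by (simp add: powr_minus_divide)
    ultimately have "(m * \<rho> powr (2 * s)) * (c * R powr (- 2 * s)) \<le> k * ((4 powr s - 1) * R powr (- 2 * s))"
      using c m k by (intro mult_mono) auto
    moreover have "(m * \<rho> powr (2 * s)) * (c * R powr (- 2 * s)) = m * (c * (\<rho> / R) powr (2 * s))"
      using \<rho> by (simp add: powr_divide powr_minus_divide)
    ultimately show ?thesis using 1 gz unfolding c_def s_def by linarith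
  qed
qed

text \<open>The weight \<open>(1/4 - \<bar>y\<bar>) powr q\<close> balances the blow-up of the growth estimate: at a maximum of the weighted
  function the oscillation is controlled by the Lipschitz estimate, so the solution is comparable to its value
  there on a ball of comparable size, and the growth estimate applies.\<close>

lemma harnack_unit_ball:
  obtains C where "0 < C" "\<And>u x z. jet_sol F (ball 0 1) u \<Longrightarrow> continuous_on (ball 0 1) u \<Longrightarrow>
    (\<And>x. x \<in> ball 0 1 \<Longrightarrow> 0 < u x) \<Longrightarrow> norm (x::real^'n) \<le> 1/8 \<Longrightarrow> norm z \<le> 1/8 \<Longrightarrow> u x \<le> C * u z"
proof -
  define q where "q = 2 * decay"
  have q: "q > 0" using decay by (simp add: q_def)
  define L where "L = lip_const"
  have L: "L > 0" using lip_const by (simp add: L_def)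
  \<comment> \<open>On a ball of radius \<open>k * d\<close> around the maximum point the Lipschitz
    estimate then permits an oscillation of at most \<open>H / 2\<close>; the bound
    \<open>1/4\<close> keeps this ball within the range of the estimate.\<close>
  define k where "k = min (1/4) (1 / (4 * L * 2 powr q))"
  have k: "0 < k" "k \<le> 1/4" "k \<le> 1 / (4 * L * 2 powr q)" using L by (auto simp: k_def)
  define c where "c = min 1 (4 powr decay - 1)"
  have c: "0 < c" using decay gr_one_powr[of 4 decay] by (auto simp: c_def)
  define C where "C = 8 powr q * 2 / (c * k powr q)"
  have C: "C > 0" using c k by (simp add: C_def)
  have "u x \<le> C * u z" if us: "jet_sol F (ball 0 1) u" and uc: "continuous_on (ball 0 1) u"
    and up: "\<And>x. x \<in> ball 0 1 \<Longrightarrow> 0 < u x" and x: "norm x \<le> 1/8" and z: "norm z \<le> 1/8" for u and x z :: "real^'n"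
  proof -
    define f where "f y = u y * (1/4 - norm y) powr q" for y
    have "continuous_on (cball 0 (1/4)) f"
      unfolding f_def using q
      by (intro continuous_on_mult continuous_on_powr' continuous_intros continuous_on_subset[OF uc]) auto
    then obtain y where y: "y \<in> cball 0 (1/4)" "\<And>y'. y' \<in> cball 0 (1/4) \<Longrightarrow> f y' \<le> f y"
      using continuous_attains_sup[of "cball (0::real^'n) (1/4)" f] by auto
    define T where "T = f y"
    have "0 < f z" using up[of z] z by (simp add: f_def)
    also have "f z \<le> T" unfolding T_def using z by (intro y(2)) simp
    finally have T: "T > 0" .
    have ny: "norm y < 1/4"
    proof (rule ccontr)
      assume "\<not> ?thesis" then have "norm y = 1/4" using y(1) by simp
      then have "f y = 0" unfolding f_def by simp
      then show False using T by (simp add: T_def)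
    qed
    define d where "d = 1/4 - norm y"
    have d: "d > 0" "d \<le> 1/4" using ny by (auto simp: d_def)
    define H where "H = u y"
    have H: "H > 0" using up[of y] ny by (simp add: H_def)
    have TH: "T = H * d powr q" by (simp add: T_def f_def H_def d_def)
    \<comment> \<open>In the ball of radius \<open>d / 2\<close> the weight is at least
      \<open>(d / 2) powr q\<close>, so maximality of the weighted value bounds \<open>u\<close> by
      \<open>2 powr q\<close> times its value at \<open>y\<close>.\<close>
    have upper: "u x' \<le> 2 powr q * H" if x': "x' \<in> ball y (d / 2)" for x'
    proof -
      have "norm x' \<le> norm y + dist y x'" using norm_triangle_ineq[of y "x' - y"] by (simp add: dist_norm norm_minus_commute)
      then have n: "d / 2 \<le> 1/4 - norm x'" using x' by (simp add: d_def)
      have "(d / 2) powr q \<le> (1/4 - norm x') powr q" using n d q by (intro powr_mono2) auto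
      then have "u x' * (d / 2) powr q \<le> f x'"
        unfolding f_def using up[of x'] n d by (intro mult_left_mono) auto
      also have "\<dots> \<le> T" unfolding T_def using n d by (intro y(2)) auto
      finally have "u x' * (d powr q / 2 powr q) \<le> H * d powr q" unfolding TH using d by (simp add: powr_divide)
      then show ?thesis using d by (simp add: field_simps)
    qed
    define \<rho> where "\<rho> = k * d"
    have \<rho>: "0 < \<rho>" "\<rho> \<le> d / 4" using k d mult_right_mono[OF k(2), of d] by (auto simp: \<rho>_def)
    have sub: "ball y (d / 2) \<subseteq> ball 0 1"
    proof
      fix x' assume "x' \<in> ball y (d / 2)"
      then show "x' \<in> ball 0 1" using norm_triangle_ineq[of y "x' - y"] ny d by (simp add: dist_norm norm_minus_commute)
    qed
    have lower: "H / 2 \<le> u x'" if x': "x' \<in> cball y \<rho>" for x'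
    proof -
      have n: "norm (x' - y) \<le> \<rho>" using x' by (simp add: dist_norm norm_minus_commute)
      have "\<bar>u x' - u y\<bar> \<le> lip_const * ((2 powr q * H) / (d / 2)) * norm (x' - y)"
      proof (rule lipschitz_estimate)
        show "jet_sol F (ball y (d / 2)) u" by (rule jet_sol_subset[OF us sub])
        show "continuous_on (ball y (d / 2)) u" by (rule continuous_on_subset[OF uc sub])
        show "\<bar>u x\<bar> \<le> 2 powr q * H" if "x \<in> ball y (d / 2)" for x
          using upper[OF that] up[of x] sub that by force
      qed (use d H n \<rho> in auto)
      also have "\<dots> \<le> L * ((2 powr q * H) / (d / 2)) * \<rho>"
        unfolding L_def[symmetric] using n L H d by (intro mult_left_mono) auto
      also have "\<dots> = (2 * L * 2 powr q * H) * k" using d by (simp add: \<rho>_def)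
      also have "\<dots> \<le> (2 * L * 2 powr q * H) * (1 / (4 * L * 2 powr q))" using k L H by (intro mult_left_mono) auto
      also have "\<dots> = H / 2" using L by simp
      finally have "\<bar>u x' - u y\<bar> \<le> H / 2" .
      from abs_le_D2[OF this] show ?thesis by (simp add: H_def)
    qed
    \<comment> \<open>Around \<open>y\<close> a ball of radius \<open>3/4\<close> fits into the unit
      ball, and \<open>z\<close> lies within half of it. The exponent \<open>2 * decay\<close>
      equals the weight exponent \<open>q\<close>, so the loss \<open>d powr q\<close> is exactly
      the factor contained in \<open>T\<close>.\<close>
    have "H / 2 * (min 1 (4 powr decay - 1) * (\<rho> / (3/4)) powr (2 * decay)) \<le> u z"
    proof (rule supersolution_growth[of y "3/4" u \<rho> "H / 2" z])
      have s34: "cball y (3/4) \<subseteq> ball 0 1"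
      proof
        fix x' assume "x' \<in> cball y (3/4)"
        then show "x' \<in> ball 0 1" using norm_triangle_ineq[of y "x' - y"] ny by (simp add: dist_norm norm_minus_commute)
      qed
      show "jet_sub (dual_operator F) (ball y (3/4)) (\<lambda>x. - u x)"
        using us s34 ball_subset_cball unfolding jet_sol_def by (blast intro: jet_sub_subset)
      show "continuous_on (cball y (3/4)) u" by (rule continuous_on_subset[OF uc s34])
      show "0 \<le> u x" if "x \<in> cball y (3/4)" for x using up[of x] s34 that by force
      show "dist y z \<le> 3/4/2" using norm_triangle_ineq4[of y z] ny z by (simp add: dist_norm)
    qed (use \<rho> d H lower in auto)
    then have "H / 2 * (c * (\<rho> / (3/4)) powr q) \<le> u z" by (simp add: c_def q_def)
    moreover have "\<rho> powr q \<le> (\<rho> / (3/4)) powr q" using \<rho> q by (intro powr_mono2) auto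
    then have "H / 2 * (c * \<rho> powr q) \<le> H / 2 * (c * (\<rho> / (3/4)) powr q)" using H c by (intro mult_left_mono) auto
    moreover have "H / 2 * (c * \<rho> powr q) = (c * k powr q / 2) * T"
      unfolding TH \<rho>_def using k d by (simp add: powr_mult)
    ultimately have Tz: "(c * k powr q / 2) * T \<le> u z" by linarith
    have "u x * (1/8) powr q \<le> f x"
      unfolding f_def using x up[of x] q by (intro mult_left_mono powr_mono2) auto
    also have "\<dots> \<le> T" unfolding T_def using x by (intro y(2)) simp
    finally have "u x * (1/8) powr q \<le> T" .
    moreover have "(1/8) powr q = 1 / (8::real) powr q" by (simp add: powr_divide)
    ultimately have "u x \<le> 8 powr q * T" by (simp add: pos_divide_le_eq mult.commute)
    also have "8 powr q * T = C * ((c * k powr q / 2) * T)" using c k by (simp add: C_def)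
    also have "\<dots> \<le> C * u z" using Tz C by (intro mult_left_mono) auto
    finally show ?thesis .
  qed
  then show thesis using that C by blast
qed

text \<open>Rescaling to the unit ball; the strict positivity required there is obtained by adding a
  constant \<open>e\<close>, which then tends to \<open>0\<close>.\<close>

lemma harnack_ball:
  obtains C where "0 < C" "\<And>u y s x z. 0 < s \<Longrightarrow> jet_sol F (ball y s) u \<Longrightarrow> continuous_on (ball y s) u \<Longrightarrow>
    (\<And>x. x \<in> ball y s \<Longrightarrow> 0 \<le> u x) \<Longrightarrow> dist (y::real^'n) x \<le> s/8 \<Longrightarrow> dist y z \<le> s/8 \<Longrightarrow> u x \<le> C * u z"
proof -
  obtain C where C: "0 < C" "\<And>u x z. jet_sol F (ball 0 1) u \<Longrightarrow> continuous_on (ball 0 1) u \<Longrightarrow>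
    (\<And>x. x \<in> ball 0 1 \<Longrightarrow> 0 < u x) \<Longrightarrow> norm (x::real^'n) \<le> 1/8 \<Longrightarrow> norm z \<le> 1/8 \<Longrightarrow> u x \<le> C * u z"
    using harnack_unit_ball by metis
  have "u x \<le> C * u z" if s: "0 < s" and us: "jet_sol F (ball y s) u" and uc: "continuous_on (ball y s) u"
    and nn: "\<And>x. x \<in> ball y s \<Longrightarrow> 0 \<le> u x" and x: "dist y x \<le> s/8" and z: "dist y z \<le> s/8" for u s and y x z :: "real^'n"
  proof -
    have "jet_sol F (ball 0 s) (\<lambda>z. u (y + z))"
      using us by (rule jet_sol_translate) (simp add: dist_norm)
    then have j: "jet_sol F (ball 0 1) (\<lambda>z. u (y + s *\<^sub>R z))"
      using s by (intro jet_sol_rescale[where u = "\<lambda>z. u (y + z)"]) auto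
    have inb: "y + s *\<^sub>R z \<in> ball y s" if "z \<in> ball 0 1" for z using that s by (simp add: dist_norm)
    have c: "continuous_on (ball 0 1) (\<lambda>z. u (y + s *\<^sub>R z))"
      using inb by (intro continuous_on_compose2[OF uc] continuous_intros) auto
    have sc: "norm ((1 / s) *\<^sub>R (x - y)) \<le> 1/8" "norm ((1 / s) *\<^sub>R (z - y)) \<le> 1/8"
      using x z s by (auto simp: dist_norm norm_minus_commute[of y] pos_divide_le_eq simp del: scaleR_diff_right)
    have "u x \<le> C * u z + (C * e - e)" if e: "e > 0" for e
    proof -
      have "u (y + s *\<^sub>R ((1 / s) *\<^sub>R (x - y))) + e \<le> C * (u (y + s *\<^sub>R ((1 / s) *\<^sub>R (z - y))) + e)"
      proof (rule C(2)[of "\<lambda>z. u (y + s *\<^sub>R z) + e"])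
        show "jet_sol F (ball 0 1) (\<lambda>z. u (y + s *\<^sub>R z) + e)" using j by (rule jet_sol_add_const)
        show "continuous_on (ball 0 1) (\<lambda>z. u (y + s *\<^sub>R z) + e)" using c by (intro continuous_intros)
        show "0 < u (y + s *\<^sub>R x') + e" if "x' \<in> ball 0 1" for x' using nn[OF inb[OF that]] e by simp
      qed (use sc in auto)
      then show ?thesis using s by (simp add: distrib_left)
    qed
    then have lim: "u x \<le> C * u z + C * e" if "e > 0" for e using that by (smt (verit))
    show ?thesis
    proof (rule field_le_epsilon)
      fix e :: real assume "0 < e"
      then show "u x \<le> C * u z + e" using lim[of "e / C"] C(1) by simp
    qed
  qed
  then show thesis using that C(1) by blast
qed

end

section \<open>Harnack inequality on spheres and compactness of solutions in a ring\<close>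

lemma open_ring: "open {x::'a::real_normed_vector. r < norm x \<and> norm x < R}"
  by (intro open_Collect_conj open_Collect_less continuous_intros)

lemma connected_ring:
  assumes "2 \<le> DIM('a::euclidean_space)" "0 < r"
  shows "connected {x::'a. r < norm x \<and> norm x < R}"
proof -
  have "{x::'a. r < norm x \<and> norm x < R} = (\<lambda>(t, x). t *\<^sub>R x) ` ({r<..<R} \<times> sphere 0 1)"
  proof (intro equalityI subsetI)
    fix x :: 'a assume x: "x \<in> {x. r < norm x \<and> norm x < R}"
    then have "x \<noteq> 0" using assms by auto
    then have "x = (\<lambda>(t, x). t *\<^sub>R x) (norm x, x /\<^sub>R norm x)" "(norm x, x /\<^sub>R norm x) \<in> {r<..<R} \<times> sphere 0 1"
      using x by auto
    then show "x \<in> (\<lambda>(t, x). t *\<^sub>R x) ` ({r<..<R} \<times> sphere 0 1)" by (rule image_eqI)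
  qed (use assms in auto)
  moreover have "connected ({r<..<R} \<times> sphere (0::'a) 1)"
    using assms by (intro connected_Times connected_sphere) auto
  moreover have "continuous_on ({r<..<R} \<times> sphere (0::'a) 1) (\<lambda>(t, x). t *\<^sub>R x)"
    unfolding split_def by (intro continuous_intros)
  ultimately show ?thesis using connected_continuous_image by metis
qed

context elliptic_operator
begin

text \<open>Local Harnack inequalities are chained over the sphere, which is connected because the
  dimension is at least \<open>2\<close>. The relation \<open>Rel\<close> quantifies over all
  admissible \<open>u\<close>, so its constant does not depend on \<open>u\<close>; a finite cover
  and the base point \<open>e\<close> make it independent of the two points as well.\<close>

lemma harnack_sphere:
  assumes n: "2 \<le> CARD('n)"
  obtains C where "0 < C" "\<And>u x z. jet_sol F {x. 1/4 < norm x \<and> norm x < 4} u \<Longrightarrow>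
    continuous_on {x. 1/4 < norm x \<and> norm x < 4} u \<Longrightarrow> (\<And>x. 1/4 < norm x \<Longrightarrow> norm x < 4 \<Longrightarrow> 0 \<le> u x) \<Longrightarrow>
    x \<in> sphere (0::real^'n) 1 \<Longrightarrow> z \<in> sphere 0 1 \<Longrightarrow> u x \<le> C * u z"
proof -
  define U where "U = {u. jet_sol F {x. 1/4 < norm x \<and> norm x < 4} u \<and> continuous_on {x. 1/4 < norm x \<and> norm x < 4} u
    \<and> (\<forall>x::real^'n. 1/4 < norm x \<longrightarrow> norm x < 4 \<longrightarrow> 0 \<le> u x)}"
  obtain C0 where C0: "0 < C0" "\<And>u y s x z. 0 < s \<Longrightarrow> jet_sol F (ball y s) u \<Longrightarrow> continuous_on (ball y s) u \<Longrightarrow>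
    (\<And>x. x \<in> ball y s \<Longrightarrow> 0 \<le> u x) \<Longrightarrow> dist (y::real^'n) x \<le> s/8 \<Longrightarrow> dist y z \<le> s/8 \<Longrightarrow> u x \<le> C0 * u z"
    using harnack_ball by metis
  have loc: "u x \<le> C0 * u z" if u: "u \<in> U" and y: "y \<in> sphere 0 1" and x: "dist y x < 1/16" and z: "dist y z < 1/16" for u y x z
  proof -
    have sub: "ball y (1/2) \<subseteq> {x. 1/4 < norm x \<and> norm x < 4}"
    proof
      fix x assume "x \<in> ball y (1/2)"
      then show "x \<in> {x. 1/4 < norm x \<and> norm x < 4}"
        using y norm_triangle_ineq4[of y "y - x"] norm_triangle_ineq2[of y "y - x"] by (simp add: dist_norm)
    qed
    show ?thesis
    proof (rule C0(2)[of "1/2" y])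
      show "jet_sol F (ball y (1/2)) u" using u sub jet_sol_subset unfolding U_def by blast
      show "continuous_on (ball y (1/2)) u" using u sub continuous_on_subset unfolding U_def by blast
      show "0 \<le> u x" if "x \<in> ball y (1/2)" for x using u sub that unfolding U_def by blast
    qed (use x z in auto)
  qed
  define Rel where "Rel x z \<longleftrightarrow> (\<exists>C>0. \<forall>u\<in>U. u x \<le> C * u z \<and> u z \<le> C * u x)" for x z :: "real^'n"
  have rel: "Rel a b" if ab: "a \<in> sphere 0 1" "b \<in> sphere 0 1" for a b
  proof (rule connected_equivalence_relation[of "sphere (0::real^'n) 1" a b Rel])
    show "connected (sphere (0::real^'n) 1)" using n by (intro connected_sphere) simp
    show "Rel y x" if "Rel x y" for x y using that unfolding Rel_def by blast
    show "Rel x z" if xy: "Rel x y" and yz: "Rel y z" for x y z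
    proof -
      obtain C where C: "C > 0" "\<And>u. u \<in> U \<Longrightarrow> u x \<le> C * u y" "\<And>u. u \<in> U \<Longrightarrow> u y \<le> C * u x"
        using xy unfolding Rel_def by blast
      obtain C' where C': "C' > 0" "\<And>u. u \<in> U \<Longrightarrow> u y \<le> C' * u z" "\<And>u. u \<in> U \<Longrightarrow> u z \<le> C' * u y"
        using yz unfolding Rel_def by blast
      have "u x \<le> (C * C') * u z \<and> u z \<le> (C * C') * u x" if "u \<in> U" for u
      proof -
        have "C * u y \<le> C * (C' * u z)" "C' * u y \<le> C' * (C * u x)"
          using C'(2)[OF that] C(3)[OF that] C(1) C'(1) by simp_all
        then have "u x \<le> C * (C' * u z)" "u z \<le> C' * (C * u x)" using C(2)[OF that] C'(3)[OF that] by linarith+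
        then show ?thesis by (simp add: mult_ac)
      qed
      then show ?thesis unfolding Rel_def using C(1) C'(1) by (intro exI[of _ "C * C'"]) auto
    qed
    show "\<exists>T. openin (top_of_set (sphere 0 1)) T \<and> y \<in> T \<and> (\<forall>x\<in>T. Rel y x)" if y: "y \<in> sphere 0 1" for y
    proof (intro exI[of _ "sphere 0 1 \<inter> ball y (1/16)"] conjI ballI)
      show "openin (top_of_set (sphere 0 1)) (sphere 0 1 \<inter> ball y (1/16))" by (intro openin_open_Int open_ball)
      fix x assume "x \<in> sphere 0 1 \<inter> ball y (1/16)"
      then have "dist y x < 1/16" by simp
      then have "\<forall>u\<in>U. u y \<le> C0 * u x \<and> u x \<le> C0 * u y" using loc[OF _ y] by simp
      then show "Rel y x" unfolding Rel_def using C0(1) by blast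
    qed (use y in auto)
  qed (use ab in auto)
  define e :: "real^'n" where "e = axis undefined 1"
  have e: "e \<in> sphere 0 1" by (simp add: e_def)
  obtain A where A: "finite A" "A \<subseteq> sphere (0::real^'n) 1" "sphere 0 1 \<subseteq> (\<Union>a\<in>A. ball a (1/16))"
  proof -
    have "sphere (0::real^'n) 1 \<subseteq> (\<Union>a\<in>sphere 0 1. ball a (1/16))" by force
    then show thesis using compactE_image[OF compact_sphere, of "sphere (0::real^'n) 1" "\<lambda>a. ball a (1/16)" 0 1] that by blast
  qed
  have "\<forall>a\<in>A. \<exists>C>0. \<forall>u\<in>U. u a \<le> C * u e \<and> u e \<le> C * u a" using rel[OF _ e] A(2) unfolding Rel_def by blast
  then obtain D where D: "\<And>a. a \<in> A \<Longrightarrow> D a > 0" "\<And>a u. a \<in> A \<Longrightarrow> u \<in> U \<Longrightarrow> u a \<le> D a * u e \<and> u e \<le> D a * u a" by metis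
  define M where "M = (\<Sum>a\<in>A. D a)"
  have DM: "D a \<le> M" if "a \<in> A" for a unfolding M_def using that A(1) D(1) by (intro member_le_sum) (auto intro: less_imp_le)
  have "A \<noteq> {}" using A(3) e by auto
  then have M: "M > 0" unfolding M_def using A(1) D(1) by (intro sum_pos) auto
  have nn: "0 \<le> u x" if "u \<in> U" "x \<in> sphere 0 1" for u x using that unfolding U_def by auto
  have "u x \<le> (C0 * M * M * C0) * u z" if u: "u \<in> U" and x: "x \<in> sphere 0 1" and z: "z \<in> sphere 0 1" for u x z
  proof -
    obtain a where a: "a \<in> A" "dist a x < 1/16" using A(3) x by auto
    obtain a' where a': "a' \<in> A" "dist a' z < 1/16" using A(3) z by auto
    have as: "a \<in> sphere 0 1" "a' \<in> sphere 0 1" using a a' A(2) by auto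
    have 1: "u x \<le> C0 * u a" using loc[OF u as(1) a(2), of a] by simp
    have 2: "u a' \<le> C0 * u z" using loc[OF u as(2) _ a'(2), of a'] by simp
    have 3: "u a \<le> M * u e"
      using D(2)[OF a(1) u] mult_right_mono[OF DM[OF a(1)] nn[OF u e]] by linarith
    have 4: "u e \<le> M * u a'"
      using D(2)[OF a'(1) u] mult_right_mono[OF DM[OF a'(1)] nn[OF u as(2)]] by linarith
    have "u x \<le> C0 * (M * (M * (C0 * u z)))"
      using 1 2 3 4 C0(1) M by (smt (verit) mult_left_mono)
    then show ?thesis by (simp add: mult.assoc)
  qed
  moreover have "C0 * M * M * C0 > 0" using C0(1) M by simp
  ultimately show thesis using that[of "C0 * M * M * C0"] unfolding U_def by blast
qed

text \<open>Quantitative touching: otherwise a locally uniform limit of a sequence of counterexamples touches \<open>G\<close>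
  from above without coinciding with it.\<close>

lemma touching_compactness:
  fixes G :: "real^'n \<Rightarrow> real"
  assumes n: "2 \<le> CARD('n)" and Gs: "jet_sol F {x. 1/4 < norm x \<and> norm x < 4} G"
    and Gc: "continuous_on {x. 1/4 < norm x \<and> norm x < 4} G" and e: "0 < e"
  obtains d where "0 < d" "\<And>u x z. jet_sol F {x. 1/4 < norm x \<and> norm x < 4} u \<Longrightarrow>
    continuous_on {x. 1/4 < norm x \<and> norm x < 4} u \<Longrightarrow> (\<And>x. 1/4 < norm x \<Longrightarrow> norm x < 4 \<Longrightarrow> \<bar>u x\<bar> \<le> S) \<Longrightarrow>
    (\<And>x. 1/4 < norm x \<Longrightarrow> norm x < 4 \<Longrightarrow> G x - d \<le> u x) \<Longrightarrow> norm x = 1 \<Longrightarrow> u x \<le> G x + d \<Longrightarrow> norm z = 1 \<Longrightarrow> u z \<le> G z + e"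
proof -
  define \<Omega> where "\<Omega> = {x::real^'n. 1/4 < norm x \<and> norm x < 4}"
  define P where "P d u \<longleftrightarrow> jet_sol F \<Omega> u \<and> continuous_on \<Omega> u \<and> (\<forall>x\<in>\<Omega>. \<bar>u x\<bar> \<le> S) \<and> (\<forall>x\<in>\<Omega>. G x - d \<le> u x)
    \<and> (\<exists>x. norm x = 1 \<and> u x \<le> G x + d)" for d u
  have "\<exists>d>0. \<forall>u. P d u \<longrightarrow> (\<forall>z. norm z = 1 \<longrightarrow> u z \<le> G z + e)"
  proof (rule ccontr)
    assume "\<not> ?thesis"
    then have "\<exists>u z. P (1 / Suc j) u \<and> norm z = 1 \<and> u z > G z + e" for j :: nat
      by (meson not_le of_nat_0_less_iff zero_less_Suc zero_less_divide_1_iff)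
    then obtain u z where u: "\<And>j::nat. P (1 / Suc j) (u j)" "\<And>j. norm (z j) = 1" "\<And>j. u j (z j) > G (z j) + e" by metis
    define S' where "S' = max S 1"
    have ub: "\<bar>u j x\<bar> \<le> S'" if "x \<in> \<Omega>" for j x using u(1)[of j] that unfolding P_def S'_def by (meson max.coboundedI1)
    have us: "jet_sol F \<Omega> (u j)" and uc: "continuous_on \<Omega> (u j)" for j using u(1)[of j] unfolding P_def by auto
    define K where "K = {x::real^'n. 1/2 \<le> norm x \<and> norm x \<le> 2}"
    have "closed K" unfolding K_def by (intro closed_Collect_conj closed_Collect_le continuous_intros)
    moreover have "K \<subseteq> cball 0 2" by (auto simp: K_def)
    then have "bounded K" using bounded_cball bounded_subset by blast
    ultimately have Kc: "compact K" by (simp add: compact_eq_bounded_closed)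
    have KO: "K \<subseteq> \<Omega>" by (auto simp: K_def \<Omega>_def)
    \<comment> \<open>The compact ring \<open>K\<close> keeps distance \<open>1/4\<close> from the
      boundary of \<Omega>, so all members of the sequence share one Lipschitz constant and are
      equicontinuous.\<close>
    have lip: "\<bar>u j y - u j x\<bar> \<le> lip_const * (S' / (1/4)) * norm (y - x)" if x: "x \<in> K" and y: "norm (y - x) \<le> 1/8" for j x y
    proof (rule lipschitz_estimate)
      have sub: "ball x (1/4) \<subseteq> \<Omega>"
      proof
        fix y assume "y \<in> ball x (1/4)"
        then show "y \<in> \<Omega>" using x norm_triangle_ineq4[of x "x - y"] norm_triangle_ineq2[of x "x - y"]
          by (simp add: dist_norm K_def \<Omega>_def)
      qed
      show "jet_sol F (ball x (1/4)) (u j)" by (rule jet_sol_subset[OF us sub])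
      show "continuous_on (ball x (1/4)) (u j)" by (rule continuous_on_subset[OF uc sub])
      show "\<bar>u j y\<bar> \<le> S'" if "y \<in> ball x (1/4)" for y using ub sub that by blast
    qed (use y in \<open>auto simp: S'_def\<close>)
    define B where "B = lip_const * (S' / (1/4))"
    have B: "B > 0" using lip_const by (simp add: B_def S'_def)
    have eq: "\<exists>d. 0 < d \<and> (\<forall>j y. y \<in> K \<and> norm (x - y) < d \<longrightarrow> norm (u j x - u j y) < \<epsilon>)" if x: "x \<in> K" and \<epsilon>: "0 < \<epsilon>" for x \<epsilon>
    proof (intro exI[of _ "min (1/8) (\<epsilon> / B)"] conjI allI impI)
      show "0 < min (1/8) (\<epsilon> / B)" using \<epsilon> B by simp
      fix j y assume y: "y \<in> K \<and> norm (x - y) < min (1/8) (\<epsilon> / B)"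
      then have "\<bar>u j y - u j x\<bar> \<le> B * norm (y - x)" unfolding B_def by (intro lip x) (simp add: norm_minus_commute)
      also have "\<dots> < B * (\<epsilon> / B)" using y B by (intro mult_strict_left_mono) (auto simp: norm_minus_commute)
      also have "\<dots> = \<epsilon>" using B by simp
      finally show "norm (u j x - u j y) < \<epsilon>" by (simp add: abs_minus_commute)
    qed
    obtain v k where v: "continuous_on K v" "strict_mono (k :: nat \<Rightarrow> nat)"
      "\<And>\<epsilon>. 0 < \<epsilon> \<Longrightarrow> \<exists>N. \<forall>n x. n \<ge> N \<and> x \<in> K \<longrightarrow> norm (u (k n) x - v x) < \<epsilon>"
    proof (rule Arzela_Ascoli[OF Kc, of u S'])
      show "norm (u n x) \<le> S'" if "x \<in> K" for n x using ub[of x n] that KO by auto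
    qed (use eq in blast)+
    define V where "V = {x::real^'n. 1/2 < norm x \<and> norm x < 2}"
    have V: "open V" "connected V" "V \<subseteq> K" "sphere 0 1 \<subseteq> V"
    proof -
      show "open V" unfolding V_def by (rule open_ring)
      show "connected V" unfolding V_def using n by (intro connected_ring) auto
    qed (auto simp: V_def K_def)
    have lim1: "\<exists>j. \<forall>x\<in>cball z r. \<bar>u (k j) x - v x\<bar> < \<epsilon>" if sub: "cball z r \<subseteq> K" and eps: "\<epsilon> > 0" for z r \<epsilon>
    proof -
      obtain N where "\<forall>n x. n \<ge> N \<and> x \<in> K \<longrightarrow> norm (u (k n) x - v x) < \<epsilon>" using v(3)[OF eps] by blast
      then show ?thesis using sub by (intro exI[of _ N]) auto
    qed
    have vs: "jet_sub F V v" "jet_sub (dual_operator F) V (\<lambda>x. - v x)"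
    proof -
      show "jet_sub F V v" unfolding jet_sub_def
      proof (intro ballI allI impI)
        fix z p X assume z: "z \<in> V" "sym_matrix X" "superjet v z p ((*v) X)"
        obtain r where r: "r > 0" "cball z r \<subseteq> V" using V(1) z(1) open_contains_cball by blast
        show "F X \<le> 0"
        proof (rule jet_sub_uniform_limit[OF r(1) _ _ _ z(2,3), where u = "\<lambda>j. u (k j)"])
          show "continuous_on (cball z r) (u (k j))" for j using r V KO by (intro continuous_on_subset[OF uc]) blast
          show "jet_sub F (ball z r) (u (k j))" for j
            using us[of "k j"] r V KO ball_subset_cball[of z r] unfolding jet_sol_def by (blast intro: jet_sub_subset)
          show "\<exists>j. \<forall>x\<in>cball z r. \<bar>u (k j) x - v x\<bar> < \<epsilon>" if "\<epsilon> > 0" for \<epsilon> using lim1 r V that by blast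
        qed
      qed
      show "jet_sub (dual_operator F) V (\<lambda>x. - v x)" unfolding jet_sub_def
      proof (intro ballI allI impI)
        fix z p X assume z: "z \<in> V" "sym_matrix X" "superjet (\<lambda>x. - v x) z p ((*v) X)"
        obtain r where r: "r > 0" "cball z r \<subseteq> V" using V(1) z(1) open_contains_cball by blast
        show "dual_operator F X \<le> 0"
        proof (rule elliptic_operator.jet_sub_uniform_limit[OF dual r(1) _ _ _ z(2,3), where u = "\<lambda>j x. - u (k j) x"])
          show "continuous_on (cball z r) (\<lambda>x. - u (k j) x)" for j
            using r V KO by (intro continuous_on_minus continuous_on_subset[OF uc]) blast
          show "jet_sub (dual_operator F) (ball z r) (\<lambda>x. - u (k j) x)" for j
            using us[of "k j"] r V KO ball_subset_cball[of z r] unfolding jet_sol_def by (blast intro: jet_sub_subset)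
          show "\<exists>j. \<forall>x\<in>cball z r. \<bar>- u (k j) x - - v x\<bar> < \<epsilon>" if "\<epsilon> > 0" for \<epsilon>
            using lim1[of z r \<epsilon>] r V that by (simp add: abs_minus_commute)
        qed
      qed
    qed
    have vG: "G x \<le> v x" if x: "x \<in> K" for x
    proof (rule field_le_epsilon)
      fix \<epsilon> :: real assume \<epsilon>: "\<epsilon> > 0"
      obtain N where N: "\<And>n x. n \<ge> N \<Longrightarrow> x \<in> K \<Longrightarrow> \<bar>u (k n) x - v x\<bar> < \<epsilon> / 2"
        using v(3)[of "\<epsilon> / 2"] \<epsilon> unfolding real_norm_def by auto
      obtain M :: nat where M: "1 / Suc M < \<epsilon> / 2" using \<epsilon> by (metis half_gt_zero nat_approx_posE)
      define j where "j = max N M"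
      have "M \<le> k j" using seq_suble[OF v(2), of j] by (simp add: j_def)
      then have "1 / real (Suc (k j)) \<le> 1 / real (Suc M)" by (intro divide_left_mono) auto
      moreover have "G x - 1 / Suc (k j) \<le> u (k j) x" using u(1)[of "k j"] x KO unfolding P_def by blast
      moreover have "\<bar>u (k j) x - v x\<bar> < \<epsilon> / 2" using x by (intro N) (auto simp: j_def)
      ultimately show "G x \<le> v x + \<epsilon>" using M unfolding abs_less_iff by linarith
    qed
    have GK: "continuous_on K G" using Gc KO continuous_on_subset unfolding \<Omega>_def by blast
    have SK: "sphere 0 1 \<subseteq> K" using V by blast
    have "\<exists>a\<in>sphere (0::real^'n) 1. \<forall>x\<in>sphere 0 1. v a - G a \<le> v x - G x"
      by (intro continuous_attains_inf continuous_intros continuous_on_subset[OF v(1) SK] continuous_on_subset[OF GK SK]) auto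
    then obtain a where a: "norm a = 1" "\<And>x. norm x = 1 \<Longrightarrow> v a - G a \<le> v x - G x" by auto
    have aK: "a \<in> V" "a \<in> K" using a(1) V by auto
    \<comment> \<open>At a point of the unit sphere where \<open>v - G\<close> is minimal. Were this
      minimum positive, a late member of the sequence would stay too far above \<open>G\<close> on
      the whole sphere, although each of them nearly touches it somewhere.\<close>
    have va: "v a = G a"
    proof (rule ccontr)
      assume "v a \<noteq> G a"
      define m where "m = v a - G a"
      have m: "m > 0" using vG[OF aK(2)] \<open>v a \<noteq> G a\<close> by (simp add: m_def)
      obtain N where N: "\<And>n x. n \<ge> N \<Longrightarrow> x \<in> K \<Longrightarrow> \<bar>u (k n) x - v x\<bar> < m / 2"
        using v(3)[of "m / 2"] m unfolding real_norm_def by auto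
      obtain M :: nat where M: "1 / Suc M < m / 2" using m by (metis half_gt_zero nat_approx_posE)
      define j where "j = max N M"
      have "M \<le> k j" using seq_suble[OF v(2), of j] by (simp add: j_def)
      then have "1 / real (Suc (k j)) \<le> 1 / real (Suc M)" by (intro divide_left_mono) auto
      moreover obtain x where x: "norm x = 1" "u (k j) x \<le> G x + 1 / Suc (k j)" using u(1)[of "k j"] unfolding P_def by blast
      moreover have "x \<in> K" using x(1) by (simp add: K_def)
      then have "\<bar>u (k j) x - v x\<bar> < m / 2" by (intro N) (auto simp: j_def)
      ultimately show False using a(2)[OF x(1)] M unfolding m_def[symmetric] abs_less_iff by linarith
    qed
    have vG': "v x = G x" if x: "x \<in> V" for x
    proof -
      have "G x + - v x = 0"
      proof (rule strong_maximum_principle[OF V(1,2) _ _ _ vs(2) _ aK(1) _ x])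
        show "continuous_on V G" using GK V continuous_on_subset by blast
        show "continuous_on V (\<lambda>x. - v x)" using v(1) V by (intro continuous_on_minus) (blast intro: continuous_on_subset)
        show "jet_sub F V G" using Gs V KO unfolding jet_sol_def \<Omega>_def by (blast intro: jet_sub_subset)
        show "G x + - v x \<le> 0" if "x \<in> V" for x using vG[of x] that V by auto
      qed (use va in simp)
      then show ?thesis by simp
    qed
    obtain N where N: "\<And>n x. n \<ge> N \<Longrightarrow> x \<in> K \<Longrightarrow> \<bar>u (k n) x - v x\<bar> < e"
      using v(3)[of e] e unfolding real_norm_def by auto
    have "z (k N) \<in> V" using u(2)[of "k N"] V by auto
    then show False using N[of N "z (k N)"] vG'[of "z (k N)"] u(3)[of "k N"] V by (auto simp: abs_less_iff)
  qed
  then obtain d where d: "d > 0" "\<And>u z. P d u \<Longrightarrow> norm z = 1 \<Longrightarrow> u z \<le> G z + e" by blast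
  show thesis
  proof (rule that[OF d(1)])
    fix u x z assume "jet_sol F {x. 1/4 < norm x \<and> norm x < 4} u" "continuous_on {x. 1/4 < norm x \<and> norm x < 4} u"
      "\<And>x. 1/4 < norm x \<Longrightarrow> norm x < 4 \<Longrightarrow> \<bar>u x\<bar> \<le> S" "\<And>x. 1/4 < norm x \<Longrightarrow> norm x < 4 \<Longrightarrow> G x - d \<le> u x"
      "norm (x::real^'n) = 1" "u x \<le> G x + d" "norm (z::real^'n) = 1"
    then show "u z \<le> G z + e" by (intro d(2)) (auto simp: P_def \<Omega>_def)
  qed
qed

end

subsection \<open>Solutions in punctured balls\<close>

definition psol :: "(real^'n^'n \<Rightarrow> real) \<Rightarrow> real \<Rightarrow> (real^'n \<Rightarrow> real) \<Rightarrow> bool" where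
  "psol F \<rho> u \<longleftrightarrow> jet_sol F (ball 0 \<rho> - {0}) u \<and> continuous_on (ball 0 \<rho> - {0}) u"

lemma psol_subset: "psol F \<rho> u \<Longrightarrow> \<rho>' \<le> \<rho> \<Longrightarrow> psol F \<rho>' u"
  unfolding psol_def by (auto intro!: jet_sol_subset[of F "ball 0 \<rho> - {0}"] continuous_on_subset[of "ball 0 \<rho> - {0}"])

lemma psol_dual: "psol F \<rho> u \<Longrightarrow> psol (dual_operator F) \<rho> (\<lambda>x. - u x)"
  unfolding psol_def by (auto intro: jet_sol_dual continuous_on_minus)

lemma psol_add_affine: "psol F \<rho> u \<Longrightarrow> psol F \<rho> (\<lambda>x. u x + (c + p \<bullet> x))"
  unfolding psol_def by (auto intro!: jet_sol_add_affine continuous_intros)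

lemma psol_add_const: "psol F \<rho> u \<Longrightarrow> psol F \<rho> (\<lambda>x. u x + c)"
  unfolding psol_def by (auto intro!: jet_sol_add_const continuous_intros)

lemma psol_of_global: "jet_sol F (- {0}) u \<Longrightarrow> continuous_on (- {0}) u \<Longrightarrow> psol F \<rho> u"
  unfolding psol_def by (auto intro: jet_sol_subset continuous_on_subset)

lemma sphere_bounds:
  fixes u :: "'a::euclidean_space \<Rightarrow> real"
  assumes "continuous_on S u" "sphere 0 r \<subseteq> S" "0 < r"
  obtains a b where "norm a = r" "norm b = r" "\<And>x. norm x = r \<Longrightarrow> u a \<le> u x" "\<And>x. norm x = r \<Longrightarrow> u x \<le> u b"
proof -
  have c: "continuous_on (sphere 0 r) u" using assms continuous_on_subset by blast
  have ne: "sphere (0::'a) r \<noteq> {}" using assms(3) by simp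
  obtain a where "a \<in> sphere 0 r" "\<forall>x\<in>sphere 0 r. u a \<le> u x" using continuous_attains_inf[OF compact_sphere ne c] by blast
  moreover obtain b where "b \<in> sphere 0 r" "\<forall>x\<in>sphere 0 r. u x \<le> u b" using continuous_attains_sup[OF compact_sphere ne c] by blast
  ultimately show thesis using that by auto
qed

lemma psol_sphere_bounds:
  assumes "psol F \<rho> u" "0 < r" "r < \<rho>"
  obtains a b where "norm a = r" "norm b = r" "\<And>x. norm x = r \<Longrightarrow> u a \<le> u x" "\<And>x. norm x = r \<Longrightarrow> u x \<le> u b"
proof -
  have "sphere 0 r \<subseteq> ball 0 \<rho> - {0::real^'n}" using assms by auto
  then show thesis using sphere_bounds[of "ball 0 \<rho> - {0}" u r] assms that unfolding psol_def by blast
qed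

lemma eventually_at_zero:
  fixes P :: "'a::real_normed_vector \<Rightarrow> bool"
  shows "(\<forall>\<^sub>F x in at 0. P x) \<longleftrightarrow> (\<exists>d>0. \<forall>x. x \<noteq> 0 \<longrightarrow> norm x < d \<longrightarrow> P x)"
  unfolding eventually_at by (simp add: imp_conjL)

lemma tendsto_at_zero:
  fixes u :: "'a::real_normed_vector \<Rightarrow> real"
  assumes "(u \<longlongrightarrow> c) (at 0)" "0 < e"
  shows "\<exists>d>0. \<forall>x. x \<noteq> 0 \<longrightarrow> norm x < d \<longrightarrow> \<bar>u x - c\<bar> < e"
  using tendstoD[OF assms] unfolding eventually_at_zero dist_real_def .

context
  fixes \<Phi> :: "real^'n \<Rightarrow> real" and \<alpha> :: real
  assumes a: "\<alpha> < 0" and \<Phi>: "\<Phi> \<in> H_plus \<alpha>"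
begin

lemma H_plus_neg: "x \<noteq> 0 \<Longrightarrow> \<Phi> x < 0"
  using \<Phi> a by (auto simp: H_plus_def zero_less_mult_iff)

lemma H_plus_scale: "0 < r \<Longrightarrow> x \<noteq> 0 \<Longrightarrow> \<Phi> (r *\<^sub>R x) = r powr (- \<alpha>) * \<Phi> x"
proof -
  assume r: "0 < r" "x \<noteq> 0"
  then have "r powr \<alpha> * \<Phi> (r *\<^sub>R x) = \<Phi> x" using \<Phi> a by (auto simp: H_plus_def)
  then show ?thesis using r by (simp add: powr_minus field_simps)
qed

lemma H_plus_neg_bounds:
  obtains g0 g1 where "0 < g0" "\<And>x. x \<noteq> 0 \<Longrightarrow> g0 * norm x powr (- \<alpha>) \<le> - \<Phi> x"
    "\<And>x. x \<noteq> 0 \<Longrightarrow> - \<Phi> x \<le> g1 * norm x powr (- \<alpha>)"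
proof -
  have pc: "continuous_on (- {0}) \<Phi>" using \<Phi> by (simp add: H_plus_def)
  have sub: "sphere 0 1 \<subseteq> - {0::real^'n}" by auto
  obtain xl xu where x: "norm xl = 1" "norm xu = 1" "\<And>x. norm x = 1 \<Longrightarrow> \<Phi> xl \<le> \<Phi> x" "\<And>x. norm x = 1 \<Longrightarrow> \<Phi> x \<le> \<Phi> xu"
    using sphere_bounds[OF pc sub zero_less_one] by blast
  have polar: "\<Phi> x = norm x powr (- \<alpha>) * \<Phi> (x /\<^sub>R norm x)" if "x \<noteq> 0" for x
    using H_plus_scale[of "norm x" "x /\<^sub>R norm x"] that by simp
  have u: "norm (x /\<^sub>R norm x) = 1" if "x \<noteq> 0" for x :: "real^'n" using that by simp
  show thesis
  proof (rule that[of "- \<Phi> xu" "- \<Phi> xl"])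
    have "xu \<noteq> 0" using x(2) by auto
    then show "0 < - \<Phi> xu" using H_plus_neg[of xu] by simp
    show "- \<Phi> xu * norm x powr (- \<alpha>) \<le> - \<Phi> x" if "x \<noteq> 0" for x
      using mult_left_mono[OF x(4)[OF u[OF that]], of "norm x powr (- \<alpha>)"] polar[OF that] by (simp add: mult.commute)
    show "- \<Phi> x \<le> - \<Phi> xl * norm x powr (- \<alpha>)" if "x \<noteq> 0" for x
      using mult_left_mono[OF x(3)[OF u[OF that]], of "norm x powr (- \<alpha>)"] polar[OF that] by (simp add: mult.commute)
  qed
qed

lemma H_plus_tendsto_0: "(\<Phi> \<longlongrightarrow> 0) (at 0)"
proof (rule H_plus_neg_bounds)
  fix g0 g1 :: real assume g: "\<And>x. x \<noteq> 0 \<Longrightarrow> - \<Phi> x \<le> g1 * norm x powr (- \<alpha>)"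
  show ?thesis
  proof (rule Lim_null_comparison)
    show "\<forall>\<^sub>F x in at 0. norm (\<Phi> x) \<le> g1 * norm x powr (- \<alpha>)"
      unfolding eventually_at_zero
    proof (intro exI[of _ 1] conjI allI impI)
      fix x :: "real^'n" assume "x \<noteq> 0"
      then show "norm (\<Phi> x) \<le> g1 * norm x powr (- \<alpha>)" using g[of x] H_plus_neg[of x] by simp
    qed simp
    have "((\<lambda>x::real^'n. norm x powr (- \<alpha>)) \<longlongrightarrow> 0 powr (- \<alpha>)) (at 0)"
      using a by (intro tendsto_powr' tendsto_norm_zero tendsto_ident_at tendsto_const) auto
    then have "((\<lambda>x::real^'n. norm x powr (- \<alpha>)) \<longlongrightarrow> 0) (at 0)" by simp
    then show "((\<lambda>x::real^'n. g1 * norm x powr (- \<alpha>)) \<longlongrightarrow> 0) (at 0)" by (rule tendsto_mult_right_zero)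
  qed
qed

end

lemma continuous_on_ball_extension:
  fixes u :: "'a::real_normed_vector \<Rightarrow> real"
  assumes u: "continuous_on (ball 0 r - {0}) u" and lim: "(u \<longlongrightarrow> c) (at 0)"
  shows "continuous_on (ball 0 r) (u(0 := c))"
proof (rule continuous_at_imp_continuous_on, rule ballI)
  fix x :: 'a assume x: "x \<in> ball 0 r"
  show "isCont (u(0 := c)) x"
  proof (cases "x = 0")
    case True
    have "((u(0 := c)) \<longlongrightarrow> c) (at 0)" by (rule Lim_transform_eventually[OF lim]) (simp add: eventually_at_zero exI[of _ 1])
    then show ?thesis using True by (simp add: isCont_def)
  next
    case False
    have "open (ball 0 r - {0::'a})" by (intro open_Diff) auto
    then have c: "isCont u x" using u x False continuous_on_eq_continuous_at[of "ball 0 r - {0}" u] by auto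
    have "\<forall>\<^sub>F y in nhds x. u y = (u(0 := c)) y" by (rule eventually_mono[OF t1_space_nhds[OF False]]) simp
    then show ?thesis using c isCont_cong by blast
  qed
qed

section \<open>Comparison in punctured balls and size of the fundamental solutions\<close>

context elliptic_operator
begin

lemma psol_cmult: "psol F \<rho> u \<Longrightarrow> 0 \<le> c \<Longrightarrow> psol F \<rho> (\<lambda>x. c * u x)"
  unfolding psol_def by (auto intro!: jet_sol_cmult continuous_intros)

lemma psol_const: "psol F \<rho> (\<lambda>_. c)"
  unfolding psol_def by (auto intro: jet_sol_const)

lemma psol_rescale:
  assumes u: "psol F \<rho> u" and r: "0 < r" "4 * r \<le> \<rho>" and c: "0 \<le> c"
  shows "jet_sol F {x. 1/4 < norm x \<and> norm x < 4} (\<lambda>x. c * u (r *\<^sub>R x))"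
    "continuous_on {x. 1/4 < norm x \<and> norm x < 4} (\<lambda>x. c * u (r *\<^sub>R x))"
proof -
  have sub: "r *\<^sub>R x \<in> ball 0 \<rho> - {0}" if "x \<in> {x. 1/4 < norm x \<and> norm x < 4}" for x :: "real^'n"
  proof -
    have "r * norm x < r * 4" using that r(1) by (intro mult_strict_left_mono) auto
    moreover have "norm (r *\<^sub>R x) = r * norm x" using r by simp
    ultimately have "norm (r *\<^sub>R x) < \<rho>" using r by linarith
    then show ?thesis using that r by auto
  qed
  show "jet_sol F {x. 1/4 < norm x \<and> norm x < 4} (\<lambda>x. c * u (r *\<^sub>R x))"
    using u sub unfolding psol_def by (intro jet_sol_cmult jet_sol_rescale[OF _ r(1)] c) auto
  show "continuous_on {x. 1/4 < norm x \<and> norm x < 4} (\<lambda>x. c * u (r *\<^sub>R x))"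
  proof (rule continuous_on_mult_left, rule continuous_on_compose2[of "ball 0 \<rho> - {0}" u _ "(*\<^sub>R) r"])
    show "continuous_on (ball 0 \<rho> - {0}) u" using u unfolding psol_def by blast
    show "continuous_on {x. 1/4 < norm x \<and> norm x < 4} ((*\<^sub>R) r)" by (intro continuous_intros)
    show "(*\<^sub>R) r ` {x::real^'n. 1/4 < norm x \<and> norm x < 4} \<subseteq> ball 0 \<rho> - {0}" by (rule image_subsetI, rule sub)
  qed
qed

lemma ring_le:
  assumes u: "psol F \<rho> u" and v: "psol F \<rho> v" and r: "0 < r" "R < \<rho>"
    and inner: "\<And>y. norm y = r \<Longrightarrow> u y \<le> v y" and outer: "\<And>y. norm y = R \<Longrightarrow> u y \<le> v y"
    and x: "r \<le> norm x" "norm x \<le> R"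
  shows "u x \<le> v x"
proof (cases "norm x = r \<or> norm x = R")
  case False
  define U where "U = {x::real^'n. r < norm x \<and> norm x < R}"
  define D where "D = ball (0::real^'n) \<rho> - {0}"
  have cl: "closed {x::real^'n. r \<le> norm x \<and> norm x \<le> R}"
    by (intro closed_Collect_conj closed_Collect_le continuous_intros)
  have "closure U \<subseteq> {x. r \<le> norm x \<and> norm x \<le> R}" by (rule closure_minimal[OF _ cl]) (auto simp: U_def)
  then have cU: "closure U \<subseteq> D" "\<And>x. x \<in> closure U \<Longrightarrow> r \<le> norm x \<and> norm x \<le> R" using r by (auto simp: D_def)
  have U: "open U" unfolding U_def by (rule open_ring)
  have UD: "U \<subseteq> D" using r by (auto simp: U_def D_def)
  have "u x + - v x \<le> 0"
  proof (rule comparison[OF U])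
    show "bounded U" by (rule bounded_subset[OF bounded_ball[of 0 R]]) (auto simp: U_def)
    show "continuous_on (closure U) u" using u cU unfolding psol_def D_def by (blast intro: continuous_on_subset)
    show "continuous_on (closure U) (\<lambda>x. - v x)"
      using v cU unfolding psol_def D_def by (intro continuous_on_minus) (blast intro: continuous_on_subset)
    show "jet_sub F U u" using u UD unfolding psol_def jet_sol_def D_def by (blast intro: jet_sub_subset)
    show "jet_sub (dual_operator F) U (\<lambda>x. - v x)" using v UD unfolding psol_def jet_sol_def D_def by (blast intro: jet_sub_subset)
    show "x \<in> U" using False x by (auto simp: U_def)
    fix y assume "y \<in> frontier U"
    then have "y \<in> closure U" "y \<notin> U" using U by (auto simp: frontier_def interior_open)
    then have "norm y = r \<or> norm y = R" using cU(2)[of y] by (auto simp: U_def)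
    then show "u y + - v y \<le> 0" using inner outer by auto
  qed
  then show ?thesis by simp
qed (use inner outer in auto)

text \<open>The origin is avoided: it is enough that the inequality holds up to \<open>e\<close> on
  some arbitrarily small spheres. A fixed \<open>x\<close> is enclosed between such a sphere and the
  outer one, and \<open>e\<close> is arbitrary.\<close>

lemma punctured_le:
  assumes u: "psol F \<rho> u" and v: "psol F \<rho> v" and R: "R < \<rho>"
    and outer: "\<And>y. norm y = R \<Longrightarrow> u y \<le> v y"
    and inner: "\<And>e d. 0 < e \<Longrightarrow> 0 < d \<Longrightarrow> \<exists>r. 0 < r \<and> r < d \<and> (\<forall>y. norm y = r \<longrightarrow> u y \<le> v y + e)"
    and x: "x \<noteq> 0" "norm x \<le> R"
  shows "u x \<le> v x"
proof (rule field_le_epsilon)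
  fix e :: real assume e: "0 < e"
  obtain r where r: "0 < r" "r < norm x" "\<And>y. norm y = r \<Longrightarrow> u y \<le> v y + e"
    using inner[OF e, of "norm x"] x(1) by auto
  show "u x \<le> v x + e"
  proof (rule ring_le[OF u psol_add_const[OF v] r(1) R r(3)])
    show "u y \<le> v y + e" if "norm y = R" for y using outer[OF that] e by simp
  qed (use r x in auto)
qed

lemma harnack_scaled:
  assumes n: "2 \<le> CARD('n)"
  obtains C where "0 < C" "\<And>u \<rho> r x z. psol F \<rho> u \<Longrightarrow> (\<And>x. x \<noteq> 0 \<Longrightarrow> norm x < \<rho> \<Longrightarrow> 0 \<le> u x) \<Longrightarrow>
    0 < r \<Longrightarrow> 4 * r \<le> \<rho> \<Longrightarrow> norm (x::real^'n) = r \<Longrightarrow> norm z = r \<Longrightarrow> u x \<le> C * u z"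
proof (rule harnack_sphere[OF n])
  fix C assume C: "0 < C" "\<And>u x z. jet_sol F {x. 1/4 < norm x \<and> norm x < 4} u \<Longrightarrow>
    continuous_on {x. 1/4 < norm x \<and> norm x < 4} u \<Longrightarrow> (\<And>x. 1/4 < norm x \<Longrightarrow> norm x < 4 \<Longrightarrow> 0 \<le> u x) \<Longrightarrow>
    x \<in> sphere (0::real^'n) 1 \<Longrightarrow> z \<in> sphere 0 1 \<Longrightarrow> u x \<le> C * u z"
  have "u x \<le> C * u z" if u: "psol F \<rho> u" and nn: "\<And>x. x \<noteq> 0 \<Longrightarrow> norm x < \<rho> \<Longrightarrow> 0 \<le> u x"
    and r: "0 < r" "4 * r \<le> \<rho>" and x: "norm x = r" and z: "norm z = r" for u \<rho> r and x z :: "real^'n"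
  proof -
    have "1 * u (r *\<^sub>R (x /\<^sub>R r)) \<le> C * (1 * u (r *\<^sub>R (z /\<^sub>R r)))"
    proof (rule C(2)[of "\<lambda>x. 1 * u (r *\<^sub>R x)" "x /\<^sub>R r" "z /\<^sub>R r"])
      show "0 \<le> 1 * u (r *\<^sub>R y)" if "1/4 < norm y" "norm y < 4" for y
      proof -
        have "r * norm y < r * 4" using that r(1) by (intro mult_strict_left_mono) auto
        moreover have "norm (r *\<^sub>R y) = r * norm y" using r by simp
        ultimately have "norm (r *\<^sub>R y) < \<rho>" using r by linarith
        moreover have "r *\<^sub>R y \<noteq> 0" using that r by auto
        ultimately show ?thesis using nn[of "r *\<^sub>R y"] by simp
      qed
      show "jet_sol F {x. 1/4 < norm x \<and> norm x < 4} (\<lambda>x. 1 * u (r *\<^sub>R x))"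
        "continuous_on {x. 1/4 < norm x \<and> norm x < 4} (\<lambda>x. 1 * u (r *\<^sub>R x))" by (rule psol_rescale[OF u r]; simp)+
      show "x /\<^sub>R r \<in> sphere 0 1" "z /\<^sub>R r \<in> sphere 0 1" using x z r by simp_all
    qed
    then show ?thesis using r by simp
  qed
  then show thesis using that C(1) by blast
qed

text \<open>This unifies the logarithmic and the power case: at scale \<open>r\<close> the
  fundamental solution is the large number \<open>\<tau> r\<close> times a fixed positive solution
  \<open>G\<close>, up to a bounded error. For exponent \<open>0\<close>, \<open>G\<close> is the
  constant \<open>1\<close> and \<open>\<tau>\<close> is \<open>- ln\<close>; for positive exponent,
  \<open>G\<close> is \<open>\<Phi>\<close> itself and there is no error.\<close>

lemma profile:
  assumes a: "0 \<le> \<alpha>" and \<Phi>: "\<Phi> \<in> H_plus \<alpha>" "jet_sol F (- {0}) \<Phi>"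
  obtains \<tau> G g0 g1 E where "jet_sol F (- {0}) G" "continuous_on (- {0}) G" "0 < g0" "0 \<le> E"
    "\<And>x. 1/4 < norm x \<Longrightarrow> norm x < 4 \<Longrightarrow> g0 \<le> G x \<and> G x \<le> g1"
    "\<And>r x. 0 < r \<Longrightarrow> 1/4 < norm x \<Longrightarrow> norm x < 4 \<Longrightarrow> \<bar>\<Phi> (r *\<^sub>R x) - \<tau> r * G x\<bar> \<le> E"
    "\<And>M. \<exists>d>0. \<forall>r. 0 < r \<longrightarrow> r < d \<longrightarrow> M \<le> \<tau> r"
proof -
  define K where "K = {x::real^'n. 1/4 \<le> norm x \<and> norm x \<le> 4}"
  have "closed K" unfolding K_def by (intro closed_Collect_conj closed_Collect_le continuous_intros)
  moreover have "K \<subseteq> cball 0 4" by (auto simp: K_def)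
  then have "bounded K" using bounded_cball bounded_subset by blast
  ultimately have Kc: "compact K" by (simp add: compact_eq_bounded_closed)
  have "(axis undefined 1 :: real^'n) \<in> K" unfolding K_def by simp
  then have Kn: "K \<noteq> {}" by blast
  have pc: "continuous_on (- {0}) \<Phi>" using \<Phi> by (simp add: H_plus_def)
  then have pK: "continuous_on K \<Phi>" by (rule continuous_on_subset) (auto simp: K_def)
  obtain xl where xl: "xl \<in> K" "\<And>x. x \<in> K \<Longrightarrow> \<Phi> xl \<le> \<Phi> x" using continuous_attains_inf[OF Kc Kn pK] by blast
  obtain xu where xu: "xu \<in> K" "\<And>x. x \<in> K \<Longrightarrow> \<Phi> x \<le> \<Phi> xu" using continuous_attains_sup[OF Kc Kn pK] by blast
  show thesis
  proof (cases "\<alpha> = 0")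
    case True
    have h: "\<Phi> (r *\<^sub>R x) = - ln r * 1 + \<Phi> x" if "0 < r" "x \<noteq> 0" for r x
    proof -
      have "\<Phi> (r *\<^sub>R x) + ln r = \<Phi> x" using \<Phi>(1) that True by (auto simp: H_plus_def)
      then show ?thesis by simp
    qed
    show thesis
    proof (rule that[of "\<lambda>_. 1" 1 "max \<bar>\<Phi> xl\<bar> \<bar>\<Phi> xu\<bar>" 1 "\<lambda>r. - ln r"])
      show "\<bar>\<Phi> (r *\<^sub>R x) - - ln r * 1\<bar> \<le> max \<bar>\<Phi> xl\<bar> \<bar>\<Phi> xu\<bar>" if "0 < r" "1/4 < norm x" "norm x < 4" for r x
      proof -
        have "x \<in> K" "x \<noteq> 0" using that by (auto simp: K_def)
        then show ?thesis using h[of r x] that xl(2)[of x] xu(2)[of x] by auto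
      qed
      show "\<exists>d>0. \<forall>r. 0 < r \<longrightarrow> r < d \<longrightarrow> M \<le> - ln r" for M :: real
      proof (intro exI[of _ "exp (- M)"] conjI allI impI)
        fix r :: real assume "0 < r" "r < exp (- M)"
        then have "ln r < - M" by (metis exp_gt_zero ln_exp ln_less_cancel_iff)
        then show "M \<le> - ln r" by simp
      qed simp
    qed (auto intro: jet_sol_const)
  next
    case False
    then have a0: "\<alpha> > 0" using a by simp
    have pos: "\<Phi> x > 0" if "x \<noteq> 0" for x using \<Phi>(1) that a0 by (auto simp: H_plus_def zero_less_mult_iff)
    have h: "\<Phi> (r *\<^sub>R x) = r powr (- \<alpha>) * \<Phi> x" if "0 < r" "x \<noteq> 0" for r x
    proof -
      have "r powr \<alpha> * \<Phi> (r *\<^sub>R x) = \<Phi> x" using \<Phi>(1) that False by (auto simp: H_plus_def)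
      then show ?thesis using that by (simp add: powr_minus field_simps)
    qed
    show thesis
    proof (rule that[of \<Phi> "\<Phi> xl" 0 "\<Phi> xu" "\<lambda>r. r powr (- \<alpha>)"])
      show "0 < \<Phi> xl" using xl(1) by (intro pos) (auto simp: K_def)
      show "\<Phi> xl \<le> \<Phi> x \<and> \<Phi> x \<le> \<Phi> xu" if "1/4 < norm x" "norm x < 4" for x
        using that xl(2)[of x] xu(2)[of x] by (simp add: K_def)
      show "\<bar>\<Phi> (r *\<^sub>R x) - r powr (- \<alpha>) * \<Phi> x\<bar> \<le> 0" if "0 < r" "1/4 < norm x" "norm x < 4" for r x
      proof -
        have "x \<noteq> 0" using that by auto
        then show ?thesis using h[of r x] that by simp
      qed
      show "\<exists>d>0. \<forall>r. 0 < r \<longrightarrow> r < d \<longrightarrow> M \<le> r powr (- \<alpha>)" for M :: real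
      proof (intro exI[of _ "max M 1 powr (- (1 / \<alpha>))"] conjI allI impI)
        fix r :: real assume r: "0 < r" "r < max M 1 powr (- (1 / \<alpha>))"
        then have "(max M 1 powr (- (1 / \<alpha>))) powr (- \<alpha>) \<le> r powr (- \<alpha>)"
          using a0 by (intro powr_mono2') auto
        then show "M \<le> r powr (- \<alpha>)" using a0 by (simp add: powr_powr)
      qed simp
    qed (use \<Phi> pc in auto)
  qed
qed

lemma fundamental_at_top:
  assumes "0 \<le> \<alpha>" "\<Phi> \<in> H_plus \<alpha>" "jet_sol F (- {0}) \<Phi>"
  shows "\<exists>d>0. \<forall>x. x \<noteq> 0 \<longrightarrow> norm x < d \<longrightarrow> M \<le> \<Phi> (x::real^'n)"
proof (rule profile[OF assms])
  fix \<tau> G g0 g1 E assume p0: "jet_sol F (- {0}) G" "continuous_on (- {0}) G" and p: "0 < g0" "0 \<le> (E::real)"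
    "\<And>x. 1/4 < norm x \<Longrightarrow> norm x < 4 \<Longrightarrow> g0 \<le> G x \<and> G x \<le> (g1::real)"
    "\<And>r x. 0 < r \<Longrightarrow> 1/4 < norm x \<Longrightarrow> norm x < 4 \<Longrightarrow> \<bar>\<Phi> (r *\<^sub>R x) - \<tau> r * G x\<bar> \<le> E"
    "\<And>M. \<exists>d>0. \<forall>r. 0 < r \<longrightarrow> r < d \<longrightarrow> M \<le> \<tau> (r::real)"
  define M' where "M' = (\<bar>M\<bar> + E) / g0"
  have M': "0 \<le> M'" using p by (simp add: M'_def)
  obtain d where d: "d > 0" "\<And>r. 0 < r \<Longrightarrow> r < d \<Longrightarrow> M' \<le> \<tau> r" using p(5) by blast
  have "M \<le> \<Phi> x" if x: "x \<noteq> 0" "norm x < d" for x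
  proof -
    define z where "z = x /\<^sub>R norm x"
    have z: "norm z = 1" "x = norm x *\<^sub>R z" using x by (auto simp: z_def)
    have "\<bar>\<Phi> x - \<tau> (norm x) * G z\<bar> \<le> E" using p(4)[of "norm x" z] z x by simp
    moreover have "M' * g0 \<le> \<tau> (norm x) * G z" using d(2)[of "norm x"] p(3)[of z] p(1) M' x z by (intro mult_mono) auto
    moreover have "M' * g0 = \<bar>M\<bar> + E" using p(1) by (simp add: M'_def)
    ultimately show ?thesis using abs_ge_self[of M] unfolding abs_le_iff by linarith
  qed
  then show ?thesis using d(1) by blast
qed

text \<open>Comparison with the concave barrier \<open>- \<bar>x\<bar> powr (2 * b)\<close>, \<open>2 * b < 1\<close>.\<close>

lemma exponent_gt_minus_one:
  fixes \<Phi> :: "real^'n \<Rightarrow> real"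
  assumes n: "2 \<le> CARD('n)" and a: "\<alpha> < 0" and \<Phi>: "\<Phi> \<in> H_plus \<alpha>" "jet_sol F (- {0}) \<Phi>"
  shows "-1 < \<alpha>"
proof -
  \<comment> \<open>The value for which \<open>1 - 2 * b\<close> equals
    \<open>lam / (2 * Lam)\<close>, the limit allowed by \<open>F_radial_concave\<close>; it is
    positive because \<open>lam \<le> Lam\<close>.\<close>
  define b where "b = 1 / 2 - lam / (4 * Lam)"
  have b: "0 < b" "b < 1/2" "1 - 2 * b \<le> lam / (2 * Lam)"
    using lam Lam_pos by (auto simp: b_def field_simps)
  show ?thesis
  proof (rule H_plus_neg_bounds[OF a \<Phi>(1)])
    fix m M :: real
    assume m0: "0 < m" and g: "\<And>x. x \<noteq> 0 \<Longrightarrow> m * norm x powr (- \<alpha>) \<le> - \<Phi> x"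
      "\<And>x. x \<noteq> 0 \<Longrightarrow> - \<Phi> x \<le> M * norm x powr (- \<alpha>)"
    have mM: "0 < m" "m \<le> M" using m0 g[of "axis undefined 1"] by simp_all
    define w where "w x = (x \<bullet> x) powr b" for x :: "real^'n"
    have wn: "w x = norm x powr (2 * b)" for x
      unfolding w_def power2_norm_eq_inner[symmetric] by (cases "x = 0") (auto simp: powr_powr simp flip: powr_numeral)
    define f where "f x = (\<Phi>(0 := 0)) x + m * w x" for x
    have fc: "continuous_on (cball 0 1) f"
    proof -
      have "continuous_on (ball 0 2 - {0}) \<Phi>" using \<Phi>(1) by (auto simp: H_plus_def intro: continuous_on_subset)
      then have "continuous_on (ball 0 2) (\<Phi>(0 := 0))" by (rule continuous_on_ball_extension) (rule H_plus_tendsto_0[OF a \<Phi>(1)])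
      then have "continuous_on (cball 0 1) (\<Phi>(0 := 0))" by (rule continuous_on_subset) auto
      moreover have "continuous_on (cball 0 1) w"
        unfolding w_def using b by (intro continuous_on_powr' continuous_intros) auto
      ultimately show ?thesis unfolding f_def by (intro continuous_on_add continuous_on_mult_left)
    qed
    then obtain c where c: "c \<in> cball 0 1" "\<And>x. x \<in> cball 0 1 \<Longrightarrow> f x \<le> f c"
      using continuous_attains_sup[of "cball (0::real^'n) 1" f] by auto
    \<comment> \<open>A positive maximum of \<open>f\<close> would lie away from the origin and from
      the unit sphere, and there \<open>- m * w\<close>, raised by a constant, would touch the
      subsolution \<open>\<Phi>\<close> from above, although it is a strict supersolution.\<close>
    have "f c \<le> 0"
    proof (rule ccontr)
      assume pos: "\<not> ?thesis"
      have c0: "c \<noteq> 0" using pos b by (auto simp: f_def w_def)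
      have c1: "norm c < 1"
      proof (rule ccontr)
        assume "\<not> ?thesis" then have "norm c = 1" using c(1) by simp
        then show False using pos g(1)[OF c0] c0 by (simp add: f_def wn)
      qed
      define H where "H = radial_hessian b (c - 0)"
      have "jet2 (\<lambda>x. - (m * ((x - 0) \<bullet> (x - 0)) powr b)) c (- (m *\<^sub>R ((2 * b * ((c - 0) \<bullet> (c - 0)) powr (b - 1)) *\<^sub>R (c - 0)))) (\<lambda>h. - (m *\<^sub>R (H *v h)))"
        unfolding H_def by (intro jet2_uminus jet2_cmult jet2_radial_power c0)
      then have "superjet (\<lambda>x. - (m * ((x - 0) \<bullet> (x - 0)) powr b) + f c) c (- (m *\<^sub>R ((2 * b * ((c - 0) \<bullet> (c - 0)) powr (b - 1)) *\<^sub>R (c - 0)))) (\<lambda>h. - (m *\<^sub>R (H *v h)))"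
        by (intro jet2_imp_superjet jet2_add_const)
      then have "superjet \<Phi> c (- (m *\<^sub>R ((2 * b * ((c - 0) \<bullet> (c - 0)) powr (b - 1)) *\<^sub>R (c - 0)))) (\<lambda>h. - (m *\<^sub>R (H *v h)))"
      proof (rule superjet_le)
        show "min (norm c) (1 - norm c) > 0" using c0 c1 by simp
        show "\<Phi> c = - (m * ((c - 0) \<bullet> (c - 0)) powr b) + f c" using c0 by (simp add: f_def w_def)
        fix x assume x: "x \<in> ball c (min (norm c) (1 - norm c))"
        then have "x \<noteq> 0" by auto
        moreover have "norm x \<le> 1" using x norm_triangle_ineq[of c "x - c"] by (simp add: dist_norm norm_minus_commute)
        ultimately show "\<Phi> x \<le> - (m * ((x - 0) \<bullet> (x - 0)) powr b) + f c" using c(2)[of x] by (simp add: f_def w_def)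
      qed
      then have "superjet \<Phi> c (- (m *\<^sub>R ((2 * b * ((c - 0) \<bullet> (c - 0)) powr (b - 1)) *\<^sub>R (c - 0)))) ((*v) (m *\<^sub>R (- H)))"
        by (rule superjet_form_cong) (simp add: mv_simps)
      then have "F (m *\<^sub>R (- H)) \<le> 0"
      proof (rule jet_subD[rotated 3])
        show "jet_sub F (- {0}) \<Phi>" using \<Phi>(2) unfolding jet_sol_def by blast
        show "c \<in> - {0}" using c0 by simp
        show "sym_matrix (m *\<^sub>R (- H))" by (auto simp: H_def)
      qed
      moreover have "F (m *\<^sub>R (- H)) = m * F (- H)" using mM by (intro F_scaleR) (auto simp: H_def)
      moreover have "0 < F (- H)" unfolding H_def using c0 by (intro F_radial_concave n b) simp
      ultimately show False using mM by (simp add: mult_le_0_iff)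
    qed
    have key: "m * norm x powr (2 * b) \<le> M * norm x powr (- \<alpha>)" if "x \<noteq> 0" "norm x \<le> 1" for x :: "real^'n"
      using c(2)[of x] \<open>f c \<le> 0\<close> that g(2)[of x] by (simp add: f_def wn)
    \<comment> \<open>Two powers of the norm are compared near \<open>0\<close>. The radius
      \<open>t\<close> is the one at which the larger exponent would make the right side half of the
      left side.\<close>
    have "- \<alpha> \<le> 2 * b"
    proof (rule ccontr)
      assume "\<not> ?thesis"
      then have g: "0 < - \<alpha> - 2 * b" by simp
      define t where "t = (m / (2 * M)) powr (1 / (- \<alpha> - 2 * b))"
      have q: "0 < m / (2 * M)" "m / (2 * M) \<le> 1" using mM by auto
      have t: "0 < t" "t \<le> 1" unfolding t_def using q g by (auto intro!: powr_le1)
      define x where "x = t *\<^sub>R (axis undefined 1 :: real^'n)"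
      have nx: "norm x = t" using t by (simp add: x_def)
      have x0: "x \<noteq> 0" using nx t by auto
      have "t powr (- \<alpha>) = t powr (2 * b) * t powr (- \<alpha> - 2 * b)" by (simp add: powr_add[symmetric])
      also have "t powr (- \<alpha> - 2 * b) = m / (2 * M)" unfolding t_def using g q mM by (simp add: powr_powr)
      finally have "M * t powr (- \<alpha>) = (m / 2) * t powr (2 * b)" using mM by simp
      moreover have "m * t powr (2 * b) \<le> M * t powr (- \<alpha>)" using key[OF x0] nx t by simp
      moreover have "0 < m * t powr (2 * b)" using mM t by simp
      ultimately show False by simp
    qed
    then show ?thesis using b by simp
  qed
qed

section \<open>Positive solutions that vanish at the origin\<close>

lemma punctured_le_tendsto:
  assumes u: "psol F \<rho> u" and v: "psol F \<rho> v" and R: "R < \<rho>"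
    and outer: "\<And>y. norm y = R \<Longrightarrow> u y \<le> v y" and lim: "(u \<longlongrightarrow> c) (at 0)" "(v \<longlongrightarrow> c) (at 0)"
    and x: "x \<noteq> 0" "norm x \<le> R"
  shows "u x \<le> v x"
proof (rule punctured_le[OF u v R outer _ x])
  fix e d :: real assume e: "0 < e" and d: "0 < d"
  have e2: "0 < e / 2" using e by simp
  obtain d1 where d1: "0 < d1" "\<And>x. x \<noteq> 0 \<Longrightarrow> norm x < d1 \<Longrightarrow> \<bar>u x - c\<bar> < e / 2" using tendsto_at_zero[OF lim(1) e2] by blast
  obtain d2 where d2: "0 < d2" "\<And>x. x \<noteq> 0 \<Longrightarrow> norm x < d2 \<Longrightarrow> \<bar>v x - c\<bar> < e / 2" using tendsto_at_zero[OF lim(2) e2] by blast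
  obtain r where r: "0 < r" "r < min d (min d1 d2)" using dense[of 0 "min d (min d1 d2)"] d d1 d2 by auto
  have "u y \<le> v y + e" if "norm y = r" for y
  proof -
    have "y \<noteq> 0" using that r by auto
    then have "\<bar>u y - c\<bar> < e / 2" "\<bar>v y - c\<bar> < e / 2" using d1(2)[of y] d2(2)[of y] that r by auto
    then show ?thesis by argo
  qed
  then show "\<exists>r>0. r < d \<and> (\<forall>y. norm y = r \<longrightarrow> u y \<le> v y + e)" using r by auto
qed

text \<open>If the exponent were nonnegative, \<open>- \<Phi>\<close> would be a solution of
  \<open>F\<close> that tends to minus infinity at the origin. A small multiple \<open>e\<close> of
  it, raised to the minimum of \<open>u\<close> on a sphere, lies below \<open>u\<close>; as
  \<open>e\<close> tends to \<open>0\<close>, \<open>u\<close> stays above that positive minimum,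
  against its limit \<open>0\<close>.\<close>

lemma vanishing_exponent_neg:
  assumes u: "psol F \<rho> u" and \<rho>: "0 < \<rho>" and pos: "\<And>x. x \<noteq> 0 \<Longrightarrow> norm x < \<rho> \<Longrightarrow> 0 < u x"
    and lim: "(u \<longlongrightarrow> 0) (at 0)"
    and \<Phi>: "\<Phi> \<in> H_plus \<alpha>" "jet_sol (dual_operator F) (- {0}) \<Phi>"
  shows "\<alpha> < 0"
proof (rule ccontr)
  assume "\<not> ?thesis" then have a: "0 \<le> \<alpha>" by simp
  define R where "R = \<rho> / 2"
  have R: "0 < R" "R < \<rho>" using \<rho> by (auto simp: R_def)
  have pc: "continuous_on (- {0}) \<Phi>" using \<Phi> by (simp add: H_plus_def)
  have "psol (dual_operator (dual_operator F)) \<rho> (\<lambda>x. - \<Phi> x)" by (rule psol_dual[OF psol_of_global[OF \<Phi>(2) pc]])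
  then have s: "psol F \<rho> (\<lambda>x. - \<Phi> x)" by simp
  obtain b b' where b0: "norm b = R" "norm b' = R" and b: "\<And>x. norm x = R \<Longrightarrow> u b \<le> u x" "\<And>x. norm x = R \<Longrightarrow> u x \<le> u b'" using psol_sphere_bounds[OF u R] by blast
  obtain c c' where c: "norm c' = R" "norm c = R" "\<And>x. norm x = R \<Longrightarrow> - \<Phi> c' \<le> - \<Phi> x" "\<And>x. norm x = R \<Longrightarrow> - \<Phi> x \<le> - \<Phi> c" using psol_sphere_bounds[OF s R] by blast
  define K where "K = - \<Phi> c"
  have K: "0 \<le> \<Phi> x + K" if "norm x = R" for x using c(4)[OF that] by (simp add: K_def)
  have "b \<noteq> 0" using b0 R by auto
  then have m: "0 < u b" using pos[of b] b0 R by simp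
  have le: "e * - \<Phi> x + (u b - e * K) \<le> u x" if x: "x \<noteq> 0" "norm x \<le> R" and e: "0 < e" for x e
  proof (rule punctured_le[OF psol_add_const[OF psol_cmult[OF s less_imp_le[OF e]]] u R(2) _ _ x])
    fix y :: "real^'n" assume y: "norm y = R"
    have "0 \<le> e * (\<Phi> y + K)" using K[OF y] e by simp
    then show "e * - \<Phi> y + (u b - e * K) \<le> u y" using b(1)[OF y] by (simp add: algebra_simps)
  next
    fix e' d :: real assume e': "0 < e'" and d: "0 < d"
    have "\<exists>d1>0. \<forall>x. x \<noteq> 0 \<longrightarrow> norm x < d1 \<longrightarrow> u b / e - K \<le> \<Phi> x"
      by (rule elliptic_operator.fundamental_at_top[OF dual a \<Phi>])
    then obtain d1 where d1: "0 < d1" "\<And>x. x \<noteq> 0 \<Longrightarrow> norm x < d1 \<Longrightarrow> u b / e - K \<le> \<Phi> x" by blast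
    obtain r where r: "0 < r" "r < min d (min d1 R)" using dense[of 0 "min d (min d1 R)"] d d1 R by auto
    have "e * - \<Phi> y + (u b - e * K) \<le> u y + e'" if y: "norm y = r" for y
    proof -
      have y0: "y \<noteq> 0" using y r by auto
      have "e * (u b / e - K) \<le> e * \<Phi> y" using d1(2)[of y] y0 y r e by (intro mult_left_mono) auto
      then have "u b - e * K \<le> e * \<Phi> y" using e by (simp add: algebra_simps)
      moreover have "0 < u y" using pos[OF y0] y r R by simp
      ultimately show ?thesis using e' by simp
    qed
    then show "\<exists>r>0. r < d \<and> (\<forall>y. norm y = r \<longrightarrow> e * - \<Phi> y + (u b - e * K) \<le> u y + e')" using r by auto
  qed
  obtain d where d: "0 < d" "\<And>x. x \<noteq> 0 \<Longrightarrow> norm x < d \<Longrightarrow> \<bar>u x - 0\<bar> < u b / 2"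
    using tendsto_at_zero[OF lim half_gt_zero[OF m]] by blast
  define x where "x = (min d R / 2) *\<^sub>R (axis undefined 1 :: real^'n)"
  have nx: "norm x = min d R / 2" using d R by (simp add: x_def)
  then have x: "x \<noteq> 0" "norm x < d" "norm x \<le> R" using d R by auto
  \<comment> \<open>At the chosen point, where \<open>u\<close> is below half of \<open>u b\<close>,
    this multiple costs at most the other half of \<open>u b\<close>.\<close>
  define e where "e = u b / (2 * (\<bar>\<Phi> x + K\<bar> + 1))"
  have e: "0 < e" unfolding e_def using m by (intro divide_pos_pos mult_pos_pos add_nonneg_pos) auto
  have "e * (\<Phi> x + K) \<le> e * (\<bar>\<Phi> x + K\<bar> + 1)" using e by (intro mult_left_mono) auto
  moreover have "e * (\<bar>\<Phi> x + K\<bar> + 1) = u b / 2"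
  proof -
    have "\<bar>\<Phi> x + K\<bar> + 1 \<noteq> 0" using abs_ge_zero[of "\<Phi> x + K"] by linarith
    moreover have "e = u b / 2 / (\<bar>\<Phi> x + K\<bar> + 1)" unfolding e_def by (simp only: divide_divide_eq_left)
    ultimately show ?thesis using nonzero_eq_divide_eq[of "\<bar>\<Phi> x + K\<bar> + 1" e "u b / 2"] by blast
  qed
  moreover have "\<bar>u x - 0\<bar> < u b / 2" by (rule d(2)[OF x(1,2)])
  moreover have "e * - \<Phi> x + (u b - e * K) \<le> u x" by (rule le[OF x(1,3) e])
  ultimately show False using abs_le_D1[of "u x" "u b / 2"] by (simp add: algebra_simps)
qed

text \<open>The limit is the supremum \<open>A\<close> of all \<open>k\<close> for which
  \<open>k * \<Psi> \<le> u\<close> near the origin. As \<open>\<Psi>\<close> is homogeneous, the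
  rescalings of \<open>u\<close> leave the comparison function \<open>A * \<Psi>\<close> unchanged,
  so a near-contact on a sphere of any radius can be read on the unit sphere.\<close>

lemma vanishing_positive:
  assumes n: "2 \<le> CARD('n)" and u: "psol F \<rho> u" and \<rho>: "0 < \<rho>" and pos: "\<And>x. x \<noteq> 0 \<Longrightarrow> norm x < \<rho> \<Longrightarrow> 0 < u x"
    and lim: "(u \<longlongrightarrow> 0) (at 0)"
    and \<Phi>: "\<Phi> \<in> H_plus \<alpha>" "jet_sol (dual_operator F) (- {0}) \<Phi>"
  obtains a where "0 < a" "((\<lambda>x. u x / (- \<Phi> x)) \<longlongrightarrow> a) (at (0::real^'n))"
proof -
  have a: "\<alpha> < 0" by (rule vanishing_exponent_neg[OF u \<rho> pos lim \<Phi>])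
  define \<beta> where "\<beta> = - \<alpha>"
  define \<Psi> where "\<Psi> x = - \<Phi> x" for x
  have Pp: "0 < \<Psi> x" if "x \<noteq> 0" for x using H_plus_neg[OF a \<Phi>(1) that] by (simp add: \<Psi>_def)
  have Ph: "\<Psi> (r *\<^sub>R x) = r powr \<beta> * \<Psi> x" if "0 < r" "x \<noteq> 0" for r x
    using H_plus_scale[OF a \<Phi>(1) that] by (simp add: \<Psi>_def \<beta>_def)
  obtain g0 g1 where g: "0 < g0" "\<And>x. x \<noteq> 0 \<Longrightarrow> g0 * norm x powr \<beta> \<le> \<Psi> x" "\<And>x. x \<noteq> 0 \<Longrightarrow> \<Psi> x \<le> g1 * norm x powr \<beta>"
    using H_plus_neg_bounds[OF a \<Phi>(1)] unfolding \<Psi>_def \<beta>_def by blast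
  have b: "0 < \<beta>" using a by (simp add: \<beta>_def)
  have gn1: "g0 \<le> \<Psi> x" "\<Psi> x \<le> g1" if "norm x = 1" for x
  proof -
    have "x \<noteq> 0" using that by auto
    then show "g0 \<le> \<Psi> x" "\<Psi> x \<le> g1" using g(2,3)[of x] that by auto
  qed
  have g1: "0 < g1" using gn1[of "axis undefined 1"] g(1) by simp
  have ring: "\<Psi> x \<le> g1 * 4 powr \<beta>" if "1/4 < norm x" "norm x < 4" for x
  proof -
    have "x \<noteq> 0" using that by auto
    then have "\<Psi> x \<le> g1 * norm x powr \<beta>" by (rule g(3))
    also have "\<dots> \<le> g1 * 4 powr \<beta>" using that g1 b by (intro mult_left_mono powr_mono2) auto
    finally show ?thesis .
  qed
  have Plim: "(\<Psi> \<longlongrightarrow> 0) (at 0)" using tendsto_minus[OF H_plus_tendsto_0[OF a \<Phi>(1)]] by (simp add: \<Psi>_def[abs_def])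
  have pc: "continuous_on (- {0}) \<Phi>" using \<Phi> by (simp add: H_plus_def)
  have Pc: "continuous_on (- {0}) \<Psi>" unfolding \<Psi>_def[abs_def] by (intro continuous_on_minus pc)
  have Ps: "jet_sol F (- {0}) \<Psi>" using jet_sol_dual[OF \<Phi>(2)] by (simp add: \<Psi>_def[abs_def])
  have s: "psol F \<rho> (\<lambda>x. k * \<Psi> x)" if "0 \<le> k" for k by (rule psol_cmult[OF psol_of_global[OF Ps Pc] that])
  have slim: "((\<lambda>x. k * \<Psi> x) \<longlongrightarrow> 0) (at 0)" for k by (rule tendsto_mult_right_zero[OF Plim])
  define R where "R = \<rho> / 2"
  have R: "0 < R" "R < \<rho>" using \<rho> by (auto simp: R_def)
  obtain ul uu where ub: "norm ul = R" "norm uu = R" "\<And>x. norm x = R \<Longrightarrow> u ul \<le> u x" "\<And>x. norm x = R \<Longrightarrow> u x \<le> u uu"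
    using psol_sphere_bounds[OF u R] by blast
  have nz: "x \<noteq> 0" if "norm x = R" for x :: "real^'n" using that R by auto
  define Q0 Q1 where "Q0 = g0 * R powr \<beta>" and "Q1 = g1 * R powr \<beta>"
  have Q: "0 < Q0" "0 < Q1" "\<And>x. norm x = R \<Longrightarrow> Q0 \<le> \<Psi> x" "\<And>x. norm x = R \<Longrightarrow> \<Psi> x \<le> Q1"
    using g nz g1 R by (auto simp: Q0_def Q1_def)
  have ul0: "0 < u ul" using pos[OF nz[OF ub(1)]] ub(1) R by simp
  have uu0: "0 < u uu" using ub(4)[OF ub(1)] ul0 by simp
  define k0 k1 where "k0 = u ul / Q1" and "k1 = u uu / Q0"
  have k: "0 < k0" "0 < k1" using ul0 uu0 Q by (auto simp: k0_def k1_def)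
  have low: "k0 * \<Psi> x \<le> u x" if x: "x \<noteq> 0" "norm x \<le> R" for x
  proof (rule punctured_le_tendsto[OF s u R(2) _ slim lim x])
    fix y :: "real^'n" assume y: "norm y = R"
    have "k0 * \<Psi> y \<le> k0 * Q1" using k Q(4)[OF y] by (intro mult_left_mono) auto
    then show "k0 * \<Psi> y \<le> u y" using ub(3)[OF y] Q(2) by (simp add: k0_def)
  qed (use k in simp)
  have upp: "u x \<le> k1 * \<Psi> x" if x: "x \<noteq> 0" "norm x \<le> R" for x
  proof (rule punctured_le_tendsto[OF u s R(2) _ lim slim x])
    fix y :: "real^'n" assume y: "norm y = R"
    have "k1 * Q0 \<le> k1 * \<Psi> y" using k Q(3)[OF y] by (intro mult_left_mono) auto
    then show "u y \<le> k1 * \<Psi> y" using ub(4)[OF y] Q(1) by (simp add: k1_def)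
  qed (use k in simp)
  define T where "T = {k. \<exists>r>0. \<forall>x::real^'n. x \<noteq> 0 \<longrightarrow> norm x < r \<longrightarrow> k * \<Psi> x \<le> u x}"
  have k0T: "k0 \<in> T" unfolding T_def using low R(1) by (auto intro!: exI[of _ R])
  have Tb: "k \<le> k1" if "k \<in> T" for k
  proof -
    obtain r where r: "0 < r" "\<And>x. x \<noteq> 0 \<Longrightarrow> norm x < r \<Longrightarrow> k * \<Psi> x \<le> u x" using \<open>k \<in> T\<close> unfolding T_def by blast
    define x where "x = (min r R / 2) *\<^sub>R (axis undefined 1 :: real^'n)"
    have "norm x = min r R / 2" using r R by (simp add: x_def)
    then have x: "x \<noteq> 0" "norm x < r" "norm x \<le> R" using r R by auto
    have "k * \<Psi> x \<le> k1 * \<Psi> x" using r(2)[OF x(1,2)] upp[OF x(1,3)] by simp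
    then show ?thesis using Pp[OF x(1)] by simp
  qed
  have bdd: "bdd_above T" using Tb by (auto simp: bdd_above_def)
  define A where "A = Sup T"
  have A: "0 < A" using cSup_upper[OF k0T bdd] k by (simp add: A_def)
  have below: "\<exists>r>0. \<forall>x. x \<noteq> 0 \<longrightarrow> norm x < r \<longrightarrow> k * \<Psi> x \<le> u x" if "k < A" for k
  proof -
    obtain k' where k': "k' \<in> T" "k < k'" using less_cSupD[of T k] k0T \<open>k < A\<close> unfolding A_def by blast
    then obtain r where r: "0 < r" "\<And>x. x \<noteq> 0 \<Longrightarrow> norm x < r \<Longrightarrow> k' * \<Psi> x \<le> u x" unfolding T_def by blast
    have "k * \<Psi> x \<le> u x" if "x \<noteq> 0" "norm x < r" for x
      using r(2)[OF that] mult_right_mono[of k k' "\<Psi> x"] k'(2) Pp[OF that(1)] by linarith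
    then show ?thesis using r(1) by blast
  qed
  \<comment> \<open>Both functions tend to \<open>0\<close> at the origin, so an inequality on one
    sphere extends inwards and would make \<open>k\<close> admissible. Hence near-contact occurs on
    every sphere and not only on a sequence of them.\<close>
  have above: "\<exists>x. norm x = r \<and> u x < k * \<Psi> x" if kA: "A < k" and r: "0 < r" "r < \<rho>" for k r :: real
  proof (rule ccontr)
    assume c: "\<not> ?thesis"
    have "k * \<Psi> x \<le> u x" if "x \<noteq> 0" "norm x < r" for x
    proof (rule punctured_le_tendsto[OF s u r(2) _ slim lim])
      show "k * \<Psi> y \<le> u y" if "norm y = r" for y using c that by (auto simp: not_less)
    qed (use that kA A in auto)
    then have "k \<in> T" unfolding T_def using r(1) by blast
    then show False using cSup_upper[OF _ bdd, of k] kA unfolding A_def by simp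
  qed
  have "((\<lambda>x. u x / \<Psi> x) \<longlongrightarrow> A) (at 0)"
  proof (rule tendstoI)
    fix e :: real assume e: "0 < e"
    have e': "0 < e * g0 / 2" using e g(1) by simp
    have Gs: "jet_sol F {x. 1/4 < norm x \<and> norm x < 4} (\<lambda>x. A * \<Psi> x)"
      by (rule jet_sol_subset[OF jet_sol_cmult[OF Ps]]) (use A in auto)
    have Gc: "continuous_on {x. 1/4 < norm x \<and> norm x < 4} (\<lambda>x. A * \<Psi> x)"
      by (intro continuous_on_mult_left continuous_on_subset[OF Pc]) auto
    show "\<forall>\<^sub>F x in at 0. dist (u x / \<Psi> x) A < e"
    proof (rule touching_compactness[OF n Gs Gc e'])
      fix d :: real assume d0: "0 < d" and d: "\<And>w x z. jet_sol F {x. 1/4 < norm x \<and> norm x < 4} w \<Longrightarrow>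
        continuous_on {x. 1/4 < norm x \<and> norm x < 4} w \<Longrightarrow> (\<And>x. 1/4 < norm x \<Longrightarrow> norm x < 4 \<Longrightarrow> \<bar>w x\<bar> \<le> k1 * (g1 * 4 powr \<beta>)) \<Longrightarrow>
        (\<And>x. 1/4 < norm x \<Longrightarrow> norm x < 4 \<Longrightarrow> A * \<Psi> x - d \<le> w x) \<Longrightarrow> norm x = 1 \<Longrightarrow> w x \<le> A * \<Psi> x + d \<Longrightarrow> norm z = 1 \<Longrightarrow>
        w z \<le> A * \<Psi> z + e * g0 / 2"
      \<comment> \<open>An upper bound of \<open>\<Psi>\<close> on the ring where rescaled functions
        live; with \<open>\<delta> = d / D\<close>, changing the factor \<open>A\<close> by \<delta>
        changes \<open>A * \<Psi>\<close> there by at most \<open>d\<close>.\<close>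
      define D where "D = g1 * 4 powr \<beta>"
      have D: "0 < D" "g1 \<le> D" using g1 b ge_one_powr_ge_zero[of 4 \<beta>] by (auto simp: D_def)
      define \<delta> where "\<delta> = d / D"
      have \<delta>: "0 < \<delta>" "\<delta> * D = d" using d0 D by (auto simp: \<delta>_def)
      obtain r1 where r1: "0 < r1" "\<And>x. x \<noteq> 0 \<Longrightarrow> norm x < r1 \<Longrightarrow> (A - \<delta>) * \<Psi> x \<le> u x" using below[of "A - \<delta>"] \<delta> by auto
      obtain r2 where r2: "0 < r2" "\<And>x. x \<noteq> 0 \<Longrightarrow> norm x < r2 \<Longrightarrow> (A - e / 2) * \<Psi> x \<le> u x" using below[of "A - e / 2"] e by auto
      define r0 where "r0 = min (min r1 R / 4) r2"
      have r0: "0 < r0" using r1 r2 R by (simp add: r0_def)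
      have "dist (u x / \<Psi> x) A < e" if x: "x \<noteq> 0" "norm x < r0" for x
      proof -
        define r where "r = norm x"
        have r: "0 < r" "r < r2" "4 * r < r1" "4 * r < R" using x by (auto simp: r_def r0_def)
        \<comment> \<open>The rescaling under which \<open>\<Psi>\<close> is invariant; the upper
          bound \<open>upp\<close> makes all these functions bounded by one constant on the
          ring.\<close>
        define w where "w z = r powr (- \<beta>) * u (r *\<^sub>R z)" for z
        have inv: "r powr (- \<beta>) * r powr \<beta> = 1" using r(1) by (simp add: powr_minus)
        have sc: "r powr (- \<beta>) * (k * \<Psi> (r *\<^sub>R z)) = k * \<Psi> z" if "z \<noteq> 0" for k z
          using Ph[OF r(1) that] inv by simp
        have rg: "r *\<^sub>R z \<noteq> 0" "norm (r *\<^sub>R z) < r1" "norm (r *\<^sub>R z) \<le> R" "z \<noteq> 0"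
          "0 < u (r *\<^sub>R z)" if "1/4 < norm z" "norm z < 4" for z :: "real^'n"
        proof -
          show "z \<noteq> 0" using that by auto
          then show nz: "r *\<^sub>R z \<noteq> 0" using r by simp
          have "r * norm z < r * 4" using that r(1) by (intro mult_strict_left_mono) auto
          moreover have "norm (r *\<^sub>R z) = r * norm z" using r by simp
          ultimately show "norm (r *\<^sub>R z) < r1" "norm (r *\<^sub>R z) \<le> R" using r by linarith+
          then show "0 < u (r *\<^sub>R z)" using R by (intro pos[OF nz]) linarith
        qed
        obtain y where y: "norm y = r" "u y < (A + \<delta>) * \<Psi> y" using above[of "A + \<delta>" r] \<delta> r R by auto
        have sy: "r *\<^sub>R (y /\<^sub>R r) = y" "r *\<^sub>R (x /\<^sub>R r) = x" using r by auto
        have n1: "norm (y /\<^sub>R r) = 1" "norm (x /\<^sub>R r) = 1" using y r by (auto simp: r_def)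
        have z0: "y /\<^sub>R r \<noteq> 0" "x /\<^sub>R r \<noteq> 0" using n1 by auto
        have ru: "r powr \<beta> * w (x /\<^sub>R r) = (r powr (- \<beta>) * r powr \<beta>) * u x" unfolding w_def sy by (simp only: ac_simps)
        have "w (x /\<^sub>R r) \<le> A * \<Psi> (x /\<^sub>R r) + e * g0 / 2"
        proof (rule d[of w "y /\<^sub>R r"])
          show "jet_sol F {x. 1/4 < norm x \<and> norm x < 4} w" "continuous_on {x. 1/4 < norm x \<and> norm x < 4} w"
            unfolding w_def[abs_def] using psol_rescale[OF u r(1)] r(4) R(2) by auto
          fix z :: "real^'n" assume z: "1/4 < norm z" "norm z < 4"
          have "w z \<le> r powr (- \<beta>) * (k1 * \<Psi> (r *\<^sub>R z))"
            unfolding w_def by (intro mult_left_mono upp rg[OF z]) auto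
          also have "\<dots> \<le> k1 * (g1 * 4 powr \<beta>)" unfolding sc[OF rg(4)[OF z]] using k ring[OF z] by (intro mult_left_mono) auto
          finally have "w z \<le> k1 * (g1 * 4 powr \<beta>)" .
          moreover have "0 \<le> w z" unfolding w_def using rg(5)[OF z] by simp
          ultimately show "\<bar>w z\<bar> \<le> k1 * (g1 * 4 powr \<beta>)" by simp
          have "r powr (- \<beta>) * ((A - \<delta>) * \<Psi> (r *\<^sub>R z)) \<le> w z"
            unfolding w_def by (intro mult_left_mono r1(2) rg[OF z]) auto
          then have "(A - \<delta>) * \<Psi> z \<le> w z" unfolding sc[OF rg(4)[OF z]] .
          moreover have "\<delta> * \<Psi> z \<le> \<delta> * D" unfolding D_def using \<delta> ring[OF z] by (intro mult_left_mono) auto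
          ultimately show "A * \<Psi> z - d \<le> w z" using \<delta>(2) by (simp add: algebra_simps)
        next
          have "w (y /\<^sub>R r) \<le> r powr (- \<beta>) * ((A + \<delta>) * \<Psi> (r *\<^sub>R (y /\<^sub>R r)))"
            unfolding w_def sy using y(2) by (intro mult_left_mono) auto
          then have "w (y /\<^sub>R r) \<le> (A + \<delta>) * \<Psi> (y /\<^sub>R r)" unfolding sc[OF z0(1)] .
          moreover have "\<delta> * \<Psi> (y /\<^sub>R r) \<le> \<delta> * D" using \<delta> gn1(2)[OF n1(1)] D by (intro mult_left_mono) auto
          ultimately show "w (y /\<^sub>R r) \<le> A * \<Psi> (y /\<^sub>R r) + d" using \<delta>(2) by (simp add: algebra_simps)
        qed (use n1 in auto)
        also have "e * g0 / 2 \<le> e / 2 * \<Psi> (x /\<^sub>R r)" using gn1(1)[OF n1(2)] e by simp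
        finally have "w (x /\<^sub>R r) \<le> (A + e / 2) * \<Psi> (x /\<^sub>R r)" by (simp add: algebra_simps)
        then have "r powr \<beta> * w (x /\<^sub>R r) \<le> r powr \<beta> * ((A + e / 2) * \<Psi> (x /\<^sub>R r))" by (intro mult_left_mono) auto
        moreover have "r powr \<beta> * w (x /\<^sub>R r) = u x" using ru unfolding inv by simp
        moreover have "r powr \<beta> * ((A + e / 2) * \<Psi> (x /\<^sub>R r)) = (A + e / 2) * \<Psi> x" using Ph[OF r(1) z0(2)] sy(2) by simp
        ultimately have "u x \<le> (A + e / 2) * \<Psi> x" by simp
        moreover have "(A - e / 2) * \<Psi> x \<le> u x" using r2(2)[OF x(1)] r(2) by (simp add: r_def)
        ultimately have "u x / \<Psi> x \<le> A + e / 2" "A - e / 2 \<le> u x / \<Psi> x"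
          using Pp[OF x(1)] by (simp_all add: pos_divide_le_eq pos_le_divide_eq)
        then show ?thesis using e unfolding dist_real_def by argo
      qed
      then show ?thesis unfolding eventually_at_zero using r0 by blast
    qed
  qed
  then show thesis using that[OF A] unfolding \<Psi>_def by blast
qed

text \<open>The role of the fundamental solution is played by the constant \<open>m\<close>, the
  lower limit at the origin. Near-contact spreads over whole spheres, and comparison with the
  constant \<open>m + e / 2\<close> fills the region inside them.\<close>

lemma bounded_psol_tendsto:
  assumes n: "2 \<le> CARD('n)" and u: "psol F \<rho> u" and \<rho>: "0 < \<rho>"
    and bd: "\<And>x. x \<noteq> 0 \<Longrightarrow> norm x < \<rho> \<Longrightarrow> \<bar>u x\<bar> \<le> K"
  shows "\<exists>c. (u \<longlongrightarrow> c) (at (0::real^'n))"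
proof -
  have pt: "\<exists>x::real^'n. x \<noteq> 0 \<and> norm x < r" if "0 < r" for r
    using that by (intro exI[of _ "(r / 2) *\<^sub>R axis undefined 1"]) simp
  define T where "T = {k. \<exists>r>0. \<forall>x::real^'n. x \<noteq> 0 \<longrightarrow> norm x < r \<longrightarrow> k \<le> u x}"
  have T0: "- K \<in> T" unfolding T_def
  proof (intro CollectI exI[of _ \<rho>] conjI allI impI)
    show "- K \<le> u x" if "x \<noteq> 0" "norm x < \<rho>" for x using bd[OF that] by (simp add: abs_le_iff)
  qed (rule \<rho>)
  have Tb: "k \<le> K" if kT: "k \<in> T" for k
  proof -
    obtain r where r: "0 < r" "\<And>x. x \<noteq> 0 \<Longrightarrow> norm x < r \<Longrightarrow> k \<le> u x" using kT unfolding T_def by blast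
    obtain x :: "real^'n" where x: "x \<noteq> 0" "norm x < min r \<rho>" using pt[of "min r \<rho>"] r(1) \<rho> by auto
    then have "k \<le> u x" "\<bar>u x\<bar> \<le> K" using r(2)[of x] bd[of x] by auto
    then show ?thesis by (simp add: abs_le_iff)
  qed
  have bdd: "bdd_above T" using Tb by (auto simp: bdd_above_def)
  define m where "m = Sup T"
  have below: "\<exists>r>0. \<forall>x. x \<noteq> 0 \<longrightarrow> norm x < r \<longrightarrow> k \<le> u x" if km: "k < m" for k
  proof -
    obtain k' where k': "k' \<in> T" "k < k'" using less_cSupD[of T k] T0 km unfolding m_def by blast
    then obtain r where r: "0 < r" "\<And>x. x \<noteq> 0 \<Longrightarrow> norm x < r \<Longrightarrow> k' \<le> u x" unfolding T_def by blast
    have "k \<le> u x" if "x \<noteq> 0" "norm x < r" for x using r(2)[OF that] k'(2) by simp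
    then show ?thesis using r(1) by blast
  qed
  have above: "\<exists>x. x \<noteq> 0 \<and> norm x < r \<and> u x < k" if km: "m < k" and r: "0 < r" for k r
  proof (rule ccontr)
    assume c: "\<not> ?thesis"
    then have "\<forall>x. x \<noteq> 0 \<longrightarrow> norm x < r \<longrightarrow> k \<le> u x" by (auto simp: not_less)
    then have "k \<in> T" unfolding T_def using r by blast
    then show False using cSup_upper[OF _ bdd, of k] km unfolding m_def by simp
  qed
  have "(u \<longlongrightarrow> m) (at 0)"
  proof (rule tendstoI)
    fix e :: real assume e: "0 < e"
    have e2: "0 < e / 2" using e by simp
    show "\<forall>\<^sub>F x in at 0. dist (u x) m < e"
    proof (rule touching_compactness[OF n jet_sol_const[of _ m] continuous_on_const e2])
      fix d :: real assume d0: "0 < d" and d: "\<And>w x z. jet_sol F {x. 1/4 < norm x \<and> norm x < 4} w \<Longrightarrow>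
        continuous_on {x. 1/4 < norm x \<and> norm x < 4} w \<Longrightarrow> (\<And>x. 1/4 < norm x \<Longrightarrow> norm x < 4 \<Longrightarrow> \<bar>w x\<bar> \<le> K) \<Longrightarrow>
        (\<And>x. 1/4 < norm x \<Longrightarrow> norm x < 4 \<Longrightarrow> m - d \<le> w x) \<Longrightarrow> norm x = 1 \<Longrightarrow> w x \<le> m + d \<Longrightarrow> norm (z::real^'n) = 1 \<Longrightarrow>
        w z \<le> m + e / 2"
      obtain r1 where r1: "0 < r1" "\<And>x. x \<noteq> 0 \<Longrightarrow> norm x < r1 \<Longrightarrow> m - d \<le> u x" using below[of "m - d"] d0 by auto
      obtain r2 where r2: "0 < r2" "\<And>x. x \<noteq> 0 \<Longrightarrow> norm x < r2 \<Longrightarrow> m - e / 2 \<le> u x" using below[of "m - e / 2"] e by auto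
      \<comment> \<open>The radius is the norm of a point at which \<open>u\<close> is below
        \<open>m + d\<close>. Such points are known to exist only arbitrarily close to the origin,
        and spheres of this kind are just what \<open>punctured_le\<close> asks for.\<close>
      have sph: "\<exists>r>0. r < s \<and> (\<forall>x. norm x = r \<longrightarrow> u x \<le> m + e / 2)" if s: "0 < s" for s
      proof -
        define r0 where "r0 = min s (min r1 \<rho> / 4)"
        have "0 < r0" using s r1 \<rho> by (simp add: r0_def)
        then obtain y where y: "y \<noteq> 0" "norm y < r0" "u y < m + d" using above[of "m + d" r0] d0 by auto
        define r where "r = norm y"
        have r: "0 < r" "r < s" "4 * r < r1" "4 * r < \<rho>" using y by (auto simp: r_def r0_def)
        define w where "w z = 1 * u (r *\<^sub>R z)" for z
        have rg: "r *\<^sub>R z \<noteq> 0" "norm (r *\<^sub>R z) < r1" "norm (r *\<^sub>R z) < \<rho>" if "1/4 < norm z" "norm z < 4" for z :: "real^'n"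
        proof -
          show nz: "r *\<^sub>R z \<noteq> 0" using that r by auto
          have "r * norm z < r * 4" using that r(1) by (intro mult_strict_left_mono) auto
          moreover have "norm (r *\<^sub>R z) = r * norm z" using r by simp
          ultimately show "norm (r *\<^sub>R z) < r1" "norm (r *\<^sub>R z) < \<rho>" using r by linarith+
        qed
        have "u x \<le> m + e / 2" if x: "norm x = r" for x
        proof -
          have sy: "r *\<^sub>R (y /\<^sub>R r) = y" "r *\<^sub>R (x /\<^sub>R r) = x" using r by auto
          have "w (x /\<^sub>R r) \<le> m + e / 2"
          proof (rule d[of w "y /\<^sub>R r"])
            show "jet_sol F {x. 1/4 < norm x \<and> norm x < 4} w" "continuous_on {x. 1/4 < norm x \<and> norm x < 4} w"
              unfolding w_def[abs_def] using psol_rescale[OF u r(1) less_imp_le[OF r(4)], of 1] by simp_all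
            show "w (y /\<^sub>R r) \<le> m + d" unfolding w_def sy using y(3) by simp
            show "norm (y /\<^sub>R r) = 1" "norm (x /\<^sub>R r) = 1" using x r by (simp_all add: r_def)
            show "\<bar>w z\<bar> \<le> K" "m - d \<le> w z" if "1/4 < norm z" "norm z < 4" for z
              unfolding w_def using bd[OF rg(1,3)[OF that]] r1(2)[OF rg(1,2)[OF that]] by simp_all
          qed
          then show ?thesis unfolding w_def sy by simp
        qed
        then show ?thesis using r(1,2) by blast
      qed
      obtain R where R: "0 < R" "R < \<rho>" "\<And>x. norm x = R \<Longrightarrow> u x \<le> m + e / 2" using sph[OF \<rho>] by blast
      have le: "u x \<le> m + e / 2" if x: "x \<noteq> 0" "norm x \<le> R" for x
      proof (rule punctured_le[OF u psol_const R(2) R(3) _ x])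
        fix e' d' :: real assume e': "0 < e'" and d': "0 < d'"
        obtain r where r: "0 < r" "r < d'" "\<And>x. norm x = r \<Longrightarrow> u x \<le> m + e / 2" using sph[OF d'] by blast
        have "u x \<le> m + e / 2 + e'" if "norm x = r" for x using r(3)[OF that] e' by simp
        then show "\<exists>r>0. r < d' \<and> (\<forall>y. norm y = r \<longrightarrow> u y \<le> m + e / 2 + e')" using r(1,2) by blast
      qed
      show ?thesis unfolding eventually_at_zero
      proof (intro exI[of _ "min r2 R"] conjI allI impI)
        show "0 < min r2 R" using r2 R by simp
        show "dist (u x) m < e" if x: "x \<noteq> 0" "norm x < min r2 R" for x
          using le[of x] r2(2)[of x] x e by (auto simp: dist_real_def abs_less_iff)
      qed
    qed
  qed
  then show ?thesis by blast
qed

text \<open>By the Harnack inequality a large value at one point makes \<open>u\<close> large on the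
  whole sphere through it. Such spheres are arbitrarily small, and comparison with a constant fills
  the region inside one of them.\<close>

lemma unbounded_psol_at_top:
  assumes n: "2 \<le> CARD('n)" and u: "psol F \<rho> u" and \<rho>: "0 < \<rho>"
    and nn: "\<And>x. x \<noteq> 0 \<Longrightarrow> norm x < \<rho> \<Longrightarrow> 0 \<le> u x"
    and ub: "\<And>M d. 0 < d \<Longrightarrow> \<exists>x. x \<noteq> 0 \<and> norm x < d \<and> M < u x"
  shows "\<exists>d>0. \<forall>x::real^'n. x \<noteq> 0 \<longrightarrow> norm x < d \<longrightarrow> M \<le> u x"
proof (rule harnack_scaled[OF n])
  fix C assume C: "0 < C" "\<And>u \<rho> r x z. psol F \<rho> u \<Longrightarrow> (\<And>x. x \<noteq> 0 \<Longrightarrow> norm x < \<rho> \<Longrightarrow> 0 \<le> u x) \<Longrightarrow>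
    0 < r \<Longrightarrow> 4 * r \<le> \<rho> \<Longrightarrow> norm (x::real^'n) = r \<Longrightarrow> norm z = r \<Longrightarrow> u x \<le> C * u z"
  have sph: "\<exists>r>0. r < s \<and> r < \<rho> \<and> (\<forall>x. norm x = r \<longrightarrow> M \<le> u x)" if s: "0 < s" for s
  proof -
    obtain y where y: "y \<noteq> 0" "norm y < min s (\<rho> / 4)" "C * M < u y" using ub[of "min s (\<rho> / 4)" "C * M"] s \<rho> by auto
    have "M \<le> u x" if x: "norm x = norm y" for x
    proof -
      have "u y \<le> C * u x" by (rule C(2)[OF u nn _ _ refl x]) (use y in auto)
      then have "C * M < C * u x" using y(3) by simp
      then show ?thesis using C(1) by simp
    qed
    then show ?thesis using y(1,2) \<rho> by (intro exI[of _ "norm y"]) auto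
  qed
  obtain R where R: "0 < R" "R < \<rho>" "\<And>x. norm x = R \<Longrightarrow> M \<le> u x" using sph[OF \<rho>] by blast
  have "M \<le> u x" if x: "x \<noteq> 0" "norm x \<le> R" for x
  proof (rule punctured_le[OF psol_const u R(2) R(3) _ x])
    fix e d :: real assume e: "0 < e" and d: "0 < d"
    obtain r where r: "0 < r" "r < d" "\<And>x. norm x = r \<Longrightarrow> M \<le> u x" using sph[OF d] by blast
    have "M \<le> u x + e" if "norm x = r" for x using r(3)[OF that] e by simp
    then show "\<exists>r>0. r < d \<and> (\<forall>y. norm y = r \<longrightarrow> M \<le> u y + e)" using r(1,2) by blast
  qed
  then show ?thesis using R(1) by (intro exI[of _ R]) auto
qed

text \<open>With a negative exponent \<open>\<Phi>\<close> would be bounded near the origin, where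
  it tends to \<open>0\<close>, and negative on a sphere. Raised by \<open>c\<close> to be
  nonpositive on that sphere, arbitrarily large multiples of it would remain below \<open>u\<close>,
  although near the origin they exceed every bound.\<close>

lemma unbounded_exponent_nonneg:
  assumes n: "2 \<le> CARD('n)" and u: "psol F \<rho> u" and \<rho>: "0 < \<rho>"
    and nn: "\<And>x. x \<noteq> 0 \<Longrightarrow> norm x < \<rho> \<Longrightarrow> 0 \<le> u x"
    and ub: "\<And>M d. 0 < d \<Longrightarrow> \<exists>x. x \<noteq> 0 \<and> norm x < d \<and> M < u x"
    and \<Phi>: "\<Phi> \<in> H_plus \<alpha>" "jet_sol F (- {0::real^'n}) \<Phi>"
  shows "0 \<le> \<alpha>"
proof (rule ccontr)
  assume "\<not> ?thesis" then have a: "\<alpha> < 0" by simp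
  define R where "R = \<rho> / 2"
  have R: "0 < R" "R < \<rho>" using \<rho> by (auto simp: R_def)
  have pc: "continuous_on (- {0}) \<Phi>" using \<Phi> by (simp add: H_plus_def)
  have s: "psol F \<rho> \<Phi>" by (rule psol_of_global[OF \<Phi>(2) pc])
  obtain b' b where b: "norm b' = R" "norm b = R" "\<And>x. norm x = R \<Longrightarrow> \<Phi> b' \<le> \<Phi> x" "\<And>x. norm x = R \<Longrightarrow> \<Phi> x \<le> \<Phi> b"
    using psol_sphere_bounds[OF s R] by blast
  define c where "c = - \<Phi> b"
  have "b \<noteq> 0" using b R by auto
  then have c: "0 < c" using H_plus_neg[OF a \<Phi>(1)] by (simp add: c_def)
  have le: "k * \<Phi> x + k * c \<le> u x" if x: "x \<noteq> 0" "norm x \<le> R" and k: "0 \<le> k" for x k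
  proof (rule punctured_le[OF psol_add_const[OF psol_cmult[OF s k]] u R(2) _ _ x])
    fix y :: "real^'n" assume y: "norm y = R"
    have "k * (\<Phi> y + c) \<le> 0" using b(4)[OF y] k by (intro mult_nonneg_nonpos) (auto simp: c_def)
    moreover have "0 \<le> u y" using y R by (intro nn) auto
    ultimately show "k * \<Phi> y + k * c \<le> u y" by (simp add: algebra_simps)
  next
    fix e d :: real assume e: "0 < e" and d: "0 < d"
    obtain d1 where d1: "0 < d1" "\<And>x. x \<noteq> 0 \<Longrightarrow> norm x < d1 \<Longrightarrow> k * c \<le> u x"
      using unbounded_psol_at_top[OF n u \<rho> nn ub, of "k * c"] by auto
    obtain r where r: "0 < r" "r < min d d1" using dense[of 0 "min d d1"] d d1 by auto
    have "k * \<Phi> y + k * c \<le> u y + e" if y: "norm y = r" for y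
    proof -
      have y0: "y \<noteq> 0" using y r by auto
      have "k * \<Phi> y \<le> 0" using k H_plus_neg[OF a \<Phi>(1) y0] by (simp add: mult_nonneg_nonpos)
      moreover have "k * c \<le> u y" using d1(2)[OF y0] y r by simp
      ultimately show ?thesis using e by simp
    qed
    then show "\<exists>r>0. r < d \<and> (\<forall>y. norm y = r \<longrightarrow> k * \<Phi> y + k * c \<le> u y + e)" using r by auto
  qed
  obtain d where d: "0 < d" "\<And>x. x \<noteq> 0 \<Longrightarrow> norm x < d \<Longrightarrow> \<bar>\<Phi> x - 0\<bar> < c / 2"
    using tendsto_at_zero[OF H_plus_tendsto_0[OF a \<Phi>(1)] half_gt_zero[OF c]] by blast
  define x where "x = (min d R / 2) *\<^sub>R (axis undefined 1 :: real^'n)"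
  have nx: "norm x = min d R / 2" using d R by (simp add: x_def)
  then have x: "x \<noteq> 0" "norm x < d" "norm x \<le> R" using d R by auto
  have p: "c / 2 < \<Phi> x + c" using d(2)[OF x(1,2)] by (simp add: abs_less_iff)
  \<comment> \<open>Chosen such that \<open>k * (c / 2)\<close> equals \<open>u x + 1\<close>, more
    than \<open>u\<close> permits at \<open>x\<close>.\<close>
  define k where "k = 2 * (u x + 1) / c"
  have ux: "0 \<le> u x" using x R by (intro nn) auto
  then have k: "0 \<le> k" using c by (simp add: k_def)
  have "k * (c / 2) \<le> k * (\<Phi> x + c)" using p k by (intro mult_left_mono) auto
  moreover have "k * (c / 2) = u x + 1" using c by (simp add: k_def)
  ultimately show False using le[OF x(1,3) k] by (simp add: algebra_simps)
qed

text \<open>The lower bound is built into the definition of \<open>a\<close>. For the upper bound it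
  is shown that near the origin \<open>u\<close> is at most \<open>(a + e) * (\<Phi> + E)\<close>
  for each \<open>e\<close>; comparison extends this to a fixed ball with constants that stay
  bounded, and then \<open>e\<close> tends to \<open>0\<close>.\<close>

lemma unbounded_comparable:
  assumes n: "2 \<le> CARD('n)" and u: "psol F \<rho> u" and \<rho>: "0 < \<rho>"
    and nn: "\<And>x. x \<noteq> 0 \<Longrightarrow> norm x < \<rho> \<Longrightarrow> 0 \<le> u x"
    and ub: "\<And>M d. 0 < d \<Longrightarrow> \<exists>x. x \<noteq> 0 \<and> norm x < d \<and> M < u x"
    and \<Phi>: "\<Phi> \<in> H_plus \<alpha>" "jet_sol F (- {0::real^'n}) \<Phi>"
  shows "\<exists>a>0. \<exists>C R. 0 < R \<and> (\<forall>x. x \<noteq> 0 \<longrightarrow> norm x \<le> R \<longrightarrow> a * \<Phi> x - C \<le> u x \<and> u x \<le> a * \<Phi> x + C)"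
proof (rule harnack_scaled[OF n])
  fix CH assume CH: "0 < CH" "\<And>u \<rho> r x z. psol F \<rho> u \<Longrightarrow> (\<And>x. x \<noteq> 0 \<Longrightarrow> norm x < \<rho> \<Longrightarrow> 0 \<le> u x) \<Longrightarrow>
    0 < r \<Longrightarrow> 4 * r \<le> \<rho> \<Longrightarrow> norm (x::real^'n) = r \<Longrightarrow> norm z = r \<Longrightarrow> u x \<le> CH * u z"
  have \<alpha>: "0 \<le> \<alpha>" by (rule unbounded_exponent_nonneg[OF n u \<rho> nn ub \<Phi>])
  have pc: "continuous_on (- {0}) \<Phi>" using \<Phi> by (simp add: H_plus_def)
  have s: "psol F \<rho> \<Phi>" by (rule psol_of_global[OF \<Phi>(2) pc])
  obtain R1 where R1: "0 < R1" "\<And>x. x \<noteq> 0 \<Longrightarrow> norm x < R1 \<Longrightarrow> 1 \<le> \<Phi> x" using fundamental_at_top[OF \<alpha> \<Phi>, of 1] by blast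
  define R where "R = min R1 \<rho> / 2"
  have R: "0 < R" "R < \<rho>" "R < R1" using R1(1) \<rho> by (auto simp: R_def)
  have P1: "1 \<le> \<Phi> x" if "x \<noteq> 0" "norm x \<le> R" for x using R1(2)[of x] that R by simp
  have u0: "0 \<le> u x" if "x \<noteq> 0" "norm x \<le> R" for x using nn[of x] that R by simp
  have nz: "x \<noteq> 0" if "norm x = R" for x :: "real^'n" using that R by auto
  obtain b' b where b: "norm b' = R" "norm b = R" "\<And>x. norm x = R \<Longrightarrow> \<Phi> b' \<le> \<Phi> x" "\<And>x. norm x = R \<Longrightarrow> \<Phi> x \<le> \<Phi> b"
    using psol_sphere_bounds[OF s R(1,2)] by blast
  \<comment> \<open>The maximum of \<open>\<Phi>\<close> on the outer sphere: nonnegative multiples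
    of \<open>\<Phi> - C0\<close> are nonpositive there, hence below \<open>u\<close>.\<close>
  define C0 where "C0 = \<Phi> b"
  have C0: "1 \<le> C0" unfolding C0_def using b(2) by (intro P1 nz) auto
  obtain c' c where c: "norm c' = R" "norm c = R" "\<And>x. norm x = R \<Longrightarrow> u c' \<le> u x" "\<And>x. norm x = R \<Longrightarrow> u x \<le> u c"
    using psol_sphere_bounds[OF u R(1,2)] by blast
  define M0 where "M0 = u c"
  have M0: "0 \<le> M0" unfolding M0_def using c(2) by (intro u0 nz) auto
  define T where "T = {k. 0 \<le> k \<and> (\<forall>x. x \<noteq> 0 \<longrightarrow> norm x \<le> R \<longrightarrow> k * (\<Phi> x - C0) \<le> u x)}"
  have T0: "0 \<in> T" unfolding T_def using u0 by auto
  have Tle: "k \<le> u x / (\<Phi> x - C0)" if "k \<in> T" "x \<noteq> 0" "norm x \<le> R" "C0 < \<Phi> x" for k x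
    using that unfolding T_def by (simp add: pos_le_divide_eq)
  have bdd: "bdd_above T"
  proof -
    obtain d where d: "0 < d" "\<And>x. x \<noteq> 0 \<Longrightarrow> norm x < d \<Longrightarrow> C0 + 1 \<le> \<Phi> x" using fundamental_at_top[OF \<alpha> \<Phi>, of "C0 + 1"] by blast
    define x where "x = (min d R / 2) *\<^sub>R (axis undefined 1 :: real^'n)"
    have nx: "norm x = min d R / 2" using d R by (simp add: x_def)
    then have x: "x \<noteq> 0" "norm x < d" "norm x \<le> R" using d R by auto
    have "C0 < \<Phi> x" using d(2)[OF x(1,2)] by simp
    then show ?thesis using Tle[OF _ x(1,3)] by (auto simp: bdd_above_def)
  qed
  define a where "a = Sup T"
  have a0: "0 \<le> a" unfolding a_def by (rule cSup_upper[OF T0 bdd])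
  have low: "a * (\<Phi> x - C0) \<le> u x" if x: "x \<noteq> 0" "norm x \<le> R" for x
  proof (cases "C0 < \<Phi> x")
    case True
    have "a \<le> u x / (\<Phi> x - C0)" unfolding a_def using T0 Tle[OF _ x True] by (intro cSup_least) auto
    then show ?thesis using True by (simp add: pos_le_divide_eq)
  next
    case False
    then have "a * (\<Phi> x - C0) \<le> 0" using a0 by (intro mult_nonneg_nonpos) auto
    then show ?thesis using u0[OF x] by simp
  qed
  \<comment> \<open>If \<open>(a + \<delta>) * \<Phi> \<le> u\<close> held on arbitrarily small
    spheres, comparison would make \<open>a + \<delta>\<close> admissible, against the definition of
    \<open>a\<close>.\<close>
  have above: "\<exists>d>0. \<forall>r. 0 < r \<longrightarrow> r < d \<longrightarrow> (\<exists>x. norm x = r \<and> u x < (a + \<delta>) * \<Phi> x)" if \<delta>: "0 < \<delta>" for \<delta>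
  proof (rule ccontr)
    assume "\<not> ?thesis"
    then have c: "\<exists>r. 0 < r \<and> r < d \<and> (\<forall>x. norm x = r \<longrightarrow> (a + \<delta>) * \<Phi> x \<le> u x)" if "0 < d" for d
      using that by (meson not_less)
    have "(a + \<delta>) * \<Phi> x + - (a + \<delta>) * C0 \<le> u x" if x: "x \<noteq> 0" "norm x \<le> R" for x
    proof (rule punctured_le[OF psol_add_const[OF psol_cmult[OF s]] u R(2) _ _ x])
      show "0 \<le> a + \<delta>" using a0 \<delta> by simp
      fix y :: "real^'n" assume y: "norm y = R"
      have "(a + \<delta>) * (\<Phi> y - C0) \<le> 0" using b(4)[OF y] a0 \<delta> by (intro mult_nonneg_nonpos) (auto simp: C0_def)
      then show "(a + \<delta>) * \<Phi> y + - (a + \<delta>) * C0 \<le> u y" using u0[OF nz[OF y]] y by (simp add: algebra_simps)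
    next
      fix e d :: real assume e: "0 < e" and d: "0 < d"
      obtain r where r: "0 < r" "r < d" "\<And>x. norm x = r \<Longrightarrow> (a + \<delta>) * \<Phi> x \<le> u x" using c[OF d] by blast
      have "0 \<le> (a + \<delta>) * C0" using a0 \<delta> C0 by simp
      then have "(a + \<delta>) * \<Phi> y + - (a + \<delta>) * C0 \<le> u y + e" if "norm y = r" for y using r(3)[OF that] e by linarith
      then show "\<exists>r>0. r < d \<and> (\<forall>y. norm y = r \<longrightarrow> (a + \<delta>) * \<Phi> y + - (a + \<delta>) * C0 \<le> u y + e)" using r(1,2) by blast
    qed
    then have "a + \<delta> \<in> T" unfolding T_def using a0 \<delta> by (auto simp: algebra_simps)
    then show False using cSup_upper[OF _ bdd, of "a + \<delta>"] \<delta> unfolding a_def by simp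
  qed
  show ?thesis
  proof (rule profile[OF \<alpha> \<Phi>])
    fix \<tau> G g0 g1 E assume G: "jet_sol F (- {0}) G" "continuous_on (- {0}) G" and g0: "0 < g0" and E: "0 \<le> E"
      and g: "\<And>x. 1/4 < norm x \<Longrightarrow> norm x < 4 \<Longrightarrow> g0 \<le> G x \<and> G x \<le> g1"
      and pr: "\<And>r x. 0 < r \<Longrightarrow> 1/4 < norm x \<Longrightarrow> norm x < 4 \<Longrightarrow> \<bar>\<Phi> (r *\<^sub>R x) - \<tau> r * G x\<bar> \<le> E"
      and \<tau>: "\<And>M. \<exists>d>0. \<forall>r. 0 < r \<longrightarrow> r < d \<longrightarrow> M \<le> \<tau> r"
    have g1: "0 < g1" using g[of "axis undefined 1"] g0 by simp
    have pr1: "\<Phi> (r *\<^sub>R x) \<le> \<tau> r * G x + E" "\<tau> r * G x \<le> \<Phi> (r *\<^sub>R x) + E"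
      if "0 < r" "1/4 < norm x" "norm x < 4" for r x
      using abs_le_D1[OF pr[OF that]] abs_le_D2[OF pr[OF that]] by linarith+
    \<comment> \<open>The uniform bound for rescaled functions: on every small sphere some value is
      below \<open>(a + 1) * \<Phi>\<close>, and the Harnack inequality carries it to the whole
      sphere with the factor \<open>CH\<close>.\<close>
    define S where "S = CH * ((a + 1) * (g1 + E))"
    obtain d1 where d1: "0 < d1" "\<And>r. 0 < r \<Longrightarrow> r < d1 \<Longrightarrow> \<exists>x. norm x = r \<and> u x < (a + 1) * \<Phi> x" using above[of 1] by auto
    have key: "\<exists>d>0. \<forall>x. x \<noteq> 0 \<longrightarrow> norm x < d \<longrightarrow> u x \<le> (a + e) * (\<Phi> x + E)" if e: "0 < e" for e
    proof -
      have eg: "0 < e * g0" using e g0 by simp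
      have Gs: "jet_sol F {x. 1/4 < norm x \<and> norm x < 4} (\<lambda>x. a * G x)"
        by (rule jet_sol_subset[OF jet_sol_cmult[OF G(1) a0]]) auto
      have Gc: "continuous_on {x. 1/4 < norm x \<and> norm x < 4} (\<lambda>x. a * G x)"
        by (intro continuous_on_mult_left continuous_on_subset[OF G(2)]) auto
      show ?thesis
      proof (rule touching_compactness[OF n Gs Gc eg])
        fix d :: real assume d0: "0 < d" and d: "\<And>w x z. jet_sol F {x. 1/4 < norm x \<and> norm x < 4} w \<Longrightarrow>
          continuous_on {x. 1/4 < norm x \<and> norm x < 4} w \<Longrightarrow> (\<And>x. 1/4 < norm x \<Longrightarrow> norm x < 4 \<Longrightarrow> \<bar>w x\<bar> \<le> S) \<Longrightarrow>
          (\<And>x. 1/4 < norm x \<Longrightarrow> norm x < 4 \<Longrightarrow> a * G x - d \<le> w x) \<Longrightarrow> norm x = 1 \<Longrightarrow> w x \<le> a * G x + d \<Longrightarrow> norm z = 1 \<Longrightarrow>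
          w z \<le> a * G z + e * g0"
        define \<delta> where "\<delta> = d / (2 * g1)"
        have \<delta>: "0 < \<delta>" "\<delta> * g1 = d / 2" using d0 g1 by (auto simp: \<delta>_def)
        obtain d2 where d2: "0 < d2" "\<And>r. 0 < r \<Longrightarrow> r < d2 \<Longrightarrow> \<exists>x. norm x = r \<and> u x < (a + \<delta>) * \<Phi> x" using above[OF \<delta>(1)] by auto
        \<comment> \<open>At scales where \<open>\<tau> r\<close> is at least \<open>M\<close>, the
          additive constants \<open>C0\<close> and \<open>E\<close> fall within the tolerance
          \<open>d\<close> once they are divided by \<open>\<tau> r\<close>.\<close>
        define M where "M = max 1 (max (a * (E + C0) / d) (2 * (a + \<delta>) * E / d))"
        obtain d3 where d3: "0 < d3" "\<And>r. 0 < r \<Longrightarrow> r < d3 \<Longrightarrow> M \<le> \<tau> r" using \<tau>[of M] by auto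
        \<comment> \<open>A ring point has norm up to \<open>4 * r\<close> after scaling, and the
          Harnack inequality on its sphere needs room up to four times that norm; hence the factor
          \<open>16\<close>.\<close>
        define r0 where "r0 = min (min d1 R / 16) (min d2 d3)"
        have r0: "0 < r0" using d1 d2 d3 R by (simp add: r0_def)
        have "u x \<le> (a + e) * (\<Phi> x + E)" if x: "x \<noteq> 0" "norm x < r0" for x
        proof -
          define r where "r = norm x"
          have r: "0 < r" "r < d2" "r < d3" "16 * r < d1" "16 * r < R" using x by (auto simp: r_def r0_def)
          define t where "t = \<tau> r"
          have "M \<le> t" unfolding t_def by (rule d3(2)[OF r(1,3)])
          then have t: "1 \<le> t" "a * (E + C0) / d \<le> t" "2 * (a + \<delta>) * E / d \<le> t" unfolding M_def by linarith+
          then have t2: "a * (E + C0) \<le> t * d" "(a + \<delta>) * E \<le> t * (d / 2)" using d0 by (simp_all add: pos_divide_le_eq mult_ac)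
          define w where "w z = (1 / t) * u (r *\<^sub>R z)" for z
          have tw: "t * w z = u (r *\<^sub>R z)" for z using t by (simp add: w_def)
          have rg: "r *\<^sub>R z \<noteq> 0" "norm (r *\<^sub>R z) = r * norm z" "r * norm z < 4 * r" "norm (r *\<^sub>R z) \<le> R"
            if "1/4 < norm z" "norm z < 4" for z :: "real^'n"
          proof -
            show "r *\<^sub>R z \<noteq> 0" using that r by auto
            have "r * norm z < r * 4" using that r(1) by (intro mult_strict_left_mono) auto
            then show l: "r * norm z < 4 * r" by linarith
            show n: "norm (r *\<^sub>R z) = r * norm z" using r by simp
            show "norm (r *\<^sub>R z) \<le> R" using l n r by linarith
          qed
          obtain y where y: "norm y = r" "u y < (a + \<delta>) * \<Phi> y" using d2(2)[OF r(1,2)] by blast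
          have sy: "r *\<^sub>R (y /\<^sub>R r) = y" "r *\<^sub>R (x /\<^sub>R r) = x" using r by auto
          have n1: "norm (y /\<^sub>R r) = 1" "norm (x /\<^sub>R r) = 1" using y r by (auto simp: r_def)
          have "w (x /\<^sub>R r) \<le> a * G (x /\<^sub>R r) + e * g0"
          proof (rule d[of w "y /\<^sub>R r"])
            have "4 * r \<le> \<rho>" using r R by linarith
            then show "jet_sol F {x. 1/4 < norm x \<and> norm x < 4} w" "continuous_on {x. 1/4 < norm x \<and> norm x < 4} w"
              unfolding w_def[abs_def] using psol_rescale[OF u r(1), of "1 / t"] t by simp_all
            fix z :: "real^'n" assume z: "1/4 < norm z" "norm z < 4"
            have z0: "z \<noteq> 0" using z by auto
            have rz: "0 < r * norm z" "r * norm z < d1" "4 * (r * norm z) \<le> \<rho>" using rg(3)[OF z] r R z0 by (simp, linarith+)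
            obtain y' where y': "norm y' = r * norm z" "u y' < (a + 1) * \<Phi> y'" using d1(2)[OF rz(1,2)] by blast
            have ny': "norm (y' /\<^sub>R r) = norm z" using y' r by simp
            have "\<Phi> y' \<le> t * G (y' /\<^sub>R r) + E" using pr1(1)[OF r(1), of "y' /\<^sub>R r"] ny' z r by (simp add: t_def)
            also have "t * G (y' /\<^sub>R r) \<le> t * g1" using g[of "y' /\<^sub>R r"] ny' z t by (intro mult_left_mono) auto
            also have "t * g1 + E \<le> t * (g1 + E)" using mult_right_mono[OF t(1) E] by (simp add: algebra_simps)
            finally have "(a + 1) * \<Phi> y' \<le> (a + 1) * (t * (g1 + E))" using a0 by (intro mult_left_mono) auto
            then have "CH * u y' \<le> CH * ((a + 1) * (t * (g1 + E)))" using y'(2) CH(1) by (intro mult_left_mono) auto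
            moreover have "u (r *\<^sub>R z) \<le> CH * u y'" by (rule CH(2)[OF u nn rz(1,3) rg(2)[OF z] y'(1)])
            ultimately have "t * w z \<le> t * S" unfolding tw S_def by (simp add: mult_ac)
            then have "w z \<le> S" using t by simp
            moreover have "0 \<le> w z" unfolding w_def using u0[OF rg(1,4)[OF z]] t by simp
            ultimately show "\<bar>w z\<bar> \<le> S" by simp
            have "a * (t * G z) \<le> a * (\<Phi> (r *\<^sub>R z) + E)" using pr1(2)[OF r(1) z] a0 by (intro mult_left_mono) (auto simp: t_def)
            moreover have "a * (\<Phi> (r *\<^sub>R z) - C0) \<le> t * w z" unfolding tw by (rule low[OF rg(1,4)[OF z]])
            ultimately have "t * (a * G z - d) \<le> t * w z" using t2(1) by (simp add: algebra_simps)
            then show "a * G z - d \<le> w z" using t by simp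
          next
            have gy: "G (y /\<^sub>R r) \<le> g1" using g[of "y /\<^sub>R r"] n1 by simp
            have "\<Phi> y \<le> t * G (y /\<^sub>R r) + E" using pr1(1)[OF r(1), of "y /\<^sub>R r"] n1 sy by (simp add: t_def)
            then have "(a + \<delta>) * \<Phi> y \<le> (a + \<delta>) * (t * G (y /\<^sub>R r) + E)" using a0 \<delta> by (intro mult_left_mono) auto
            moreover have "t * (\<delta> * G (y /\<^sub>R r)) \<le> t * (\<delta> * g1)" using gy t \<delta> by (intro mult_left_mono) auto
            ultimately have "t * w (y /\<^sub>R r) \<le> t * (a * G (y /\<^sub>R r) + d)"
              unfolding tw sy \<delta>(2) using y(2) t2(2) by (simp add: algebra_simps)
            then show "w (y /\<^sub>R r) \<le> a * G (y /\<^sub>R r) + d" using t by simp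
          qed (use n1 in auto)
          also have "e * g0 \<le> e * G (x /\<^sub>R r)" using g[of "x /\<^sub>R r"] n1(2) e by simp
          finally have "w (x /\<^sub>R r) \<le> (a + e) * G (x /\<^sub>R r)" by (simp add: algebra_simps)
          then have "t * w (x /\<^sub>R r) \<le> t * ((a + e) * G (x /\<^sub>R r))" using t by (intro mult_left_mono) auto
          then have "u x \<le> (a + e) * (t * G (x /\<^sub>R r))" unfolding tw sy by (simp add: mult_ac)
          also have "\<dots> \<le> (a + e) * (\<Phi> x + E)"
            using pr1(2)[OF r(1), of "x /\<^sub>R r"] n1(2) sy(2) a0 e by (intro mult_left_mono) (auto simp: t_def)
          finally show ?thesis .
        qed
        then show ?thesis using r0 by blast
      qed
    qed
    have up: "u x \<le> (a + e) * \<Phi> x + ((a + e) * E + M0)" if x: "x \<noteq> 0" "norm x \<le> R" and e: "0 < e" for x e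
    proof (rule punctured_le[OF u psol_add_const[OF psol_cmult[OF s]] R(2) _ _ x])
      show "0 \<le> a + e" using a0 e by simp
      fix y :: "real^'n" assume y: "norm y = R"
      have "0 \<le> (a + e) * \<Phi> y" "0 \<le> (a + e) * E" using P1[OF nz[OF y]] y a0 e E by auto
      then show "u y \<le> (a + e) * \<Phi> y + ((a + e) * E + M0)" using c(4)[OF y] unfolding M0_def by linarith
    next
      fix e' d :: real assume e': "0 < e'" and d: "0 < d"
      obtain d1 where d1: "0 < d1" "\<And>x. x \<noteq> 0 \<Longrightarrow> norm x < d1 \<Longrightarrow> u x \<le> (a + e) * (\<Phi> x + E)" using key[OF e] by blast
      obtain r where r: "0 < r" "r < min d d1" using dense[of 0 "min d d1"] d d1 by auto
      have "u y \<le> (a + e) * \<Phi> y + ((a + e) * E + M0) + e'" if y: "norm y = r" for y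
      proof -
        have "y \<noteq> 0" using y r by auto
        then have "u y \<le> (a + e) * (\<Phi> y + E)" using d1(2)[of y] y r by simp
        then show ?thesis using M0 e' by (simp add: algebra_simps)
      qed
      then show "\<exists>r>0. r < d \<and> (\<forall>y. norm y = r \<longrightarrow> u y \<le> (a + e) * \<Phi> y + ((a + e) * E + M0) + e')" using r by auto
    qed
    have upp: "u x \<le> a * \<Phi> x + (a * E + M0)" if x: "x \<noteq> 0" "norm x \<le> R" for x
    \<comment> \<open>With the parameter \<open>e / (\<Phi> x + E)\<close> in \<open>up\<close>, the
      excess at the given \<open>x\<close> is exactly \<open>e\<close>.\<close>
    proof (rule field_le_epsilon)
      fix e :: real assume e: "0 < e"
      have p: "0 < \<Phi> x + E" using P1[OF x] E by simp
      have "u x \<le> (a + e / (\<Phi> x + E)) * \<Phi> x + ((a + e / (\<Phi> x + E)) * E + M0)" using e p by (intro up x) simp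
      also have "\<dots> = a * \<Phi> x + (a * E + M0) + e / (\<Phi> x + E) * (\<Phi> x + E)" by (simp only: distrib_left distrib_right add_ac)
      also have "e / (\<Phi> x + E) * (\<Phi> x + E) = e" using p by simp
      finally show "u x \<le> a * \<Phi> x + (a * E + M0) + e" .
    qed
    \<comment> \<open>For \<open>a = 0\<close> the upper bound would be the constant
      \<open>M0\<close>, whereas \<open>u\<close> is unbounded.\<close>
    have "a \<noteq> 0"
    proof
      assume "a = 0"
      obtain x where "x \<noteq> 0" "norm x < R" "M0 < u x" using ub[OF R(1), of M0] by blast
      then show False using upp[of x] \<open>a = 0\<close> by simp
    qed
    then have "0 < a" using a0 by simp
    moreover have "a * \<Phi> x - max (a * C0) (a * E + M0) \<le> u x \<and> u x \<le> a * \<Phi> x + max (a * C0) (a * E + M0)"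
      if x: "x \<noteq> 0" "norm x \<le> R" for x using low[OF x] upp[OF x] by (simp add: algebra_simps max_def)
    ultimately show ?thesis using R(1) by blast
  qed
qed

text \<open>If the equation fails at the origin for the extended function, a failing jet there can be tilted in every direction:
  the maximum of the tilted difference cannot sit away from the origin, where the equation holds.\<close>

lemma cone_of_not_jet_sub:
  assumes u: "psol F 1 u" and lim: "(u \<longlongrightarrow> c) (at (0::real^'n))"
    and fail: "\<not> jet_sub F (ball 0 1) (u(0 := c))"
  shows "\<exists>p. \<exists>R>0. \<forall>x. x \<noteq> 0 \<longrightarrow> norm x < R \<longrightarrow> u x - c - p \<bullet> x < 0"
proof -
  define v where "v = u(0 := c)"
  have v0: "v 0 = c" and vu: "\<And>x. x \<noteq> 0 \<Longrightarrow> v x = u x" by (auto simp: v_def)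
  have us: "jet_sub F (ball 0 1 - {0}) u" and uc: "continuous_on (ball 0 1 - {0}) u"
    using u unfolding psol_def jet_sol_def by blast+
  have vc: "continuous_on (ball 0 1) v" unfolding v_def by (rule continuous_on_ball_extension[OF uc lim])
  obtain z p X where z: "z \<in> ball 0 1" and X: "sym_matrix X" and j: "superjet v z p ((*v) X)" and FX: "\<not> F X \<le> 0"
    using fail unfolding jet_sub_def v_def[symmetric] by blast
  have z0: "z = 0"
  proof (rule ccontr)
    assume z0: "z \<noteq> 0"
    have "superjet u z p ((*v) X)"
    proof (rule superjet_cong[OF j])
      show "0 < norm z" using z0 by simp
      show "v x = u x" if "x \<in> ball z (norm z)" for x using that by (intro vu) auto
    qed
    moreover have "z \<in> ball 0 1 - {0}" using z z0 by simp
    ultimately show False using jet_subD[OF us _ X] FX by blast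
  qed
  \<comment> \<open>The failure of the equation is an open condition, so the matrix can be enlarged
    to \<open>Y\<close> with \<open>F Y > 0\<close>. The quadratic with matrix \<open>Y\<close> then
    lies above \<open>v\<close> by at least \<open>e\<close> times the squared norm.\<close>
  obtain t where t: "0 < t" "\<not> F (X + t *\<^sub>R mat 1) \<le> 0" using nonpos_of_perturbation[OF X] FX by blast
  define Y where "Y = X + t *\<^sub>R mat 1"
  have Y: "sym_matrix Y" unfolding Y_def using X by auto
  have Yh: "h \<bullet> (Y *v h) = h \<bullet> (X *v h) + t * (norm h)\<^sup>2" for h
    unfolding Y_def power2_norm_eq_inner by (simp add: mv_simps inner_add_right)
  define e where "e = t / 4"
  have e: "0 < e" using t(1) by (simp add: e_def)
  obtain d where d: "0 < d" "\<And>h. norm h < d \<Longrightarrow> v (z + h) \<le> v z + p \<bullet> h + h \<bullet> (X *v h) / 2 + e * (norm h)\<^sup>2"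
    using superjetD[OF j e] by blast
  define s where "s = min d 1 / 2"
  have s: "0 < s" "s < d" "s < 1" using d(1) by (auto simp: s_def)
  have up: "v h \<le> c + p \<bullet> h + h \<bullet> (Y *v h) / 2 - e * (norm h)\<^sup>2" if "norm h \<le> s" for h
  proof -
    have "v (z + h) \<le> v z + p \<bullet> h + h \<bullet> (X *v h) / 2 + e * (norm h)\<^sup>2" using that s by (intro d(2)) simp
    then have "v h \<le> c + p \<bullet> h + h \<bullet> (X *v h) / 2 + e * (norm h)\<^sup>2" by (simp add: z0 v0)
    moreover have "h \<bullet> (Y *v h) / 2 = h \<bullet> (X *v h) / 2 + 2 * (e * (norm h)\<^sup>2)" unfolding Yh e_def by (simp add: field_simps)
    ultimately show ?thesis by linarith
  qed
  define f where "f q x = (p + q) \<bullet> (x - 0) + (x - 0) \<bullet> (Y *v (x - 0)) / 2" for q x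
  have fx: "f q x = p \<bullet> x + q \<bullet> x + x \<bullet> (Y *v x) / 2" for q x unfolding f_def by (simp add: inner_add_left)
  \<comment> \<open>A tilt shorter than \<open>e * s\<close> cannot outweigh the gap
    \<open>e * s\<^sup>2\<close> on the sphere of radius \<open>s\<close>, and an interior maximum
    away from the origin would give \<open>F Y \<le> 0\<close>. So the maximum stays at the origin,
    for every such \<open>q\<close>.\<close>
  have tilt: "v x \<le> c + f q x" if q: "norm q < e * s" and x: "norm x \<le> s" for q x
  proof -
    have cv: "continuous_on (cball 0 s) v" by (rule continuous_on_subset[OF vc]) (use s in auto)
    have cd: "continuous_on (cball 0 s) (\<lambda>y::real^'n. y - 0)" by (intro continuous_intros)
    have cY: "continuous_on (cball 0 s) (\<lambda>y. Y *v (y - 0))"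
      by (rule bounded_linear.continuous_on[OF matrix_vector_mul_bounded_linear cd])
    have "continuous_on (cball 0 s) (\<lambda>y. v y - f q y)"
      unfolding f_def by (intro continuous_on_diff[OF cv] continuous_on_add continuous_on_divide continuous_on_inner cd cY continuous_on_const) simp
    moreover have "cball (0::real^'n) s \<noteq> {}" using s by simp
    ultimately obtain y where y: "y \<in> cball 0 s" "\<And>x. x \<in> cball 0 s \<Longrightarrow> v x - f q x \<le> v y - f q y"
      using continuous_attains_sup[OF compact_cball] by blast
    have cy: "c \<le> v y - f q y" using y(2)[of 0] s v0 by (simp add: fx)
    have "y = 0"
    proof (rule ccontr)
      assume y0: "y \<noteq> 0"
      have "norm y \<noteq> s"
      proof
        assume ys: "norm y = s"
        have "- (q \<bullet> y) \<le> norm q * norm y" using Cauchy_Schwarz_ineq2[of q y] by (simp add: abs_le_iff)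
        also have "norm q * norm y < e * s * s" using mult_strict_right_mono[OF q s(1)] ys by simp
        finally show False using up[of y] cy ys by (simp add: fx power2_eq_square)
      qed
      then have ys: "norm y < s" using y(1) by simp
      have "superjet (\<lambda>x. f q x + (v y - f q y)) y (p + q + Y *v (y - 0)) ((*v) Y)"
        unfolding f_def by (rule jet2_imp_superjet[OF jet2_add_const[OF jet2_quadratic[OF Y]]])
      then have "superjet u y (p + q + Y *v (y - 0)) ((*v) Y)"
      proof (rule superjet_le)
        show "0 < min (norm y) (s - norm y)" using y0 ys by simp
        show "u y = f q y + (v y - f q y)" using vu[OF y0] by simp
        fix x assume x: "x \<in> ball y (min (norm y) (s - norm y))"
        then have "x \<noteq> 0" by auto
        moreover have "norm x \<le> s" using x norm_triangle_ineq[of y "x - y"] by (simp add: dist_norm norm_minus_commute)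
        ultimately show "u x \<le> f q x + (v y - f q y)" using y(2)[of x] vu[of x] by simp
      qed
      moreover have "y \<in> ball 0 1 - {0}" using y0 ys s by simp
      ultimately have "F Y \<le> 0" using jet_subD[OF us _ Y] by blast
      then show False using t(2) by (simp add: Y_def)
    qed
    then show ?thesis using y(2)[of x] x v0 by (simp add: fx)
  qed
  obtain K where K: "0 < K" "\<And>h. norm (Y *v h) \<le> norm h * K"
    using bounded_linear.pos_bounded[OF matrix_vector_mul_bounded_linear[of Y]] by blast
  define R where "R = min s (e * s / K)"
  have "u x - c - p \<bullet> x < 0" if x: "x \<noteq> 0" "norm x < R" for x
  proof -
    \<comment> \<open>The tilt points against \<open>x\<close>, so that its contribution
      \<open>- (e * s / 2) * norm x\<close> beats the quadratic term for all small
      \<open>x\<close>.\<close>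
    define q where "q = - ((e * s / 2) / norm x) *\<^sub>R x"
    have nq: "norm q = e * s / 2" using x(1) e s by (simp add: q_def)
    have qx: "q \<bullet> x = - (e * s / 2 * norm x)" using x(1) by (simp add: q_def power2_norm_eq_inner[symmetric] power2_eq_square)
    have es: "0 < e * s" using e s by simp
    have "v x \<le> c + f q x" using nq es x(2) by (intro tilt) (auto simp: R_def)
    moreover have "x \<bullet> (Y *v x) \<le> norm x * (norm x * K)"
      using norm_cauchy_schwarz[of x "Y *v x"] mult_left_mono[OF K(2)[of x] norm_ge_zero[of x]] by linarith
    moreover have "norm x * (norm x * K) < norm x * (e * s)"
    proof (rule mult_strict_left_mono)
      have "norm x < e * s / K" using x(2) by (simp add: R_def)
      then show "norm x * K < e * s" using K(1) by (simp add: pos_less_divide_eq)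
    qed (use x in simp)
    ultimately have "v x < c + p \<bullet> x" unfolding fx qx by (simp add: algebra_simps)
    then show ?thesis using vu[OF x(1)] by simp
  qed
  moreover have "0 < R" using s e K by (simp add: R_def)
  ultimately show ?thesis by blast
qed

end

subsection \<open>The five alternatives\<close>

text \<open>These predicates express three of the five alternatives; the two that belong to the dual
  operator are \<open>blowup\<close> and \<open>cusp\<close> applied to \<open>- u\<close> and the
  dual fundamental solution.\<close>

definition removable :: "(real^'n^'n \<Rightarrow> real) \<Rightarrow> (real^'n \<Rightarrow> real) \<Rightarrow> bool" where
  "removable F u \<longleftrightarrow> (\<exists>c. continuous_on (ball 0 1) (u(0 := c)) \<and> jet_sol F (ball 0 1) (u(0 := c)))"

definition blowup :: "real \<Rightarrow> (real^'n \<Rightarrow> real) \<Rightarrow> (real^'n \<Rightarrow> real) \<Rightarrow> bool" where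
  "blowup \<alpha> \<Phi> u \<longleftrightarrow> 0 \<le> \<alpha> \<and> (\<exists>a>0. \<exists>C>0. \<forall>x\<in>ball 0 (1/2) - {0}. a * \<Phi> x - C \<le> u x \<and> u x \<le> a * \<Phi> x + C)"

definition cusp :: "real \<Rightarrow> (real^'n \<Rightarrow> real) \<Rightarrow> (real^'n \<Rightarrow> real) \<Rightarrow> bool" where
  "cusp \<alpha> \<Phi> u \<longleftrightarrow> \<alpha> < 0 \<and> (\<exists>c. \<exists>a>0. ((\<lambda>x. (u x - c) / \<Phi> x) \<longlongrightarrow> a) (at 0))"

lemma removable_dual:
  assumes "removable F u"
  shows "removable (dual_operator F) (\<lambda>x. - u x)"
proof -
  obtain c where c: "continuous_on (ball 0 1) (u(0 := c))" "jet_sol F (ball 0 1) (u(0 := c))" using assms unfolding removable_def by blast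
  have eq: "(\<lambda>x. - u x)(0 := - c) = (\<lambda>x. - (u(0 := c)) x)" by auto
  have "continuous_on (ball 0 1) ((\<lambda>x. - u x)(0 := - c))" unfolding eq by (rule continuous_on_minus[OF c(1)])
  moreover have "jet_sol (dual_operator F) (ball 0 1) ((\<lambda>x. - u x)(0 := - c))" unfolding eq by (rule jet_sol_dual[OF c(2)])
  ultimately show ?thesis unfolding removable_def by blast
qed

lemma removable_tendsto:
  assumes "continuous_on (ball 0 1) (u(0 := c))"
  shows "(u \<longlongrightarrow> (c::real)) (at (0::'a::real_normed_vector))"
proof -
  have "isCont (u(0 := c)) 0" using assms continuous_on_eq_continuous_at[of "ball (0::'a) 1" "u(0 := c)"] by auto
  then have "((u(0 := c)) \<longlongrightarrow> c) (at 0)" by (simp add: isCont_def)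
  then show ?thesis by (rule Lim_transform_eventually) (simp add: eventually_at_zero exI[of _ 1])
qed

text \<open>\<open>\<Phi>\<close> is negative and tends to \<open>0\<close>. Multiplying the
  quotient by it gives the limit, and positivity of the quotient near the origin gives the sign of
  \<open>u - c\<close>.\<close>

lemma cusp_tendsto:
  assumes u: "cusp \<alpha> \<Phi> u" and \<Phi>: "\<Phi> \<in> H_plus \<alpha>"
  obtains c where "(u \<longlongrightarrow> c) (at 0)" "\<forall>\<^sub>F x in at 0. u x < c"
proof -
  obtain c a where a: "\<alpha> < 0" "0 < a" "((\<lambda>x. (u x - c) / \<Phi> x) \<longlongrightarrow> a) (at 0)" using u unfolding cusp_def by blast
  have neg: "\<Phi> x < 0" if "x \<noteq> 0" for x by (rule H_plus_neg[OF a(1) \<Phi> that])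
  have nz: "\<forall>\<^sub>F x in at 0. \<Phi> x < 0" unfolding eventually_at_zero using neg by (intro exI[of _ 1]) simp
  have "((\<lambda>x. (u x - c) / \<Phi> x * \<Phi> x + c) \<longlongrightarrow> a * 0 + c) (at 0)"
    by (intro tendsto_intros a(3) H_plus_tendsto_0[OF a(1) \<Phi>])
  then have "((\<lambda>x. (u x - c) / \<Phi> x * \<Phi> x + c) \<longlongrightarrow> c) (at 0)" by simp
  then have l: "(u \<longlongrightarrow> c) (at 0)"
    by (rule Lim_transform_eventually) (use nz in \<open>auto elim: eventually_mono\<close>)
  have "\<forall>\<^sub>F x in at 0. 0 < (u x - c) / \<Phi> x" by (rule order_tendstoD(1)[OF a(3,2)])
  then have "\<forall>\<^sub>F x in at 0. u x < c"
    using nz by eventually_elim (simp add: zero_less_divide_iff)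
  with l show thesis by (rule that)
qed

context elliptic_operator
begin

text \<open>The function \<open>w\<close> is a positive solution of the dual equation that vanishes
  at the origin, hence it is governed by a fundamental solution of the dual of the dual, that is, of
  \<open>F\<close>. The quotient in question is \<open>w / - \<Phi>\<close> plus the linear part
  divided by \<open>\<Phi>\<close>, and the latter tends to \<open>0\<close> since
  \<open>\<Phi>\<close> decays more slowly than the norm.\<close>

lemma cusp_of_cone:
  assumes n: "2 \<le> CARD('n)" and u: "psol F 1 u" and lim: "(u \<longlongrightarrow> c) (at (0::real^'n))"
    and R: "0 < R" and cone: "\<And>x. x \<noteq> 0 \<Longrightarrow> norm x < R \<Longrightarrow> u x - c - p \<bullet> x < 0"
    and \<Phi>: "\<Phi> \<in> H_plus \<alpha>" "jet_sol F (- {0}) \<Phi>"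
  shows "cusp \<alpha> \<Phi> u"
proof -
  define \<rho> where "\<rho> = min R 1"
  have \<rho>: "0 < \<rho>" "\<rho> \<le> 1" "\<rho> \<le> R" using R by (auto simp: \<rho>_def)
  define w where "w x = - (u x + (- c + (- p) \<bullet> x))" for x
  have w: "psol (dual_operator F) \<rho> w"
    unfolding w_def[abs_def] by (rule psol_dual[OF psol_add_affine[OF psol_subset[OF u \<rho>(2)]]])
  have pos: "0 < w x" if "x \<noteq> 0" "norm x < \<rho>" for x using cone[of x] that \<rho>(3) by (simp add: w_def)
  have "((\<lambda>x. - (u x + (- c + (- p) \<bullet> x))) \<longlongrightarrow> - (c + (- c + (- p) \<bullet> 0))) (at 0)" by (intro tendsto_intros lim)
  then have wl: "(w \<longlongrightarrow> 0) (at 0)" by (simp add: w_def[abs_def])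
  have \<Phi>d: "jet_sol (dual_operator (dual_operator F)) (- {0}) \<Phi>" using \<Phi>(2) by simp
  have a: "\<alpha> < 0" by (rule elliptic_operator.vanishing_exponent_neg[OF dual w \<rho>(1) pos wl \<Phi>(1) \<Phi>d])
  have a1: "- 1 < \<alpha>" by (rule exponent_gt_minus_one[OF n a \<Phi>])
  show ?thesis
  proof (rule elliptic_operator.vanishing_positive[OF dual n w \<rho>(1) pos wl \<Phi>(1) \<Phi>d])
    fix b assume b: "0 < b" "((\<lambda>x. w x / - \<Phi> x) \<longlongrightarrow> b) (at 0)"
    have pl: "((\<lambda>x. (p \<bullet> x) / \<Phi> x) \<longlongrightarrow> 0) (at 0)"
    proof (rule H_plus_neg_bounds[OF a \<Phi>(1)])
      fix g0 g1 assume g0: "0 < g0" and g: "\<And>x. x \<noteq> 0 \<Longrightarrow> g0 * norm x powr (- \<alpha>) \<le> - \<Phi> x"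
      show ?thesis
      proof (rule Lim_null_comparison)
        have "norm ((p \<bullet> x) / \<Phi> x) \<le> norm p / g0 * norm x powr (1 + \<alpha>)" if x: "x \<noteq> 0" for x
        proof -
          have q: "0 < g0 * norm x powr (- \<alpha>)" using g0 x by simp
          have "norm ((p \<bullet> x) / \<Phi> x) = \<bar>p \<bullet> x\<bar> / (- \<Phi> x)" using H_plus_neg[OF a \<Phi>(1) x] by simp
          also have "\<dots> \<le> (norm p * norm x) / (g0 * norm x powr (- \<alpha>))"
            by (rule frac_le[OF _ Cauchy_Schwarz_ineq2 q g[OF x]]) simp
          also have "\<dots> = norm p / g0 * norm x powr (1 + \<alpha>)" using x g0 by (simp add: powr_add powr_minus field_simps)
          finally show ?thesis .
        qed
        then show "\<forall>\<^sub>F x in at 0. norm ((p \<bullet> x) / \<Phi> x) \<le> norm p / g0 * norm x powr (1 + \<alpha>)"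
          unfolding eventually_at_zero by (intro exI[of _ 1]) simp
        have "((\<lambda>x::real^'n. norm x powr (1 + \<alpha>)) \<longlongrightarrow> 0 powr (1 + \<alpha>)) (at 0)"
          using a1 by (intro tendsto_powr' tendsto_norm_zero tendsto_ident_at tendsto_const) auto
        then have "((\<lambda>x::real^'n. norm x powr (1 + \<alpha>)) \<longlongrightarrow> 0) (at 0)" by simp
        then show "((\<lambda>x::real^'n. norm p / g0 * norm x powr (1 + \<alpha>)) \<longlongrightarrow> 0) (at 0)" by (rule tendsto_mult_right_zero)
      qed
    qed
    have "w x / - \<Phi> x + (p \<bullet> x) / \<Phi> x = (u x - c) / \<Phi> x" for x
      unfolding w_def by (cases "\<Phi> x = 0") (simp_all add: field_simps)
    then have "((\<lambda>x. (u x - c) / \<Phi> x) \<longlongrightarrow> b + 0) (at 0)" using tendsto_add[OF b(2) pl] by simp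
    then show ?thesis unfolding cusp_def using a b(1) by auto
  qed
qed

text \<open>The lower bound excludes only the downward blow-up. A bounded solution may fail at the
  origin as a subsolution or as a supersolution, which leads to a cusp for \<open>F\<close> or for
  the dual operator.\<close>

lemma isolated_singularity_bounded_below:
  assumes n: "2 \<le> CARD('n)" and u: "psol F 1 u" and lb: "\<forall>\<^sub>F x in at (0::real^'n). K \<le> u x"
    and \<Phi>: "\<Phi> \<in> H_plus \<alpha>" "jet_sol F (- {0}) \<Phi>"
    and \<Phi>': "\<Phi>' \<in> H_plus \<alpha>'" "jet_sol (dual_operator F) (- {0}) \<Phi>'"
  shows "removable F u \<or> blowup \<alpha> \<Phi> u \<or> cusp \<alpha> \<Phi> u \<or> cusp \<alpha>' \<Phi>' (\<lambda>x. - u x)"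
proof -
  obtain d0 where d0: "0 < d0" "\<And>x. x \<noteq> 0 \<Longrightarrow> norm x < d0 \<Longrightarrow> K \<le> u x" using lb unfolding eventually_at_zero by blast
  show ?thesis
  proof (cases "\<exists>M d. 0 < d \<and> (\<forall>x. x \<noteq> 0 \<longrightarrow> norm x < d \<longrightarrow> u x \<le> M)")
    case True
    then obtain M d where d: "0 < d" "\<And>x. x \<noteq> 0 \<Longrightarrow> norm x < d \<Longrightarrow> u x \<le> M" by blast
    define \<rho> where "\<rho> = min 1 (min d d0)"
    have \<rho>: "0 < \<rho>" "\<rho> \<le> 1" "\<rho> \<le> d" "\<rho> \<le> d0" using d d0 by (auto simp: \<rho>_def)
    have "\<bar>u x\<bar> \<le> max \<bar>K\<bar> \<bar>M\<bar>" if "x \<noteq> 0" "norm x < \<rho>" for x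
      using d(2)[of x] d0(2)[of x] that \<rho> by auto
    then obtain c where c: "(u \<longlongrightarrow> c) (at 0)" using bounded_psol_tendsto[OF n psol_subset[OF u \<rho>(2)] \<rho>(1)] by blast
    have uc: "continuous_on (ball 0 1 - {0}) u" using u unfolding psol_def by blast
    have c': "((\<lambda>x. - u x) \<longlongrightarrow> - c) (at 0)" by (rule tendsto_minus[OF c])
    have eq: "(\<lambda>x. - u x)(0 := - c) = (\<lambda>x. - (u(0 := c)) x)" by auto
    consider "jet_sub F (ball 0 1) (u(0 := c))" "jet_sub (dual_operator F) (ball 0 1) ((\<lambda>x. - u x)(0 := - c))"
      | "\<not> jet_sub F (ball 0 1) (u(0 := c))" | "\<not> jet_sub (dual_operator F) (ball 0 1) ((\<lambda>x. - u x)(0 := - c))" by blast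
    then show ?thesis
    proof cases
      case 1
      then have "removable F u" unfolding removable_def jet_sol_def eq
        using continuous_on_ball_extension[OF uc c] by blast
      then show ?thesis by blast
    next
      case 2
      then obtain p R where p: "0 < R" "\<And>x. x \<noteq> 0 \<Longrightarrow> norm x < R \<Longrightarrow> u x - c - p \<bullet> x < 0"
        using cone_of_not_jet_sub[OF u c] by blast
      then have "cusp \<alpha> \<Phi> u" using cusp_of_cone[OF n u c p \<Phi>] by blast
      then show ?thesis by blast
    next
      case 3
      then obtain p R where p: "0 < R" "\<And>x. x \<noteq> 0 \<Longrightarrow> norm x < R \<Longrightarrow> - u x - (- c) - p \<bullet> x < 0"
        using elliptic_operator.cone_of_not_jet_sub[OF dual psol_dual[OF u] c'] by blast
      then have "cusp \<alpha>' \<Phi>' (\<lambda>x. - u x)" using elliptic_operator.cusp_of_cone[OF dual n psol_dual[OF u] c' p \<Phi>'] by blast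
      then show ?thesis by blast
    qed
  next
    case False
    define \<rho> where "\<rho> = min 1 d0"
    have \<rho>: "0 < \<rho>" "\<rho> \<le> 1" "\<rho> \<le> d0" using d0 by (auto simp: \<rho>_def)
    have v: "psol F \<rho> (\<lambda>x. u x + - K)" by (rule psol_add_const[OF psol_subset[OF u \<rho>(2)]])
    have nn: "0 \<le> u x + - K" if "x \<noteq> 0" "norm x < \<rho>" for x using d0(2)[of x] that \<rho> by simp
    have ub: "\<exists>x. x \<noteq> 0 \<and> norm x < d \<and> M < u x + - K" if d: "0 < d" for M d
    proof (rule ccontr)
      assume "\<not> ?thesis"
      then have "\<forall>x. x \<noteq> 0 \<longrightarrow> norm x < d \<longrightarrow> u x \<le> M + K" by (auto simp: not_less algebra_simps)
      then show False using False d by blast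
    qed
    have \<alpha>: "0 \<le> \<alpha>" by (rule unbounded_exponent_nonneg[OF n v \<rho>(1) nn ub \<Phi>])
    obtain a C R where a: "0 < a" "0 < R"
      and b: "\<And>x. x \<noteq> 0 \<Longrightarrow> norm x \<le> R \<Longrightarrow> a * \<Phi> x - C \<le> u x + - K \<and> u x + - K \<le> a * \<Phi> x + C"
      using unbounded_comparable[OF n v \<rho>(1) nn ub \<Phi>] by blast
    \<comment> \<open>Between \<open>R\<close> and \<open>1/2\<close> there is no singularity, so
      \<open>u - a * \<Phi>\<close> is bounded by compactness; this extends the estimate to the ball
      of radius \<open>1/2\<close>.\<close>
    define A where "A = {x::real^'n. R \<le> norm x \<and> norm x \<le> 1/2}"
    have "closed A" unfolding A_def by (intro closed_Collect_conj closed_Collect_le continuous_intros)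
    moreover have "A \<subseteq> cball 0 1" by (auto simp: A_def)
    then have "bounded A" using bounded_cball bounded_subset by blast
    ultimately have Ac: "compact A" by (simp add: compact_eq_bounded_closed)
    have uc: "continuous_on (ball 0 1 - {0}) u" using u unfolding psol_def by blast
    have pc: "continuous_on (- {0}) \<Phi>" using \<Phi> by (simp add: H_plus_def)
    have "continuous_on A (\<lambda>x. u x - a * \<Phi> x)"
      by (intro continuous_intros continuous_on_subset[OF uc] continuous_on_subset[OF pc]) (use a in \<open>auto simp: A_def\<close>)
    then have "bounded ((\<lambda>x. u x - a * \<Phi> x) ` A)" by (rule compact_imp_bounded[OF compact_continuous_image[OF _ Ac]])
    then obtain B where B: "\<And>x. x \<in> A \<Longrightarrow> \<bar>u x - a * \<Phi> x\<bar> \<le> B" unfolding bounded_iff by auto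
    define D where "D = \<bar>B\<bar> + \<bar>C\<bar> + \<bar>K\<bar> + 1"
    have "a * \<Phi> x - D \<le> u x \<and> u x \<le> a * \<Phi> x + D" if x: "x \<in> ball 0 (1/2) - {0}" for x
    proof (cases "norm x \<le> R")
      case True
      then have "a * \<Phi> x - C \<le> u x + - K" "u x + - K \<le> a * \<Phi> x + C" using b[of x] x by auto
      then show ?thesis unfolding D_def by linarith
    next
      case False
      then have "\<bar>u x - a * \<Phi> x\<bar> \<le> B" using x by (intro B) (auto simp: A_def)
      then show ?thesis unfolding D_def by linarith
    qed
    moreover have "0 < D" unfolding D_def by linarith
    ultimately have "blowup \<alpha> \<Phi> u" unfolding blowup_def using \<alpha> a(1) by blast
    then show ?thesis by blast
  qed
qed

lemma blowup_at_top:
  assumes u: "blowup \<alpha> \<Phi> u" and \<Phi>: "\<Phi> \<in> H_plus \<alpha>" "jet_sol F (- {0::real^'n}) \<Phi>"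
  shows "\<forall>\<^sub>F x in at 0. M \<le> u x"
proof -
  obtain a C where a: "0 \<le> \<alpha>" "0 < a" "\<And>x. x \<in> ball 0 (1/2) - {0} \<Longrightarrow> a * \<Phi> x - C \<le> u x" using u unfolding blowup_def by blast
  obtain d where d: "0 < d" "\<And>x. x \<noteq> 0 \<Longrightarrow> norm x < d \<Longrightarrow> (M + C) / a \<le> \<Phi> x" using fundamental_at_top[OF a(1) \<Phi>] by blast
  have "M \<le> u x" if "x \<noteq> 0" "norm x < min d (1/2)" for x
  proof -
    have "(M + C) / a \<le> \<Phi> x" "a * \<Phi> x - C \<le> u x" using that d(2)[of x] a(3)[of x] by auto
    then show ?thesis using a(2) by (simp add: pos_divide_le_eq mult.commute)
  qed
  then show ?thesis unfolding eventually_at_zero using d(1) by (intro exI[of _ "min d (1/2)"]) auto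
qed

text \<open>The extended solution would have a strict local maximum at the origin, against the
  strong maximum principle for \<open>u\<close> and a constant.\<close>

lemma not_removable_cusp:
  assumes r: "removable F u" and u: "cusp \<alpha> \<Phi> u" and \<Phi>: "\<Phi> \<in> H_plus \<alpha>"
  shows False
proof (rule cusp_tendsto[OF u \<Phi>])
  fix c assume c: "(u \<longlongrightarrow> c) (at (0::real^'n))" "\<forall>\<^sub>F x in at 0. u x < c"
  obtain c' where c': "continuous_on (ball 0 1) (u(0 := c'))" "jet_sol F (ball 0 1) (u(0 := c'))" using r unfolding removable_def by blast
  have "c' = c" by (rule tendsto_unique[OF _ removable_tendsto[OF c'(1)] c(1)]) simp
  then have v: "continuous_on (ball 0 1) (u(0 := c))" "jet_sol F (ball 0 1) (u(0 := c))" using c' by auto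
  obtain d where d: "0 < d" "\<And>x. x \<noteq> 0 \<Longrightarrow> norm x < d \<Longrightarrow> u x < c" using c(2) unfolding eventually_at_zero by blast
  define s where "s = min d 1"
  have s: "0 < s" "s \<le> d" "s \<le> 1" using d by (auto simp: s_def)
  have sub: "ball (0::real^'n) s \<subseteq> ball 0 1" using s by auto
  define x where "x = (s / 2) *\<^sub>R (axis undefined 1 :: real^'n)"
  have "norm x = s / 2" using s by (simp add: x_def)
  then have x: "x \<noteq> 0" "norm x < d" "x \<in> ball 0 s" using s by auto
  have "(u(0 := c)) x + - c = 0"
  proof (rule strong_maximum_principle[OF open_ball connected_ball _ continuous_on_const _ _ _ _ _ x(3)])
    show "continuous_on (ball 0 s) (u(0 := c))" by (rule continuous_on_subset[OF v(1) sub])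
    show "jet_sub F (ball 0 s) (u(0 := c))" using v(2) sub unfolding jet_sol_def by (blast intro: jet_sub_subset)
    show "jet_sub (dual_operator F) (ball 0 s) (\<lambda>_. - c)" by (rule elliptic_operator.jet_sub_const[OF dual])
    show "(u(0 := c)) y + - c \<le> 0" if "y \<in> ball 0 s" for y using d(2)[of y] that s by (auto intro: less_imp_le)
    show "0 \<in> ball (0::real^'n) s" using s by simp
  qed simp
  then show False using d(2)[OF x(1,2)] x(1) by simp
qed

end

lemma exactly_one_of_five:
  assumes "A \<or> B \<or> C \<or> D \<or> E"
    and "\<not> (A \<and> B)" "\<not> (A \<and> C)" "\<not> (A \<and> D)" "\<not> (A \<and> E)" "\<not> (B \<and> C)" "\<not> (B \<and> D)" "\<not> (B \<and> E)"
      "\<not> (C \<and> D)" "\<not> (C \<and> E)" "\<not> (D \<and> E)"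
  shows "exactly_one [A, B, C, D, E]"
proof -
  have *: "i < length [A, B, C, D, E] \<and> [A, B, C, D, E] ! i \<longleftrightarrow> i = 0 \<and> A \<or> i = 1 \<and> B \<or> i = 2 \<and> C \<or> i = 3 \<and> D \<or> i = 4 \<and> E" for i
    by (auto simp: less_Suc_eq numeral_eq_Suc)
  show ?thesis unfolding exactly_one_def * using assms by (elim disjE) (rule ex1I; force)+
qed

theorem theorem5:
  fixes F :: "real ^ 'n ^ 'n \<Rightarrow> real"
    and lam Lam :: real
    and \<Phi> \<Phi>' u :: "real ^ 'n \<Rightarrow> real"
  assumes n_ge_2: "2 \<le> CARD('n)"
    and bounds: "0 < lam" "lam \<le> Lam"
    and elliptic: "uniformly_elliptic lam Lam F"
    and homogeneous: "positively_homogeneous F"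
    and fund: "upward_fundamental_solution F \<Phi>"
    and fund_dual: "upward_fundamental_solution (dual_operator F) \<Phi>'"
    and u_cont: "continuous_on (ball 0 1 - {0}) u"
    and u_sol: "visc_solution F (ball 0 1 - {0}) u"
    and u_bdd: "(\<exists>K. \<forall>\<^sub>F x in at 0. u x \<le> K) \<or> (\<exists>K. \<forall>\<^sub>F x in at 0. K \<le> u x)"
  shows "exactly_one
    [ \<exists>c. continuous_on (ball 0 1) (u(0 := c)) \<and> visc_solution F (ball 0 1) (u(0 := c)),

      0 \<le> scaling_exponent F \<and>
      (\<exists>a>0. \<exists>C>0. \<forall>x\<in>ball 0 (1/2) - {0}. a * \<Phi> x - C \<le> u x \<and> u x \<le> a * \<Phi> x + C),

      0 \<le> scaling_exponent (dual_operator F) \<and>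
      (\<exists>a>0. \<exists>C>0. \<forall>x\<in>ball 0 (1/2) - {0}. - a * \<Phi>' x - C \<le> u x \<and> u x \<le> - a * \<Phi>' x + C),

      scaling_exponent F < 0 \<and>
      (\<exists>c. \<exists>a>0. ((\<lambda>x. (u x - c) / \<Phi> x) \<longlongrightarrow> a) (at 0)),

      scaling_exponent (dual_operator F) < 0 \<and>
      (\<exists>c. \<exists>a>0. ((\<lambda>x. (u x - c) / (- \<Phi>' x)) \<longlongrightarrow> a) (at 0)) ]"
proof -
  interpret elliptic_operator F lam Lam using bounds elliptic homogeneous by unfold_locales
  interpret dual: elliptic_operator "dual_operator F" lam Lam by (rule dual)
  let ?\<alpha> = "scaling_exponent F" and ?\<beta> = "scaling_exponent (dual_operator F)"
  have o: "open (- {0::real^'n})" "open (ball 0 1 - {0::real^'n})" by auto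
  have P: "\<Phi> \<in> H_plus ?\<alpha>" "jet_sol F (- {0}) \<Phi>"
    using fund jet_sol_of_visc[OF o(1)] unfolding upward_fundamental_solution_def by blast+
  have P': "\<Phi>' \<in> H_plus ?\<beta>" "jet_sol (dual_operator F) (- {0}) \<Phi>'"
    using fund_dual dual.jet_sol_of_visc[OF o(1)] unfolding upward_fundamental_solution_def by blast+
  have Pd: "jet_sol (dual_operator (dual_operator F)) (- {0}) \<Phi>" using P(2) by simp
  have u: "psol F 1 u" unfolding psol_def using jet_sol_of_visc[OF o(2) u_sol] u_cont by blast
  let ?v = "\<lambda>x. - u x"
  have A: "(\<exists>c. continuous_on (ball 0 1) (u(0 := c)) \<and> visc_solution F (ball 0 1) (u(0 := c))) \<longleftrightarrow> removable F u"
    unfolding removable_def using jet_sol_of_visc[OF open_ball] visc_of_jet_sol by blast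
  have "(- a * \<Phi>' x - C \<le> u x \<and> u x \<le> - a * \<Phi>' x + C) \<longleftrightarrow> (a * \<Phi>' x - C \<le> - u x \<and> - u x \<le> a * \<Phi>' x + C)" for a C x
    by auto
  then have C: "(0 \<le> ?\<beta> \<and> (\<exists>a>0. \<exists>C>0. \<forall>x\<in>ball 0 (1/2) - {0}. - a * \<Phi>' x - C \<le> u x \<and> u x \<le> - a * \<Phi>' x + C))
    \<longleftrightarrow> blowup ?\<beta> \<Phi>' ?v" unfolding blowup_def by simp
  have q: "(u x - c) / (- \<Phi>' x) = (- u x - (- c)) / \<Phi>' x" for c x
    by (simp add: minus_divide_right[symmetric] minus_divide_left)
  have neg_ex: "(\<exists>c. Q (- c)) \<longleftrightarrow> (\<exists>c. Q c)" for Q :: "real \<Rightarrow> bool" by (metis minus_minus)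
  have "(\<exists>c. \<exists>a>0. ((\<lambda>x. (u x - c) / (- \<Phi>' x)) \<longlongrightarrow> a) (at 0)) \<longleftrightarrow> (\<exists>c. \<exists>a>0. ((\<lambda>x. (- u x - c) / \<Phi>' x) \<longlongrightarrow> a) (at 0))"
    unfolding q by (rule neg_ex)
  then have E: "(?\<beta> < 0 \<and> (\<exists>c. \<exists>a>0. ((\<lambda>x. (u x - c) / (- \<Phi>' x)) \<longlongrightarrow> a) (at 0))) \<longleftrightarrow> cusp ?\<beta> \<Phi>' ?v"
    unfolding cusp_def by simp
  \<comment> \<open>A solution bounded only above is treated through \<open>- u\<close> and the dual
    operator, with the two fundamental solutions exchanged.\<close>
  have some: "removable F u \<or> blowup ?\<alpha> \<Phi> u \<or> blowup ?\<beta> \<Phi>' ?v \<or> cusp ?\<alpha> \<Phi> u \<or> cusp ?\<beta> \<Phi>' ?v"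
  proof (cases "\<exists>K. \<forall>\<^sub>F x in at 0. K \<le> u x")
    case True
    then obtain K where K: "\<forall>\<^sub>F x in at 0. K \<le> u x" by blast
    show ?thesis using isolated_singularity_bounded_below[OF n_ge_2 u K P P'] by blast
  next
    case False
    then obtain K where "\<forall>\<^sub>F x in at 0. u x \<le> K" using u_bdd by blast
    then have K: "\<forall>\<^sub>F x in at 0. - K \<le> - u x" by simp
    have "removable (dual_operator F) ?v \<or> blowup ?\<beta> \<Phi>' ?v \<or> cusp ?\<beta> \<Phi>' ?v \<or> cusp ?\<alpha> \<Phi> (\<lambda>x. - (- u x))"
      by (rule dual.isolated_singularity_bounded_below[OF n_ge_2 psol_dual[OF u] K P' P(1) Pd])
    moreover have "removable F u" if "removable (dual_operator F) ?v" using removable_dual[OF that] by simp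
    ultimately show ?thesis by auto
  qed
  have nb: "\<not> (\<forall>\<^sub>F x in at (0::real^'n). False)" by simp
  have top: "\<forall>\<^sub>F x in at 0. M \<le> u x" if "blowup ?\<alpha> \<Phi> u" for M by (rule blowup_at_top[OF that P])
  have bot: "\<forall>\<^sub>F x in at 0. M \<le> - u x" if "blowup ?\<beta> \<Phi>' ?v" for M by (rule dual.blowup_at_top[OF that P'])
  \<comment> \<open>Exclusiveness: a blow-up has no finite limit, while a removable singularity and
    a cusp have one. The remaining pairs are separated by the sign of an infinite limit, by the
    strict sign of \<open>u - c\<close>, and by the strong maximum principle.\<close>
  have nolim: False if "blowup ?\<alpha> \<Phi> u \<or> blowup ?\<beta> \<Phi>' ?v" and c: "(u \<longlongrightarrow> c) (at 0)" for c
    using that(1)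
  proof
    assume "blowup ?\<alpha> \<Phi> u"
    have "\<forall>\<^sub>F x in at 0. u x < c + 1" "\<forall>\<^sub>F x in at 0. c + 1 \<le> u x"
      using order_tendstoD(2)[OF c, of "c + 1"] top[OF \<open>blowup ?\<alpha> \<Phi> u\<close>, of "c + 1"] by simp_all
    then have "\<forall>\<^sub>F x in at (0::real^'n). False" by eventually_elim simp
    then show False using nb by blast
  next
    assume "blowup ?\<beta> \<Phi>' ?v"
    have "\<forall>\<^sub>F x in at 0. c - 1 < u x" "\<forall>\<^sub>F x in at 0. - (c - 1) \<le> - u x"
      using order_tendstoD(1)[OF c, of "c - 1"] bot[OF \<open>blowup ?\<beta> \<Phi>' ?v\<close>, of "- (c - 1)"] by simp_all
    then have "\<forall>\<^sub>F x in at (0::real^'n). False" by eventually_elim simp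
    then show False using nb by blast
  qed
  have rl: "\<exists>c. (u \<longlongrightarrow> c) (at 0)" if "removable F u" using that removable_tendsto unfolding removable_def by blast
  have cl: "\<exists>c. (u \<longlongrightarrow> c) (at 0)" if "cusp ?\<alpha> \<Phi> u" using cusp_tendsto[OF that P(1)] by blast
  have cl': "\<exists>c. (u \<longlongrightarrow> c) (at 0)" if "cusp ?\<beta> \<Phi>' ?v"
  proof (rule cusp_tendsto[OF that P'(1)])
    fix c assume "((\<lambda>x. - u x) \<longlongrightarrow> c) (at 0)"
    then show ?thesis using tendsto_minus[of "\<lambda>x. - u x" c "at 0"] by auto
  qed
  have bb: "\<not> (blowup ?\<alpha> \<Phi> u \<and> blowup ?\<beta> \<Phi>' ?v)"
  proof
    assume a: "blowup ?\<alpha> \<Phi> u \<and> blowup ?\<beta> \<Phi>' ?v"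
    have "\<forall>\<^sub>F x in at 0. 1 \<le> u x" "\<forall>\<^sub>F x in at 0. 0 \<le> - u x" using top[of 1] bot[of 0] a by blast+
    then have "\<forall>\<^sub>F x in at (0::real^'n). False" by eventually_elim simp
    then show False using nb by blast
  qed
  have cc: "\<not> (cusp ?\<alpha> \<Phi> u \<and> cusp ?\<beta> \<Phi>' ?v)"
  proof
    assume a: "cusp ?\<alpha> \<Phi> u \<and> cusp ?\<beta> \<Phi>' ?v"
    show False
    proof (rule cusp_tendsto[OF conjunct1[OF a] P(1)], rule cusp_tendsto[OF conjunct2[OF a] P'(1)])
      fix c c' assume c: "(u \<longlongrightarrow> c) (at 0)" "\<forall>\<^sub>F x in at 0. u x < c"
        and c': "((\<lambda>x. - u x) \<longlongrightarrow> c') (at 0)" "\<forall>\<^sub>F x in at 0. - u x < c'"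
      have "c' = - c" by (rule tendsto_unique[OF _ c'(1) tendsto_minus[OF c(1)]]) simp
      then have "\<forall>\<^sub>F x in at 0. - u x < - c" using c'(2) by simp
      with c(2) have "\<forall>\<^sub>F x in at (0::real^'n). False" by eventually_elim simp
      then show False using nb by blast
    qed
  qed
  have rc: "\<not> (removable F u \<and> cusp ?\<alpha> \<Phi> u)" using not_removable_cusp[OF _ _ P(1)] by blast
  have rc': "\<not> (removable F u \<and> cusp ?\<beta> \<Phi>' ?v)" using dual.not_removable_cusp[OF removable_dual _ P'(1)] by blast
  have "exactly_one [removable F u, blowup ?\<alpha> \<Phi> u, blowup ?\<beta> \<Phi>' ?v, cusp ?\<alpha> \<Phi> u, cusp ?\<beta> \<Phi>' ?v]"
    by (rule exactly_one_of_five[OF some _ _ rc rc' bb _ _ _ _ cc]) (use nolim rl cl cl' in blast)+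
  then show ?thesis unfolding A C E unfolding blowup_def[of ?\<alpha>] cusp_def[of ?\<alpha>] .
qed

end
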